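(* Let $\tau>0$, $q>0$, $0<c_2<1$, $\iota>0$, $k_0>\frac1{4\iota}$, $k_1>0$, $\omega>0$, $\theta=\omega^2$, and $A,B\in\mathbb{R}$ with $A^2+B^2>0$. Suppose that $t>\tau$. With the observer errors $\tilde\varepsilon,\tilde\varepsilon_s$ and the function $\Delta^t$ defined in the context, consider the predictor error system $$\left\{\begin{array}{l}\tilde\varepsilon^t_{ss}(x,s)=\tilde\varepsilon^t_{xx}(x,s),\quad 0<x<1,\ t-\tau<s<t,\\ \tilde\varepsilon^t_x(0,s)=-q\tilde\varepsilon^t(0,s),\\ \tilde\varepsilon^t(1,s)=\Delta^t(s),\\ \tilde\varepsilon^t(x,t-\tau)=\tilde\varepsilon(x,t-\tau),\quad \tilde\varepsilon^t_s(x,t-\tau)=\tilde\varepsilon_s(x,t-\tau).\end{array}\right.$$ For any initial value $(\tilde\varepsilon(\cdot,t-\tau),\tilde\varepsilon_s(\cdot,t-\tau))\in\mathcal{H}_1$, there exists a unique solution $(\tilde\varepsilon^t,\tilde\varepsilon^t_s)\in C([t-\tau,t];\mathcal{H}_1)$ to this system such that $$\|(\tilde\varepsilon^t(\cdot,t),\tilde\varepsilon^t_s(\cdot,t))\|_{\mathcal{H}_1}\le M_5e^{-\mu_5t}$$ for some constants $M_5,\mu_5>0$ (independent of $t$).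
   Context: Spaces: $H^1_R(0,1)=\{w\in H^1(0,1):w(1)=0\}$; $\mathcal{H}_1=H^1_R(0,1)\times L^2(0,1)$; $\mathcal{H}_4=\{(f,g,h)\in H^1(0,1)\times L^2(0,1)\times H^1(0,1): f(1)=-h(1),\ h(0)=-c_2f(0)\}$. Disturbance model: $S_\eta=\begin{bmatrix}0&\omega\\-\omega&0\end{bmatrix}$, $\gamma_\eta=[1\ \ 0]$, $\dot\eta(s)=S_\eta\eta(s)$, $\eta(0)=[A\ \ B]^\top$. Plant: $\varepsilon_{ss}=\varepsilon_{xx}$ on $0<x<1$, $\varepsilon_x(0,s)=-q\varepsilon(0,s)$, $\varepsilon(1,s)=u(s)-\gamma_\eta\eta(s)$, where $u$ is the control input; the measurement is $e(s+\tau)=\varepsilon(0,s)$, $s\in[0,t-\tau]$. Compensator: $Y_{1s}=-Y_{1x}$, $Y_1(0,s)=-c_2e(s+\tau)$. Let $g_1,g_2:[0,1]\to\mathbb{R}^{1\times2}$ be the unique solution of $g_1''=g_1S_\eta^2$, $g_1'(0)=0$, $g_1(1)=-\gamma_\eta-g_2(1)$, $g_2'=-g_2S_\eta$, $g_2(0)=-c_2g_1(0)$. Set $z=\varepsilon-g_1\eta$, $Y_2=Y_1-g_2\eta$. State observer on $[0,t-\tau]$: $\hat z_{ss}=\hat z_{xx}$, $\hat z_x(0,s)=-qe(s+\tau)$, $\hat z(1,s)=u(s)-(\hat Y_2(1,s)-Y_1(1,s))$, $\hat Y_{2s}=-\hat Y_{2x}$, $\hat Y_2(0,s)=-c_2\hat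 z(0,s)$. Errors: $\tilde z=z-\hat z$, $\tilde Y_2=Y_2-\hat Y_2$, with $(\tilde z,\tilde z_s,\tilde Y_2)$ considered in $\mathcal{H}_4$. For $\vartheta\in\mathbb{R}$, $S_c(\vartheta)=\begin{bmatrix}0&1\\-\vartheta&0\end{bmatrix}$. Let $T$ be the nonsingular matrix with $S_c(\theta)=TS_\eta T^{-1}$, $\gamma_\eta=g_1(0)T^{-1}$, and $d(s)=T\eta(s)$. Adaptive observer on $[0,t-\tau]$ (initial data arbitrary in $\mathbb{R}^4$): with $y_d(s)=e(s+\tau)-\hat z(0,s)$, $\dot\xi=-\iota\xi-y_d$, $\dot{\hat\chi}_1=\hat\varphi+\iota y_d+\hat\theta\xi+k_0(y_d-\hat\chi_1)$, $\dot{\hat\varphi}=-\iota\hat\varphi-\iota^2y_d$, $\dot{\hat\theta}=k_1\xi(y_d-\hat\chi_1)$, $\hat d=(\hat\chi_1,\ \hat\varphi+\xi\hat\theta+\iota\hat\chi_1)^\top$. Let $f_1(\cdot,\vartheta),f_2(\cdot,\vartheta)$ solve $f_1''=f_1S_c(\vartheta)^2$, $f_1'(0)=0$, $f_1(0)=\gamma_\eta$, $f_2'=-f_2S_c(\vartheta)$, $f_2(0)=-c_2\gamma_\eta$ (primes are $x$-derivatives). Observer errors for $s\in[0,t-\tau]$: $\tilde\varepsilon(x,s)=\tilde z(x,s)+f_1(x,\theta)d(s)-f_1(x,\hat\theta(s))\hat d(s)$, $\tilde\varepsilon_s(x,s)=\tilde z_s(x,s)+f_1(x,\theta)S_c(\theta)d(s)-f_1(x,\hat\theta(s))S_c(\hat\theta(s))\hat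 d(s)$. Disturbance predictor for $s\in[t-\tau,t]$: $\dot{\hat d}^t(s)=S_c(\hat\theta(t-\tau))\hat d^t(s)$, $\hat d^t(t-\tau)=\hat d(t-\tau)$; $D^t(s)=-\big(f_1(1,\hat\theta(t-\tau))+f_2(1,\hat\theta(t-\tau))\big)\hat d^t(s)$; and $$\Delta^t(s)=(f_1(1,\theta)+f_2(1,\theta))d(s)+D^t(s).$$ State predictor for $s\in[t-\tau,t]$: $\hat\varepsilon^t_{ss}=\hat\varepsilon^t_{xx}$, $\hat\varepsilon^t_x(0,s)=-q\hat\varepsilon^t(0,s)$, $\hat\varepsilon^t(1,s)=u(s)-D^t(s)$, with initial data at $s=t-\tau$ equal to $\hat z+f_1(\cdot,\hat\theta)\hat d$ and $\hat z_s+f_1(\cdot,\hat\theta)S_c(\hat\theta)\hat d$ evaluated at $t-\tau$. The predictor error is $\tilde\varepsilon^t=\varepsilon-\hat\varepsilon^t$, which satisfies the system in the claim.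
   Formalization: Since the system prescribes ε̃ᵗ(1,s)=Δᵗ(s), generally nonzero, membership in H₁ is read after subtracting Δᵗ(s) from the first component, for the solution and for the initial value; so the initial value must satisfy ε̃(1,t−τ)=Δᵗ(t−τ). *)

theory Defs
  imports "HOL-Analysis.Analysis"
begin

definition inner01 :: "(real \<Rightarrow> real) \<Rightarrow> (real \<Rightarrow> real) \<Rightarrow> real" where
  "inner01 f g = (LINT x|lebesgue_on {0..1}. f x * g x)"

text \<open>Elements of the spaces below are functions, not classes: equality in \<open>L2\<close> is
  almost-everywhere equality, and an element of \<open>H1\<close> is the continuous representative on
  \<open>[0,1]\<close>, so that its boundary values are ordinary values.\<close>

definition L2 :: "(real \<Rightarrow> real) set" where
  "L2 = {g. g \<in> borel_measurable (lebesgue_on {0..1}) \<and>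
            integrable (lebesgue_on {0..1}) (\<lambda>x. (g x)\<^sup>2)}"

definition L2_norm :: "(real \<Rightarrow> real) \<Rightarrow> real" where
  "L2_norm g = sqrt (inner01 g g)"

text \<open>Continuously differentiable test functions determine the same weak derivatives as smooth
  ones.\<close>

definition test_fun :: "(real \<Rightarrow> real) \<Rightarrow> (real \<Rightarrow> real) \<Rightarrow> bool" where
  "test_fun \<phi> \<phi>' \<longleftrightarrow>
     (\<forall>x. (\<phi> has_real_derivative \<phi>' x) (at x)) \<and> continuous_on UNIV \<phi>' \<and>
     (\<exists>a b. 0 < a \<and> a < b \<and> b < 1 \<and> (\<forall>x. x \<notin> {a..b} \<longrightarrow> \<phi> x = 0))"

definition is_weak_deriv :: "(real \<Rightarrow> real) \<Rightarrow> (real \<Rightarrow> real) \<Rightarrow> bool" where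
  "is_weak_deriv f g \<longleftrightarrow>
     g \<in> L2 \<and> (\<forall>\<phi> \<phi>'. test_fun \<phi> \<phi>' \<longrightarrow> inner01 f \<phi>' = - inner01 g \<phi>)"

definition H1 :: "(real \<Rightarrow> real) set" where
  "H1 = {f. continuous_on {0..1} f \<and> (\<exists>g. is_weak_deriv f g)}"

text \<open>For \<open>f\<close> in \<open>H1\<close> the choice is determined up to a null set.\<close>

definition wderiv :: "(real \<Rightarrow> real) \<Rightarrow> real \<Rightarrow> real" where
  "wderiv f = (SOME g. is_weak_deriv f g)"

definition H1_norm :: "(real \<Rightarrow> real) \<Rightarrow> real" where
  "H1_norm f = sqrt ((L2_norm f)\<^sup>2 + (L2_norm (wderiv f))\<^sup>2)"

definition H1_R :: "(real \<Rightarrow> real) set" where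
  "H1_R = {f \<in> H1. f 1 = 0}"

definition space_H1 :: "((real \<Rightarrow> real) \<times> (real \<Rightarrow> real)) set" where
  "space_H1 = H1_R \<times> L2"

definition space_H1_norm :: "(real \<Rightarrow> real) \<times> (real \<Rightarrow> real) \<Rightarrow> real" where
  "space_H1_norm p = sqrt ((H1_norm (fst p))\<^sup>2 + (L2_norm (snd p))\<^sup>2)"

definition space_H4 :: "real \<Rightarrow> ((real \<Rightarrow> real) \<times> (real \<Rightarrow> real) \<times> (real \<Rightarrow> real)) set" where
  "space_H4 c2 = {(f, g, h). f \<in> H1 \<and> g \<in> L2 \<and> h \<in> H1 \<and> f 1 = - h 1 \<and> h 0 = - c2 * f 0}"

text \<open>A function of space and time is written \<open>w x s\<close>, space first.\<close>

definition cont_H1 :: "real set \<Rightarrow> (real \<Rightarrow> real \<Rightarrow> real) \<Rightarrow> bool" where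
  "cont_H1 I w \<longleftrightarrow> (\<forall>s\<in>I. (\<lambda>x. w x s) \<in> H1 \<and>
     ((\<lambda>r. H1_norm (\<lambda>x. w x r - w x s)) \<longlongrightarrow> 0) (at s within I))"

definition cont_L2 :: "real set \<Rightarrow> (real \<Rightarrow> real \<Rightarrow> real) \<Rightarrow> bool" where
  "cont_L2 I v \<longleftrightarrow> (\<forall>s\<in>I. (\<lambda>x. v x s) \<in> L2 \<and>
     ((\<lambda>r. L2_norm (\<lambda>x. v x r - v x s)) \<longlongrightarrow> 0) (at s within I))"

definition time_deriv :: "real set \<Rightarrow> (real \<Rightarrow> real \<Rightarrow> real) \<Rightarrow> (real \<Rightarrow> real \<Rightarrow> real) \<Rightarrow> bool" where
  "time_deriv I w v \<longleftrightarrow>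
     (\<forall>s\<in>I. ((\<lambda>r. L2_norm (\<lambda>x. (w x r - w x s) / (r - s) - v x s)) \<longlongrightarrow> 0) (at s within I))"

text \<open>Weak (finite energy) solution \<open>(w, v)\<close>, \<open>v = w\<^sub>s\<close>, for times in \<open>I\<close> of
    \<open>w\<^sub>s\<^sub>s = w\<^sub>x\<^sub>x\<close>,  \<open>w\<^sub>x(0,s) = p(s)\<close>,  \<open>w(1,s) = r(s)\<close>.
  The equation is multiplied by \<open>\<psi>\<close> with \<open>\<psi>(1) = 0\<close> and integrated by parts once, so the
  condition on \<open>w\<^sub>x(0,s)\<close>, which has no pointwise meaning here, enters as the term \<open>- p(s) \<psi>(0)\<close>.\<close>

definition wave_solution ::
  "real set \<Rightarrow> (real \<Rightarrow> real) \<Rightarrow> (real \<Rightarrow> real) \<Rightarrow>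
   (real \<Rightarrow> real \<Rightarrow> real) \<Rightarrow> (real \<Rightarrow> real \<Rightarrow> real) \<Rightarrow> bool" where
  "wave_solution I p r w v \<longleftrightarrow>
     cont_H1 I w \<and> cont_L2 I v \<and> time_deriv I w v \<and>
     (\<forall>s\<in>I. w 1 s = r s) \<and>
     (\<forall>\<psi>\<in>H1_R. \<forall>s\<in>I.
        ((\<lambda>\<sigma>. inner01 (\<lambda>x. v x \<sigma>) \<psi>) has_real_derivative
           (- inner01 (wderiv (\<lambda>x. w x s)) (wderiv \<psi>) - p s * \<psi> 0)) (at s within I))"

text \<open>\<open>Y\<^sub>s = - Y\<^sub>x\<close>, \<open>Y(0,s) = b(s)\<close>, the equation being an identity in \<open>L2\<close>.\<close>

definition transport_solution ::
  "real set \<Rightarrow> (real \<Rightarrow> real) \<Rightarrow> (real \<Rightarrow> real \<Rightarrow> real) \<Rightarrow> bool" where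
  "transport_solution I b Y \<longleftrightarrow>
     cont_H1 I Y \<and> time_deriv I Y (\<lambda>x s. - wderiv (\<lambda>y. Y y s) x) \<and> (\<forall>s\<in>I. Y 0 s = b s)"

text \<open>Row vectors in \<open>\<real>\<^sup>1\<^sup>\<times>\<^sup>2\<close> are elements of \<open>real ^ 2\<close>: row times matrix is \<open>v*\<close>, row times
  column is the inner product.\<close>

definition S_eta :: "real \<Rightarrow> real ^ 2 ^ 2" where
  "S_eta \<omega> = vector [vector [0, \<omega>], vector [- \<omega>, 0]]"

definition S_c :: "real \<Rightarrow> real ^ 2 ^ 2" where
  "S_c \<rho> = vector [vector [0, 1], vector [- \<rho>, 0]]"

definition gamma_eta :: "real ^ 2" where
  "gamma_eta = vector [1, 0]"

definition disturbance_model :: "real \<Rightarrow> real \<Rightarrow> real \<Rightarrow> (real \<Rightarrow> real ^ 2) \<Rightarrow> bool" where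
  "disturbance_model \<omega> A B \<eta> \<longleftrightarrow>
     \<eta> 0 = vector [A, B] \<and>
     (\<forall>s\<ge>0. (\<eta> has_vector_derivative (S_eta \<omega> *v \<eta> s)) (at s within {0..}))"

definition g_functions :: "real \<Rightarrow> real \<Rightarrow> (real \<Rightarrow> real ^ 2) \<Rightarrow> (real \<Rightarrow> real ^ 2) \<Rightarrow> bool" where
  "g_functions \<omega> c2 g1 g2 \<longleftrightarrow>
     (\<exists>g1'. (\<forall>x\<in>{0..1}. (g1 has_vector_derivative g1' x) (at x within {0..1}) \<and>
               (g1' has_vector_derivative (g1 x v* (S_eta \<omega> ** S_eta \<omega>))) (at x within {0..1})) \<and>
            g1' 0 = 0) \<and>
     (\<forall>x\<in>{0..1}. (g2 has_vector_derivative - (g2 x v* S_eta \<omega>)) (at x within {0..1})) \<and>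
     g1 1 = - gamma_eta - g2 1 \<and> g2 0 = - c2 *\<^sub>R g1 0"

definition f_functions ::
  "real \<Rightarrow> (real \<Rightarrow> real \<Rightarrow> real ^ 2) \<Rightarrow> (real \<Rightarrow> real \<Rightarrow> real ^ 2) \<Rightarrow> bool" where
  "f_functions c2 f1 f2 \<longleftrightarrow> (\<forall>\<rho>.
     (\<exists>f1'. (\<forall>x\<in>{0..1}. ((\<lambda>x. f1 x \<rho>) has_vector_derivative f1' x) (at x within {0..1}) \<and>
               (f1' has_vector_derivative (f1 x \<rho> v* (S_c \<rho> ** S_c \<rho>))) (at x within {0..1})) \<and>
            f1' 0 = 0) \<and>
     (\<forall>x\<in>{0..1}. ((\<lambda>x. f2 x \<rho>) has_vector_derivative - (f2 x \<rho> v* S_c \<rho>)) (at x within {0..1})) \<and>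
     f1 0 \<rho> = gamma_eta \<and> f2 0 \<rho> = - c2 *\<^sub>R gamma_eta)"

definition canonical_transformation ::
  "real \<Rightarrow> real \<Rightarrow> (real \<Rightarrow> real ^ 2) \<Rightarrow> real ^ 2 ^ 2 \<Rightarrow> bool" where
  "canonical_transformation \<omega> \<theta> g1 T \<longleftrightarrow>
     invertible T \<and> S_c \<theta> = T ** S_eta \<omega> ** matrix_inv T \<and> gamma_eta = g1 0 v* matrix_inv T"

text \<open>All trajectories live on \<open>s \<ge> 0\<close>; their restrictions to \<open>[0, t - \<tau>]\<close> are the ones that
  are used at time \<open>t\<close>.\<close>

definition plant ::
  "real \<Rightarrow> (real \<Rightarrow> real) \<Rightarrow> (real \<Rightarrow> real ^ 2) \<Rightarrow>
   (real \<Rightarrow> real \<Rightarrow> real) \<Rightarrow> (real \<Rightarrow> real \<Rightarrow> real) \<Rightarrow> bool" where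
  "plant q u \<eta> \<epsilon> \<epsilon>s \<longleftrightarrow>
     wave_solution {0..} (\<lambda>s. - q * \<epsilon> 0 s) (\<lambda>s. u s - gamma_eta \<bullet> \<eta> s) \<epsilon> \<epsilon>s"

definition measurement ::
  "real \<Rightarrow> (real \<Rightarrow> real \<Rightarrow> real) \<Rightarrow> (real \<Rightarrow> real) \<Rightarrow> bool" where
  "measurement \<tau> \<epsilon> e \<longleftrightarrow> (\<forall>s\<ge>0. e (s + \<tau>) = \<epsilon> 0 s)"

definition compensator ::
  "real \<Rightarrow> real \<Rightarrow> (real \<Rightarrow> real) \<Rightarrow> (real \<Rightarrow> real \<Rightarrow> real) \<Rightarrow> bool" where
  "compensator \<tau> c2 e Y1 \<longleftrightarrow> transport_solution {0..} (\<lambda>s. - c2 * e (s + \<tau>)) Y1"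

definition state_observer ::
  "real \<Rightarrow> real \<Rightarrow> real \<Rightarrow> (real \<Rightarrow> real) \<Rightarrow> (real \<Rightarrow> real) \<Rightarrow> (real \<Rightarrow> real \<Rightarrow> real) \<Rightarrow>
   (real \<Rightarrow> real \<Rightarrow> real) \<Rightarrow> (real \<Rightarrow> real \<Rightarrow> real) \<Rightarrow> (real \<Rightarrow> real \<Rightarrow> real) \<Rightarrow> bool" where
  "state_observer \<tau> q c2 u e Y1 zh zhs Y2h \<longleftrightarrow>
     wave_solution {0..} (\<lambda>s. - q * e (s + \<tau>)) (\<lambda>s. u s - (Y2h 1 s - Y1 1 s)) zh zhs \<and>
     transport_solution {0..} (\<lambda>s. - c2 * zh 0 s) Y2h"

text \<open>The errors \<open>z - zh\<close>, its time derivative and \<open>Y\<^sub>2 - Y2h\<close>, where \<open>z = \<epsilon> - g\<^sub>1 \<eta>\<close> and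
  \<open>Y\<^sub>2 = Y\<^sub>1 - g\<^sub>2 \<eta>\<close>; the time derivative of \<open>g\<^sub>1 \<eta>\<close> is \<open>g\<^sub>1 S\<^sub>\<eta> \<eta>\<close>.\<close>

definition z_err ::
  "(real \<Rightarrow> real \<Rightarrow> real) \<Rightarrow> (real \<Rightarrow> real ^ 2) \<Rightarrow> (real \<Rightarrow> real ^ 2) \<Rightarrow>
   (real \<Rightarrow> real \<Rightarrow> real) \<Rightarrow> real \<Rightarrow> real \<Rightarrow> real" where
  "z_err \<epsilon> g1 \<eta> zh x s = (\<epsilon> x s - g1 x \<bullet> \<eta> s) - zh x s"

definition zs_err ::
  "real \<Rightarrow> (real \<Rightarrow> real \<Rightarrow> real) \<Rightarrow> (real \<Rightarrow> real ^ 2) \<Rightarrow> (real \<Rightarrow> real ^ 2) \<Rightarrow>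
   (real \<Rightarrow> real \<Rightarrow> real) \<Rightarrow> real \<Rightarrow> real \<Rightarrow> real" where
  "zs_err \<omega> \<epsilon>s g1 \<eta> zhs x s = (\<epsilon>s x s - (g1 x v* S_eta \<omega>) \<bullet> \<eta> s) - zhs x s"

definition Y2_err ::
  "(real \<Rightarrow> real \<Rightarrow> real) \<Rightarrow> (real \<Rightarrow> real ^ 2) \<Rightarrow> (real \<Rightarrow> real ^ 2) \<Rightarrow>
   (real \<Rightarrow> real \<Rightarrow> real) \<Rightarrow> real \<Rightarrow> real \<Rightarrow> real" where
  "Y2_err Y1 g2 \<eta> Y2h x s = (Y1 x s - g2 x \<bullet> \<eta> s) - Y2h x s"

definition adaptive_observer ::
  "real \<Rightarrow> real \<Rightarrow> real \<Rightarrow> (real \<Rightarrow> real) \<Rightarrow>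
   (real \<Rightarrow> real) \<Rightarrow> (real \<Rightarrow> real) \<Rightarrow> (real \<Rightarrow> real) \<Rightarrow> (real \<Rightarrow> real) \<Rightarrow> bool" where
  "adaptive_observer \<iota> k0 k1 yd \<xi> \<chi>h \<phi>h \<theta>h \<longleftrightarrow> (\<forall>s\<ge>0.
     (\<xi> has_real_derivative (- \<iota> * \<xi> s - yd s)) (at s within {0..}) \<and>
     (\<chi>h has_real_derivative
        (\<phi>h s + \<iota> * yd s + \<theta>h s * \<xi> s + k0 * (yd s - \<chi>h s))) (at s within {0..}) \<and>
     (\<phi>h has_real_derivative (- \<iota> * \<phi>h s - \<iota>\<^sup>2 * yd s)) (at s within {0..}) \<and>
     (\<theta>h has_real_derivative (k1 * \<xi> s * (yd s - \<chi>h s))) (at s within {0..}))"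

definition d_hat ::
  "real \<Rightarrow> (real \<Rightarrow> real) \<Rightarrow> (real \<Rightarrow> real) \<Rightarrow> (real \<Rightarrow> real) \<Rightarrow> (real \<Rightarrow> real) \<Rightarrow> real \<Rightarrow> real ^ 2" where
  "d_hat \<iota> \<xi> \<chi>h \<phi>h \<theta>h s = vector [\<chi>h s, \<phi>h s + \<xi> s * \<theta>h s + \<iota> * \<chi>h s]"

definition obs_err ::
  "real \<Rightarrow> (real \<Rightarrow> real \<Rightarrow> real ^ 2) \<Rightarrow> (real \<Rightarrow> real \<Rightarrow> real) \<Rightarrow>
   (real \<Rightarrow> real ^ 2) \<Rightarrow> (real \<Rightarrow> real) \<Rightarrow> (real \<Rightarrow> real ^ 2) \<Rightarrow> real \<Rightarrow> real \<Rightarrow> real" where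
  "obs_err \<theta> f1 zt d \<theta>h dh x s = zt x s + f1 x \<theta> \<bullet> d s - f1 x (\<theta>h s) \<bullet> dh s"

definition obs_err_s ::
  "real \<Rightarrow> (real \<Rightarrow> real \<Rightarrow> real ^ 2) \<Rightarrow> (real \<Rightarrow> real \<Rightarrow> real) \<Rightarrow>
   (real \<Rightarrow> real ^ 2) \<Rightarrow> (real \<Rightarrow> real) \<Rightarrow> (real \<Rightarrow> real ^ 2) \<Rightarrow> real \<Rightarrow> real \<Rightarrow> real" where
  "obs_err_s \<theta> f1 zts d \<theta>h dh x s =
     zts x s + (f1 x \<theta> v* S_c \<theta>) \<bullet> d s - (f1 x (\<theta>h s) v* S_c (\<theta>h s)) \<bullet> dh s"

definition disturbance_predictor ::
  "real \<Rightarrow> (real \<Rightarrow> real) \<Rightarrow> (real \<Rightarrow> real ^ 2) \<Rightarrow> real \<Rightarrow> (real \<Rightarrow> real ^ 2) \<Rightarrow> bool" where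
  "disturbance_predictor \<tau> \<theta>h dh t dht \<longleftrightarrow>
     dht (t - \<tau>) = dh (t - \<tau>) \<and>
     (\<forall>s\<in>{t-\<tau>..t}. (dht has_vector_derivative (S_c (\<theta>h (t - \<tau>)) *v dht s)) (at s within {t-\<tau>..t}))"

definition D_pred ::
  "real \<Rightarrow> (real \<Rightarrow> real \<Rightarrow> real ^ 2) \<Rightarrow> (real \<Rightarrow> real \<Rightarrow> real ^ 2) \<Rightarrow> (real \<Rightarrow> real) \<Rightarrow>
   real \<Rightarrow> (real \<Rightarrow> real ^ 2) \<Rightarrow> real \<Rightarrow> real" where
  "D_pred \<tau> f1 f2 \<theta>h t dht s = - ((f1 1 (\<theta>h (t - \<tau>)) + f2 1 (\<theta>h (t - \<tau>))) \<bullet> dht s)"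

definition Delta ::
  "real \<Rightarrow> real \<Rightarrow> (real \<Rightarrow> real \<Rightarrow> real ^ 2) \<Rightarrow> (real \<Rightarrow> real \<Rightarrow> real ^ 2) \<Rightarrow> (real \<Rightarrow> real ^ 2) \<Rightarrow>
   (real \<Rightarrow> real) \<Rightarrow> real \<Rightarrow> (real \<Rightarrow> real ^ 2) \<Rightarrow> real \<Rightarrow> real" where
  "Delta \<tau> \<theta> f1 f2 d \<theta>h t dht s =
     (f1 1 \<theta> + f2 1 \<theta>) \<bullet> d s + D_pred \<tau> f1 f2 \<theta>h t dht s"

text \<open>The first clause puts the solution into the state space \<open>H1_R \<times> L2\<close> translated by the
  boundary datum \<open>\<delta>\<close>: elements of \<open>H1_R\<close> vanish at 1, while the system prescribes
  \<open>w(1,s) = \<delta>(s)\<close>. Initial data in the same translated space satisfy the compatibility condition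
  \<open>w0(1) = \<delta>(t - \<tau>)\<close>; otherwise a jump runs along the characteristics and no solution is
  continuous in time with values in \<open>H1 \<times> L2\<close>.\<close>

definition predictor_error_solution ::
  "real \<Rightarrow> real \<Rightarrow> real \<Rightarrow> (real \<Rightarrow> real) \<Rightarrow> (real \<Rightarrow> real) \<Rightarrow> (real \<Rightarrow> real) \<Rightarrow>
   (real \<Rightarrow> real \<Rightarrow> real) \<Rightarrow> (real \<Rightarrow> real \<Rightarrow> real) \<Rightarrow> bool" where
  "predictor_error_solution \<tau> q t \<delta> w0 w1 w v \<longleftrightarrow>
     (\<forall>s\<in>{t-\<tau>..t}. (\<lambda>x. w x s - \<delta> s, \<lambda>x. v x s) \<in> space_H1) \<and>
     wave_solution {t-\<tau>..t} (\<lambda>s. - q * w 0 s) \<delta> w v \<and>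
     (\<forall>x\<in>{0..1}. w x (t - \<tau>) = w0 x) \<and>
     (AE x in lebesgue_on {0..1}. v x (t - \<tau>) = w1 x)"

end

theory Submission
  imports Defs
begin

text \<open>The error \<open>z - zh\<close> solves a wave equation with a Neumann condition at 0, so it is
  \<open>F(s + x) + F(s - x)\<close>; the coupling with the transport equation becomes
  \<open>F(y + 2) = (2 c2 - 1) F(y)\<close>, a contraction, and the error decays exponentially. Hence the adaptive
  observer sees the disturbance output up to an exponentially small error. Its regressor is a filtered
  sinusoid and thus persistently exciting, so the errors of \<open>\<theta>h\<close> and \<open>dh\<close> decay exponentially as
  well. On the window of length \<open>\<tau>\<close>, Gronwall's inequality bounds the derivative of \<open>\<Delta> t\<close> by these
  errors at time \<open>t - \<tau>\<close>. The predictor error is a wave equation on a window of fixed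
  length, solved by d'Alembert's formula with norm bounded by the data, and its uniqueness follows
  by pairing with the time-reversed solutions.\<close>

section \<open>Square integrable functions and their primitives\<close>

text \<open>The energy conserved under \<open>w\<^sub>x(0) = - q w(0)\<close> contains the term
  \<open>- q w(0)^2\<close> and need not be positive, and the velocity of a finite energy solution
  is only in \<open>L2\<close>, so it is not an admissible \<psi> in the weak form. Uniqueness
  therefore uses a bilinear form in which displacements alone serve as test functions. This
  presupposes existence, which comes from an explicit construction. Uniqueness in turn identifies
  the observer error, given only as some weak solution, with a d'Alembert wave. There
  \<open>2 * c2 - 1\<close> arises from
  \<open>F(y + 2) + F(y) = - Y(1, y + 1) = - Y(0, y) = 2 * c2 * F(y)\<close>: transport across the
  interval takes time 1. Profiles are extended from \<open>[0,1]\<close> to the line as primitives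
  of square integrable functions. A travelling wave is then a translate, and its regularity in time
  is a statement about translation in \<open>L2\<close> of the line. The constants of the prediction
  window do not depend on \<open>t\<close>, so decay at \<open>t - \<tau>\<close> becomes decay at
  \<open>t\<close> at the cost of a factor \<open>exp (\<mu> * \<tau>)\<close>.\<close>

definition sqint :: "'a measure \<Rightarrow> ('a \<Rightarrow> real) \<Rightarrow> bool" where
  "sqint M f \<longleftrightarrow> f \<in> borel_measurable M \<and> integrable M (\<lambda>x. (f x)\<^sup>2)"

definition l2norm :: "'a measure \<Rightarrow> ('a \<Rightarrow> real) \<Rightarrow> real" where
  "l2norm M f = sqrt (LINT x|M. (f x)\<^sup>2)"

lemma sqint_measurable: "sqint M f \<Longrightarrow> f \<in> borel_measurable M"
  by (simp add: sqint_def)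

lemma sqint_mult:
  assumes "sqint M f" "sqint M g"
  shows "integrable M (\<lambda>x. f x * g x)"
proof (rule Bochner_Integration.integrable_bound)
  show "integrable M (\<lambda>x. (f x)\<^sup>2 + (g x)\<^sup>2)"
    using assms by (auto simp: sqint_def)
  show "(\<lambda>x. f x * g x) \<in> borel_measurable M"
    using assms by (auto simp: sqint_def)
  have "\<bar>a * b\<bar> \<le> a\<^sup>2 + b\<^sup>2" for a b :: real
  proof -
    have "2 * (\<bar>a\<bar> * \<bar>b\<bar>) \<le> a\<^sup>2 + b\<^sup>2"
      using sum_squares_bound[of "\<bar>a\<bar>" "\<bar>b\<bar>"] by simp
    moreover have "0 \<le> \<bar>a\<bar> * \<bar>b\<bar>" by simp
    ultimately show ?thesis unfolding abs_mult by linarith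
  qed
  then show "AE x in M. norm (f x * g x) \<le> norm ((f x)\<^sup>2 + (g x)\<^sup>2)"
    by auto
qed

lemma sqint_add: "sqint M f \<Longrightarrow> sqint M g \<Longrightarrow> sqint M (\<lambda>x. f x + g x)"
  using sqint_mult[of M f g]
  by (auto simp: sqint_def power2_sum mult.assoc)

lemma sqint_cmult: "sqint M f \<Longrightarrow> sqint M (\<lambda>x. c * f x)"
  by (auto simp: sqint_def power_mult_distrib)

lemma sqint_minus: "sqint M f \<Longrightarrow> sqint M (\<lambda>x. - f x)"
  by (auto simp: sqint_def)

lemma sqint_diff: "sqint M f \<Longrightarrow> sqint M g \<Longrightarrow> sqint M (\<lambda>x. f x - g x)"
  using sqint_add[of M f "\<lambda>x. - g x"] sqint_minus[of M g] by simp

lemma sqint_divide: "sqint M f \<Longrightarrow> sqint M (\<lambda>x. f x / c)"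
  using sqint_cmult[of M f "inverse c"] by (simp add: field_simps)

lemma sqint_zero: "sqint M (\<lambda>x. 0)"
  by (simp add: sqint_def)

lemma sqint_const: "finite_measure M \<Longrightarrow> sqint M (\<lambda>x. c)"
  by (simp add: sqint_def finite_measure.integrable_const)

lemma sqint_indicator:
  assumes "sqint M f" "A \<in> sets M"
  shows "sqint M (\<lambda>x. indicator A x * f x)"
proof -
  have "integrable M (\<lambda>x. indicator A x *\<^sub>R (f x)\<^sup>2)"
    by (rule integrable_mult_indicator) (use assms in \<open>auto simp: sqint_def\<close>)
  moreover have "(indicator A x * f x)\<^sup>2 = indicator A x *\<^sub>R (f x)\<^sup>2" for x
    by (auto simp: indicator_def)
  ultimately show ?thesis
    using assms by (auto simp: sqint_def)
qed

lemma sqint_cong_AE: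
  assumes "sqint M f" "g \<in> borel_measurable M" "AE x in M. f x = g x"
  shows "sqint M g"
proof -
  have "integrable M (\<lambda>x. (g x)\<^sup>2) \<longleftrightarrow> integrable M (\<lambda>x. (f x)\<^sup>2)"
    by (rule integrable_cong_AE) (use assms in \<open>auto simp: sqint_def elim: AE_mp\<close>)
  then show ?thesis using assms by (simp add: sqint_def)
qed

lemma l2norm_nonneg [simp]: "0 \<le> l2norm M f"
  by (simp add: l2norm_def)

lemma l2norm_sq: "(l2norm M f)\<^sup>2 = (LINT x|M. (f x)\<^sup>2)"
  by (simp add: l2norm_def)

lemma l2norm_cong_AE:
  assumes "f \<in> borel_measurable M" "g \<in> borel_measurable M" "AE x in M. f x = g x"
  shows "l2norm M f = l2norm M g"
proof -
  have "(LINT x|M. (f x)\<^sup>2) = (LINT x|M. (g x)\<^sup>2)"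
    by (rule integral_cong_AE) (use assms in \<open>auto elim: AE_mp\<close>)
  then show ?thesis by (simp add: l2norm_def)
qed

lemma l2norm_cong: "(\<And>x. x \<in> space M \<Longrightarrow> f x = g x) \<Longrightarrow> l2norm M f = l2norm M g"
  unfolding l2norm_def by (metis (no_types, lifting) Bochner_Integration.integral_cong)

lemma l2norm_cmult: "l2norm M (\<lambda>x. c * f x) = \<bar>c\<bar> * l2norm M f"
  by (simp add: l2norm_def power_mult_distrib real_sqrt_mult)

lemma l2norm_minus: "l2norm M (\<lambda>x. - f x) = l2norm M f"
  by (simp add: l2norm_def)

lemma l2norm_minus_commute: "l2norm M (\<lambda>x. f x - g x) = l2norm M (\<lambda>x. g x - f x)"
  by (simp add: l2norm_def power2_commute)

lemma l2norm_zero [simp]: "l2norm M (\<lambda>x. 0) = 0"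
  by (simp add: l2norm_def)

lemma l2norm_eq_0_imp:
  assumes "sqint M f" "l2norm M f = 0"
  shows "AE x in M. f x = 0"
proof -
  have "(LINT x|M. (f x)\<^sup>2) = 0" using assms(2) by (simp add: l2norm_def)
  then have "AE x in M. (f x)\<^sup>2 = 0"
    using integral_nonneg_eq_0_iff_AE[of M "\<lambda>x. (f x)\<^sup>2"] assms(1) by (simp add: sqint_def)
  then show ?thesis by simp
qed

text \<open>The quadratic in \<open>t\<close> is evaluated at its minimiser \<open>b / c\<close>;
  for \<open>c = 0\<close> it is affine and can be bounded below only if
  \<open>b = 0\<close>.\<close>

lemma discriminant_bound:
  fixes a b c :: real
  assumes "\<And>t. 0 \<le> a - 2 * t * b + t\<^sup>2 * c" "0 \<le> c"
  shows "b\<^sup>2 \<le> a * c"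
proof (cases "c = 0")
  case True
  have "b = 0"
  proof (rule ccontr)
    assume "b \<noteq> 0"
    \<comment> \<open>At this \<open>t\<close> the affine expression equals -1.\<close>
    then show False using assms(1)[of "(a + 1) / (2 * b)"] True by (simp add: field_simps)
  qed
  then show ?thesis using True by simp
next
  case False
  then have "c > 0" using assms by simp
  have "0 \<le> a - 2 * (b / c) * b + (b / c)\<^sup>2 * c" by (rule assms)
  also have "\<dots> = a - b\<^sup>2 / c" using \<open>c > 0\<close> by (simp add: field_simps power2_eq_square)
  finally show ?thesis using \<open>c > 0\<close> by (simp add: field_simps)
qed

lemma Cauchy_Schwarz_integral:
  assumes "sqint M f" "sqint M g"
  shows "\<bar>LINT x|M. f x * g x\<bar> \<le> l2norm M f * l2norm M g"
proof -
  let ?a = "LINT x|M. (f x)\<^sup>2" and ?b = "LINT x|M. f x * g x" and ?c = "LINT x|M. (g x)\<^sup>2"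
  have i: "integrable M (\<lambda>x. (f x)\<^sup>2)" "integrable M (\<lambda>x. (g x)\<^sup>2)" "integrable M (\<lambda>x. f x * g x)"
    using assms sqint_mult by (auto simp: sqint_def)
  have "?b\<^sup>2 \<le> ?a * ?c"
  proof (rule discriminant_bound)
    fix t :: real
    have "0 \<le> (LINT x|M. (f x - t * g x)\<^sup>2)" by simp
    also have "(\<lambda>x. (f x - t * g x)\<^sup>2) = (\<lambda>x. (f x)\<^sup>2 - 2 * t * (f x * g x) + t\<^sup>2 * (g x)\<^sup>2)"
      by (auto simp: power2_eq_square algebra_simps)
    also have "(LINT x|M. (f x)\<^sup>2 - 2 * t * (f x * g x) + t\<^sup>2 * (g x)\<^sup>2) = ?a - 2 * t * ?b + t\<^sup>2 * ?c"
      using i by simp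
    finally show "0 \<le> ?a - 2 * t * ?b + t\<^sup>2 * ?c" .
  qed simp
  then have "sqrt (?b\<^sup>2) \<le> sqrt (?a * ?c)" by (rule real_sqrt_le_mono)
  then show ?thesis unfolding l2norm_def by (simp only: real_sqrt_abs real_sqrt_mult)
qed

lemma l2norm_triangle:
  assumes "sqint M f" "sqint M g"
  shows "l2norm M (\<lambda>x. f x + g x) \<le> l2norm M f + l2norm M g"
proof -
  have i: "integrable M (\<lambda>x. (f x)\<^sup>2)" "integrable M (\<lambda>x. (g x)\<^sup>2)" "integrable M (\<lambda>x. f x * g x)"
    using assms sqint_mult by (auto simp: sqint_def)
  have "(l2norm M (\<lambda>x. f x + g x))\<^sup>2 = (LINT x|M. (f x)\<^sup>2 + (g x)\<^sup>2 + 2 * (f x * g x))"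
    unfolding l2norm_sq power2_sum by (simp add: mult.assoc)
  also have "\<dots> = (l2norm M f)\<^sup>2 + (l2norm M g)\<^sup>2 + 2 * (LINT x|M. f x * g x)"
    unfolding l2norm_sq using i by simp
  also have "\<dots> \<le> (l2norm M f)\<^sup>2 + (l2norm M g)\<^sup>2 + 2 * (l2norm M f * l2norm M g)"
    using Cauchy_Schwarz_integral[OF assms] by linarith
  also have "\<dots> = (l2norm M f + l2norm M g)\<^sup>2" by (simp add: power2_sum)
  finally show ?thesis by (rule power2_le_imp_le) simp
qed

lemma l2norm_triangle_diff:
  assumes "sqint M f" "sqint M g"
  shows "l2norm M (\<lambda>x. f x - g x) \<le> l2norm M f + l2norm M g"
  using l2norm_triangle[OF assms(1) sqint_minus[OF assms(2)]] by (simp add: l2norm_minus)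

lemma l2norm_triangle3:
  assumes "sqint M f" "sqint M g" "sqint M h"
  shows "l2norm M (\<lambda>x. f x - h x) \<le> l2norm M (\<lambda>x. f x - g x) + l2norm M (\<lambda>x. g x - h x)"
  using l2norm_triangle[OF sqint_diff[OF assms(1,2)] sqint_diff[OF assms(2,3)]] by simp

lemma l2norm_mono:
  assumes "sqint M g" "\<And>x. x \<in> space M \<Longrightarrow> \<bar>f x\<bar> \<le> \<bar>g x\<bar>" "f \<in> borel_measurable M"
  shows "sqint M f" "l2norm M f \<le> l2norm M g"
proof -
  have *: "(f x)\<^sup>2 \<le> (g x)\<^sup>2" if "x \<in> space M" for x
    using assms(2)[OF that] by (simp add: abs_le_square_iff)
  have ig: "integrable M (\<lambda>x. (g x)\<^sup>2)" using assms by (simp add: sqint_def)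
  have "integrable M (\<lambda>x. (f x)\<^sup>2)"
    by (rule Bochner_Integration.integrable_bound[OF ig]) (use * assms(3) in auto)
  then show "sqint M f" using assms(3) by (simp add: sqint_def)
  show "l2norm M f \<le> l2norm M g"
    unfolding l2norm_def using * \<open>integrable M (\<lambda>x. (f x)\<^sup>2)\<close> ig
    by (intro real_sqrt_le_mono integral_mono) auto
qed

lemma l2norm_le_const:
  assumes "finite_measure M" "f \<in> borel_measurable M" "\<And>x. x \<in> space M \<Longrightarrow> \<bar>f x\<bar> \<le> c" "0 \<le> c"
  shows "sqint M f" "l2norm M f \<le> c * sqrt (measure M (space M))"
proof -
  have s: "sqint M (\<lambda>x. c)" by (rule sqint_const[OF assms(1)])
  show "sqint M f" using l2norm_mono(1)[OF s _ assms(2)] assms(3,4) by auto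
  have "l2norm M (\<lambda>x. c) = c * sqrt (measure M (space M))"
    using assms by (simp add: l2norm_def real_sqrt_mult mult.commute)
  then show "l2norm M f \<le> c * sqrt (measure M (space M))"
    using l2norm_mono(2)[OF s _ assms(2)] assms(3,4) by auto
qed

lemma l2norm_tendsto_0I:
  assumes "\<And>r. l2norm M (\<lambda>x. f r x) \<le> g r" "(g \<longlongrightarrow> 0) F"
  shows "((\<lambda>r. l2norm M (\<lambda>x. f r x)) \<longlongrightarrow> 0) F"
  by (rule tendsto_sandwich[OF _ _ tendsto_const assms(2)]) (auto intro: always_eventually assms(1))

subsection \<open>Square integrable functions on the line\<close>

lemma sqint_affine:
  assumes "sqint lborel f" "k \<noteq> 0"
  shows "sqint lborel (\<lambda>x::real. f (c + k * x))"
  using assms lborel_integrable_real_affine_iff[of k "\<lambda>x. (f x)\<^sup>2" c] by (auto simp: sqint_def)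

lemma l2norm_affine:
  assumes "\<bar>k\<bar> = 1"
  shows "l2norm lborel (\<lambda>x::real. f (c + k * x)) = l2norm lborel f"
proof -
  have "(LINT x|lborel. (f x)\<^sup>2) = (LINT x|lborel. (f (c + k * x))\<^sup>2)"
    using lborel_integral_real_affine[of k "\<lambda>x. (f x)\<^sup>2" c] assms by fastforce
  then show ?thesis by (simp add: l2norm_def)
qed

lemma sqint_shift: "sqint lborel f \<Longrightarrow> sqint lborel (\<lambda>x::real. f (x + h))"
  using sqint_affine[of f 1 h] by (simp add: add.commute)

lemma l2norm_shift: "l2norm lborel (\<lambda>x::real. f (x + h)) = l2norm lborel f"
  using l2norm_affine[of 1 f h] by (simp add: add.commute)

lemma sqint_indicator_Icc: "sqint lborel (indicator {a..b} :: real \<Rightarrow> real)"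
proof -
  have "(indicator {a..b} x :: real)\<^sup>2 = indicator {a..b} x" for x :: real
    by (simp add: indicator_def)
  moreover have "integrable lborel (indicator {a..b} :: real \<Rightarrow> real)"
    by (rule integrable_real_indicator) (auto simp: emeasure_lborel_Icc_eq)
  ultimately show ?thesis by (simp add: sqint_def)
qed

lemma l2norm_indicator_Icc: "a \<le> b \<Longrightarrow> l2norm lborel (indicator {a..b} :: real \<Rightarrow> real) = sqrt (b - a)"
proof -
  have "(indicator {a..b} x :: real)\<^sup>2 = indicator {a..b} x" for x :: real
    by (simp add: indicator_def)
  then show "a \<le> b \<Longrightarrow> ?thesis" by (simp add: l2norm_def)
qed

lemma sqint_integrable_Icc:
  "sqint lborel f \<Longrightarrow> integrable lborel (\<lambda>x::real. indicator {a..b} x * f x)"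
  by (rule sqint_mult[OF sqint_indicator_Icc])

lemma integral_Icc_le_l2norm:
  assumes "sqint lborel f" "a \<le> b"
  shows "\<bar>LINT x|lborel. indicator {a..b} x * f x\<bar> \<le> sqrt (b - a) * l2norm lborel f"
  using Cauchy_Schwarz_integral[OF sqint_indicator_Icc assms(1), of a b] assms(2)
  by (simp add: l2norm_indicator_Icc)

text \<open>Keeping the indicator on the right localises the Cauchy-Schwarz bound, so that it can
  afterwards be integrated over the position of the interval.\<close>

lemma integral_Icc_sq_le:
  assumes "sqint lborel f" "a \<le> b"
  shows "(LINT x|lborel. indicator {a..b} x * f x)\<^sup>2
           \<le> (b - a) * (LINT x|lborel. indicator {a..b} x * (f x)\<^sup>2)"
proof -
  let ?g = "\<lambda>x. indicator {a..b} x * f x"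
  have g: "sqint lborel ?g" by (rule sqint_indicator[OF assms(1)]) simp
  have "(LINT x|lborel. indicator {a..b} x * ?g x) = (LINT x|lborel. ?g x)"
    by (rule Bochner_Integration.integral_cong) (auto simp: indicator_def)
  then have "\<bar>LINT x|lborel. ?g x\<bar> \<le> sqrt (b - a) * l2norm lborel ?g"
    using integral_Icc_le_l2norm[OF g assms(2)] by simp
  then have "\<bar>LINT x|lborel. ?g x\<bar>\<^sup>2 \<le> (sqrt (b - a) * l2norm lborel ?g)\<^sup>2"
    by (rule power_mono) simp
  also have "\<dots> = (b - a) * (LINT x|lborel. (?g x)\<^sup>2)"
    using assms(2) by (simp add: power_mult_distrib l2norm_sq)
  also have "(\<lambda>x. (?g x)\<^sup>2) = (\<lambda>x. indicator {a..b} x * (f x)\<^sup>2)"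
    by (auto simp: indicator_def)
  finally show ?thesis by simp
qed

text \<open>Absolutely continuous functions described by their increments. Square integrability over
  the line is asked of \<open>f\<close> only, so \<open>F\<close> need not decay and constants are
  included.\<close>

definition primitive :: "(real \<Rightarrow> real) \<Rightarrow> (real \<Rightarrow> real) \<Rightarrow> bool" where
  "primitive F f \<longleftrightarrow> sqint lborel f \<and>
     (\<forall>x y. x \<le> y \<longrightarrow> F y - F x = (LINT r|lborel. indicator {x..y} r * f r))"

lemma primitive_sqint: "primitive F f \<Longrightarrow> sqint lborel f"
  by (simp add: primitive_def)

lemma primitiveD: "primitive F f \<Longrightarrow> x \<le> y \<Longrightarrow> F y - F x = (LINT r|lborel. indicator {x..y} r * f r)"
  by (simp add: primitive_def)

lemma integral_Icc_combine:
  fixes f :: "real \<Rightarrow> real"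
  assumes "sqint lborel f" "a \<le> b" "b \<le> c"
  shows "(LINT r|lborel. indicator {a..c} r * f r) =
         (LINT r|lborel. indicator {a..b} r * f r) + (LINT r|lborel. indicator {b..c} r * f r)"
proof -
  have "(LINT r|lborel. indicator {a..b} r * f r) + (LINT r|lborel. indicator {b..c} r * f r)
     = (LINT r|lborel. indicator {a..b} r * f r + indicator {b..c} r * f r)"
    using sqint_integrable_Icc[OF assms(1)] by simp
  also have "\<dots> = (LINT r|lborel. indicator {a..c} r * f r)"
  proof (rule integral_cong_AE)
    have "AE r in lborel. r \<noteq> b" by (rule AE_lborel_singleton)
    then show "AE r in lborel. indicator {a..b} r * f r + indicator {b..c} r * f r = indicator {a..c} r * f r"
      by eventually_elim (use assms in \<open>auto simp: indicator_def\<close>)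
  qed (use assms in \<open>auto simp: sqint_def\<close>)
  finally show ?thesis by simp
qed

lemma primitive_exists:
  assumes "sqint lborel f"
  obtains F where "primitive F f" "F c = d"
proof -
  let ?I = "\<lambda>a b. LINT r|lborel. indicator {a..b} r * f r"
  define F where "F y = (if c \<le> y then d + ?I c y else d - ?I y c)" for y
  have "?I c c = 0"
    using integral_Icc_le_l2norm[OF assms, of c c] by simp
  then have "F c = d" by (simp add: F_def)
  moreover have "primitive F f"
    unfolding primitive_def
  proof (intro conjI allI impI)
    fix x y :: real assume "x \<le> y"
    show "F y - F x = ?I x y"
      using integral_Icc_combine[OF assms, of c x y] integral_Icc_combine[OF assms, of x c y]
        integral_Icc_combine[OF assms, of x y c] \<open>x \<le> y\<close> \<open>?I c c = 0\<close>
      by (auto simp: F_def not_le)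
  qed (fact assms)
  ultimately show thesis using that by blast
qed

lemma primitive_add: "primitive F f \<Longrightarrow> primitive G g \<Longrightarrow> primitive (\<lambda>x. F x + G x) (\<lambda>x. f x + g x)"
  unfolding primitive_def
  using sqint_integrable_Icc
  by (auto simp: sqint_add distrib_left algebra_simps)

lemma primitive_cmult: "primitive F f \<Longrightarrow> primitive (\<lambda>x. c * F x) (\<lambda>x. c * f x)"
  unfolding primitive_def
  by (auto simp: sqint_cmult mult.left_commute simp flip: right_diff_distrib)

lemma primitive_diff: "primitive F f \<Longrightarrow> primitive G g \<Longrightarrow> primitive (\<lambda>x. F x - G x) (\<lambda>x. f x - g x)"
  using primitive_add[of F f "\<lambda>x. -1 * G x" "\<lambda>x. -1 * g x"] primitive_cmult[of G g "-1"] by simp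

lemma primitive_const: "primitive (\<lambda>x. c) (\<lambda>x. 0)"
  by (simp add: primitive_def sqint_zero)

lemma primitive_shift: 
  assumes "primitive F f" shows "primitive (\<lambda>x. F (x + h)) (\<lambda>x. f (x + h))"
  unfolding primitive_def
proof (intro conjI allI impI)
  show "sqint lborel (\<lambda>x. f (x + h))" by (rule sqint_shift[OF primitive_sqint[OF assms]])
  fix x y :: real assume "x \<le> y"
  then have "F (y + h) - F (x + h) = (LINT r|lborel. indicator {x+h..y+h} r * f r)"
    by (intro primitiveD[OF assms]) simp
  also have "\<dots> = (LINT r|lborel. indicator {x+h..y+h} (h + 1 * r) * f (h + 1 * r))"
    by (subst lborel_integral_real_affine[where c=1 and t=h]) auto
  also have "\<dots> = (LINT r|lborel. indicator {x..y} r * f (r + h))"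
    by (rule Bochner_Integration.integral_cong) (auto simp: indicator_def add.commute)
  finally show "F (y + h) - F (x + h) = (LINT r|lborel. indicator {x..y} r * f (r + h))" .
qed

lemma primitive_reflect:
  assumes "primitive F f" shows "primitive (\<lambda>x. F (- x)) (\<lambda>x. - f (- x))"
  unfolding primitive_def
proof (intro conjI allI impI)
  show "sqint lborel (\<lambda>x. - f (- x))"
    using sqint_affine[OF primitive_sqint[OF assms], of "-1" 0] sqint_minus by force
  fix x y :: real assume "x \<le> y"
  then have "F (- x) - F (- y) = (LINT r|lborel. indicator {-y..-x} r * f r)"
    by (intro primitiveD[OF assms]) simp
  also have "\<dots> = (LINT r|lborel. indicator {-y..-x} (0 + (-1) * r) * f (0 + (-1) * r))"
    by (subst lborel_integral_real_affine[where c="-1" and t=0]) auto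
  also have "\<dots> = (LINT r|lborel. indicator {x..y} r * f (- r))"
    by (rule Bochner_Integration.integral_cong) (auto simp: indicator_def)
  finally show "F (- y) - F (- x) = (LINT r|lborel. indicator {x..y} r * - f (- r))" 
    by simp
qed

text \<open>Cauchy-Schwarz against the indicator of the interval. This is the source of the
  pointwise bounds on profiles: the value at one point and the norm of \<open>f\<close> control
  \<open>F\<close> at bounded distance.\<close>

lemma primitive_Holder:
  assumes "primitive F f"
  shows "\<bar>F y - F x\<bar> \<le> sqrt \<bar>y - x\<bar> * l2norm lborel f"
proof -
  have *: "\<bar>F y - F x\<bar> \<le> sqrt (y - x) * l2norm lborel f" if "x \<le> y" for x y
    using primitiveD[OF assms that] integral_Icc_le_l2norm[OF primitive_sqint[OF assms] that] by simp
  show ?thesis using *[of x y] *[of y x] by (cases "x \<le> y") (auto simp: abs_minus_commute)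
qed

lemma primitive_continuous:
  assumes "primitive F f"
  shows "continuous_on A F"
proof -
  have "isCont F x" for x
  proof -
    have "((\<lambda>y. \<bar>F y - F x\<bar>) \<longlongrightarrow> 0) (at x)"
    proof (rule tendsto_sandwich[OF _ _ tendsto_const])
      show "\<forall>\<^sub>F y in at x. \<bar>F y - F x\<bar> \<le> sqrt \<bar>y - x\<bar> * l2norm lborel f"
        by (intro always_eventually allI primitive_Holder[OF assms])
      have "((\<lambda>y. sqrt \<bar>y - x\<bar> * l2norm lborel f) \<longlongrightarrow> sqrt \<bar>x - x\<bar> * l2norm lborel f) (at x)"
        by (intro tendsto_intros)
      then show "((\<lambda>y. sqrt \<bar>y - x\<bar> * l2norm lborel f) \<longlongrightarrow> 0) (at x)" by simp
    qed auto
    then show ?thesis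
      by (simp add: isCont_def tendsto_rabs_zero_iff LIM_zero_iff)
  qed
  then show ?thesis by (simp add: continuous_at_imp_continuous_on)
qed

lemma primitive_measurable: "primitive F f \<Longrightarrow> F \<in> borel_measurable borel"
  using primitive_continuous[of F f UNIV] borel_measurable_continuous_onI by blast

text \<open>Clamping the argument continues \<open>F\<close> by constants and its derivative by 0,
  which brings functions given on a compact interval into the calculus on the line.\<close>

lemma continuous_derivative_primitive:
  assumes "a \<le> b" and d: "\<And>x. x \<in> {a..b} \<Longrightarrow> (F has_real_derivative f x) (at x within {a..b})"
    and c: "continuous_on {a..b} f"
  shows "primitive (\<lambda>x. F (max a (min b x))) (\<lambda>x. indicator {a..b} x * f x)"
  unfolding primitive_def
proof (intro conjI allI impI)
  let ?g = "\<lambda>x. indicator {a..b} x * f x"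
  have gm: "?g \<in> borel_measurable borel"
    using borel_measurable_continuous_on_indicator[OF _ c] by simp
  obtain B where B: "\<And>x. x \<in> {a..b} \<Longrightarrow> \<bar>f x\<bar> \<le> B"
    using compact_imp_bounded[OF compact_continuous_image[OF c]]
    by (fastforce simp: bounded_iff)
  then have "B \<ge> 0" using \<open>a \<le> b\<close> by (metis abs_ge_zero atLeastAtMost_iff order_refl order_trans)
  show s: "sqint lborel ?g"
    by (rule l2norm_mono(1)[OF sqint_cmult[OF sqint_indicator_Icc[of a b], of B]])
      (use gm B \<open>B \<ge> 0\<close> in \<open>auto simp: indicator_def\<close>)
  have ftc: "(LINT r|lborel. indicator {x..y} r * ?g r) = F y - F x" if "a \<le> x" "x \<le> y" "y \<le> b" for x y
  proof -
    have "(LINT r|lborel. indicator {x..y} r *\<^sub>R f r) = F y - F x"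
    proof (rule integral_FTC_atLeastAtMost[OF that(2)])
      show "(F has_vector_derivative f r) (at r within {x..y})" if "x \<le> r" "r \<le> y" for r
        using d[of r] that \<open>a \<le> x\<close> \<open>y \<le> b\<close>
        by (auto simp: has_real_derivative_iff_has_vector_derivative
            intro: has_vector_derivative_within_subset)
      show "continuous_on {x..y} f" by (rule continuous_on_subset[OF c]) (use that in auto)
    qed
    moreover have "(\<lambda>r. indicator {x..y} r * ?g r) = (\<lambda>r. indicator {x..y} r *\<^sub>R f r)"
      using that by (auto simp: indicator_def)
    ultimately show ?thesis by simp
  qed
  have out: "(LINT r|lborel. indicator {x..y} r * ?g r) = 0" if "y \<le> a \<or> b \<le> x" for x y
  proof -
    show ?thesis
    proof (rule integral_eq_zero_AE)
      have "AE r in lborel. r \<noteq> a" "AE r in lborel. r \<noteq> b" by (rule AE_lborel_singleton)+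
      then show "AE r in lborel. indicator {x..y} r * ?g r = 0"
        by eventually_elim (use that in \<open>auto simp: indicator_def\<close>)
    qed
  qed
  fix x y :: real assume "x \<le> y"
  \<comment> \<open>The interval from \<open>x\<close> to \<open>y\<close> is cut at the clamped
    endpoints; the outer pieces meet \<open>{a..b}\<close> in at most a null set and contribute
    nothing.\<close>
  let ?c = "\<lambda>x. max a (min b x)"
  let ?I = "\<lambda>x y. LINT r|lborel. indicator {x..y} r * ?g r"
  show "F (?c y) - F (?c x) = ?I x y"
  proof (cases "y \<le> a \<or> b \<le> x")
    case True
    then have "?c y = ?c x" using \<open>x \<le> y\<close> \<open>a \<le> b\<close> by linarith
    then show ?thesis using out[OF True] by simp
  next
    case False
    obtain c d where cd: "c = ?c x" "d = ?c y" by simp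
    have le: "a \<le> c" "c \<le> d" "d \<le> b" "x \<le> c" "d \<le> y" "c \<le> a \<or> c = x" "b \<le> d \<or> d = y"
      using False \<open>x \<le> y\<close> \<open>a \<le> b\<close> unfolding cd by linarith+
    have z: "?I u u = 0" for u
      using integral_Icc_le_l2norm[OF s, of u u] by simp
    have "?I x c = 0" using le(6)
    proof
      assume "c = x" then show ?thesis using z[of x] by (simp only:)
    qed (rule out, simp)
    moreover have "?I d y = 0" using le(7)
    proof
      assume "d = y" then show ?thesis using z[of y] by (simp only:)
    qed (rule out, simp)
    moreover have "?I c d = F d - F c" by (rule ftc[OF le(1-3)])
    moreover have "?I x y = ?I x c + (?I c d + ?I d y)"
      using integral_Icc_combine[OF s le(4), of y] integral_Icc_combine[OF s le(2,5)] le by linarith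
    ultimately show ?thesis unfolding cd[symmetric] by linarith
  qed
qed

text \<open>Agreement of the values at \<open>c\<close> excludes a jump, and the derivative at the
  single point \<open>c\<close> is immaterial. Both boundary reflections are assembled in this
  way.\<close>

lemma primitive_glue:
  assumes "primitive F f" "primitive G g" "F c = G c"
  shows "primitive (\<lambda>x. if x \<le> c then F x else G x) (\<lambda>x. if x \<le> c then f x else g x)"
  unfolding primitive_def
proof (intro conjI allI impI)
  let ?h = "\<lambda>x. if x \<le> c then f x else g x"
  have f: "sqint lborel f" and g: "sqint lborel g" using assms primitive_sqint by auto
  have "sqint lborel (\<lambda>x. indicator {..c} x * f x + indicator {c<..} x * g x)"
    by (intro sqint_add sqint_indicator f g) auto
  moreover have "(\<lambda>x. indicator {..c} x * f x + indicator {c<..} x * g x) = ?h"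
    by (auto simp: indicator_def)
  ultimately show s: "sqint lborel ?h" by simp
  have lo: "(LINT r|lborel. indicator {x..y} r * ?h r) = F y - F x" if "x \<le> y" "y \<le> c" for x y
    unfolding primitiveD[OF assms(1) that(1)]
    by (rule Bochner_Integration.integral_cong) (use that in \<open>auto simp: indicator_def\<close>)
  have hi: "(LINT r|lborel. indicator {x..y} r * ?h r) = G y - G x" if "x \<le> y" "c \<le> x" for x y
    unfolding primitiveD[OF assms(2) that(1)]
  proof (rule integral_cong_AE)
    have "AE r in lborel. r \<noteq> c" by (rule AE_lborel_singleton)
    then show "AE r in lborel. indicator {x..y} r * ?h r = indicator {x..y} r * g r"
      by eventually_elim (use that in \<open>auto simp: indicator_def\<close>)
  qed (use f g s in \<open>auto simp: sqint_def\<close>)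
  fix x y :: real assume "x \<le> y"
  then show "(if y \<le> c then F y else G y) - (if x \<le> c then F x else G x)
              = (LINT r|lborel. indicator {x..y} r * ?h r)"
    using lo[of x y] hi[of x y] lo[of x c] hi[of c y] integral_Icc_combine[OF s, of x c y] assms(3)
    by (cases "y \<le> c"; cases "x \<le> c") auto
qed

section \<open>Density and translation in \<open>L2\<close>\<close>

lemma integrable_indicator_Icc: "integrable lborel (indicator {a..b} :: real \<Rightarrow> real)"
  by (rule integrable_real_indicator) (auto simp: emeasure_lborel_Icc_eq)

text \<open>For \<open>h \<ge> 0\<close>, \<open>(F (x + h) - F x)^2\<close> is at most
  \<open>h\<close> times the integral of \<open>f^2\<close> over \<open>{x..x+h}\<close>.
  Integrating in \<open>x\<close> and exchanging the integrals, each \<open>r\<close> is counted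
  over a set of length \<open>h\<close>, which gives \<open>h^2\<close> times the squared norm of
  \<open>f\<close>. Validity for every \<open>h\<close> is what lets density arguments reach
  difference quotients.\<close>

lemma l2norm_increment:
  assumes "primitive F f"
  shows "sqint lborel (\<lambda>x. F (x + h) - F x)"
    and "l2norm lborel (\<lambda>x. F (x + h) - F x) \<le> \<bar>h\<bar> * l2norm lborel f"
proof -
  have f: "sqint lborel f" and Fm: "F \<in> borel_measurable borel"
    using assms primitive_sqint primitive_measurable by auto
  have fm[measurable]: "f \<in> borel_measurable borel" using f by (simp add: sqint_def)
  have pos: "sqint lborel (\<lambda>x. F (x + h) - F x) \<and>
     l2norm lborel (\<lambda>x. F (x + h) - F x) \<le> h * l2norm lborel f" if "h \<ge> 0" for h
  proof -
    let ?D = "\<lambda>x. F (x + h) - F x"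
    \<comment> \<open>The exchange of integrals needs joint measurability of the indicator; it
      follows from closedness of this planar strip.\<close>
    have "{p::real\<times>real. fst p \<le> snd p \<and> snd p \<le> fst p + h} \<in> sets borel"
      by (intro borel_closed closed_Collect_conj closed_Collect_le continuous_intros)
    then have "{p::real\<times>real. fst p \<le> snd p \<and> snd p \<le> fst p + h} \<in> sets (borel \<Otimes>\<^sub>M borel)"
      by (simp only: borel_prod)
    then have "(\<lambda>p::real\<times>real. indicator {p. fst p \<le> snd p \<and> snd p \<le> fst p + h} p * ennreal ((f (snd p))\<^sup>2))
        \<in> borel_measurable (borel \<Otimes>\<^sub>M borel)"
      by measurable
    moreover have "(\<lambda>p::real\<times>real. indicator {p. fst p \<le> snd p \<and> snd p \<le> fst p + h} p * ennreal ((f (snd p))\<^sup>2))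
        = (\<lambda>(x, r). indicator {x..x+h} r * ennreal ((f r)\<^sup>2))"
      by (auto simp: indicator_def)
    moreover have "sets (lborel \<Otimes>\<^sub>M lborel) = sets (borel \<Otimes>\<^sub>M (borel :: real measure) :: (real\<times>real) measure)"
      by (intro sets_pair_measure_cong) auto
    ultimately have meas: "(\<lambda>(x, r). indicator {x..x+h} r * ennreal ((f r)\<^sup>2)) \<in> borel_measurable (lborel \<Otimes>\<^sub>M lborel)"
      by (simp cong: measurable_cong_sets)
    have Dm: "?D \<in> borel_measurable borel" using Fm by measurable
    have "(\<integral>\<^sup>+x. ennreal ((?D x)\<^sup>2) \<partial>lborel)
        \<le> (\<integral>\<^sup>+x. ennreal h * (\<integral>\<^sup>+r. indicator {x..x+h} r * ennreal ((f r)\<^sup>2) \<partial>lborel) \<partial>lborel)"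
    proof (rule nn_integral_mono)
      fix x :: real
      let ?J = "LINT r|lborel. indicator {x..x+h} r * (f r)\<^sup>2"
      have i: "integrable lborel (\<lambda>r. indicator {x..x+h} r * (f r)\<^sup>2)"
        using sqint_mult[OF f sqint_indicator[OF f, of "{x..x+h}"]]
        by (simp add: power2_eq_square mult_ac)
      have "(?D x)\<^sup>2 \<le> h * ?J"
        using integral_Icc_sq_le[OF f, of x "x + h"] primitiveD[OF assms, of x "x + h"] that by simp
      then have "ennreal ((?D x)\<^sup>2) \<le> ennreal h * ennreal ?J"
        using that by (simp add: ennreal_mult'[symmetric] ennreal_leI)
      also have "ennreal ?J = (\<integral>\<^sup>+r. ennreal (indicator {x..x+h} r * (f r)\<^sup>2) \<partial>lborel)"
        by (rule nn_integral_eq_integral[OF i, symmetric]) auto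
      also have "\<dots> = (\<integral>\<^sup>+r. indicator {x..x+h} r * ennreal ((f r)\<^sup>2) \<partial>lborel)"
        by (rule nn_integral_cong) (auto simp: indicator_def)
      finally show "ennreal ((?D x)\<^sup>2) \<le> ennreal h * (\<integral>\<^sup>+r. indicator {x..x+h} r * ennreal ((f r)\<^sup>2) \<partial>lborel)" .
    qed
    also have "\<dots> = ennreal h * (\<integral>\<^sup>+x. (\<integral>\<^sup>+r. indicator {x..x+h} r * ennreal ((f r)\<^sup>2) \<partial>lborel) \<partial>lborel)"
    proof (rule nn_integral_cmult)
      show "(\<lambda>x. \<integral>\<^sup>+r. indicator {x..x+h} r * ennreal ((f r)\<^sup>2) \<partial>lborel) \<in> borel_measurable lborel"
        by (rule lborel.borel_measurable_nn_integral[OF meas])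
    qed
    also have "(\<integral>\<^sup>+x. (\<integral>\<^sup>+r. indicator {x..x+h} r * ennreal ((f r)\<^sup>2) \<partial>lborel) \<partial>lborel)
        = (\<integral>\<^sup>+r. (\<integral>\<^sup>+x. indicator {x..x+h} r * ennreal ((f r)\<^sup>2) \<partial>lborel) \<partial>lborel)"
      using lborel_pair.Fubini'[OF meas] by simp
    also have "\<dots> = (\<integral>\<^sup>+r. ennreal h * ennreal ((f r)\<^sup>2) \<partial>lborel)"
    proof (rule nn_integral_cong)
      fix r :: real
      have "(\<integral>\<^sup>+x. indicator {x..x+h} r * ennreal ((f r)\<^sup>2) \<partial>lborel)
          = (\<integral>\<^sup>+x. ennreal ((f r)\<^sup>2) * indicator {r-h..r} x \<partial>lborel)"
        by (rule nn_integral_cong) (auto simp: indicator_def)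
      also have "\<dots> = ennreal h * ennreal ((f r)\<^sup>2)"
        using that by (simp add: nn_integral_cmult_indicator emeasure_lborel_Icc_eq mult.commute)
      finally show "(\<integral>\<^sup>+x. indicator {x..x+h} r * ennreal ((f r)\<^sup>2) \<partial>lborel) = ennreal h * ennreal ((f r)\<^sup>2)" .
    qed
    also have "\<dots> = ennreal h * ennreal (LINT r|lborel. (f r)\<^sup>2)"
      using f by (subst nn_integral_cmult) (auto simp: sqint_def nn_integral_eq_integral)
    finally have bound: "(\<integral>\<^sup>+x. ennreal ((?D x)\<^sup>2) \<partial>lborel) \<le> ennreal (h * h * (l2norm lborel f)\<^sup>2)"
      using that by (simp add: l2norm_sq ennreal_mult'[symmetric] mult.assoc)
    have "integrable lborel (\<lambda>x. (?D x)\<^sup>2)"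
      by (rule integrableI_bounded) (use Dm bound in \<open>auto simp: le_less_trans\<close>)
    then have s: "sqint lborel ?D" using Dm by (simp add: sqint_def)
    have "ennreal ((l2norm lborel ?D)\<^sup>2) \<le> ennreal (h * h * (l2norm lborel f)\<^sup>2)"
      using bound nn_integral_eq_integral[OF \<open>integrable lborel (\<lambda>x. (?D x)\<^sup>2)\<close>] by (simp add: l2norm_sq)
    then have "(l2norm lborel ?D)\<^sup>2 \<le> (h * l2norm lborel f)\<^sup>2"
      using that by (simp add: ennreal_le_iff power2_eq_square mult_ac)
    then have "l2norm lborel ?D \<le> h * l2norm lborel f"
      by (rule power2_le_imp_le) (use that in simp)
    with s show ?thesis by simp
  qed
  have "sqint lborel (\<lambda>x. F (x + h) - F x) \<and>
     l2norm lborel (\<lambda>x. F (x + h) - F x) \<le> \<bar>h\<bar> * l2norm lborel f"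
  proof (cases "h \<ge> 0")
    case True
    then show ?thesis using pos by simp
  next
    case False
    \<comment> \<open>An increment with negative step is, up to sign, a translate of one with
      positive step.\<close>
    let ?E = "\<lambda>x. F (x + - h) - F x"
    have p: "sqint lborel ?E" "l2norm lborel ?E \<le> - h * l2norm lborel f" using pos[of "- h"] False by auto
    have "sqint lborel (\<lambda>x. - ?E (x + h))" by (intro sqint_minus sqint_shift p)
    moreover have "l2norm lborel (\<lambda>x. - ?E (x + h)) = l2norm lborel ?E"
      using l2norm_shift[of ?E h] by (simp only: l2norm_minus)
    ultimately show ?thesis using p False by simp
  qed
  then show "sqint lborel (\<lambda>x. F (x + h) - F x)"
    "l2norm lborel (\<lambda>x. F (x + h) - F x) \<le> \<bar>h\<bar> * l2norm lborel f" by auto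
qed


lemma dominated_l2norm_tendsto:
  fixes u :: "nat \<Rightarrow> real \<Rightarrow> real"
  assumes g: "sqint lborel g" and u: "\<And>n. u n \<in> borel_measurable borel" and f: "f \<in> borel_measurable borel"
    and lim: "AE x in lborel. (\<lambda>n. u n x) \<longlonglongrightarrow> f x"
    and dom: "\<And>n x. \<bar>u n x - f x\<bar> \<le> \<bar>g x\<bar>"
  shows "(\<lambda>n. l2norm lborel (\<lambda>x. f x - u n x)) \<longlonglongrightarrow> 0"
proof -
  have "(\<lambda>n. LINT x|lborel. (f x - u n x)\<^sup>2) \<longlonglongrightarrow> (LINT x|(lborel::real measure). 0)"
  proof (rule integral_dominated_convergence[where w = "\<lambda>x. (g x)\<^sup>2"])
    show "AE x in lborel. (\<lambda>n. (f x - u n x)\<^sup>2) \<longlonglongrightarrow> 0"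
      using lim
    proof eventually_elim
      case (elim x)
      then have "(\<lambda>n. (f x - u n x)\<^sup>2) \<longlonglongrightarrow> (f x - f x)\<^sup>2" by (intro tendsto_intros)
      then show ?case by simp
    qed
    show "AE x in lborel. norm ((f x - u n x)\<^sup>2) \<le> (g x)\<^sup>2" for n
      using dom[of n] by (auto simp: abs_minus_commute simp flip: abs_le_square_iff)
  qed (use assms in \<open>auto simp: sqint_def\<close>)
  then have "(\<lambda>n. sqrt (LINT x|lborel. (f x - u n x)\<^sup>2)) \<longlonglongrightarrow> sqrt 0"
    by (intro tendsto_intros) simp
  then show ?thesis by (simp add: l2norm_def)
qed

text \<open>Two approximations: \<open>f\<close> is truncated in height and in space to
  \<open>h n\<close>, and this bounded function is an almost everywhere limit of continuous ones;
  clipping and cutting these off restores domination.\<close>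

lemma l2_dense_continuous:
  fixes f :: "real \<Rightarrow> real"
  assumes f: "sqint lborel f" and "e > 0"
  obtains \<phi> R where "continuous_on UNIV \<phi>" "\<And>x. x \<notin> {-R..R} \<Longrightarrow> \<phi> x = 0" "R \<ge> 0" "sqint lborel \<phi>"
    "l2norm lborel (\<lambda>x. f x - \<phi> x) < e"
proof -
  have fm[measurable]: "f \<in> borel_measurable borel" using f by (simp add: sqint_def)
  define clip :: "nat \<Rightarrow> real \<Rightarrow> real" where "clip n y = max (- real n) (min (real n) y)" for n y
  have clip_bound: "\<bar>clip n y\<bar> \<le> n" for n y unfolding clip_def by linarith
  have clip_le: "\<bar>clip n y\<bar> \<le> \<bar>y\<bar>" for n y unfolding clip_def by linarith
  have clip_meas[measurable]: "clip n \<in> borel_measurable borel" for n unfolding clip_def by measurable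
  define h where "h n x = indicator {-real n..real n} x * clip n (f x)" for n x
  have hm[measurable]: "h n \<in> borel_measurable borel" for n unfolding h_def by measurable
  have h_le: "\<bar>h n x\<bar> \<le> \<bar>f x\<bar>" for n x using clip_le[of n "f x"] by (auto simp: h_def indicator_def)
  have "(\<lambda>n. l2norm lborel (\<lambda>x. f x - h n x)) \<longlonglongrightarrow> 0"
  proof (rule dominated_l2norm_tendsto[OF sqint_cmult[OF f, of 2]])
    show "AE x in lborel. (\<lambda>n. h n x) \<longlonglongrightarrow> f x"
    proof (intro AE_I2 tendsto_eventually)
      fix x
      obtain N :: nat where N: "max \<bar>x\<bar> \<bar>f x\<bar> \<le> N" using real_arch_simple by blast
      show "\<forall>\<^sub>F n in sequentially. h n x = f x"
        unfolding eventually_sequentially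
      proof (intro exI[of _ N] allI impI)
        fix n assume "N \<le> n"
        then have "\<bar>x\<bar> \<le> real n" "\<bar>f x\<bar> \<le> real n" using N by auto
        then show "h n x = f x" unfolding h_def clip_def indicator_def by auto
      qed
    qed
    show "\<bar>h n x - f x\<bar> \<le> \<bar>2 * f x\<bar>" for n x using h_le[of n x] by linarith
  qed auto
  then have "\<forall>\<^sub>F n in sequentially. l2norm lborel (\<lambda>x. f x - h n x) < e / 2"
    using \<open>e > 0\<close> by (intro order_tendstoD) auto
  then obtain n where n: "l2norm lborel (\<lambda>x. f x - h n x) < e / 2"
    by (auto simp: eventually_sequentially)
  \<comment> \<open>\<open>measurable_on\<close> supplies continuous functions that converge
    pointwise off a negligible set.\<close>
  have "h n measurable_on UNIV"
    using hm[of n] by (intro lebesgue_measurable_imp_measurable_on measurable_completion) auto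
  then obtain N g where N: "negligible N" and g: "\<And>k. continuous_on UNIV (g k)"
    and lim: "\<And>x. x \<notin> N \<Longrightarrow> (\<lambda>k. g k x) \<longlonglongrightarrow> h n x"
    unfolding measurable_on_def by auto
  define R where "R = real n + 1"
  \<comment> \<open>\<open>cut\<close> is 1 where \<open>h n\<close> lives and 0 outside
    \<open>{-R..R}\<close>: it leaves the limit unchanged and gives all \<open>u k\<close> a common
    compact support.\<close>
  define cut where "cut x = max 0 (min 1 (R - \<bar>x\<bar>))" for x :: real
  have cut: "\<bar>x\<bar> \<le> real n \<Longrightarrow> cut x = 1" "\<bar>x\<bar> \<ge> R \<Longrightarrow> cut x = 0" "0 \<le> cut x" "cut x \<le> 1" for x
    unfolding cut_def R_def by auto
  define u where "u k x = cut x * clip n (g k x)" for k x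
  have ucont: "continuous_on UNIV (u k)" for k
    unfolding u_def cut_def clip_def by (intro continuous_intros g)
  have um[measurable]: "u k \<in> borel_measurable borel" for k
    using ucont by (rule borel_measurable_continuous_onI)
  have ubound: "\<bar>u k x\<bar> \<le> real n" for k x
  proof -
    have "\<bar>u k x\<bar> = cut x * \<bar>clip n (g k x)\<bar>" using cut by (simp add: u_def abs_mult)
    also have "\<dots> \<le> 1 * real n" using cut[of x] clip_bound by (intro mult_mono) auto
    finally show ?thesis by simp
  qed
  have uout: "x \<notin> {-R..R} \<Longrightarrow> u k x = 0" for k x using cut(2)[of x] by (auto simp: u_def)
  have hbound: "\<bar>h n x\<bar> \<le> real n" for x using clip_bound[of n "f x"] by (auto simp: h_def indicator_def)
  have su: "sqint lborel (u k)" for k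
    by (rule l2norm_mono(1)[OF sqint_cmult[OF sqint_indicator_Icc[of "-R" R], of "real n"]])
      (use ubound uout in \<open>auto simp: indicator_def\<close>)
  have "(\<lambda>k. l2norm lborel (\<lambda>x. h n x - u k x)) \<longlonglongrightarrow> 0"
  proof (rule dominated_l2norm_tendsto[OF sqint_cmult[OF sqint_indicator_Icc[of "-R" R], of "2 * real n"]])
    have "AE x in lebesgue. x \<notin> N"
      using N negligible_iff_null_sets AE_not_in by blast
    then have "AE x in lborel. x \<notin> N" by (simp add: AE_completion_iff)
    then show "AE x in lborel. (\<lambda>k. u k x) \<longlonglongrightarrow> h n x"
    proof eventually_elim
      case (elim x)
      have "(\<lambda>k. u k x) \<longlonglongrightarrow> cut x * clip n (h n x)"
        unfolding u_def clip_def by (intro tendsto_intros lim elim)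
      moreover have "cut x * clip n (h n x) = h n x"
      proof (cases "\<bar>x\<bar> \<le> real n")
        case True
        then show ?thesis using hbound[of x] by (simp add: cut clip_def)
      next
        case False
        then have "h n x = 0" by (auto simp: h_def indicator_def)
        then show ?thesis by (simp add: clip_def)
      qed
      ultimately show ?case by simp
    qed
    show "\<bar>u k x - h n x\<bar> \<le> \<bar>2 * real n * indicator {-R..R} x\<bar>" for k x
    proof (cases "x \<in> {-R..R}")
      case True
      then show ?thesis using ubound[of k x] hbound[of x] by simp
    next
      case False
      then have "h n x = 0" by (auto simp: h_def indicator_def R_def)
      then show ?thesis using uout[OF False] by simp
    qed
  qed auto
  then have "\<forall>\<^sub>F k in sequentially. l2norm lborel (\<lambda>x. h n x - u k x) < e / 2"
    using \<open>e > 0\<close> by (intro order_tendstoD) auto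
  then obtain k where k: "l2norm lborel (\<lambda>x. h n x - u k x) < e / 2"
    by (auto simp: eventually_sequentially)
  have "sqint lborel (h n)" by (rule l2norm_mono(1)[OF f]) (use h_le in auto)
  then have "l2norm lborel (\<lambda>x. f x - u k x) < e"
    using l2norm_triangle3[OF f _ su, of "h n" k] n k by simp
  then show thesis using that[of "u k" R] ucont uout su by (auto simp: R_def)
qed

text \<open>Uniform continuity is taken on a compact interval with margin 1 around the support. Two
  points closer than 1 either both lie in that interval or both lie outside the support.\<close>

lemma uniformly_small_translate:
  fixes \<phi> :: "real \<Rightarrow> real"
  assumes "continuous_on UNIV \<phi>" "\<And>x. x \<notin> {-R..R} \<Longrightarrow> \<phi> x = 0" "e > 0"
  obtains d where "d > 0" "\<And>x y. \<bar>y - x\<bar> < d \<Longrightarrow> \<bar>\<phi> y - \<phi> x\<bar> < e"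
proof -
  have "uniformly_continuous_on {-R-1..R+1} \<phi>"
    by (intro compact_uniformly_continuous continuous_on_subset[OF assms(1)]) auto
  then obtain d where d: "d > 0" "\<And>x y. x \<in> {-R-1..R+1} \<Longrightarrow> y \<in> {-R-1..R+1} \<Longrightarrow> \<bar>y - x\<bar> < d \<Longrightarrow> \<bar>\<phi> y - \<phi> x\<bar> < e"
    unfolding uniformly_continuous_on_def dist_real_def using \<open>e > 0\<close> by blast
  show thesis
  proof (rule that[of "min d 1"])
    show "min d 1 > 0" using d by simp
    fix x y assume xy: "\<bar>y - x\<bar> < min d 1"
    show "\<bar>\<phi> y - \<phi> x\<bar> < e"
    proof (cases "x \<in> {-R-1..R+1} \<and> y \<in> {-R-1..R+1}")
      case True then show ?thesis using d(2)[of x y] xy by auto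
    next
      case False
      then have "x \<notin> {-R..R}" "y \<notin> {-R..R}" using xy by auto
      then show ?thesis using assms(2,3) by simp
    qed
  qed
qed

lemma l2norm_small_support:
  fixes u :: "real \<Rightarrow> real"
  assumes "u \<in> borel_measurable borel" "\<And>x. \<bar>u x\<bar> \<le> c" "\<And>x. x \<notin> {-R..R} \<Longrightarrow> u x = 0" "R \<ge> 0"
  shows "l2norm lborel u \<le> c * sqrt (2 * R)"
proof -
  have "c \<ge> 0" using assms(2)[of 0] by linarith
  have "l2norm lborel u \<le> l2norm lborel (\<lambda>x. c * indicator {-R..R} x)"
    by (rule l2norm_mono(2)[OF sqint_cmult[OF sqint_indicator_Icc]])
      (use assms \<open>c \<ge> 0\<close> in \<open>auto simp: indicator_def\<close>)
  also have "\<dots> = c * sqrt (2 * R)"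
    using assms(4) \<open>c \<ge> 0\<close> by (simp add: l2norm_cmult l2norm_indicator_Icc)
  finally show ?thesis .
qed

text \<open>Translation preserves the norm, so replacing \<open>f\<close> by \<phi> costs twice the
  approximation error, while \<phi> and its translate are uniformly close on a bounded set.\<close>

lemma l2_translation_continuous:
  fixes f :: "real \<Rightarrow> real"
  assumes f: "sqint lborel f"
  shows "((\<lambda>h. l2norm lborel (\<lambda>x. f (x + h) - f x)) \<longlongrightarrow> 0) (at 0)"
proof (rule tendstoI)
  fix e :: real assume "e > 0"
  obtain \<phi> R where \<phi>: "continuous_on UNIV \<phi>" "\<And>x. x \<notin> {-R..R} \<Longrightarrow> \<phi> x = 0" "R \<ge> 0" "sqint lborel \<phi>"
    "l2norm lborel (\<lambda>x. f x - \<phi> x) < e / 4"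
    using l2_dense_continuous[OF f, of "e / 4"] \<open>e > 0\<close> by auto
  \<comment> \<open>\<open>X\<close> is the norm of the indicator of \<open>{-(R+1)..R+1}\<close>,
    outside which a difference with step below 1 vanishes; a uniform bound by \<open>c\<close> thus
    becomes \<open>e / 4\<close>.\<close>
  define X where "X = sqrt (2 * (R + 1))"
  define c where "c = e / (4 * X)"
  have "X > 0" using \<phi>(3) by (simp add: X_def)
  then have "c > 0" using \<open>e > 0\<close> by (simp add: c_def)
  obtain d where d: "d > 0" "\<And>x y. \<bar>y - x\<bar> < d \<Longrightarrow> \<bar>\<phi> y - \<phi> x\<bar> < c"
    using uniformly_small_translate[OF \<phi>(1,2) \<open>c > 0\<close>] by blast
  have \<phi>m[measurable]: "\<phi> \<in> borel_measurable borel" using \<phi>(4) by (simp add: sqint_def)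
  show "\<forall>\<^sub>F h in at 0. dist (l2norm lborel (\<lambda>x. f (x + h) - f x)) 0 < e"
    unfolding eventually_at
  proof (intro exI[of _ "min d 1"] conjI ballI impI)
    show "min d 1 > 0" using d by simp
    fix h :: real assume h: "h \<noteq> 0 \<and> dist h 0 < min d 1"
    have sh: "sqint lborel (\<lambda>x. f (x + h))" "sqint lborel (\<lambda>x. \<phi> (x + h))" by (intro sqint_shift f \<phi>)+
    have "l2norm lborel (\<lambda>x. f (x + h) - f x) \<le>
        l2norm lborel (\<lambda>x. f (x + h) - \<phi> (x + h)) + l2norm lborel (\<lambda>x. \<phi> (x + h) - f x)"
      by (rule l2norm_triangle3[OF sh f])
    also have "l2norm lborel (\<lambda>x. \<phi> (x + h) - f x) \<le>
        l2norm lborel (\<lambda>x. \<phi> (x + h) - \<phi> x) + l2norm lborel (\<lambda>x. \<phi> x - f x)"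
      by (rule l2norm_triangle3[OF sh(2) \<phi>(4) f])
    also have "l2norm lborel (\<lambda>x. \<phi> (x + h) - \<phi> x) \<le> c * X"
      unfolding X_def
    proof (rule l2norm_small_support)
      show "\<bar>\<phi> (x + h) - \<phi> x\<bar> \<le> c" for x using d(2)[of "x + h" x] h by (simp add: dist_real_def less_imp_le)
      show "\<phi> (x + h) - \<phi> x = 0" if "x \<notin> {-(R+1)..R+1}" for x
      proof -
        have "x \<notin> {-R..R}" "x + h \<notin> {-R..R}" using that h by (auto simp: dist_real_def)
        then show ?thesis using \<phi>(2) by simp
      qed
    qed (use \<phi> in auto)
    also have "l2norm lborel (\<lambda>x. f (x + h) - \<phi> (x + h)) = l2norm lborel (\<lambda>x. f x - \<phi> x)"
      by (rule l2norm_shift)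
    also have "l2norm lborel (\<lambda>x. \<phi> x - f x) = l2norm lborel (\<lambda>x. f x - \<phi> x)"
      by (rule l2norm_minus_commute)
    also have "c * X = e / 4" using \<open>X > 0\<close> by (simp add: c_def)
    finally show "dist (l2norm lborel (\<lambda>x. f (x + h) - f x)) 0 < e" using \<phi>(5) \<open>e > 0\<close> by (simp add: dist_real_def)
  qed
qed

text \<open>For a continuous density of compact support the quotients converge uniformly. The
  remainder \<open>F - P\<close> is controlled for every \<open>h\<close> at once: by
  \<open>l2norm_increment\<close> its quotient never exceeds the norm of
  \<open>f - \<phi>\<close>.\<close>

lemma l2_difference_quotient:
  assumes F: "primitive F f"
  shows "((\<lambda>h. l2norm lborel (\<lambda>x. (F (x + h) - F x) / h - f x)) \<longlongrightarrow> 0) (at 0)"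
proof (rule tendstoI)
  fix e :: real assume "e > 0"
  have f: "sqint lborel f" using F by (rule primitive_sqint)
  obtain \<phi> R where \<phi>: "continuous_on UNIV \<phi>" "\<And>x. x \<notin> {-R..R} \<Longrightarrow> \<phi> x = 0" "R \<ge> 0" "sqint lborel \<phi>"
    "l2norm lborel (\<lambda>x. f x - \<phi> x) < e / 4"
    using l2_dense_continuous[OF f, of "e / 4"] \<open>e > 0\<close> by auto
  obtain P where P: "primitive P \<phi>" using primitive_exists[OF \<phi>(4)] by blast
  define X where "X = sqrt (2 * (R + 1))"
  define c where "c = e / (4 * X)"
  have "X > 0" using \<phi>(3) by (simp add: X_def)
  then have "c > 0" using \<open>e > 0\<close> by (simp add: c_def)
  obtain d where d: "d > 0" "\<And>x y. \<bar>y - x\<bar> < d \<Longrightarrow> \<bar>\<phi> y - \<phi> x\<bar> < c"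
    using uniformly_small_translate[OF \<phi>(1,2) \<open>c > 0\<close>] by blast
  have \<phi>m[measurable]: "\<phi> \<in> borel_measurable borel" using \<phi>(4) by (simp add: sqint_def)
  have Pm[measurable]: "P \<in> borel_measurable borel" by (rule primitive_measurable[OF P])
  have "\<bar>P y - P x - (y - x) * \<phi> z\<bar> \<le> c * (y - x)" if "x \<le> y" "\<And>r. r \<in> {x..y} \<Longrightarrow> \<bar>\<phi> r - \<phi> z\<bar> \<le> c" for x y z
  proof -
    have i: "integrable lborel (\<lambda>r. indicator {x..y} r * \<phi> r)" "integrable lborel (\<lambda>r. indicator {x..y} r * \<phi> z)"
      "integrable lborel (\<lambda>r. indicator {x..y} r * c)"
      using sqint_integrable_Icc[OF \<phi>(4)] by (auto simp: integrable_indicator_Icc)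
    have "(LINT r|lborel. indicator {x..y} r * k) = (y - x) * k" for k :: real using that(1) by simp
    then have "P y - P x - (y - x) * \<phi> z = (LINT r|lborel. indicator {x..y} r * \<phi> r - indicator {x..y} r * \<phi> z)"
      using i that(1) by (simp add: primitiveD[OF P that(1)])
    also have "\<bar>\<dots>\<bar> \<le> (LINT r|lborel. \<bar>indicator {x..y} r * \<phi> r - indicator {x..y} r * \<phi> z\<bar>)"
      by (rule integral_abs_bound)
    also have "\<dots> \<le> (LINT r|lborel. indicator {x..y} r * c)"
      using i that(2) by (intro integral_mono) (auto simp: indicator_def)
    also have "\<dots> = c * (y - x)" using that(1) by simp
    finally show ?thesis .
  qed note est = this
  have quot: "\<bar>(P (x + h) - P x) / h - \<phi> x\<bar> \<le> c" if "h \<noteq> 0" "\<bar>h\<bar> < d" for x h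
  proof -
    have small: "\<bar>\<phi> r - \<phi> x\<bar> \<le> c" if "\<bar>r - x\<bar> \<le> \<bar>h\<bar>" for r
      using d(2)[of r x] that \<open>\<bar>h\<bar> < d\<close> by simp
    have "\<bar>P (x + h) - P x - h * \<phi> x\<bar> \<le> c * \<bar>h\<bar>"
    proof (cases "h > 0")
      case True
      then show ?thesis using est[of x "x + h" x] small by auto
    next
      case False
      then have "\<bar>P x - P (x + h) - (x - (x + h)) * \<phi> x\<bar> \<le> c * (x - (x + h))"
        using \<open>h \<noteq> 0\<close> small by (intro est) auto
      then show ?thesis using False by (simp add: abs_if algebra_simps split: if_splits)
    qed
    moreover have "(P (x + h) - P x) / h - \<phi> x = (P (x + h) - P x - h * \<phi> x) / h"
      using that by (simp add: field_simps)
    ultimately show ?thesis using that by (simp add: abs_divide divide_le_eq)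
  qed
  show "\<forall>\<^sub>F h in at 0. dist (l2norm lborel (\<lambda>x. (F (x + h) - F x) / h - f x)) 0 < e"
    unfolding eventually_at
  proof (intro exI[of _ "min d 1"] conjI ballI impI)
    show "min d 1 > 0" using d by simp
    fix h :: real assume h: "h \<noteq> 0 \<and> dist h 0 < min d 1"
    have sF: "sqint lborel (\<lambda>x. (F (x + h) - F x) / h)" and sP: "sqint lborel (\<lambda>x. (P (x + h) - P x) / h)"
      by (intro sqint_divide l2norm_increment(1)[OF F] l2norm_increment(1)[OF P])+
    have "l2norm lborel (\<lambda>x. (F (x + h) - F x) / h - f x) \<le>
        l2norm lborel (\<lambda>x. (F (x + h) - F x) / h - (P (x + h) - P x) / h)
         + l2norm lborel (\<lambda>x. (P (x + h) - P x) / h - f x)"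
      by (rule l2norm_triangle3[OF sF sP f])
    also have "l2norm lborel (\<lambda>x. (P (x + h) - P x) / h - f x) \<le>
        l2norm lborel (\<lambda>x. (P (x + h) - P x) / h - \<phi> x) + l2norm lborel (\<lambda>x. \<phi> x - f x)"
      by (rule l2norm_triangle3[OF sP \<phi>(4) f])
    also have "l2norm lborel (\<lambda>x. (P (x + h) - P x) / h - \<phi> x) \<le> c * X"
      unfolding X_def
    proof (rule l2norm_small_support)
      show "\<bar>(P (x + h) - P x) / h - \<phi> x\<bar> \<le> c" for x using quot[of h x] h by (simp add: dist_real_def)
      show "(P (x + h) - P x) / h - \<phi> x = 0" if "x \<notin> {-(R+1)..R+1}" for x
      proof -
        have z: "\<phi> r = 0" if "\<bar>r - x\<bar> \<le> \<bar>h\<bar>" for r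
        proof -
          have "\<not> (-(R+1) \<le> x \<and> x \<le> R+1)" "\<bar>h\<bar> < 1" using \<open>x \<notin> {-(R+1)..R+1}\<close> h by (auto simp: dist_real_def)
          then have "\<not> (-R \<le> r \<and> r \<le> R)" using that by linarith
          then show ?thesis using \<phi>(2)[of r] by simp
        qed
        have "(LINT r|lborel. indicator {u..v} r * \<phi> r) = 0" if "\<And>r. r \<in> {u..v} \<Longrightarrow> \<bar>r - x\<bar> \<le> \<bar>h\<bar>" for u v
          using that z by (intro integral_eq_zero_AE AE_I2) (auto simp: indicator_def)
        then have "P (x + h) = P x"
          using primitiveD[OF P, of x "x + h"] primitiveD[OF P, of "x + h" x] 
          by (cases "h \<ge> 0") auto
        then show ?thesis using z[of x] by simp
      qed
    qed (use \<phi> in auto)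
    also have "l2norm lborel (\<lambda>x. (F (x + h) - F x) / h - (P (x + h) - P x) / h)
        = l2norm lborel (\<lambda>x. inverse h * ((F (x + h) - P (x + h)) - (F x - P x)))"
      by (rule l2norm_cong) (use h in \<open>simp add: field_simps\<close>)
    also have "\<dots> = \<bar>inverse h\<bar> * l2norm lborel (\<lambda>x. (F (x + h) - P (x + h)) - (F x - P x))"
      by (rule l2norm_cmult)
    also have "\<dots> \<le> \<bar>inverse h\<bar> * (\<bar>h\<bar> * l2norm lborel (\<lambda>x. f x - \<phi> x))"
      by (intro mult_left_mono l2norm_increment(2)[OF primitive_diff[OF F P]]) simp
    also have "\<dots> = l2norm lborel (\<lambda>x. f x - \<phi> x)" using h by simp
    also have "l2norm lborel (\<lambda>x. \<phi> x - f x) = l2norm lborel (\<lambda>x. f x - \<phi> x)"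
      by (rule l2norm_minus_commute)
    also have "c * X = e / 4" using \<open>X > 0\<close> by (simp add: c_def)
    finally show "dist (l2norm lborel (\<lambda>x. (F (x + h) - F x) / h - f x)) 0 < e"
      using \<phi>(5) \<open>e > 0\<close> by (simp add: dist_real_def)
  qed
qed

text \<open>The quotients of a constant vanish and converge to \<open>f\<close> in norm, so
  pointwise differentiation is avoided.\<close>

lemma primitive_constant_imp_zero:
  assumes "primitive F f" "\<And>x y. F x = F y"
  shows "AE x in lborel. f x = 0"
proof -
  have f: "sqint lborel f" by (rule primitive_sqint[OF assms(1)])
  have "((\<lambda>h::real. l2norm lborel f) \<longlongrightarrow> 0) (at 0)"
  proof -
    have "F (x + h) - F x = 0" for x h using assms(2)[of "x + h" x] by linarith
    then show ?thesis using l2_difference_quotient[OF assms(1)] by (simp add: l2norm_minus)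
  qed
  then have "l2norm lborel f = 0"
    by (simp add: tendsto_const_iff)
  then show ?thesis using l2norm_eq_0_imp[OF f] by simp
qed

lemma primitive_derivative_unique:
  assumes "primitive F f" "primitive F g"
  shows "AE x in lborel. f x = g x"
  using primitive_constant_imp_zero[OF primitive_diff[OF assms]] by simp

section \<open>The Sobolev space on the unit interval\<close>

text \<open>\<open>f x * g y\<close> is integrated over the triangle
  \<open>a \<le> y \<le> x \<le> b\<close> in both orders; the inner integrals are increments of
  \<open>G\<close> from \<open>a\<close> and of \<open>F\<close> up to \<open>b\<close>.\<close>

lemma primitive_by_parts:
  assumes F: "primitive F f" and G: "primitive G g" and "a \<le> b"
  shows "(LINT x|lborel. indicator {a..b} x * (f x * G x)) + (LINT x|lborel. indicator {a..b} x * (F x * g x))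
    = F b * G b - F a * G a"
proof -
  have f: "sqint lborel f" and g: "sqint lborel g" using F G primitive_sqint by auto
  have [measurable]: "f \<in> borel_measurable borel" "g \<in> borel_measurable borel"
    "F \<in> borel_measurable borel" "G \<in> borel_measurable borel"
    using f g F G primitive_measurable by (auto simp: sqint_def)
  define u where "u x = indicator {a..b} x * f x" for x
  define v where "v x = indicator {a..b} x * g x" for x
  have [measurable]: "u \<in> borel_measurable borel" "v \<in> borel_measurable borel"
    unfolding u_def v_def by measurable
  have u: "integrable lborel u" and v: "integrable lborel v"
    unfolding u_def v_def using sqint_integrable_Icc f g by auto
  have sp: "sets (lborel \<Otimes>\<^sub>M lborel) = sets (borel \<Otimes>\<^sub>M (borel :: real measure) :: (real\<times>real) measure)"
    by (intro sets_pair_measure_cong) auto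
  have K0: "integrable (lborel \<Otimes>\<^sub>M lborel) (\<lambda>(x, y). u x * v y)"
  proof (rule lborel_pair.Fubini_integrable)
    show "(\<lambda>(x, y). u x * v y) \<in> borel_measurable (lborel \<Otimes>\<^sub>M lborel)"
      by (subst measurable_cong_sets[OF sp refl]) measurable
    show "integrable lborel (\<lambda>x. LINT y|lborel. norm (case (x, y) of (x, y) \<Rightarrow> u x * v y))"
      using u v by (simp add: abs_mult)
    show "AE x in lborel. integrable lborel (\<lambda>y. case (x, y) of (x, y) \<Rightarrow> u x * v y)"
      using v by simp
  qed
  define K where "K x y = indicator {a..x} y * (u x * v y)" for x y
  have K: "integrable (lborel \<Otimes>\<^sub>M lborel) (case_prod K)"
  proof (rule Bochner_Integration.integrable_bound[OF K0])
    have "{p::real\<times>real. a \<le> snd p \<and> snd p \<le> fst p} \<in> sets borel"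
      by (intro borel_closed closed_Collect_conj closed_Collect_le continuous_intros)
    then have "{p::real\<times>real. a \<le> snd p \<and> snd p \<le> fst p} \<in> sets (borel \<Otimes>\<^sub>M borel)"
      by (simp only: borel_prod)
    then have "(\<lambda>p::real\<times>real. indicator {p. a \<le> snd p \<and> snd p \<le> fst p} p * (u (fst p) * v (snd p)))
        \<in> borel_measurable (borel \<Otimes>\<^sub>M borel)"
      by measurable
    moreover have "(\<lambda>p::real\<times>real. indicator {p. a \<le> snd p \<and> snd p \<le> fst p} p * (u (fst p) * v (snd p))) = case_prod K"
      by (auto simp: indicator_def K_def)
    ultimately show "case_prod K \<in> borel_measurable (lborel \<Otimes>\<^sub>M lborel)"
      by (subst measurable_cong_sets[OF sp refl]) simp
    show "AE p in lborel \<Otimes>\<^sub>M lborel. norm (case_prod K p) \<le> norm (case p of (x, y) \<Rightarrow> u x * v y)"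
      by (auto simp: K_def indicator_def)
  qed
  have Kx: "(LINT y|lborel. K x y) = u x * G x - u x * G a" for x
  proof (cases "x \<in> {a..b}")
    case True
    have "(LINT y|lborel. K x y) = (LINT y|lborel. u x * (indicator {a..x} y * g y))"
      by (rule Bochner_Integration.integral_cong) (use True in \<open>auto simp: K_def v_def indicator_def\<close>)
    also have "\<dots> = u x * (G x - G a)" using primitiveD[OF G, of a x] True by simp
    finally show ?thesis by (simp add: algebra_simps)
  qed (simp add: K_def u_def)
  have Ky: "(LINT x|lborel. K x y) = F b * v y - indicator {a..b} y * (F y * g y)" for y
  proof (cases "y \<in> {a..b}")
    case True
    have "(LINT x|lborel. K x y) = (LINT x|lborel. v y * (indicator {y..b} x * f x))"
      by (rule Bochner_Integration.integral_cong) (use True in \<open>auto simp: K_def u_def indicator_def\<close>)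
    also have "\<dots> = v y * (F b - F y)" using primitiveD[OF F, of y b] True by simp
    finally show ?thesis using True by (simp add: algebra_simps v_def)
  qed (simp add: K_def v_def)
  have Fub: "(LINT x|lborel. u x * G x - u x * G a) = (LINT y|lborel. F b * v y - indicator {a..b} y * (F y * g y))"
    using lborel_pair.Fubini_integral[OF K] by (simp add: Kx Ky)
  have bnd: "integrable lborel (\<lambda>x. indicator {a..b} x * (w x * H x))" if "sqint lborel w" "continuous_on UNIV H" for w H :: "real \<Rightarrow> real"
  proof -
    have c: "continuous_on {a..b} H" using that(2) by (rule continuous_on_subset) simp
    obtain B where B: "\<And>x. x \<in> {a..b} \<Longrightarrow> \<bar>H x\<bar> \<le> B"
      using compact_imp_bounded[OF compact_continuous_image[OF c]] by (fastforce simp: bounded_iff)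
    have [measurable]: "H \<in> borel_measurable borel" "w \<in> borel_measurable borel"
      using that by (auto intro: borel_measurable_continuous_onI simp: sqint_def)
    have "sqint lborel (\<lambda>x. indicator {a..b} x * H x)"
      by (rule l2norm_mono(1)[OF sqint_cmult[OF sqint_indicator_Icc[of a b], of B]])
        (use B in \<open>fastforce simp: indicator_def\<close>)+
    from sqint_mult[OF that(1) this] show ?thesis by (simp add: mult_ac)
  qed
  have i1: "integrable lborel (\<lambda>x. indicator {a..b} x * (f x * G x))"
    by (rule bnd[OF f primitive_continuous[OF G]])
  have i2: "integrable lborel (\<lambda>x. indicator {a..b} x * (F x * g x))"
    using bnd[OF g primitive_continuous[OF F]] by (simp add: mult.commute)
  have P: "(LINT x|lborel. u x) = F b - F a" "(LINT x|lborel. v x) = G b - G a"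
    using primitiveD[OF F \<open>a \<le> b\<close>] primitiveD[OF G \<open>a \<le> b\<close>] by (simp_all add: u_def[abs_def] v_def[abs_def])
  have X: "(LINT x|lborel. u x * G x - u x * G a) = (LINT x|lborel. indicator {a..b} x * (f x * G x)) - (LINT x|lborel. u x) * G a"
  proof -
    have "integrable lborel (\<lambda>x. u x * G x)" "(LINT x|lborel. u x * G x) = (LINT x|lborel. indicator {a..b} x * (f x * G x))"
      using i1 by (simp_all add: u_def mult.assoc)
    then show ?thesis using u by simp
  qed
  have Y: "(LINT y|lborel. F b * v y - indicator {a..b} y * (F y * g y))
     = F b * (LINT y|lborel. v y) - (LINT x|lborel. indicator {a..b} x * (F x * g x))"
    using i2 v by simp
  have "(LINT x|lborel. indicator {a..b} x * (f x * G x)) - (F b - F a) * G a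
      = F b * (G b - G a) - (LINT x|lborel. indicator {a..b} x * (F x * g x))"
    using Fub unfolding X Y P .
  then show ?thesis by (simp add: algebra_simps)
qed

section \<open>The unit interval inside the line\<close>

abbreviation (input) I01 :: "real measure" where
  "I01 \<equiv> lebesgue_on {0..1}"

lemma space_I01 [simp]: "space I01 = {0..1}"
  by simp

lemma finite_measure_I01: "finite_measure I01"
  by (rule finite_measureI) (simp add: emeasure_restrict_space)

lemma measure_I01 [simp]: "measure I01 {0..1} = 1"
  by (simp add: measure_restrict_space)

lemma borel_I01: "f \<in> borel_measurable borel \<Longrightarrow> f \<in> borel_measurable I01"
  by (intro measurable_restrict_space1 measurable_completion) simp

lemma AE_lborel_I01: "AE x in lborel. P x \<Longrightarrow> AE x in I01. P x"
proof -
  assume "AE x in lborel. P x"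
  then have "AE x in lebesgue. P x" by (rule AE_completion)
  then show ?thesis by (subst AE_restrict_space_iff) auto
qed

lemma integral_I01:
  fixes f :: "real \<Rightarrow> real"
  assumes "f \<in> borel_measurable borel"
  shows "(LINT x|I01. f x) = (LINT x|lborel. indicator {0..1} x * f x)"
proof -
  have "(LINT x|I01. f x) = (LINT x|lebesgue. indicator {0..1} x *\<^sub>R f x)"
    by (rule integral_restrict_space) simp
  also have "\<dots> = (LINT x|lborel. indicator {0..1} x *\<^sub>R f x)"
    by (rule integral_completion) (use assms in simp)
  finally show ?thesis by simp
qed

lemma integrable_I01:
  fixes f :: "real \<Rightarrow> real"
  assumes "f \<in> borel_measurable borel"
  shows "integrable I01 f \<longleftrightarrow> integrable lborel (\<lambda>x. indicator {0..1} x * f x)"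
proof -
  have "integrable I01 f \<longleftrightarrow> integrable lebesgue (\<lambda>x. indicator {0..1} x *\<^sub>R f x)"
    by (rule integrable_restrict_space) simp
  also have "\<dots> \<longleftrightarrow> integrable lborel (\<lambda>x. indicator {0..1} x *\<^sub>R f x)"
    by (rule integrable_completion) (use assms in simp)
  finally show ?thesis by simp
qed

lemma sqint_I01:
  assumes "sqint lborel f"
  shows "sqint I01 f" "l2norm I01 f \<le> l2norm lborel f"
proof -
  have m: "f \<in> borel_measurable borel" using assms by (simp add: sqint_def)
  have i: "sqint lborel (\<lambda>x. indicator {0..1} x * f x)" by (rule sqint_indicator[OF assms]) simp
  have eq: "(indicator {0..1} x * f x)\<^sup>2 = indicator {0..1} x * (f x)\<^sup>2" for x
    by (simp add: indicator_def)
  show "sqint I01 f"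
    using i m borel_I01[OF m] by (simp add: sqint_def integrable_I01 eq)
  have "l2norm I01 f = l2norm lborel (\<lambda>x. indicator {0..1} x * f x)"
    using m by (simp add: l2norm_def integral_I01 eq)
  also have "\<dots> \<le> l2norm lborel f"
    by (rule l2norm_mono(2)[OF assms]) (use m in \<open>auto simp: indicator_def\<close>)
  finally show "l2norm I01 f \<le> l2norm lborel f" .
qed

lemma L2_iff: "g \<in> L2 \<longleftrightarrow> sqint I01 g"
  by (simp add: L2_def sqint_def)

lemma inner01_eq: "inner01 f g = (LINT x|I01. f x * g x)"
  by (simp add: inner01_def)

lemma L2_norm_eq: "L2_norm g = l2norm I01 g"
  by (simp add: L2_norm_def l2norm_def inner01_def power2_eq_square)

text \<open>Members of \<open>L2\<close> are merely Lebesgue measurable on \<open>[0,1]\<close>,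
  while translates and iterated integrals on the line are handled with Borel functions. The change
  concerns a null set, and extension by 0 preserves the norm.\<close>

lemma sqint_I01_borel_representative:
  assumes "sqint I01 g"
  obtains g0 where "sqint lborel g0" "AE x in I01. g0 x = g x" "\<And>x. x \<notin> {0..1} \<Longrightarrow> g0 x = 0"
    "l2norm lborel g0 = l2norm I01 g"
proof -
  have "(\<lambda>x. indicator {0..1} x *\<^sub>R g x) \<in> borel_measurable lebesgue"
    using assms borel_measurable_restrict_space_iff[of "{0..1}" lebesgue g] by (simp add: sqint_def)
  then obtain g' where g'm: "g' \<in> borel_measurable lborel" and g': "AE x in lborel. indicator {0..1} x *\<^sub>R g x = g' x"
    using completion_ex_borel_measurable_real by blast
  define g0 where "g0 x = indicator {0..1} x * g' x" for x
  have g0m: "g0 \<in> borel_measurable borel" unfolding g0_def using g'm by simp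
  have "AE x in I01. indicator {0..1} x *\<^sub>R g x = g' x" by (rule AE_lborel_I01[OF g'])
  moreover have "AE x in I01. x \<in> {0..1}" by (metis AE_space space_I01)
  ultimately have ae: "AE x in I01. g0 x = g x" 
    by eventually_elim (auto simp: g0_def)
  have m: "g0 \<in> borel_measurable I01" by (rule borel_I01[OF g0m])
  have "sqint I01 g0" by (rule sqint_cong_AE[OF assms m]) (use ae in \<open>auto elim: AE_mp\<close>)
  moreover have supp: "(\<lambda>x. indicator {0..1} x * (g0 x)\<^sup>2) = (\<lambda>x. (g0 x)\<^sup>2)"
    by (auto simp: g0_def split: split_indicator)
  ultimately have s: "sqint lborel g0"
    using g0m integrable_I01[of "\<lambda>x. (g0 x)\<^sup>2"] by (simp add: sqint_def)
  have "(LINT x|I01. (g0 x)\<^sup>2) = (LINT x|lborel. (g0 x)\<^sup>2)"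
    using g0m integral_I01[of "\<lambda>x. (g0 x)\<^sup>2"] by (simp add: supp)
  then have "l2norm lborel g0 = l2norm I01 g0" by (simp add: l2norm_def)
  also have "\<dots> = l2norm I01 g"
    by (rule l2norm_cong_AE[OF m _ ae]) (use assms in \<open>simp add: sqint_def\<close>)
  finally show thesis using that[of g0] s ae by (auto simp: g0_def)
qed

text \<open>The second difference of the positive part: a triangular bump on \<open>{-1..1}\<close>
  with integral 1. Its antiderivative \<open>ramp\<close> is a continuously differentiable step from
  0 to 1, which is all the smoothness that \<open>test_fun\<close> asks for.\<close>

definition hat :: "real \<Rightarrow> real" where
  "hat y = max 0 (y + 1) - 2 * max 0 y + max 0 (y - 1)"

definition ramp :: "real \<Rightarrow> real" where
  "ramp y = ((max 0 (y + 1))\<^sup>2 - 2 * (max 0 y)\<^sup>2 + (max 0 (y - 1))\<^sup>2) / 2"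

lemma DERIV_max_sq: "((\<lambda>y. (max 0 y)\<^sup>2) has_real_derivative 2 * max 0 y) (at (y::real))"
proof -
  consider "y > 0" | "y < 0" | "y = 0" by linarith
  then show ?thesis
  proof cases
    case 1
    have "((\<lambda>y. y\<^sup>2) has_real_derivative 2 * y) (at y)" by (auto intro!: derivative_eq_intros)
    then show ?thesis
      by (rule DERIV_cong_ev[THEN iffD1, rotated 3])
        (use 1 eventually_nhds_in_open[of "{0<..}" y] in \<open>auto elim!: eventually_mono\<close>)
  next
    case 2
    have "((\<lambda>y. 0) has_real_derivative 0) (at y)" by simp
    then show ?thesis
      by (rule DERIV_cong_ev[THEN iffD1, rotated 3])
        (use 2 eventually_nhds_in_open[of "{..<0}" y] in \<open>auto elim!: eventually_mono\<close>)
  next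
    case 3
    have "((\<lambda>h. ((max 0 (0 + h))\<^sup>2 - (max 0 0)\<^sup>2) / h) \<longlongrightarrow> 0) (at (0::real))"
    proof (rule Lim_null_comparison)
      have "norm (((max 0 (0 + h))\<^sup>2 - (max 0 0)\<^sup>2) / h) \<le> \<bar>h\<bar>" for h :: real
        by (cases "h > 0") (auto simp: power2_eq_square)
      then show "\<forall>\<^sub>F h in at 0. norm (((max 0 (0 + h))\<^sup>2 - (max 0 0)\<^sup>2) / h) \<le> \<bar>h::real\<bar>" by (simp add: always_eventually)
      show "((\<lambda>h. \<bar>h\<bar>) \<longlongrightarrow> 0) (at (0::real))" by (intro tendsto_rabs_zero tendsto_ident_at)
    qed
    then show ?thesis using 3 by (simp add: DERIV_def)
  qed
qed

lemma DERIV_ramp: "(ramp has_real_derivative hat y) (at y)"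
proof -
  have *: "((\<lambda>y. (max 0 (y + c))\<^sup>2) has_real_derivative 2 * max 0 (y + c) * 1) (at y)" for c :: real
    by (rule DERIV_chain'[of "\<lambda>y. y + c", OF _ DERIV_max_sq]) (auto intro!: derivative_eq_intros)
  have "((\<lambda>y. ((max 0 (y + 1))\<^sup>2 - 2 * (max 0 (y + 0))\<^sup>2 + (max 0 (y + -1))\<^sup>2) / 2) has_real_derivative
      (2 * max 0 (y + 1) * 1 - 2 * (2 * max 0 (y + 0) * 1) + 2 * max 0 (y + -1) * 1) / 2) (at y)"
    by (intro DERIV_cdivide DERIV_add DERIV_diff DERIV_cmult *)
  then have "(ramp has_real_derivative
      (2 * max 0 (y + 1) * 1 - 2 * (2 * max 0 (y + 0) * 1) + 2 * max 0 (y + -1) * 1) / 2) (at y)"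
    unfolding ramp_def[abs_def] by simp
  moreover have "(2 * max 0 (y + 1) * 1 - 2 * (2 * max 0 (y + 0) * 1) + 2 * max 0 (y + -1) * 1) / 2 = hat y"
    unfolding hat_def by simp
  ultimately show ?thesis by simp
qed

lemma continuous_hat: "continuous_on A hat"
  unfolding hat_def[abs_def] by (intro continuous_intros)

lemma ramp_simps: "y \<le> -1 \<Longrightarrow> ramp y = 0" "y \<ge> 1 \<Longrightarrow> ramp y = 1"
  unfolding ramp_def by (auto simp: power2_eq_square algebra_simps)

lemma hat_nonneg: "0 \<le> hat y"
  unfolding hat_def by linarith

lemma hat_le: "hat y \<le> 1"
  unfolding hat_def by linarith

lemma hat_outside: "y \<notin> {-1..1} \<Longrightarrow> hat y = 0"
  unfolding hat_def by auto

lemma ramp_mono: "x \<le> y \<Longrightarrow> ramp x \<le> ramp y"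
  by (rule DERIV_nonneg_imp_nondecreasing) (use DERIV_ramp hat_nonneg in blast)+

lemma ramp_bounds: "0 \<le> ramp y" "ramp y \<le> 1"
proof -
  show "0 \<le> ramp y" using ramp_mono[of "min y (-1)" y] ramp_simps(1)[of "min y (-1)"] by simp
  show "ramp y \<le> 1" using ramp_mono[of y "max y 1"] ramp_simps(2)[of "max y 1"] by simp
qed

lemma continuous_ramp: "continuous_on A ramp"
  by (meson DERIV_ramp DERIV_isCont continuous_at_imp_continuous_on)

lemma sqint_hat: "sqint lborel hat"
  by (rule l2norm_mono(1)[OF sqint_indicator_Icc[of "-1" 1]])
    (use hat_nonneg hat_le hat_outside continuous_hat[of UNIV] in
      \<open>auto simp: indicator_def intro: borel_measurable_continuous_onI\<close>)

lemma integral_hat: "integrable lborel hat" "(LINT x|lborel. hat x) = 1"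
proof -
  have eq: "hat = (\<lambda>x. indicator {-1..1} x * hat x)"
    using hat_outside by (auto split: split_indicator)
  show "integrable lborel hat" by (subst eq) (rule sqint_integrable_Icc[OF sqint_hat])
  have "(LINT x|lborel. indicator {-1..1} x *\<^sub>R hat x) = ramp 1 - ramp (-1)"
    by (rule integral_FTC_atLeastAtMost)
      (auto intro: continuous_hat has_field_derivative_at_within DERIV_ramp
        simp flip: has_real_derivative_iff_has_vector_derivative)
  then show "(LINT x|lborel. hat x) = 1" by (subst eq) (simp add: ramp_simps)
qed

text \<open>A plateau of height 1 on \<open>[a, b]\<close>, up to boundary layers of width \<open>2 e\<close>.\<close>

definition plateau :: "real \<Rightarrow> real \<Rightarrow> real \<Rightarrow> real \<Rightarrow> real" where
  "plateau e a b x = ramp ((x - a) / e) - ramp ((x - b) / e)"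

definition plateau' :: "real \<Rightarrow> real \<Rightarrow> real \<Rightarrow> real \<Rightarrow> real" where
  "plateau' e a b x = (hat ((x - a) / e) - hat ((x - b) / e)) / e"

lemma test_fun_plateau:
  assumes "e > 0" "a \<le> b" "0 < a - e" "b + e < 1"
  shows "test_fun (plateau e a b) (plateau' e a b)"
  unfolding test_fun_def
proof (intro conjI allI exI impI)
  fix x
  have "((\<lambda>x. ramp ((x - a) / e)) has_real_derivative hat ((x - a) / e) * (1 / e)) (at x)" for a
    by (rule DERIV_chain'[OF _ DERIV_ramp]) (use assms in \<open>auto intro!: derivative_eq_intros\<close>)
  from DERIV_diff[OF this[of a] this[of b]]
  show "(plateau e a b has_real_derivative plateau' e a b x) (at x)"
    unfolding plateau_def[abs_def] plateau'_def by (simp add: diff_divide_distrib)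
next
  show "continuous_on UNIV (plateau' e a b)"
    unfolding plateau'_def[abs_def] using assms
    by (intro continuous_intros continuous_on_compose2[OF continuous_hat[of UNIV]]) auto
next
  show "0 < a - e" "a - e < b + e" "b + e < 1" using assms by auto
next
  fix x assume x: "x \<notin> {a - e..b + e}"
  show "plateau e a b x = 0"
  proof (cases "x < a - e")
    case True
    then have "(x - a) / e \<le> -1" "(x - b) / e \<le> -1" using assms by (auto simp: field_simps)
    then show ?thesis by (simp add: plateau_def ramp_simps)
  next
    case False
    then have "(x - a) / e \<ge> 1" "(x - b) / e \<ge> 1" using assms x by (auto simp: field_simps)
    then show ?thesis by (simp add: plateau_def ramp_simps)
  qed
qed

lemma plateau_bounds: "e > 0 \<Longrightarrow> a \<le> b \<Longrightarrow> 0 \<le> plateau e a b x" "e > 0 \<Longrightarrow> a \<le> b \<Longrightarrow> plateau e a b x \<le> 1"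
proof -
  assume "e > 0" "a \<le> b"
  then have "(x - b) / e \<le> (x - a) / e" by (simp add: divide_right_mono)
  then show "0 \<le> plateau e a b x" using ramp_mono by (simp add: plateau_def)
  show "plateau e a b x \<le> 1" using ramp_bounds[of "(x - a) / e"] ramp_bounds[of "(x - b) / e"]
    by (simp add: plateau_def)
qed

text \<open>The scaled hats are an approximate identity at \<open>a\<close>; after the substitution
  \<open>x = a + \<epsilon> n * y\<close> the kernel no longer moves and dominated convergence
  applies.\<close>

lemma scaled_average_tendsto:
  fixes f :: "real \<Rightarrow> real"
  assumes f: "continuous_on UNIV f" and B: "\<And>x. \<bar>f x\<bar> \<le> B"
    and \<epsilon>: "\<And>n. \<epsilon> n > 0" "\<epsilon> \<longlonglongrightarrow> 0"
  shows "(\<lambda>n. LINT x|lborel. f x * (hat ((x - a) / \<epsilon> n) / \<epsilon> n)) \<longlonglongrightarrow> f a"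
proof -
  have [measurable]: "f \<in> borel_measurable borel" "hat \<in> borel_measurable borel"
    using f continuous_hat[of UNIV] by (auto intro: borel_measurable_continuous_onI)
  have "(LINT x|lborel. f x * (hat ((x - a) / \<epsilon> n) / \<epsilon> n)) = (LINT y|lborel. f (a + \<epsilon> n * y) * hat y)" for n
  proof -
    have "(LINT x|lborel. f x * (hat ((x - a) / \<epsilon> n) / \<epsilon> n))
        = \<epsilon> n * (LINT y|lborel. f (a + \<epsilon> n * y) * (hat (\<epsilon> n * y / \<epsilon> n) / \<epsilon> n))"
      using \<epsilon>(1)[of n] by (subst lborel_integral_real_affine[where c="\<epsilon> n" and t=a]) auto
    also have "\<dots> = (LINT y|lborel. \<epsilon> n * (f (a + \<epsilon> n * y) * (hat (\<epsilon> n * y / \<epsilon> n) / \<epsilon> n)))" by simp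
    also have "\<dots> = (LINT y|lborel. f (a + \<epsilon> n * y) * hat y)"
      by (rule Bochner_Integration.integral_cong) (use \<epsilon>(1)[of n] in simp_all)
    finally show ?thesis .
  qed
  moreover have "(\<lambda>n. LINT y|lborel. f (a + \<epsilon> n * y) * hat y) \<longlonglongrightarrow> (LINT y|lborel. f a * hat y)"
  proof (rule integral_dominated_convergence[where w="\<lambda>y. B * hat y"])
    show "integrable lborel (\<lambda>y. B * hat y)" using integral_hat(1) by simp
    show "AE y in lborel. (\<lambda>n. f (a + \<epsilon> n * y) * hat y) \<longlonglongrightarrow> f a * hat y"
    proof (intro AE_I2 tendsto_mult_right)
      fix y
      have "(\<lambda>n. a + \<epsilon> n * y) \<longlonglongrightarrow> a + 0 * y" by (intro tendsto_intros \<epsilon>)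
      then have "(\<lambda>n. a + \<epsilon> n * y) \<longlonglongrightarrow> a" by simp
      moreover have "isCont f a" using f by (simp add: continuous_on_eq_continuous_at)
      ultimately show "(\<lambda>n. f (a + \<epsilon> n * y)) \<longlonglongrightarrow> f a" by (rule isCont_tendsto_compose[rotated])
    qed
    show "AE y in lborel. norm (f (a + \<epsilon> n * y) * hat y) \<le> B * hat y" for n
      using B hat_nonneg by (auto simp: abs_mult intro!: mult_right_mono)
  qed measurable
  ultimately show ?thesis using integral_hat by simp
qed

text \<open>The plateaus are bounded by 1 and tend to the indicator of \<open>{a..b}\<close> away
  from the two endpoints.\<close>

lemma plateau_pairing_tendsto:
  assumes g: "sqint lborel g" and \<epsilon>: "\<And>n. \<epsilon> n > 0" "\<epsilon> \<longlonglongrightarrow> 0" and "a \<le> b"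
    and supp: "\<And>x. x \<notin> {0..1} \<Longrightarrow> g x = 0"
  shows "(\<lambda>n. LINT x|lborel. g x * plateau (\<epsilon> n) a b x) \<longlonglongrightarrow> (LINT x|lborel. indicator {a..b} x * g x)"
proof (rule integral_dominated_convergence[where w="\<lambda>x. \<bar>g x\<bar>"])
  have [measurable]: "g \<in> borel_measurable borel" "ramp \<in> borel_measurable borel"
    using g continuous_ramp[of UNIV] by (auto intro: borel_measurable_continuous_onI simp: sqint_def)
  show "(\<lambda>x. indicator {a..b} x * g x) \<in> borel_measurable lborel" by measurable
  show "(\<lambda>x. g x * plateau (\<epsilon> n) a b x) \<in> borel_measurable lborel" for n
    unfolding plateau_def by measurable
  have "(\<lambda>x. indicator {0..1} x * g x) = g" using supp by (auto split: split_indicator)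
  then show "integrable lborel (\<lambda>x. \<bar>g x\<bar>)" using sqint_integrable_Icc[OF g, of 0 1] by simp
  show "AE x in lborel. norm (g x * plateau (\<epsilon> n) a b x) \<le> \<bar>g x\<bar>" for n
    using plateau_bounds[OF \<epsilon>(1) \<open>a \<le> b\<close>] by (auto simp: abs_mult mult_left_le)
  have "AE x in lborel. x \<noteq> a" "AE x in lborel. x \<noteq> b" by (rule AE_lborel_singleton)+
  then show "AE x in lborel. (\<lambda>n. g x * plateau (\<epsilon> n) a b x) \<longlonglongrightarrow> indicator {a..b} x * g x"
  proof eventually_elim
    case (elim x)
    have ramp_pos: "\<forall>\<^sub>F n in sequentially. ramp (y / \<epsilon> n) = 1" if "y > 0" for y
      using order_tendstoD(2)[OF \<epsilon>(2) that]
      by eventually_elim (use \<epsilon>(1) in \<open>simp add: ramp_simps field_simps less_imp_le\<close>)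
    have ramp_neg: "\<forall>\<^sub>F n in sequentially. ramp (y / \<epsilon> n) = 0" if "y < 0" for y
    proof -
      have "\<forall>\<^sub>F n in sequentially. \<epsilon> n < - y" using order_tendstoD(2)[OF \<epsilon>(2), of "- y"] that by simp
      then show ?thesis
      proof eventually_elim
        case (elim n)
        then have "y / \<epsilon> n \<le> -1" using \<epsilon>(1)[of n] by (simp add: divide_le_eq)
        then show ?case by (rule ramp_simps)
      qed
    qed
    have "\<forall>\<^sub>F n in sequentially. plateau (\<epsilon> n) a b x = indicator {a..b} x"
    proof -
      consider "x < a" | "a < x" "x < b" | "b < x" using elim by linarith
      then show ?thesis
      proof cases
        case 1
        then show ?thesis using ramp_neg[of "x - a"] ramp_neg[of "x - b"] \<open>a \<le> b\<close>
          by (auto simp: plateau_def elim: eventually_elim2)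
      next
        case 2
        then show ?thesis using ramp_pos[of "x - a"] ramp_neg[of "x - b"]
          by (auto simp: plateau_def elim: eventually_elim2)
      next
        case 3
        then show ?thesis using ramp_pos[of "x - a"] ramp_pos[of "x - b"] \<open>a \<le> b\<close>
          by (auto simp: plateau_def elim: eventually_elim2)
      qed
    qed
    then show ?case
      by (intro tendsto_eventually) (auto elim!: eventually_mono)
  qed
qed

section \<open>Weak derivatives and primitives\<close>

lemma inner01_cong_AE:
  assumes "f \<in> borel_measurable I01" "f' \<in> borel_measurable I01" "g \<in> borel_measurable I01"
    "AE x in I01. f x = f' x"
  shows "inner01 f g = inner01 f' g"
  unfolding inner01_def by (rule integral_cong_AE) (use assms in \<open>auto elim: AE_mp\<close>)

lemma inner01_commute: "inner01 f g = inner01 g f"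
  by (simp add: inner01_def mult.commute)

lemma inner01_cong: "(\<And>x. x \<in> {0..1} \<Longrightarrow> f x = f' x) \<Longrightarrow> (\<And>x. x \<in> {0..1} \<Longrightarrow> g x = g' x) \<Longrightarrow> inner01 f g = inner01 f' g'"
  unfolding inner01_def by (intro Bochner_Integration.integral_cong) auto

lemma is_weak_deriv_cong: "(\<And>x. x \<in> {0..1} \<Longrightarrow> f x = f' x) \<Longrightarrow> is_weak_deriv f g \<longleftrightarrow> is_weak_deriv f' g"
  unfolding is_weak_deriv_def using inner01_cong[of f f'] by metis

lemma test_fun_primitive:
  assumes "test_fun \<phi> \<phi>'"
  shows "primitive (\<lambda>x. \<phi> (max 0 (min 1 x))) (\<lambda>x. indicator {0..1} x * \<phi>' x)" "\<phi> 0 = 0" "\<phi> 1 = 0"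
proof -
  show "primitive (\<lambda>x. \<phi> (max 0 (min 1 x))) (\<lambda>x. indicator {0..1} x * \<phi>' x)"
    using assms by (intro continuous_derivative_primitive)
      (auto simp: test_fun_def intro: has_field_derivative_at_within continuous_on_subset)
  show "\<phi> 0 = 0" "\<phi> 1 = 0" using assms by (auto simp: test_fun_def)
qed

text \<open>Integration by parts, where test functions vanish at 0 and 1 and leave no boundary
  terms.\<close>

lemma primitive_is_weak_deriv:
  assumes F: "primitive F f"
  shows "is_weak_deriv F f" "F \<in> H1"
proof -
  have f: "sqint lborel f" by (rule primitive_sqint[OF F])
  have fm[measurable]: "f \<in> borel_measurable borel" "F \<in> borel_measurable borel"
    using f primitive_measurable[OF F] by (auto simp: sqint_def)
  show "is_weak_deriv F f"
    unfolding is_weak_deriv_def L2_iff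
  proof (intro conjI allI impI)
    show "sqint I01 f" by (rule sqint_I01[OF f])
    fix \<phi> \<phi>' assume t: "test_fun \<phi> \<phi>'"
    then have "continuous_on UNIV \<phi>" "continuous_on UNIV \<phi>'"
      unfolding test_fun_def by (auto intro: continuous_at_imp_continuous_on DERIV_isCont)
    then have [measurable]: "\<phi> \<in> borel_measurable borel" "\<phi>' \<in> borel_measurable borel"
      by (auto intro: borel_measurable_continuous_onI)
    have "inner01 F \<phi>' = (LINT x|lborel. indicator {0..1} x * (F x * (indicator {0..1} x * \<phi>' x)))"
      by (simp add: inner01_def integral_I01) (auto intro!: Bochner_Integration.integral_cong split: split_indicator)
    moreover have "inner01 f \<phi> = (LINT x|lborel. indicator {0..1} x * (f x * \<phi> (max 0 (min 1 x))))"
      by (simp add: inner01_def integral_I01) (auto intro!: Bochner_Integration.integral_cong split: split_indicator)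
    ultimately show "inner01 F \<phi>' = - inner01 f \<phi>"
      using primitive_by_parts[OF F test_fun_primitive(1)[OF t], of 0 1] test_fun_primitive(2,3)[OF t] by simp
  qed
  then show "F \<in> H1" unfolding H1_def using primitive_continuous[OF F] by auto
qed

text \<open>The derivative of a plateau is a bump at \<open>a\<close> minus a bump at
  \<open>b\<close>, so the weak identity tends to the increment formula between interior points, and
  continuity carries it to the closed interval. The last clause determines \<open>F\<close> on the
  whole line from \<open>f\<close> alone, which makes the primitives of different weak derivatives
  comparable.\<close>

lemma weak_deriv_primitive:
  assumes c: "continuous_on {0..1} f" and w: "is_weak_deriv f g"
  obtains F f' where "primitive F f'" "\<And>x. x \<in> {0..1} \<Longrightarrow> F x = f x" "AE x in I01. f' x = g x"
    "l2norm lborel f' = l2norm I01 g" "\<And>x. F x = f (max 0 (min 1 x))"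
proof -
  have g: "sqint I01 g" using w by (simp add: is_weak_deriv_def L2_iff)
  obtain g0 where g0: "sqint lborel g0" "AE x in I01. g0 x = g x" "\<And>x. x \<notin> {0..1} \<Longrightarrow> g0 x = 0"
    "l2norm lborel g0 = l2norm I01 g" using sqint_I01_borel_representative[OF g] by blast
  obtain W where W: "primitive W g0" "W 0 = f 0" using primitive_exists[OF g0(1)] by blast
  define fc where "fc x = f (max 0 (min 1 x))" for x
  have fc: "continuous_on UNIV fc"
    unfolding fc_def[abs_def] by (intro continuous_on_compose2[OF c] continuous_intros) auto
  obtain B where "\<And>x. x \<in> {0..1} \<Longrightarrow> \<bar>f x\<bar> \<le> B"
    using compact_imp_bounded[OF compact_continuous_image[OF c]] by (fastforce simp: bounded_iff)
  then have B: "\<bar>fc x\<bar> \<le> B" for x unfolding fc_def by auto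
  have [measurable]: "fc \<in> borel_measurable borel" "hat \<in> borel_measurable borel" "ramp \<in> borel_measurable borel"
    "g0 \<in> borel_measurable borel"
    using fc continuous_hat[of UNIV] continuous_ramp[of UNIV] g0(1)
    by (auto intro: borel_measurable_continuous_onI simp: sqint_def)
  have interior: "fc b - fc a = W b - W a" if "0 < a" "a \<le> b" "b < 1" for a b
  proof -
    define m where "m = min a (1 - b)"
    \<comment> \<open>The shift by 2 keeps \<open>\<epsilon> n < m\<close>, so the boundary layers
      of the plateau stay inside the open unit interval for every \<open>n\<close>.\<close>
    define \<epsilon> where "\<epsilon> n = m / (real n + 2)" for n
    have "m > 0" using that by (simp add: m_def)
    have \<epsilon>: "\<epsilon> n > 0" "\<epsilon> n < m" for n using \<open>m > 0\<close> by (auto simp: \<epsilon>_def field_simps intro: add_pos_nonneg)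
    have "(\<lambda>n. m / real n) \<longlonglongrightarrow> 0" by (rule lim_const_over_n)
    from LIMSEQ_ignore_initial_segment[OF this, of 2] have \<epsilon>0: "\<epsilon> \<longlonglongrightarrow> 0" 
      by (simp add: \<epsilon>_def[abs_def] add.commute)
    have t: "test_fun (plateau (\<epsilon> n) a b) (plateau' (\<epsilon> n) a b)" for n
      by (rule test_fun_plateau) (use \<epsilon>[of n] that in \<open>auto simp: m_def\<close>)
    have out: "plateau' (\<epsilon> n) a b x = 0" if "x \<notin> {0..1}" for n x
    proof -
      have "hat ((x - y) / \<epsilon> n) = 0" if "y \<in> {a, b}" for y
      proof (rule hat_outside)
        have "\<epsilon> n < y" "\<epsilon> n < 1 - y" using \<epsilon>(2)[of n] that \<open>a \<le> b\<close> by (auto simp: m_def)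
        then show "(x - y) / \<epsilon> n \<notin> {-1..1}"
          using \<epsilon>(1)[of n] \<open>x \<notin> {0..1}\<close> by (auto simp: field_simps)
      qed
      then show ?thesis by (simp add: plateau'_def)
    qed
    have hint: "integrable lborel (\<lambda>x. fc x * (hat ((x - y) / \<epsilon> n) / \<epsilon> n))" for y n
    proof -
      have "integrable lborel (\<lambda>x. hat (- y / \<epsilon> n + (1 / \<epsilon> n) * x))"
        by (rule lborel_integrable_real_affine[OF integral_hat(1)]) (use \<epsilon>(1)[of n] in simp)
      then have i: "integrable lborel (\<lambda>x. B * (hat ((x - y) / \<epsilon> n) / \<epsilon> n))"
        by (simp add: diff_divide_distrib)
      show ?thesis
        by (rule Bochner_Integration.integrable_bound[OF i])
          (use B hat_nonneg \<epsilon>(1)[of n] in \<open>auto simp: abs_mult intro!: mult_mono AE_I2 order_trans[OF B] divide_right_mono\<close>)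
    qed
    have "inner01 f (plateau' (\<epsilon> n) a b) =
        (LINT x|lborel. fc x * (hat ((x - a) / \<epsilon> n) / \<epsilon> n)) - (LINT x|lborel. fc x * (hat ((x - b) / \<epsilon> n) / \<epsilon> n))" for n
    proof -
      have "inner01 f (plateau' (\<epsilon> n) a b) = inner01 fc (plateau' (\<epsilon> n) a b)"
        by (rule inner01_cong) (auto simp: fc_def)
      also have "\<dots> = (LINT x|lborel. indicator {0..1} x * (fc x * plateau' (\<epsilon> n) a b x))"
        unfolding inner01_def plateau'_def by (rule integral_I01) measurable
      also have "\<dots> = (LINT x|lborel. fc x * (hat ((x - a) / \<epsilon> n) / \<epsilon> n) - fc x * (hat ((x - b) / \<epsilon> n) / \<epsilon> n))"
      proof (rule Bochner_Integration.integral_cong[OF refl])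
        fix x
        have "indicator {0..1} x * (fc x * plateau' (\<epsilon> n) a b x) = fc x * plateau' (\<epsilon> n) a b x"
          using out[of x n] by (cases "x \<in> {0..1}") auto
        then show "indicator {0..1} x * (fc x * plateau' (\<epsilon> n) a b x)
            = fc x * (hat ((x - a) / \<epsilon> n) / \<epsilon> n) - fc x * (hat ((x - b) / \<epsilon> n) / \<epsilon> n)"
          by (simp add: plateau'_def diff_divide_distrib right_diff_distrib)
      qed
      finally show ?thesis using hint by simp
    qed
    then have l1: "(\<lambda>n. inner01 f (plateau' (\<epsilon> n) a b)) \<longlonglongrightarrow> fc a - fc b"
      using tendsto_diff[OF scaled_average_tendsto[OF fc B \<epsilon>(1) \<epsilon>0, of a] scaled_average_tendsto[OF fc B \<epsilon>(1) \<epsilon>0, of b]]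
      by simp
    have "inner01 f (plateau' (\<epsilon> n) a b) = - (LINT x|lborel. g0 x * plateau (\<epsilon> n) a b x)" for n
    proof -
      have pm: "plateau (\<epsilon> n) a b \<in> borel_measurable borel" unfolding plateau_def[abs_def] by measurable
      have "inner01 f (plateau' (\<epsilon> n) a b) = - inner01 g (plateau (\<epsilon> n) a b)"
        using w t by (auto simp: is_weak_deriv_def)
      also have "inner01 g (plateau (\<epsilon> n) a b) = inner01 g0 (plateau (\<epsilon> n) a b)"
        by (rule inner01_cong_AE)
          (use g g0(2) pm in \<open>auto intro: borel_I01 simp: sqint_def elim: AE_mp\<close>)
      also have "\<dots> = (LINT x|lborel. indicator {0..1} x * (g0 x * plateau (\<epsilon> n) a b x))"
        unfolding inner01_def by (rule integral_I01) (use pm in measurable)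
      also have "\<dots> = (LINT x|lborel. g0 x * plateau (\<epsilon> n) a b x)"
        by (rule Bochner_Integration.integral_cong) (use g0(3) in \<open>auto split: split_indicator\<close>)
      finally show ?thesis .
    qed
    then have "(\<lambda>n. inner01 f (plateau' (\<epsilon> n) a b)) \<longlonglongrightarrow> - (LINT x|lborel. indicator {a..b} x * g0 x)"
      using tendsto_minus[OF plateau_pairing_tendsto[OF g0(1) \<epsilon>(1) \<epsilon>0 that(2) g0(3)]] by simp
    with l1 have "fc a - fc b = - (LINT x|lborel. indicator {a..b} x * g0 x)" by (rule LIMSEQ_unique)
    then show ?thesis using primitiveD[OF W(1) that(2)] by simp
  qed
  let ?D = "\<lambda>x. fc x - W x"
  have Dc: "continuous_on UNIV ?D" by (intro continuous_intros fc primitive_continuous[OF W(1)])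
  \<comment> \<open>\<open>fc\<close> and \<open>W\<close> differ by a constant in the interior;
    continuity extends this to the endpoints, and \<open>W 0 = f 0\<close> makes the constant
    0.\<close>
  obtain c where c: "c = ?D (1/2)" by simp
  have mid: "?D x = c" if "x \<in> {0<..<1}" for x
    unfolding c using interior[of x "1/2"] interior[of "1/2" x] that by (cases "x \<le> 1/2") auto
  have D: "?D x = c" if "x \<in> {0..1}" for x
    by (rule continuous_constant_on_closure[of "{0<..<1}" ?D c x])
      (use that mid continuous_on_subset[OF Dc] in auto)
  have "c = 0" using D[of 0] W(2) by (simp add: fc_def)
  then have eq: "W x = f x" if "x \<in> {0..1}" for x using D[OF that] that by (simp add: fc_def)
  have "W x = f (max 0 (min 1 x))" for x
  proof -
    have z: "(LINT r|lborel. indicator {u..v} r * g0 r) = 0" if "v \<le> 0 \<or> 1 \<le> u" for u v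
    proof (rule integral_eq_zero_AE)
      have "AE r in lborel. r \<noteq> 0" "AE r in lborel. r \<noteq> (1::real)" by (rule AE_lborel_singleton)+
      then show "AE r in lborel. indicator {u..v} r * g0 r = 0"
      proof eventually_elim
        case (elim r)
        then show ?case using that g0(3)[of r] by (auto split: split_indicator)
      qed
    qed
    consider "x < 0" | "x \<in> {0..1}" | "x > 1" by fastforce
    then show ?thesis
    proof cases
      case 1 then show ?thesis using primitiveD[OF W(1), of x 0] z[of 0 x] W(2) by simp
    next
      case 2 then show ?thesis using eq by simp
    next
      case 3 then show ?thesis using primitiveD[OF W(1), of 1 x] z[of x 1] eq[of 1] by simp
    qed
  qed
  then show thesis using that[OF W(1) eq g0(2) g0(4)] by blast
qed

text \<open>Both weak derivatives belong to the same clamped extension of \<open>f\<close>, so the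
  claim reduces to uniqueness of the derivative of a primitive.\<close>

lemma weak_deriv_unique:
  assumes c: "continuous_on {0..1} f" and "is_weak_deriv f g" "is_weak_deriv f h"
  shows "AE x in I01. g x = h x"
proof -
  obtain F f' where F: "primitive F f'" "AE x in I01. f' x = g x" "\<And>x. F x = f (max 0 (min 1 x))"
    using weak_deriv_primitive[OF assms(1,2)] by metis
  obtain G g' where G: "primitive G g'" "AE x in I01. g' x = h x" "\<And>x. G x = f (max 0 (min 1 x))"
    using weak_deriv_primitive[OF assms(1,3)] by metis
  have "G = F" using F(3) G(3) by auto
  then have "AE x in I01. f' x = g' x"
    using AE_lborel_I01[OF primitive_derivative_unique[of F f' g']] F(1) G(1) by simp
  with F(2) G(2) show ?thesis by eventually_elim simp
qed

lemma H1_wderiv: "f \<in> H1 \<Longrightarrow> is_weak_deriv f (wderiv f)"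
proof -
  assume "f \<in> H1"
  then have "\<exists>g. is_weak_deriv f g" by (simp add: H1_def)
  then show ?thesis unfolding wderiv_def by (rule someI_ex)
qed

lemma H1_continuous: "f \<in> H1 \<Longrightarrow> continuous_on {0..1} f"
  by (simp add: H1_def)

lemma H1_cong: "(\<And>x. x \<in> {0..1} \<Longrightarrow> f x = g x) \<Longrightarrow> f \<in> H1 \<longleftrightarrow> g \<in> H1"
proof -
  assume *: "\<And>x. x \<in> {0..1} \<Longrightarrow> f x = g x"
  have "continuous_on {0..1} f \<longleftrightarrow> continuous_on {0..1} g" by (rule continuous_on_cong) (use * in auto)
  moreover have "is_weak_deriv f = is_weak_deriv g" by (rule ext) (rule is_weak_deriv_cong[OF *])
  ultimately show ?thesis by (simp add: H1_def)
qed

lemma wderiv_AE: "f \<in> H1 \<Longrightarrow> is_weak_deriv f g \<Longrightarrow> AE x in I01. wderiv f x = g x"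
  using weak_deriv_unique[OF H1_continuous H1_wderiv] by blast

lemma is_weak_deriv_H1: "continuous_on {0..1} f \<Longrightarrow> is_weak_deriv f g \<Longrightarrow> f \<in> H1"
  by (auto simp: H1_def)

lemma is_weak_deriv_sqint: "is_weak_deriv f g \<Longrightarrow> sqint I01 g"
  by (simp add: is_weak_deriv_def L2_iff)

lemma wderiv_sqint: "f \<in> H1 \<Longrightarrow> sqint I01 (wderiv f)"
  using H1_wderiv is_weak_deriv_sqint by blast

lemma H1_primitive:
  assumes "f \<in> H1"
  obtains F f' where "primitive F f'" "\<And>x. x \<in> {0..1} \<Longrightarrow> F x = f x" "AE x in I01. f' x = wderiv f x"
    "l2norm lborel f' = l2norm I01 (wderiv f)"
  using weak_deriv_primitive[OF H1_continuous[OF assms] H1_wderiv[OF assms]] by metis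

lemma continuous_sqint_I01:
  assumes "continuous_on {0..1} f"
  shows "sqint I01 f"
proof -
  obtain B where B: "\<And>x. x \<in> {0..1} \<Longrightarrow> \<bar>f x\<bar> \<le> B"
    using compact_imp_bounded[OF compact_continuous_image[OF assms]] by (fastforce simp: bounded_iff)
  have "\<bar>f 0\<bar> \<le> B" using B[of 0] by simp
  then have "B \<ge> 0" by linarith
  have "f \<in> borel_measurable I01"
    using continuous_imp_measurable_on_sets_lebesgue[OF assms] by simp
  then show ?thesis using B \<open>B \<ge> 0\<close> by (intro l2norm_le_const(1)[OF finite_measure_I01]) auto
qed

lemma H1_sqint: "f \<in> H1 \<Longrightarrow> sqint I01 f"
  using H1_continuous continuous_sqint_I01 by blast

lemma H1_norm_eq:
  assumes "f \<in> H1" "is_weak_deriv f g"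
  shows "H1_norm f = sqrt ((l2norm I01 f)\<^sup>2 + (l2norm I01 g)\<^sup>2)"
proof -
  have "l2norm I01 (wderiv f) = l2norm I01 g"
    by (rule l2norm_cong_AE) (use wderiv_AE[OF assms] wderiv_sqint[OF assms(1)] is_weak_deriv_sqint[OF assms(2)] in \<open>auto simp: sqint_def\<close>)
  then show ?thesis by (simp add: H1_norm_def L2_norm_eq)
qed

section \<open>Travelling waves\<close>

lemma inner01_le: "sqint I01 f \<Longrightarrow> sqint I01 g \<Longrightarrow> \<bar>inner01 f g\<bar> \<le> l2norm I01 f * l2norm I01 g"
  unfolding inner01_eq by (rule Cauchy_Schwarz_integral)

lemma inner01_add_left:
  "sqint I01 f \<Longrightarrow> sqint I01 g \<Longrightarrow> sqint I01 h \<Longrightarrow> inner01 (\<lambda>x. f x + g x) h = inner01 f h + inner01 g h"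
  using sqint_mult[of I01 f h] sqint_mult[of I01 g h] by (simp add: inner01_def distrib_right)

lemma inner01_cmult_left: "inner01 (\<lambda>x. c * f x) h = c * inner01 f h"
  by (simp add: inner01_def mult.assoc)

lemma inner01_cmult_right: "inner01 f (\<lambda>x. c * h x) = c * inner01 f h"
  by (simp add: inner01_def mult.left_commute)

lemma inner01_minus_left: "inner01 (\<lambda>x. - f x) h = - inner01 f h"
  by (simp add: inner01_def)

lemma inner01_diff_left:
  "sqint I01 f \<Longrightarrow> sqint I01 g \<Longrightarrow> sqint I01 h \<Longrightarrow> inner01 (\<lambda>x. f x - g x) h = inner01 f h - inner01 g h"
  using sqint_mult[of I01 f h] sqint_mult[of I01 g h] by (simp add: inner01_def left_diff_distrib)

lemma inner01_diff_right:
  "sqint I01 f \<Longrightarrow> sqint I01 g \<Longrightarrow> sqint I01 h \<Longrightarrow> inner01 h (\<lambda>x. f x - g x) = inner01 h f - inner01 h g"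
  using inner01_diff_left[of f g h] by (simp add: inner01_commute)

lemma inner01_self: "inner01 f f = (l2norm I01 f)\<^sup>2"
  by (simp add: inner01_def l2norm_sq flip: power2_eq_square)

text \<open>Square integrability along the filter is asked for eventually only, because in the
  applications it is known just for times inside \<open>I\<close>.\<close>

lemma inner01_tendsto:
  assumes ev: "\<forall>\<^sub>F r in F. sqint I01 (a r) \<and> sqint I01 (b r)" and s: "sqint I01 a0" "sqint I01 b0"
    and a: "((\<lambda>r. l2norm I01 (\<lambda>x. a r x - a0 x)) \<longlongrightarrow> 0) F"
    and b: "((\<lambda>r. l2norm I01 (\<lambda>x. b r x - b0 x)) \<longlongrightarrow> 0) F"
  shows "((\<lambda>r. inner01 (a r) (b r)) \<longlongrightarrow> inner01 a0 b0) F"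
proof -
  let ?A = "\<lambda>r. l2norm I01 (\<lambda>x. a r x - a0 x)" and ?B = "\<lambda>r. l2norm I01 (\<lambda>x. b r x - b0 x)"
  have ev': "\<forall>\<^sub>F r in F. \<bar>inner01 (a r) (b r) - inner01 a0 b0\<bar> \<le> ?A r * (?B r + l2norm I01 b0) + l2norm I01 a0 * ?B r"
    using ev
  proof eventually_elim
    case (elim r)
    then have ar: "sqint I01 (a r)" and br: "sqint I01 (b r)" by auto
    have da: "sqint I01 (\<lambda>x. a r x - a0 x)" and db: "sqint I01 (\<lambda>x. b r x - b0 x)"
      by (intro sqint_diff ar br s)+
    have "inner01 (a r) (b r) - inner01 a0 b0 = inner01 (\<lambda>x. a r x - a0 x) (b r) + inner01 a0 (\<lambda>x. b r x - b0 x)"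
      using ar br s by (simp add: inner01_diff_left inner01_diff_right)
    also have "\<bar>\<dots>\<bar> \<le> ?A r * l2norm I01 (b r) + l2norm I01 a0 * ?B r"
      using inner01_le[OF da br] inner01_le[OF s(1) db] by linarith
    also have "?A r * l2norm I01 (b r) \<le> ?A r * (?B r + l2norm I01 b0)"
      using l2norm_triangle[OF db s(2)] by (intro mult_left_mono) auto
    finally show ?case by simp
  qed
  have "((\<lambda>r. ?A r * (?B r + l2norm I01 b0) + l2norm I01 a0 * ?B r) \<longlongrightarrow> 0 * (0 + l2norm I01 b0) + l2norm I01 a0 * 0) F"
    by (intro tendsto_intros a b)
  then have lim: "((\<lambda>r. ?A r * (?B r + l2norm I01 b0) + l2norm I01 a0 * ?B r) \<longlongrightarrow> 0) F" by simp
  have "((\<lambda>r. inner01 (a r) (b r) - inner01 a0 b0) \<longlongrightarrow> 0) F"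
    by (rule Lim_null_comparison[OF _ lim]) (use ev' in simp)
  then show ?thesis by (simp add: LIM_zero_iff)
qed

lemma inner01_has_derivative:
  assumes s: "\<And>r. r \<in> insert s I \<Longrightarrow> sqint I01 (\<lambda>x. w x r)" "sqint I01 v" "sqint I01 h"
    and lim: "((\<lambda>r. l2norm I01 (\<lambda>x. (w x r - w x s) / (r - s) - v x)) \<longlongrightarrow> 0) (at s within I)"
  shows "((\<lambda>\<sigma>. inner01 (\<lambda>x. w x \<sigma>) h) has_real_derivative inner01 v h) (at s within I)"
proof -
  have ev: "\<forall>\<^sub>F r in at s within I. r \<in> I" by (simp add: eventually_at_filter)
  have "((\<lambda>r. inner01 (\<lambda>x. (w x r - w x s) / (r - s)) h) \<longlongrightarrow> inner01 v h) (at s within I)"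
  proof (rule inner01_tendsto[OF _ s(2,3) lim])
    show "\<forall>\<^sub>F r in at s within I. sqint I01 (\<lambda>x. (w x r - w x s) / (r - s)) \<and> sqint I01 h"
      using ev by eventually_elim (intro conjI sqint_divide sqint_diff s, auto)
  qed simp
  moreover have "\<forall>\<^sub>F r in at s within I. inner01 (\<lambda>x. (w x r - w x s) / (r - s)) h
     = (inner01 (\<lambda>x. w x r) h - inner01 (\<lambda>x. w x s) h) / (r - s)"
    using ev
  proof eventually_elim
    case (elim r)
    have "inner01 (\<lambda>x. inverse (r - s) * (w x r - w x s)) h = inverse (r - s) * (inner01 (\<lambda>x. w x r) h - inner01 (\<lambda>x. w x s) h)"
      using s elim by (simp only: inner01_cmult_left) (simp add: inner01_diff_left)
    then show ?case by (simp add: divide_inverse mult.commute)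
  qed
  ultimately have "((\<lambda>r. (inner01 (\<lambda>x. w x r) h - inner01 (\<lambda>x. w x s) h) / (r - s)) \<longlongrightarrow> inner01 v h) (at s within I)"
    using tendsto_cong by fast
  then show ?thesis by (simp add: has_field_derivative_iff)
qed

text \<open>Only the first factor is differentiable weakly, the second one in \<open>L2\<close>.\<close>

lemma inner01_product_derivative:
  assumes s: "\<And>r. r \<in> insert s I \<Longrightarrow> sqint I01 (\<lambda>x. v x r)" "\<And>r. r \<in> insert s I \<Longrightarrow> sqint I01 (\<lambda>x. \<phi> x r)" "sqint I01 \<phi>s"
    and D: "((\<lambda>\<sigma>. inner01 (\<lambda>x. v x \<sigma>) (\<lambda>x. \<phi> x s)) has_real_derivative D) (at s within I)"
    and c: "((\<lambda>r. l2norm I01 (\<lambda>x. v x r - v x s)) \<longlongrightarrow> 0) (at s within I)"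
    and lim: "((\<lambda>r. l2norm I01 (\<lambda>x. (\<phi> x r - \<phi> x s) / (r - s) - \<phi>s x)) \<longlongrightarrow> 0) (at s within I)"
  shows "((\<lambda>\<sigma>. inner01 (\<lambda>x. v x \<sigma>) (\<lambda>x. \<phi> x \<sigma>)) has_real_derivative D + inner01 (\<lambda>x. v x s) \<phi>s) (at s within I)"
proof -
  have ev: "\<forall>\<^sub>F r in at s within I. r \<in> I \<and> r \<noteq> s" by (simp add: eventually_at_filter)
  have "((\<lambda>r. inner01 (\<lambda>x. v x r) (\<lambda>x. (\<phi> x r - \<phi> x s) / (r - s))) \<longlongrightarrow> inner01 (\<lambda>x. v x s) \<phi>s) (at s within I)"
  proof (rule inner01_tendsto[OF _ _ s(3) c lim])
    show "\<forall>\<^sub>F r in at s within I. sqint I01 (\<lambda>x. v x r) \<and> sqint I01 (\<lambda>x. (\<phi> x r - \<phi> x s) / (r - s))"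
      using ev by eventually_elim (intro conjI sqint_divide sqint_diff s, auto)
  qed (use s in auto)
  from tendsto_add[OF D[unfolded has_field_derivative_iff] this]
  have "((\<lambda>r. (inner01 (\<lambda>x. v x r) (\<lambda>x. \<phi> x s) - inner01 (\<lambda>x. v x s) (\<lambda>x. \<phi> x s)) / (r - s)
     + inner01 (\<lambda>x. v x r) (\<lambda>x. (\<phi> x r - \<phi> x s) / (r - s))) \<longlongrightarrow> D + inner01 (\<lambda>x. v x s) \<phi>s) (at s within I)" .
  moreover have "\<forall>\<^sub>F r in at s within I.
     (inner01 (\<lambda>x. v x r) (\<lambda>x. \<phi> x s) - inner01 (\<lambda>x. v x s) (\<lambda>x. \<phi> x s)) / (r - s)
      + inner01 (\<lambda>x. v x r) (\<lambda>x. (\<phi> x r - \<phi> x s) / (r - s))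
     = (inner01 (\<lambda>x. v x r) (\<lambda>x. \<phi> x r) - inner01 (\<lambda>x. v x s) (\<lambda>x. \<phi> x s)) / (r - s)"
    using ev
  proof eventually_elim
    case (elim r)
    have "inner01 (\<lambda>x. v x r) (\<lambda>x. inverse (r - s) * (\<phi> x r - \<phi> x s)) 
        = inverse (r - s) * (inner01 (\<lambda>x. v x r) (\<lambda>x. \<phi> x r) - inner01 (\<lambda>x. v x r) (\<lambda>x. \<phi> x s))"
      using s elim by (simp only: inner01_cmult_right) (simp add: inner01_diff_right)
    then have "inner01 (\<lambda>x. v x r) (\<lambda>x. (\<phi> x r - \<phi> x s) / (r - s))
        = (inner01 (\<lambda>x. v x r) (\<lambda>x. \<phi> x r) - inner01 (\<lambda>x. v x r) (\<lambda>x. \<phi> x s)) / (r - s)"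
      by (simp add: divide_inverse mult.commute)
    then show ?case by (simp flip: add_divide_distrib)
  qed
  ultimately have "((\<lambda>r. (inner01 (\<lambda>x. v x r) (\<lambda>x. \<phi> x r) - inner01 (\<lambda>x. v x s) (\<lambda>x. \<phi> x s)) / (r - s))
       \<longlongrightarrow> D + inner01 (\<lambda>x. v x s) \<phi>s) (at s within I)"
    using tendsto_cong by fast
  then show ?thesis by (simp add: has_field_derivative_iff)
qed

lemma at_within_affine:
  fixes k :: real
  assumes "\<And>r. r \<in> J \<Longrightarrow> k * r + c \<in> I" "k \<noteq> 0"
  shows "filterlim (\<lambda>r. k * r + c) (at (k * s + c) within I) (at s within J)"
  unfolding filterlim_at
proof
  show "((\<lambda>r. k * r + c) \<longlongrightarrow> k * s + c) (at s within J)" by (intro tendsto_intros)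
  show "\<forall>\<^sub>F r in at s within J. k * r + c \<in> I \<and> k * r + c \<noteq> k * s + c"
    using assms by (simp add: eventually_at_filter)
qed

lemma tendsto_offset:
  fixes s :: real and g :: "real \<Rightarrow> real"
  assumes "(g \<longlongrightarrow> 0) (at 0)"
  shows "((\<lambda>r. g (r - s)) \<longlongrightarrow> 0) (at s within I)"
proof -
  have "filterlim (\<lambda>r. r - s) (at 0) (at s within I)"
    using at_within_affine[of I 1 "- s" UNIV s] by simp
  then show ?thesis using assms filterlim_compose by blast
qed

text \<open>A change of time in \<open>f (s + k * x)\<close> is a translation of \<open>f\<close>
  along the line, and the norm over \<open>[0,1]\<close> is at most the norm over the line.\<close>

lemma l2_travelling_continuous:
  assumes f: "sqint lborel f" and k: "\<bar>k\<bar> = 1"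
  shows "((\<lambda>r. l2norm I01 (\<lambda>x. f (r + k * x) - f (s + k * x))) \<longlongrightarrow> 0) (at s within I)"
proof (rule l2norm_tendsto_0I)
  fix r
  have "k \<noteq> 0" using k by auto
  let ?u = "\<lambda>y. f (y + (r - s)) - f y"
  have u: "sqint lborel ?u" by (intro sqint_diff sqint_shift f)
  have "(\<lambda>x. f (r + k * x) - f (s + k * x)) = (\<lambda>x. ?u (s + k * x))" by (simp add: algebra_simps)
  then show "l2norm I01 (\<lambda>x. f (r + k * x) - f (s + k * x)) \<le> l2norm lborel ?u"
    using sqint_I01(2)[OF sqint_affine[OF u \<open>k \<noteq> 0\<close>, of s]] l2norm_affine[OF k, of ?u s] by simp
qed (rule tendsto_offset[OF l2_translation_continuous[OF f]])

lemma l2_travelling_derivative: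
  assumes F: "primitive F f" and k: "\<bar>k\<bar> = 1"
  shows "((\<lambda>r. l2norm I01 (\<lambda>x. (F (r + k * x) - F (s + k * x)) / (r - s) - f (s + k * x))) \<longlongrightarrow> 0) (at s within I)"
proof (rule l2norm_tendsto_0I)
  fix r
  have "k \<noteq> 0" using k by auto
  let ?u = "\<lambda>y. (F (y + (r - s)) - F y) / (r - s) - f y"
  have u: "sqint lborel ?u"
    by (intro sqint_diff sqint_divide l2norm_increment(1)[OF F] primitive_sqint[OF F])
  have "(\<lambda>x. (F (r + k * x) - F (s + k * x)) / (r - s) - f (s + k * x)) = (\<lambda>x. ?u (s + k * x))"
    by (simp add: algebra_simps)
  then show "l2norm I01 (\<lambda>x. (F (r + k * x) - F (s + k * x)) / (r - s) - f (s + k * x)) \<le> l2norm lborel ?u"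
    using sqint_I01(2)[OF sqint_affine[OF u \<open>k \<noteq> 0\<close>, of s]] l2norm_affine[OF k, of ?u s] by simp
qed (rule tendsto_offset[OF l2_difference_quotient[OF F]])

lemma l2norm_tendsto_add:
  assumes "\<And>r. sqint M (a r)" "\<And>r. sqint M (b r)"
    and "((\<lambda>r. l2norm M (a r)) \<longlongrightarrow> 0) F" "((\<lambda>r. l2norm M (b r)) \<longlongrightarrow> 0) F"
  shows "((\<lambda>r. l2norm M (\<lambda>x. a r x + b r x)) \<longlongrightarrow> 0) F"
proof (rule l2norm_tendsto_0I)
  show "l2norm M (\<lambda>x. a r x + b r x) \<le> l2norm M (a r) + l2norm M (b r)" for r
    by (rule l2norm_triangle[OF assms(1,2)])
  show "((\<lambda>r. l2norm M (a r) + l2norm M (b r)) \<longlongrightarrow> 0) F"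
    using tendsto_add[OF assms(3,4)] by simp
qed

lemma primitive_travelling:
  assumes "primitive F f" "k = 1 \<or> k = - 1"
  shows "primitive (\<lambda>x. F (s + k * x)) (\<lambda>x. k * f (s + k * x))"
proof -
  have 1: "primitive (\<lambda>x. F (x + s)) (\<lambda>x. f (x + s))" by (rule primitive_shift[OF assms(1)])
  show ?thesis using 1 primitive_reflect[OF 1] assms(2) by (auto simp: add.commute)
qed

lemma H1_norm_tendsto_0I:
  assumes "\<And>r. is_weak_deriv (\<lambda>x. w r x) (\<lambda>x. w' r x)" "\<And>r. continuous_on {0..1} (w r)"
    and "((\<lambda>r. l2norm I01 (w r)) \<longlongrightarrow> 0) F" "((\<lambda>r. l2norm I01 (w' r)) \<longlongrightarrow> 0) F"
  shows "((\<lambda>r. H1_norm (w r)) \<longlongrightarrow> 0) F"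
proof -
  have "H1_norm (w r) = sqrt ((l2norm I01 (w r))\<^sup>2 + (l2norm I01 (w' r))\<^sup>2)" for r
    by (rule H1_norm_eq[OF is_weak_deriv_H1]) (use assms in auto)
  moreover have "((\<lambda>r. sqrt ((l2norm I01 (w r))\<^sup>2 + (l2norm I01 (w' r))\<^sup>2)) \<longlongrightarrow> sqrt (0\<^sup>2 + 0\<^sup>2)) F"
    by (intro tendsto_intros assms)
  ultimately show ?thesis by simp
qed

lemma l2norm_le_sup_I01:
  assumes "continuous_on {0..1} f" "\<And>x. x \<in> {0..1} \<Longrightarrow> \<bar>f x\<bar> \<le> c"
  shows "l2norm I01 f \<le> c"
proof -
  have "\<bar>f 0\<bar> \<le> c" using assms(2)[of 0] by simp
  then have "0 \<le> c" by linarith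
  then show ?thesis
    using l2norm_le_const(2)[OF finite_measure_I01, of f c] assms(2) continuous_sqint_I01[OF assms(1)]
    by (simp add: sqint_def)
qed

text \<open>d'Alembert's solution: \<open>F\<close> runs to the left and \<open>G\<close> to the
  right. As \<open>f\<close> and \<open>g\<close> are only square integrable, \<open>v\<close> and
  \<open>w'\<close> need not be differentiable, and the wave equation is verified in weak
  form.\<close>

locale travelling_waves =
  fixes F f G g :: "real \<Rightarrow> real"
  assumes F: "primitive F f" and G: "primitive G g"
begin

definition "w x s = F (s + x) + G (s - x)"
definition "v x s = f (s + x) + g (s - x)"
definition "w' x s = f (s + x) - g (s - x)"

lemma primitive_w: "primitive (\<lambda>x. w x s) (\<lambda>x. w' x s)"
  using primitive_add[OF primitive_travelling[OF F, of 1 s] primitive_travelling[OF G, of "-1" s]]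
  by (simp add: w_def w'_def)

lemma weak_deriv_w: "is_weak_deriv (\<lambda>x. w x s) (\<lambda>x. w' x s)" "(\<lambda>x. w x s) \<in> H1"
  using primitive_is_weak_deriv[OF primitive_w] by auto

lemma sqint_f: "sqint I01 (\<lambda>x. f (s + x))" and sqint_g: "sqint I01 (\<lambda>x. g (s - x))"
  using sqint_I01(1)[OF sqint_affine[OF primitive_sqint[OF F], of 1 s]]
    sqint_I01(1)[OF sqint_affine[OF primitive_sqint[OF G], of "-1" s]] by auto

lemma sqint_v: "sqint I01 (\<lambda>x. v x s)"
  unfolding v_def by (intro sqint_add sqint_f sqint_g)

lemma l2_f: "((\<lambda>r. l2norm I01 (\<lambda>x. f (r + x) - f (s + x))) \<longlongrightarrow> 0) (at s within I)"
  using l2_travelling_continuous[OF primitive_sqint[OF F], of 1] by simp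

lemma l2_g: "((\<lambda>r. l2norm I01 (\<lambda>x. g (r - x) - g (s - x))) \<longlongrightarrow> 0) (at s within I)"
  using l2_travelling_continuous[OF primitive_sqint[OF G], of "-1"] by simp

lemma cont_L2_v: "cont_L2 I v"
  unfolding cont_L2_def L2_iff L2_norm_eq
proof (intro ballI conjI sqint_v)
  fix s
  have eq: "v x r - v x s = (f (r + x) - f (s + x)) + (g (r - x) - g (s - x))" for x r
    by (simp add: v_def)
  show "((\<lambda>r. l2norm I01 (\<lambda>x. v x r - v x s)) \<longlongrightarrow> 0) (at s within I)"
    unfolding eq by (rule l2norm_tendsto_add) (intro sqint_diff sqint_f sqint_g l2_f l2_g)+
qed

lemma cont_H1_w: "cont_H1 I w"
  unfolding cont_H1_def
proof (intro ballI conjI weak_deriv_w)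
  fix s
  show "((\<lambda>r. H1_norm (\<lambda>x. w x r - w x s)) \<longlongrightarrow> 0) (at s within I)"
  proof (rule H1_norm_tendsto_0I)
    show "is_weak_deriv (\<lambda>x. w x r - w x s) (\<lambda>x. w' x r - w' x s)" for r
      by (intro primitive_is_weak_deriv primitive_diff primitive_w)
    show cont: "continuous_on {0..1} (\<lambda>x. w x r - w x s)" for r
      by (rule primitive_continuous[OF primitive_diff[OF primitive_w primitive_w]])
    let ?C = "l2norm lborel f + l2norm lborel g"
    show "((\<lambda>r. l2norm I01 (\<lambda>x. w x r - w x s)) \<longlongrightarrow> 0) (at s within I)"
    proof (rule l2norm_tendsto_0I)
      fix r
      show "l2norm I01 (\<lambda>x. w x r - w x s) \<le> sqrt \<bar>r - s\<bar> * ?C"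
      proof (rule l2norm_le_sup_I01)
        fix x
        have "\<bar>w x r - w x s\<bar> \<le> \<bar>F (r + x) - F (s + x)\<bar> + \<bar>G (r - x) - G (s - x)\<bar>"
          by (simp add: w_def)
        also have "\<dots> \<le> sqrt \<bar>r - s\<bar> * l2norm lborel f + sqrt \<bar>r - s\<bar> * l2norm lborel g"
          using primitive_Holder[OF F, of "r + x" "s + x"] primitive_Holder[OF G, of "r - x" "s - x"] by simp
        finally show "\<bar>w x r - w x s\<bar> \<le> sqrt \<bar>r - s\<bar> * ?C" by (simp add: distrib_left)
      qed (rule cont)
    next
      have "((\<lambda>r. sqrt \<bar>r - s\<bar> * ?C) \<longlongrightarrow> sqrt \<bar>s - s\<bar> * ?C) (at s within I)" by (intro tendsto_intros)
      then show "((\<lambda>r. sqrt \<bar>r - s\<bar> * ?C) \<longlongrightarrow> 0) (at s within I)" by simp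
    qed
    have eq: "w' x r - w' x s = (f (r + x) - f (s + x)) + - (g (r - x) - g (s - x))" for x r
      by (simp add: w'_def)
    have "((\<lambda>r. l2norm I01 (\<lambda>x. - (g (r - x) - g (s - x)))) \<longlongrightarrow> 0) (at s within I)"
      using l2_g[of s I] by (simp only: l2norm_minus)
    then show "((\<lambda>r. l2norm I01 (\<lambda>x. w' x r - w' x s)) \<longlongrightarrow> 0) (at s within I)"
      unfolding eq by (intro l2norm_tendsto_add sqint_minus sqint_diff sqint_f sqint_g l2_f)
  qed
qed

lemma l2_F: "((\<lambda>r. l2norm I01 (\<lambda>x. (F (r + x) - F (s + x)) / (r - s) - f (s + x))) \<longlongrightarrow> 0) (at s within I)"
  using l2_travelling_derivative[OF F, of 1] by simp

lemma l2_G: "((\<lambda>r. l2norm I01 (\<lambda>x. (G (r - x) - G (s - x)) / (r - s) - g (s - x))) \<longlongrightarrow> 0) (at s within I)"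
  using l2_travelling_derivative[OF G, of "-1"] by simp

lemma primitive_Fx: "primitive (\<lambda>x. F (s + x)) (\<lambda>x. f (s + x))"
  using primitive_travelling[OF F, of 1 s] by simp

lemma primitive_Gx: "primitive (\<lambda>x. G (s - x)) (\<lambda>x. - g (s - x))"
  using primitive_travelling[OF G, of "-1" s] by simp

lemma sqint_F: "sqint I01 (\<lambda>x. F (s + x))"
  by (rule continuous_sqint_I01, rule primitive_continuous[OF primitive_Fx])

lemma sqint_G: "sqint I01 (\<lambda>x. G (s - x))"
  by (rule continuous_sqint_I01, rule primitive_continuous[OF primitive_Gx])

lemma time_deriv_w: "time_deriv I w v"
  unfolding time_deriv_def L2_norm_eq
proof
  fix s
  have eq: "(w x r - w x s) / (r - s) - v x s = ((F (r + x) - F (s + x)) / (r - s) - f (s + x))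
      + ((G (r - x) - G (s - x)) / (r - s) - g (s - x))" for x r
    by (simp add: w_def v_def add_divide_distrib diff_divide_distrib)
  show "((\<lambda>r. l2norm I01 (\<lambda>x. (w x r - w x s) / (r - s) - v x s)) \<longlongrightarrow> 0) (at s within I)"
    unfolding eq
    by (intro l2norm_tendsto_add l2_F l2_G sqint_diff sqint_divide sqint_F sqint_G sqint_f sqint_g)
qed

text \<open>\<open>v\<close> is the \<open>x\<close>-derivative of
  \<open>F (s + x) - G (s - x)\<close>. Integration by parts moves this derivative to \<psi> and
  leaves \<open>- (F s - G s) * \<psi> 0\<close> at the boundary, so differentiability in time at a
  point is asked of the difference \<open>F - G\<close> alone.\<close>

lemma weak_form:
  assumes p: "((\<lambda>s. F s - G s) has_real_derivative p) (at s within I)" and \<psi>: "\<psi> \<in> H1_R"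
  shows "((\<lambda>\<sigma>. inner01 (\<lambda>x. v x \<sigma>) \<psi>) has_real_derivative
           (- inner01 (wderiv (\<lambda>x. w x s)) (wderiv \<psi>) - p * \<psi> 0)) (at s within I)"
proof -
  have "\<psi> \<in> H1" "\<psi> 1 = 0" using \<psi> by (auto simp: H1_R_def)
  obtain \<Psi> d where \<Psi>: "primitive \<Psi> d" "\<And>x. x \<in> {0..1} \<Longrightarrow> \<Psi> x = \<psi> x" "AE x in I01. d x = wderiv \<psi> x"
    using H1_primitive[OF \<open>\<psi> \<in> H1\<close>] by metis
  have d: "sqint I01 d" by (rule sqint_I01[OF primitive_sqint[OF \<Psi>(1)]])
  have s\<Psi>: "sqint I01 \<Psi>" by (rule continuous_sqint_I01[OF primitive_continuous[OF \<Psi>(1)]])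
  have parts: "inner01 h' \<Psi> = H 1 * \<Psi> 1 - H 0 * \<Psi> 0 - inner01 H d" if "primitive H h'" for H h'
  proof -
    have [measurable]: "H \<in> borel_measurable borel" "\<Psi> \<in> borel_measurable borel"
      "h' \<in> borel_measurable borel" "d \<in> borel_measurable borel"
      using primitive_measurable primitive_sqint that \<Psi>(1) by (auto simp: sqint_def)
    have "inner01 h' \<Psi> = (LINT x|lborel. indicator {0..1} x * (h' x * \<Psi> x))"
      "inner01 H d = (LINT x|lborel. indicator {0..1} x * (H x * d x))"
      unfolding inner01_def by (rule integral_I01, measurable)+
    then show ?thesis using primitive_by_parts[OF that \<Psi>(1), of 0 1] by simp
  qed
  have A: "inner01 (\<lambda>x. v x \<sigma>) \<psi> = - ((F \<sigma> - G \<sigma>) * \<psi> 0) - (inner01 (\<lambda>x. F (\<sigma> + x)) d - inner01 (\<lambda>x. G (\<sigma> - x)) d)" for \<sigma>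
  proof -
    have "inner01 (\<lambda>x. v x \<sigma>) \<psi> = inner01 (\<lambda>x. f (\<sigma> + x) + g (\<sigma> - x)) \<Psi>"
      by (rule inner01_cong) (auto simp: v_def \<Psi>)
    also have "\<dots> = inner01 (\<lambda>x. f (\<sigma> + x)) \<Psi> + inner01 (\<lambda>x. g (\<sigma> - x)) \<Psi>"
      by (intro inner01_add_left sqint_f sqint_g s\<Psi>)
    also have "inner01 (\<lambda>x. f (\<sigma> + x)) \<Psi> = - F \<sigma> * \<psi> 0 - inner01 (\<lambda>x. F (\<sigma> + x)) d"
      using parts[OF primitive_Fx[of \<sigma>]] \<Psi>(2)[of 0] \<Psi>(2)[of 1] \<open>\<psi> 1 = 0\<close> by simp
    also have "inner01 (\<lambda>x. g (\<sigma> - x)) \<Psi> = G \<sigma> * \<psi> 0 + inner01 (\<lambda>x. G (\<sigma> - x)) d"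
      using parts[OF primitive_Gx[of \<sigma>]] \<Psi>(2)[of 0] \<Psi>(2)[of 1] \<open>\<psi> 1 = 0\<close> by (simp add: inner01_minus_left)
    finally show ?thesis by (simp add: algebra_simps)
  qed
  have B: "((\<lambda>\<sigma>. - ((F \<sigma> - G \<sigma>) * \<psi> 0) - (inner01 (\<lambda>x. F (\<sigma> + x)) d - inner01 (\<lambda>x. G (\<sigma> - x)) d)) has_real_derivative
      - (p * \<psi> 0) - (inner01 (\<lambda>x. f (s + x)) d - inner01 (\<lambda>x. g (s - x)) d)) (at s within I)"
    by (intro DERIV_diff DERIV_minus DERIV_cmult_right p
        inner01_has_derivative[where w="\<lambda>x s. F (s + x)"] inner01_has_derivative[where w="\<lambda>x s. G (s - x)"]
        sqint_F sqint_G sqint_f sqint_g d l2_F l2_G)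
  have C: "inner01 (wderiv (\<lambda>x. w x s)) (wderiv \<psi>) = inner01 (\<lambda>x. f (s + x)) d - inner01 (\<lambda>x. g (s - x)) d"
  proof -
    have m: "wderiv (\<lambda>x. w x s) \<in> borel_measurable I01" "(\<lambda>x. w' x s) \<in> borel_measurable I01"
      "wderiv \<psi> \<in> borel_measurable I01" "d \<in> borel_measurable I01"
      using wderiv_sqint weak_deriv_w(2)[of s] is_weak_deriv_sqint[OF weak_deriv_w(1)] d \<open>\<psi> \<in> H1\<close> by (auto simp: sqint_def)
    have "inner01 (wderiv (\<lambda>x. w x s)) (wderiv \<psi>) = inner01 (\<lambda>x. w' x s) (wderiv \<psi>)"
      by (rule inner01_cong_AE[OF m(1,2,3) wderiv_AE[OF weak_deriv_w(2,1)]])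
    also have "\<dots> = inner01 d (\<lambda>x. w' x s)"
      by (subst inner01_commute, rule inner01_cong_AE[OF m(3,4,2)]) (use \<Psi>(3) in \<open>auto elim: AE_mp\<close>)
    also have "\<dots> = inner01 (\<lambda>x. f (s + x)) d - inner01 (\<lambda>x. g (s - x)) d"
      by (subst inner01_commute) (simp add: w'_def inner01_diff_left sqint_f sqint_g d)
    finally show ?thesis .
  qed
  show ?thesis unfolding A by (rule DERIV_cong[OF B]) (simp add: C)
qed

lemma is_wave_solution:
  assumes "\<And>s. s \<in> I \<Longrightarrow> ((\<lambda>s. F s - G s) has_real_derivative p s) (at s within I)"
    and "\<And>s. s \<in> I \<Longrightarrow> F (s + 1) + G (s - 1) = r s"
  shows "wave_solution I p r w v"
  unfolding wave_solution_def
  using assms cont_H1_w cont_L2_v time_deriv_w weak_form[OF assms(1)] by (auto simp: w_def)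

lemma sup_norm_bound:
  assumes "\<bar>F 0\<bar> + \<bar>G 0\<bar> + l2norm lborel f + l2norm lborel g \<le> C" "\<bar>s\<bar> \<le> L"
  shows "\<bar>w x s\<bar> \<le> (1 + sqrt (L + \<bar>x\<bar>)) * C"
proof -
  have "\<bar>H y\<bar> \<le> \<bar>H 0\<bar> + sqrt (L + \<bar>x\<bar>) * l2norm lborel h" if "primitive H h" "\<bar>y\<bar> \<le> L + \<bar>x\<bar>" for H h y
  proof -
    have "sqrt \<bar>y\<bar> * l2norm lborel h \<le> sqrt (L + \<bar>x\<bar>) * l2norm lborel h"
      using that(2) by (intro mult_right_mono) auto
    then show ?thesis using primitive_Holder[OF that(1), of y 0] by simp
  qed
  from this[OF F, of "s + x"] this[OF G, of "s - x"] assms(2)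
  have "\<bar>w x s\<bar> \<le> (\<bar>F 0\<bar> + \<bar>G 0\<bar>) + sqrt (L + \<bar>x\<bar>) * (l2norm lborel f + l2norm lborel g)"
    unfolding w_def distrib_left by linarith
  also have "\<dots> \<le> C + sqrt (L + \<bar>x\<bar>) * C"
  proof (intro add_mono mult_left_mono)
    show "\<bar>F 0\<bar> + \<bar>G 0\<bar> \<le> C" "l2norm lborel f + l2norm lborel g \<le> C"
      using assms(1) l2norm_nonneg[of lborel f] l2norm_nonneg[of lborel g] by linarith+
  qed (use assms(2) in simp)
  finally show ?thesis by (simp add: distrib_right)
qed

text \<open>The norms of \<open>w\<close>, \<open>w'\<close> and \<open>v\<close> contribute
  \<open>1 + sqrt (L + 1)\<close>, 1 and 1. Since \<open>C\<close> bounds the profiles on the whole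
  line, one constant serves all times up to \<open>L\<close>.\<close>

lemma norm_bound:
  assumes "\<bar>F 0\<bar> + \<bar>G 0\<bar> + l2norm lborel f + l2norm lborel g \<le> C" "\<bar>s\<bar> \<le> L"
  shows "space_H1_norm (\<lambda>x. w x s, \<lambda>x. v x s) \<le> (3 + sqrt (L + 1)) * C"
proof -
  have "C \<ge> 0" using assms(1) l2norm_nonneg[of lborel f] l2norm_nonneg[of lborel g] by linarith
  have fl: "l2norm I01 (\<lambda>x. f (s + x)) \<le> l2norm lborel f" "l2norm I01 (\<lambda>x. g (s - x)) \<le> l2norm lborel g"
    using sqint_I01(2)[OF sqint_affine[OF primitive_sqint[OF F], of 1 s]] l2norm_affine[of 1 f s]
      sqint_I01(2)[OF sqint_affine[OF primitive_sqint[OF G], of "-1" s]] l2norm_affine[of "-1" g s] by auto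
  then have fl': "l2norm I01 (\<lambda>x. f (s + x)) + l2norm I01 (\<lambda>x. g (s - x)) \<le> C" using assms(1) by linarith
  have v: "l2norm I01 (\<lambda>x. v x s) \<le> C"
    unfolding v_def using l2norm_triangle[OF sqint_f sqint_g, of s s] fl' by linarith
  have w': "l2norm I01 (\<lambda>x. w' x s) \<le> C"
    unfolding w'_def using l2norm_triangle_diff[OF sqint_f sqint_g, of s s] fl' by linarith
  have w: "l2norm I01 (\<lambda>x. w x s) \<le> (1 + sqrt (L + 1)) * C"
  proof (rule l2norm_le_sup_I01[OF primitive_continuous[OF primitive_w]])
    fix x :: real assume "x \<in> {0..1}"
    then have "(1 + sqrt (L + \<bar>x\<bar>)) * C \<le> (1 + sqrt (L + 1)) * C"
      using \<open>C \<ge> 0\<close> by (intro mult_right_mono) auto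
    then show "\<bar>w x s\<bar> \<le> (1 + sqrt (L + 1)) * C" using sup_norm_bound[OF assms, of x] by linarith
  qed
  have "H1_norm (\<lambda>x. w x s) \<le> l2norm I01 (\<lambda>x. w x s) + l2norm I01 (\<lambda>x. w' x s)"
    unfolding H1_norm_eq[OF weak_deriv_w(2,1)] by (rule sqrt_sum_squares_le_sum) auto
  moreover have "space_H1_norm (\<lambda>x. w x s, \<lambda>x. v x s) \<le> H1_norm (\<lambda>x. w x s) + l2norm I01 (\<lambda>x. v x s)"
    unfolding space_H1_norm_def fst_conv snd_conv L2_norm_eq
    by (rule sqrt_sum_squares_le_sum) (auto simp: H1_norm_def)
  ultimately show ?thesis using v w w' by (simp add: algebra_simps)
qed

end

section \<open>Weak solutions of the wave equation\<close>

lemma eventually_at_within_mem: "\<forall>\<^sub>F r in at s within I. r \<in> I"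
  by (simp add: eventually_at_filter)

lemma is_weak_deriv_diff:
  assumes "f \<in> H1" "g \<in> H1" "is_weak_deriv f f'" "is_weak_deriv g g'"
  shows "is_weak_deriv (\<lambda>x. f x - g x) (\<lambda>x. f' x - g' x)"
proof -
  have s: "sqint I01 f" "sqint I01 g" "sqint I01 f'" "sqint I01 g'"
    using assms H1_sqint is_weak_deriv_sqint by auto
  have "sqint I01 \<phi> \<and> sqint I01 \<phi>'" if "test_fun \<phi> \<phi>'" for \<phi> \<phi>'
  proof -
    have "continuous_on UNIV \<phi>" "continuous_on UNIV \<phi>'" using that
      unfolding test_fun_def by (auto intro: continuous_at_imp_continuous_on DERIV_isCont)
    then show ?thesis using continuous_sqint_I01 continuous_on_subset by blast
  qed
  then show ?thesis
    using assms(3,4) s unfolding is_weak_deriv_def L2_iff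
    by (auto simp: inner01_diff_left sqint_diff)
qed

lemma H1_diff: "f \<in> H1 \<Longrightarrow> g \<in> H1 \<Longrightarrow> (\<lambda>x. f x - g x) \<in> H1"
  using is_weak_deriv_H1[OF continuous_on_diff is_weak_deriv_diff[OF _ _ H1_wderiv H1_wderiv]] H1_continuous by blast

lemma wderiv_diff_AE:
  "f \<in> H1 \<Longrightarrow> g \<in> H1 \<Longrightarrow> AE x in I01. wderiv (\<lambda>x. f x - g x) x = wderiv f x - wderiv g x"
  using wderiv_AE[OF H1_diff is_weak_deriv_diff[OF _ _ H1_wderiv H1_wderiv]] by blast

lemma H1_norm_nonneg: "0 \<le> H1_norm f"
  by (simp add: H1_norm_def)

lemma H1_norm_triangle_diff:
  assumes "f \<in> H1" "g \<in> H1"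
  shows "H1_norm (\<lambda>x. f x - g x) \<le> H1_norm f + H1_norm g"
proof -
  have "H1_norm (\<lambda>x. f x - g x) = sqrt ((l2norm I01 (\<lambda>x. f x - g x))\<^sup>2 + (l2norm I01 (\<lambda>x. wderiv f x - wderiv g x))\<^sup>2)"
    by (rule H1_norm_eq[OF H1_diff is_weak_deriv_diff]) (use assms H1_wderiv in auto)
  also have "\<dots> \<le> sqrt ((l2norm I01 f + l2norm I01 g)\<^sup>2 + (l2norm I01 (wderiv f) + l2norm I01 (wderiv g))\<^sup>2)"
    using assms H1_sqint wderiv_sqint by (intro real_sqrt_le_mono add_mono power_mono l2norm_triangle_diff) auto
  also have "\<dots> \<le> sqrt ((l2norm I01 f)\<^sup>2 + (l2norm I01 (wderiv f))\<^sup>2) + sqrt ((l2norm I01 g)\<^sup>2 + (l2norm I01 (wderiv g))\<^sup>2)"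
    by (rule real_sqrt_sum_squares_triangle_ineq)
  finally show ?thesis by (simp add: H1_norm_def L2_norm_eq)
qed

lemma H1_norm_cong:
  assumes "f \<in> H1" "\<And>x. x \<in> {0..1} \<Longrightarrow> f x = g x"
  shows "H1_norm f = H1_norm g"
proof -
  have "is_weak_deriv f (wderiv g)" "g \<in> H1"
    using H1_cong[of f g] is_weak_deriv_cong[of f g] assms H1_wderiv by auto
  moreover have "l2norm I01 f = l2norm I01 g" by (rule l2norm_cong) (use assms in auto)
  ultimately show ?thesis using H1_norm_eq[OF assms(1)] H1_norm_eq[of g "wderiv g"] H1_wderiv by simp
qed

lemma cont_H1_diff:
  assumes "cont_H1 I w1" "cont_H1 I w2"
  shows "cont_H1 I (\<lambda>x s. w1 x s - w2 x s)"
  unfolding cont_H1_def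
proof (intro ballI conjI)
  fix s assume s: "s \<in> I"
  have h: "(\<lambda>x. w1 x r) \<in> H1" "(\<lambda>x. w2 x r) \<in> H1" if "r \<in> I" for r
    using assms that by (auto simp: cont_H1_def)
  show "(\<lambda>x. w1 x s - w2 x s) \<in> H1" by (intro H1_diff h s)
  show "((\<lambda>r. H1_norm (\<lambda>x. w1 x r - w2 x r - (w1 x s - w2 x s))) \<longlongrightarrow> 0) (at s within I)"
  proof (rule tendsto_sandwich[OF _ _ tendsto_const])
    show "\<forall>\<^sub>F r in at s within I. 0 \<le> H1_norm (\<lambda>x. w1 x r - w2 x r - (w1 x s - w2 x s))"
      by (simp add: H1_norm_nonneg)
    show "\<forall>\<^sub>F r in at s within I. H1_norm (\<lambda>x. w1 x r - w2 x r - (w1 x s - w2 x s))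
       \<le> H1_norm (\<lambda>x. w1 x r - w1 x s) + H1_norm (\<lambda>x. w2 x r - w2 x s)"
      using eventually_at_within_mem
    proof eventually_elim
      case (elim r)
      have "(\<lambda>x. w1 x r - w2 x r - (w1 x s - w2 x s)) = (\<lambda>x. (w1 x r - w1 x s) - (w2 x r - w2 x s))" by auto
      then show ?case using H1_norm_triangle_diff[OF H1_diff[OF h(1)[OF elim] h(1)[OF s]] H1_diff[OF h(2)[OF elim] h(2)[OF s]]]
        by simp
    qed
    have "((\<lambda>r. H1_norm (\<lambda>x. w1 x r - w1 x s) + H1_norm (\<lambda>x. w2 x r - w2 x s)) \<longlongrightarrow> 0 + 0) (at s within I)"
      using assms s by (intro tendsto_add) (auto simp: cont_H1_def)
    then show "((\<lambda>r. H1_norm (\<lambda>x. w1 x r - w1 x s) + H1_norm (\<lambda>x. w2 x r - w2 x s)) \<longlongrightarrow> 0) (at s within I)" by simp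
  qed
qed

lemma l2_tendsto_diff:
  assumes "\<forall>\<^sub>F r in F. sqint M (a r) \<and> sqint M (b r)"
    and "((\<lambda>r. l2norm M (a r)) \<longlongrightarrow> 0) F" "((\<lambda>r. l2norm M (b r)) \<longlongrightarrow> 0) F"
  shows "((\<lambda>r. l2norm M (\<lambda>x. a r x - b r x)) \<longlongrightarrow> 0) F"
proof (rule tendsto_sandwich[OF _ _ tendsto_const])
  show "\<forall>\<^sub>F r in F. l2norm M (\<lambda>x. a r x - b r x) \<le> l2norm M (a r) + l2norm M (b r)"
    using assms(1) by eventually_elim (simp add: l2norm_triangle_diff)
  show "((\<lambda>r. l2norm M (a r) + l2norm M (b r)) \<longlongrightarrow> 0) F" using tendsto_add[OF assms(2,3)] by simp
qed simp

lemma cont_L2_diff: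
  assumes "cont_L2 I v1" "cont_L2 I v2"
  shows "cont_L2 I (\<lambda>x s. v1 x s - v2 x s)"
  unfolding cont_L2_def L2_iff L2_norm_eq
proof (intro ballI conjI)
  fix s assume s: "s \<in> I"
  have h: "sqint I01 (\<lambda>x. v1 x r)" "sqint I01 (\<lambda>x. v2 x r)" if "r \<in> I" for r
    using assms that by (auto simp: cont_L2_def L2_iff)
  show "sqint I01 (\<lambda>x. v1 x s - v2 x s)" by (intro sqint_diff h s)
  have "\<forall>\<^sub>F r in at s within I. sqint I01 (\<lambda>x. v1 x r - v1 x s) \<and> sqint I01 (\<lambda>x. v2 x r - v2 x s)"
    using eventually_at_within_mem by eventually_elim (intro conjI sqint_diff h s)
  from l2_tendsto_diff[OF this] have
    "((\<lambda>r. l2norm I01 (\<lambda>x. v1 x r - v1 x s - (v2 x r - v2 x s))) \<longlongrightarrow> 0) (at s within I)"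
    using assms s by (auto simp: cont_L2_def L2_norm_eq)
  then show "((\<lambda>r. l2norm I01 (\<lambda>x. v1 x r - v2 x r - (v1 x s - v2 x s))) \<longlongrightarrow> 0) (at s within I)"
    by (simp add: algebra_simps)
qed

lemma time_deriv_diff:
  assumes "time_deriv I w1 v1" "time_deriv I w2 v2"
    and h: "\<And>r. r \<in> I \<Longrightarrow> sqint I01 (\<lambda>x. w1 x r)" "\<And>r. r \<in> I \<Longrightarrow> sqint I01 (\<lambda>x. w2 x r)"
      "\<And>r. r \<in> I \<Longrightarrow> sqint I01 (\<lambda>x. v1 x r)" "\<And>r. r \<in> I \<Longrightarrow> sqint I01 (\<lambda>x. v2 x r)"
  shows "time_deriv I (\<lambda>x s. w1 x s - w2 x s) (\<lambda>x s. v1 x s - v2 x s)"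
  unfolding time_deriv_def L2_norm_eq
proof
  fix s assume s: "s \<in> I"
  have eq: "(w1 x r - w2 x r - (w1 x s - w2 x s)) / (r - s) - (v1 x s - v2 x s)
    = ((w1 x r - w1 x s) / (r - s) - v1 x s) - ((w2 x r - w2 x s) / (r - s) - v2 x s)" for x r
    by (simp add: diff_divide_distrib)
  have "\<forall>\<^sub>F r in at s within I. sqint I01 (\<lambda>x. (w1 x r - w1 x s) / (r - s) - v1 x s) \<and> sqint I01 (\<lambda>x. (w2 x r - w2 x s) / (r - s) - v2 x s)"
    using eventually_at_within_mem by eventually_elim (intro conjI sqint_diff sqint_divide h s)
  from l2_tendsto_diff[OF this] show
    "((\<lambda>r. l2norm I01 (\<lambda>x. (w1 x r - w2 x r - (w1 x s - w2 x s)) / (r - s) - (v1 x s - v2 x s))) \<longlongrightarrow> 0) (at s within I)"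
    unfolding eq using assms(1,2) s by (auto simp: time_deriv_def L2_norm_eq)
qed

lemma wave_solution_regularity:
  assumes "wave_solution I p r w v" "s \<in> I"
  shows "(\<lambda>x. w x s) \<in> H1" "sqint I01 (\<lambda>x. w x s)" "sqint I01 (\<lambda>x. v x s)" "w 1 s = r s"
  using assms H1_sqint by (auto simp: wave_solution_def cont_H1_def cont_L2_def L2_iff)

lemma inner01_wderiv_diff:
  assumes "f \<in> H1" "g \<in> H1" "h \<in> H1"
  shows "inner01 (wderiv (\<lambda>x. f x - g x)) (wderiv h) = inner01 (wderiv f) (wderiv h) - inner01 (wderiv g) (wderiv h)"
proof -
  have s: "sqint I01 (wderiv f)" "sqint I01 (wderiv g)" "sqint I01 (wderiv h)" "sqint I01 (wderiv (\<lambda>x. f x - g x))"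
    using assms wderiv_sqint H1_diff by auto
  have "inner01 (wderiv (\<lambda>x. f x - g x)) (wderiv h) = inner01 (\<lambda>x. wderiv f x - wderiv g x) (wderiv h)"
    by (rule inner01_cong_AE[OF _ _ _ wderiv_diff_AE[OF assms(1,2)]])
      (use s sqint_diff[OF s(1,2)] in \<open>auto simp: sqint_def\<close>)
  then show ?thesis using s by (simp add: inner01_diff_left)
qed

lemma wave_solution_diff:
  assumes 1: "wave_solution I p1 r1 w1 v1" and 2: "wave_solution I p2 r2 w2 v2"
  shows "wave_solution I (\<lambda>s. p1 s - p2 s) (\<lambda>s. r1 s - r2 s) (\<lambda>x s. w1 x s - w2 x s) (\<lambda>x s. v1 x s - v2 x s)"
proof -
  note reg = wave_solution_regularity[OF 1] wave_solution_regularity[OF 2]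
  show ?thesis
    unfolding wave_solution_def
  proof (intro conjI ballI)
    show "cont_H1 I (\<lambda>x s. w1 x s - w2 x s)" "cont_L2 I (\<lambda>x s. v1 x s - v2 x s)"
      using 1 2 cont_H1_diff cont_L2_diff by (auto simp: wave_solution_def)
    show "time_deriv I (\<lambda>x s. w1 x s - w2 x s) (\<lambda>x s. v1 x s - v2 x s)"
      using 1 2 reg by (intro time_deriv_diff) (auto simp: wave_solution_def)
    show "w1 1 s - w2 1 s = r1 s - r2 s" if "s \<in> I" for s using reg that by simp
    fix \<psi> s assume \<psi>: "\<psi> \<in> H1_R" and s: "s \<in> I"
    then have \<psi>H: "\<psi> \<in> H1" by (simp add: H1_R_def)
    have "((\<lambda>\<sigma>. inner01 (\<lambda>x. v1 x \<sigma>) \<psi> - inner01 (\<lambda>x. v2 x \<sigma>) \<psi>) has_real_derivative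
        (- inner01 (wderiv (\<lambda>x. w1 x s)) (wderiv \<psi>) - p1 s * \<psi> 0) -
        (- inner01 (wderiv (\<lambda>x. w2 x s)) (wderiv \<psi>) - p2 s * \<psi> 0)) (at s within I)"
      using 1 2 \<psi> s by (intro DERIV_diff) (auto simp: wave_solution_def)
    then show "((\<lambda>\<sigma>. inner01 (\<lambda>x. v1 x \<sigma> - v2 x \<sigma>) \<psi>) has_real_derivative
        - inner01 (wderiv (\<lambda>x. w1 x s - w2 x s)) (wderiv \<psi>) - (p1 s - p2 s) * \<psi> 0) (at s within I)"
    proof (rule has_field_derivative_transform_within[where d=1, THEN DERIV_cong])
      show "inner01 (\<lambda>x. v1 x \<sigma>) \<psi> - inner01 (\<lambda>x. v2 x \<sigma>) \<psi> = inner01 (\<lambda>x. v1 x \<sigma> - v2 x \<sigma>) \<psi>" if "\<sigma> \<in> I" for \<sigma>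
        using reg that H1_sqint[OF \<psi>H] by (simp add: inner01_diff_left)
    qed (use s reg \<psi>H in \<open>auto simp: inner01_wderiv_diff algebra_simps\<close>)
  qed
qed

text \<open>In the weak form one factor \<open>k\<close> comes from the velocity and one from the
  chain rule, and \<open>k * k = 1\<close>. This symmetry supplies the backward solutions of the
  uniqueness proof and moves the prediction window to time 0.\<close>

lemma wave_solution_affine:
  assumes 1: "wave_solution I p r w v" and J: "\<And>s. s \<in> J \<Longrightarrow> k * s + c \<in> I" and k: "k = 1 \<or> k = -1"
  shows "wave_solution J (\<lambda>s. p (k * s + c)) (\<lambda>s. r (k * s + c)) (\<lambda>x s. w x (k * s + c)) (\<lambda>x s. k * v x (k * s + c))"
proof -
  have k0: "k \<noteq> 0" "k * k = 1" "\<bar>k\<bar> = 1" using k by auto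
  have fl: "filterlim (\<lambda>r. k * r + c) (at (k * s + c) within I) (at s within J)" for s
    by (rule at_within_affine[OF J k0(1)])
  show ?thesis
    unfolding wave_solution_def cont_H1_def cont_L2_def time_deriv_def L2_iff L2_norm_eq
  proof (intro conjI ballI)
    fix s assume s: "s \<in> J"
    note s' = J[OF s]
    show "(\<lambda>x. w x (k * s + c)) \<in> H1" "sqint I01 (\<lambda>x. k * v x (k * s + c))" "w 1 (k * s + c) = r (k * s + c)"
      using wave_solution_regularity[OF 1 s'] by (auto intro: sqint_cmult)
    have "((\<lambda>r. H1_norm (\<lambda>x. w x r - w x (k * s + c))) \<longlongrightarrow> 0) (at (k * s + c) within I)"
      using 1 s' by (auto simp: wave_solution_def cont_H1_def)
    from filterlim_compose[OF this fl]
    show "((\<lambda>r. H1_norm (\<lambda>x. w x (k * r + c) - w x (k * s + c))) \<longlongrightarrow> 0) (at s within J)" .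
    have "((\<lambda>r. l2norm I01 (\<lambda>x. v x r - v x (k * s + c))) \<longlongrightarrow> 0) (at (k * s + c) within I)"
      using 1 s' by (auto simp: wave_solution_def cont_L2_def L2_norm_eq)
    from filterlim_compose[OF this fl]
    have "((\<lambda>r. l2norm I01 (\<lambda>x. k * (v x (k * r + c) - v x (k * s + c)))) \<longlongrightarrow> 0) (at s within J)"
      by (simp only: l2norm_cmult k0 mult_1)
    then show "((\<lambda>r. l2norm I01 (\<lambda>x. k * v x (k * r + c) - k * v x (k * s + c))) \<longlongrightarrow> 0) (at s within J)"
      by (simp add: right_diff_distrib)
    have "((\<lambda>r. l2norm I01 (\<lambda>x. (w x r - w x (k * s + c)) / (r - (k * s + c)) - v x (k * s + c))) \<longlongrightarrow> 0) (at (k * s + c) within I)"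
      using 1 s' by (auto simp: wave_solution_def time_deriv_def L2_norm_eq)
    from filterlim_compose[OF this fl]
    have "((\<lambda>r. l2norm I01 (\<lambda>x. k * ((w x (k * r + c) - w x (k * s + c)) / ((k * r + c) - (k * s + c)) - v x (k * s + c)))) \<longlongrightarrow> 0) (at s within J)"
      by (simp only: l2norm_cmult k0 mult_1)
    moreover have "k * ((w x (k * r + c) - w x (k * s + c)) / ((k * r + c) - (k * s + c)) - v x (k * s + c))
        = (w x (k * r + c) - w x (k * s + c)) / (r - s) - k * v x (k * s + c)" for x r
      using k by (auto simp: divide_simps) (auto simp: algebra_simps)
    ultimately show "((\<lambda>r. l2norm I01 (\<lambda>x. (w x (k * r + c) - w x (k * s + c)) / (r - s) - k * v x (k * s + c))) \<longlongrightarrow> 0) (at s within J)"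
      by simp
  next
    fix \<psi> s assume \<psi>: "\<psi> \<in> H1_R" and s: "s \<in> J"
    let ?D = "- inner01 (wderiv (\<lambda>x. w x (k * s + c))) (wderiv \<psi>) - p (k * s + c) * \<psi> 0"
    have "((\<lambda>\<sigma>. inner01 (\<lambda>x. v x \<sigma>) \<psi>) has_real_derivative ?D) (at (k * s + c) within (\<lambda>s. k * s + c) ` J)"
      by (rule DERIV_subset[of _ _ _ I]) (use 1 J[OF s] J \<psi> in \<open>auto simp: wave_solution_def\<close>)
    moreover have "((\<lambda>s. k * s + c) has_real_derivative k) (at s within J)"
      by (auto intro!: derivative_eq_intros)
    ultimately have "((\<lambda>\<sigma>. inner01 (\<lambda>x. v x \<sigma>) \<psi>) \<circ> (\<lambda>s. k * s + c) has_real_derivative ?D * k) (at s within J)"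
      by (rule DERIV_image_chain)
    from DERIV_cmult[OF this, of k]
    have "((\<lambda>\<sigma>. k * inner01 (\<lambda>x. v x (k * \<sigma> + c)) \<psi>) has_real_derivative k * (?D * k)) (at s within J)"
      by (simp only: o_def)
    moreover have "k * (?D * k) = ?D" using k by auto
    ultimately show "((\<lambda>\<sigma>. inner01 (\<lambda>x. k * v x (k * \<sigma> + c)) \<psi>) has_real_derivative ?D) (at s within J)"
      by (simp only: inner01_cmult_left)
  qed
qed

lemma wave_solution_cong:
  assumes "wave_solution I p r w v" "\<And>s. s \<in> I \<Longrightarrow> p s = p' s" "\<And>s. s \<in> I \<Longrightarrow> r s = r' s"
  shows "wave_solution I p' r' w v"
  using assms by (auto simp: wave_solution_def)

lemma wave_solution_subset:
  assumes "wave_solution I p r w v" "J \<subseteq> I"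
  shows "wave_solution J p r w v"
  using wave_solution_affine[OF assms(1), of J 1 0] assms(2) by auto

text \<open>Both displacements vanish at 1 and are therefore admissible test functions for each
  other. The terms with spatial derivatives are symmetric, the Robin terms agree, and the products
  of velocities cancel.\<close>

lemma symplectic_form_conserved:
  assumes 1: "wave_solution I (\<lambda>s. - q * w 0 s) (\<lambda>s. 0) w v"
    and 2: "wave_solution I (\<lambda>s. - q * \<phi> 0 s) (\<lambda>s. 0) \<phi> \<phi>s" and s: "s \<in> I"
  shows "((\<lambda>\<sigma>. inner01 (\<lambda>x. v x \<sigma>) (\<lambda>x. \<phi> x \<sigma>) - inner01 (\<lambda>x. \<phi>s x \<sigma>) (\<lambda>x. w x \<sigma>)) has_real_derivative 0) (at s within I)"
proof -
  note r1 = wave_solution_regularity[OF 1] and r2 = wave_solution_regularity[OF 2]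
  have H: "(\<lambda>x. w x s) \<in> H1_R" "(\<lambda>x. \<phi> x s) \<in> H1_R" using r1 r2 s by (auto simp: H1_R_def)
  have "((\<lambda>\<sigma>. inner01 (\<lambda>x. v x \<sigma>) (\<lambda>x. \<phi> x \<sigma>)) has_real_derivative
     (- inner01 (wderiv (\<lambda>x. w x s)) (wderiv (\<lambda>x. \<phi> x s)) - (- q * w 0 s) * \<phi> 0 s) + inner01 (\<lambda>x. v x s) (\<lambda>x. \<phi>s x s)) (at s within I)"
    by (rule inner01_product_derivative)
      (use 1 2 r1 r2 s H in \<open>auto simp: wave_solution_def cont_L2_def time_deriv_def L2_norm_eq insert_absorb\<close>)
  moreover have "((\<lambda>\<sigma>. inner01 (\<lambda>x. \<phi>s x \<sigma>) (\<lambda>x. w x \<sigma>)) has_real_derivative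
     (- inner01 (wderiv (\<lambda>x. \<phi> x s)) (wderiv (\<lambda>x. w x s)) - (- q * \<phi> 0 s) * w 0 s) + inner01 (\<lambda>x. \<phi>s x s) (\<lambda>x. v x s)) (at s within I)"
    by (rule inner01_product_derivative)
      (use 1 2 r1 r2 s H in \<open>auto simp: wave_solution_def cont_L2_def time_deriv_def L2_norm_eq insert_absorb\<close>)
  ultimately show ?thesis
    by (rule DERIV_diff[THEN DERIV_cong]) (simp add: inner01_commute)
qed

text \<open>The velocity is a norm limit of difference quotients that all vanish; the limit
  determines it because \<open>s\<close> is an accumulation point of \<open>I\<close>.\<close>

lemma time_deriv_zero:
  assumes "time_deriv I w v" "\<And>r x. r \<in> I \<Longrightarrow> x \<in> {0..1} \<Longrightarrow> w x r = 0" "s \<in> I" "at s within I \<noteq> bot"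
    "sqint I01 (\<lambda>x. v x s)"
  shows "AE x in I01. v x s = 0"
proof -
  have "((\<lambda>r. l2norm I01 (\<lambda>x. (w x r - w x s) / (r - s) - v x s)) \<longlongrightarrow> 0) (at s within I)"
    using assms by (simp add: time_deriv_def L2_norm_eq)
  moreover have "\<forall>\<^sub>F r in at s within I. l2norm I01 (\<lambda>x. (w x r - w x s) / (r - s) - v x s) = l2norm I01 (\<lambda>x. v x s)"
    using eventually_at_within_mem
  proof eventually_elim
    case (elim r)
    have "l2norm I01 (\<lambda>x. (w x r - w x s) / (r - s) - v x s) = l2norm I01 (\<lambda>x. - v x s)"
      by (rule l2norm_cong) (use assms(2,3) elim in auto)
    then show ?case by (simp add: l2norm_minus)
  qed
  ultimately have "((\<lambda>r. l2norm I01 (\<lambda>x. v x s)) \<longlongrightarrow> 0) (at s within I)"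
    by (simp add: tendsto_cong)
  then have "l2norm I01 (\<lambda>x. v x s) = 0"
    using assms(4) by (simp add: tendsto_const_iff)
  then show ?thesis using l2norm_eq_0_imp[OF assms(5)] by simp
qed

lemma continuous_l2norm_zero:
  assumes "continuous_on {0..1} f" "l2norm I01 f = 0" "x \<in> {0..1}"
  shows "f x = 0"
proof -
  have "AE x in I01. f x = 0" by (rule l2norm_eq_0_imp[OF continuous_sqint_I01 assms(2)]) fact
  then have "AE x in lebesgue. x \<in> {0..1} \<longrightarrow> f x = 0" by (subst (asm) AE_restrict_space_iff) auto
  then have ae: "AE x in lebesgue. x \<in> {0<..<1} \<longrightarrow> f x = 0" by (rule AE_mp) auto
  have "f x = 0" if x: "x \<in> {0<..<1}" for x
  proof (rule ccontr)
    assume "f x \<noteq> 0"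
    have "isCont f x" using assms(1) x continuous_on_interior[of "{0..1}" f x] by simp
    then have "(f \<longlongrightarrow> f x) (nhds x)" by (simp add: isCont_def tendsto_at_iff_tendsto_nhds)
    then have "\<forall>\<^sub>F y in nhds x. f y \<noteq> 0" using \<open>f x \<noteq> 0\<close> by (rule tendsto_imp_eventually_ne)
    moreover have "\<forall>\<^sub>F y in nhds x. y \<in> {0<..<1}" by (rule eventually_nhds_in_open) (use x in auto)
    ultimately have "\<forall>\<^sub>F y in nhds x. f y \<noteq> 0 \<and> y \<in> {0<..<1}" by eventually_elim simp
    then obtain e where e: "e > 0" "\<And>y. dist y x < e \<Longrightarrow> f y \<noteq> 0 \<and> y \<in> {0<..<1}"
      unfolding eventually_nhds_metric by blast
    have "AE y in lebesgue. y \<notin> ball x e"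
      using ae by eventually_elim (use e in \<open>auto simp: dist_commute\<close>)
    then have "ball x e \<in> null_sets lebesgue" by (subst (asm) AE_iff_null_sets[symmetric]) auto
    then have "negligible (ball x e)" by (simp add: negligible_iff_null_sets)
    then show False using e(1) open_not_negligible[of "ball x e"] by simp
  qed
  then show ?thesis
    using continuous_constant_on_closure[of "{0<..<1}" f 0 x] assms by simp
qed

section \<open>Well-posedness of the wave equation\<close>

text \<open>Variation of constants for \<open>Z' = 2 * F + q * Z\<close> with
  \<open>Z(0) = 0\<close>. Setting \<open>G = F + q * Z\<close> yields
  \<open>(F - G)' = - q * (F + G)\<close>, the Robin condition at 0 for
  \<open>F (s + x) + G (s - x)\<close>.\<close>

definition robin_memory :: "real \<Rightarrow> (real \<Rightarrow> real) \<Rightarrow> real \<Rightarrow> real" where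
  "robin_memory q F y = exp (q * y) * integral {0..y} (\<lambda>r. exp (- q * r) * (2 * F r))"

lemma robin_memory_0 [simp]: "robin_memory q F 0 = 0"
  by (simp add: robin_memory_def)

lemma robin_memory_cong: "(\<And>r. 0 \<le> r \<Longrightarrow> r \<le> y \<Longrightarrow> F r = F' r) \<Longrightarrow> robin_memory q F y = robin_memory q F' y"
proof -
  assume "\<And>r. 0 \<le> r \<Longrightarrow> r \<le> y \<Longrightarrow> F r = F' r"
  then have "integral {0..y} (\<lambda>r. exp (- q * r) * (2 * F r)) = integral {0..y} (\<lambda>r. exp (- q * r) * (2 * F' r))"
    by (intro Henstock_Kurzweil_Integration.integral_cong) simp
  then show ?thesis by (simp only: robin_memory_def)
qed

lemma robin_memory_derivative:
  assumes "continuous_on {0..N} F" "y \<in> {0..N}"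
  shows "(robin_memory q F has_real_derivative 2 * F y + q * robin_memory q F y) (at y within {0..N})"
proof -
  have "continuous_on {0..N} (\<lambda>r. exp (- q * r) * (2 * F r))"
    by (intro continuous_intros assms)
  then have "((\<lambda>y. integral {0..y} (\<lambda>r. exp (- q * r) * (2 * F r))) has_real_derivative exp (- q * y) * (2 * F y)) (at y within {0..N})"
    by (rule integral_has_real_derivative[OF _ assms(2)])
  moreover have "((\<lambda>y. exp (q * y)) has_real_derivative q * exp (q * y)) (at y within {0..N})"
    by (auto intro!: derivative_eq_intros)
  ultimately have D: "(robin_memory q F has_real_derivative
     q * exp (q * y) * integral {0..y} (\<lambda>r. exp (- q * r) * (2 * F r)) + exp (- q * y) * (2 * F y) * exp (q * y)) (at y within {0..N})"
    unfolding robin_memory_def[abs_def] by (intro DERIV_mult)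
  have "exp (- q * y) * (2 * F y) * exp (q * y) = 2 * F y"
  proof -
    have "exp (- q * y) * (2 * F y) * exp (q * y) = (2 * F y) * (exp (- q * y) * exp (q * y))"
      by (simp only: mult_ac)
    also have "exp (- q * y) * exp (q * y) = 1" by (simp flip: exp_add)
    finally show ?thesis by simp
  qed
  then show ?thesis
    by (intro DERIV_cong[OF D]) (simp add: robin_memory_def mult.assoc)
qed

lemma robin_memory_bound:
  assumes "continuous_on {0..N} F" "\<And>r. r \<in> {0..N} \<Longrightarrow> \<bar>F r\<bar> \<le> B" "y \<in> {0..N}" "0 \<le> q" "0 \<le> B"
  shows "\<bar>robin_memory q F y\<bar> \<le> exp (q * N) * (2 * B * N)"
proof -
  have c: "continuous_on {0..y} (\<lambda>r. exp (- q * r) * (2 * F r))"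
    by (intro continuous_intros continuous_on_subset[OF assms(1)]) (use assms in auto)
  have "norm (integral {0..y} (\<lambda>r. exp (- q * r) * (2 * F r))) \<le> (2 * B) * (y - 0)"
  proof (rule integral_bound)
    fix r assume r: "r \<in> {0..y}"
    have "exp (- q * r) * \<bar>F r\<bar> \<le> 1 * B"
      using assms r by (intro mult_mono) auto
    then show "norm (exp (- q * r) * (2 * F r)) \<le> 2 * B" by (simp add: abs_mult)
  qed (use assms c in auto)
  also have "\<dots> \<le> 2 * B * N" using assms by (auto intro!: mult_left_mono)
  finally show ?thesis
    unfolding robin_memory_def using assms by (auto simp: abs_mult intro!: mult_mono)
qed

text \<open>For \<open>y \<le> 0\<close> the profile comes from the initial data, for
  \<open>y > 0\<close> it is the wave reflected at \<open>x = 0\<close>. The memory term is frozen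
  beyond \<open>N\<close>, as its possible exponential growth would spoil square integrability on
  the line.\<close>

definition reflect_robin :: "real \<Rightarrow> real \<Rightarrow> (real \<Rightarrow> real) \<Rightarrow> (real \<Rightarrow> real) \<Rightarrow> real \<Rightarrow> real" where
  "reflect_robin q N G0 F y = (if y \<le> 0 then G0 y else F y + q * robin_memory q F (max 0 (min N y)))"

text \<open>The condition \<open>F (s + 1) + G (s - 1) = R s\<close> solved for \<open>F\<close> at
  \<open>y = s + 1\<close>; up to \<open>y = 1\<close> the initial data decide.\<close>

definition reflect_dirichlet :: "(real \<Rightarrow> real) \<Rightarrow> (real \<Rightarrow> real) \<Rightarrow> (real \<Rightarrow> real) \<Rightarrow> real \<Rightarrow> real" where
  "reflect_dirichlet R F0 G y = (if y \<le> 1 then F0 y else R (y - 1) - G (y - 2))"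

lemma l2norm_glue:
  assumes "sqint lborel f" "sqint lborel g"
  shows "l2norm lborel (\<lambda>x::real. if x \<le> c then f x else g x) \<le> l2norm lborel f + l2norm lborel g"
proof -
  have eq: "(\<lambda>x. if x \<le> c then f x else g x) = (\<lambda>x. indicator {..c} x * f x + indicator {c<..} x * g x)"
    by (auto split: split_indicator)
  have s: "sqint lborel (\<lambda>x. indicator {..c} x * f x)" "sqint lborel (\<lambda>x. indicator {c<..} x * g x)"
    by (intro sqint_indicator assms, simp)+
  have "l2norm lborel (\<lambda>x. indicator {..c} x * f x) \<le> l2norm lborel f"
    by (rule l2norm_mono(2)[OF assms(1)]) (use s in \<open>auto simp: sqint_def split: split_indicator\<close>)
  moreover have "l2norm lborel (\<lambda>x. indicator {c<..} x * g x) \<le> l2norm lborel g"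
    by (rule l2norm_mono(2)[OF assms(2)]) (use s in \<open>auto simp: sqint_def split: split_indicator\<close>)
  ultimately show ?thesis unfolding eq using l2norm_triangle[OF s] by linarith
qed

lemma l2norm_truncated_le:
  assumes "a \<le> b" "continuous_on {a..b} f" "\<And>x. x \<in> {a..b} \<Longrightarrow> \<bar>f x\<bar> \<le> B"
  shows "l2norm lborel (\<lambda>x. indicator {a..b} x * f x) \<le> B * sqrt (b - a)"
proof -
  have "\<bar>f a\<bar> \<le> B" using assms by simp
  then have "B \<ge> 0" by linarith
  have m: "(\<lambda>x. indicator {a..b} x * f x) \<in> borel_measurable borel"
    using borel_measurable_continuous_on_indicator[OF _ assms(2)] by simp
  have "l2norm lborel (\<lambda>x. indicator {a..b} x * f x) \<le> l2norm lborel (\<lambda>x. B * indicator {a..b} x)"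
    by (rule l2norm_mono(2)[OF sqint_cmult[OF sqint_indicator_Icc]])
      (use m assms(3) \<open>B \<ge> 0\<close> in \<open>auto split: split_indicator\<close>)
  then show ?thesis using assms(1) \<open>B \<ge> 0\<close> by (simp add: l2norm_cmult l2norm_indicator_Icc)
qed

text \<open>\<open>C\<close> is fixed before the data: on \<open>{0..N}\<close> the size of
  \<open>F\<close> is bounded through \<open>\<bar>F 0\<bar>\<close> and the norm of
  \<open>f\<close>, the derivative \<open>2 * F + q * Z\<close> of the memory term by
  \<open>E\<close> times this, and its norm by a further \<open>sqrt N\<close>.\<close>

lemma robin_reflection:
  assumes "0 \<le> q" "0 \<le> N"
  obtains C where "C \<ge> 0"
    "\<And>F f G0 g0. primitive F f \<Longrightarrow> primitive G0 g0 \<Longrightarrow> G0 0 = F 0 \<Longrightarrow>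
       \<exists>g. primitive (reflect_robin q N G0 F) g \<and> (\<forall>y\<le>0. g y = g0 y) \<and>
           l2norm lborel g \<le> l2norm lborel g0 + C * (\<bar>F 0\<bar> + l2norm lborel f)"
proof -
  define E where "E = 2 + q * (exp (q * N) * (2 * N))"
  have "E \<ge> 0" using assms by (simp add: E_def)
  define Q where "Q = q * E * sqrt N * (1 + sqrt N)"
  define C where "C = 1 + Q"
  show thesis
  proof (rule that[of C])
    show "C \<ge> 0" using assms \<open>E \<ge> 0\<close> by (simp add: C_def Q_def)
    fix F f G0 g0 :: "real \<Rightarrow> real" assume F: "primitive F f" and G0: "primitive G0 g0" and eq: "G0 0 = F 0"
    have c: "continuous_on {0..N} F" by (rule primitive_continuous[OF F])
    define B where "B = \<bar>F 0\<bar> + sqrt N * l2norm lborel f"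
    have "B \<ge> 0" using assms by (simp add: B_def)
    have FB: "\<bar>F r\<bar> \<le> B" if "r \<in> {0..N}" for r
    proof -
      have "sqrt \<bar>r\<bar> * l2norm lborel f \<le> sqrt N * l2norm lborel f"
        using that by (intro mult_right_mono) auto
      then show ?thesis using primitive_Holder[OF F, of r 0] by (simp add: B_def)
    qed
    let ?Z = "robin_memory q F"
    let ?z = "\<lambda>y. 2 * F y + q * ?Z y"
    have cz: "continuous_on {0..N} ?z"
      using robin_memory_derivative[OF c] 
      by (intro continuous_intros c DERIV_continuous_on) 
    have Z: "primitive (\<lambda>x. ?Z (max 0 (min N x))) (\<lambda>x. indicator {0..N} x * ?z x)"
      by (rule continuous_derivative_primitive[OF assms(2) robin_memory_derivative[OF c] cz])
    have zb: "\<bar>?z y\<bar> \<le> E * B" if "y \<in> {0..N}" for y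
    proof -
      have "q * \<bar>?Z y\<bar> \<le> q * (exp (q * N) * (2 * B * N))"
        using robin_memory_bound[OF c FB that assms(1) \<open>B \<ge> 0\<close>] assms by (intro mult_left_mono) auto
      then have "\<bar>q * ?Z y\<bar> \<le> q * (exp (q * N) * (2 * B * N))" using assms by (simp add: abs_mult)
      then have "\<bar>?z y\<bar> \<le> 2 * B + q * (exp (q * N) * (2 * B * N))" using FB[OF that] by linarith
      then show ?thesis by (simp add: E_def algebra_simps)
    qed
    have zl: "l2norm lborel (\<lambda>x. indicator {0..N} x * ?z x) \<le> E * B * sqrt (N - 0)"
      by (rule l2norm_truncated_le[OF assms(2) cz zb])
    let ?h = "\<lambda>x. f x + q * (indicator {0..N} x * ?z x)"
    have H: "primitive (\<lambda>y. F y + q * ?Z (max 0 (min N y))) ?h"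
      by (intro primitive_add F primitive_cmult Z)
    have gl: "primitive (\<lambda>y. if y \<le> 0 then G0 y else F y + q * ?Z (max 0 (min N y))) (\<lambda>y. if y \<le> 0 then g0 y else ?h y)"
      by (rule primitive_glue[OF G0 H]) (use eq assms in \<open>simp add: max_def min_def\<close>)
    have f: "sqint lborel f" and z: "sqint lborel (\<lambda>x. indicator {0..N} x * ?z x)"
      using F Z primitive_sqint by blast+
    have "l2norm lborel ?h \<le> l2norm lborel f + l2norm lborel (\<lambda>x. q * (indicator {0..N} x * ?z x))"
      by (rule l2norm_triangle[OF f sqint_cmult[OF z]])
    also have "l2norm lborel (\<lambda>x. q * (indicator {0..N} x * ?z x)) = q * l2norm lborel (\<lambda>x. indicator {0..N} x * ?z x)"
      using assms by (simp add: l2norm_cmult)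
    also have "\<dots> \<le> q * (E * B * sqrt N)" using zl assms by (intro mult_left_mono) auto
    also have "B \<le> (1 + sqrt N) * (\<bar>F 0\<bar> + l2norm lborel f)"
      using assms by (simp add: B_def algebra_simps)
    finally have "l2norm lborel ?h \<le> l2norm lborel f + q * (E * ((1 + sqrt N) * (\<bar>F 0\<bar> + l2norm lborel f)) * sqrt N)"
      using assms \<open>E \<ge> 0\<close> by (simp add: mult_left_mono mult_right_mono)
    also have "q * (E * ((1 + sqrt N) * (\<bar>F 0\<bar> + l2norm lborel f)) * sqrt N) = Q * (\<bar>F 0\<bar> + l2norm lborel f)"
      unfolding Q_def by (simp only: mult_ac)
    also have "l2norm lborel f + Q * (\<bar>F 0\<bar> + l2norm lborel f) \<le> C * (\<bar>F 0\<bar> + l2norm lborel f)"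
      unfolding C_def by (simp add: distrib_right)
    finally have "l2norm lborel (\<lambda>y. if y \<le> 0 then g0 y else ?h y) \<le> l2norm lborel g0 + C * (\<bar>F 0\<bar> + l2norm lborel f)"
      using l2norm_glue[OF primitive_sqint[OF G0] primitive_sqint[OF H], of 0] by linarith
    then show "\<exists>g. primitive (reflect_robin q N G0 F) g \<and> (\<forall>y\<le>0. g y = g0 y) \<and>
           l2norm lborel g \<le> l2norm lborel g0 + C * (\<bar>F 0\<bar> + l2norm lborel f)"
      using gl unfolding reflect_robin_def[abs_def]
      by (intro exI[of _ "\<lambda>y. if y \<le> 0 then g0 y else ?h y"]) simp
  qed
qed

text \<open>Causality: the memory term integrates \<open>F\<close> over the past of \<open>y\<close>
  only.\<close>

lemma reflect_robin_cong:
  assumes "\<And>r. r \<le> y \<Longrightarrow> F r = F' r"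
  shows "reflect_robin q N G0 F y = reflect_robin q N G0 F' y"
proof (cases "y \<le> 0")
  case False
  then have "robin_memory q F (max 0 (min N y)) = robin_memory q F' (max 0 (min N y))"
    by (intro robin_memory_cong assms) linarith
  then show ?thesis using assms[of y] by (simp add: reflect_robin_def)
qed (simp add: reflect_robin_def)

lemma reflect_robin_condition:
  assumes F: "primitive F f" and eq: "G0 0 = F 0" and s: "s \<in> {0..N}"
  shows "((\<lambda>y. F y - reflect_robin q N G0 F y) has_real_derivative
           - q * (F s + reflect_robin q N G0 F s)) (at s within {0..N})"
proof -
  have G: "reflect_robin q N G0 F y = F y + q * robin_memory q F y" if "y \<in> {0..N}" for y
    using that eq by (auto simp: reflect_robin_def max_def min_def)
  have "((\<lambda>y. - q * robin_memory q F y) has_real_derivative - q * (2 * F s + q * robin_memory q F s)) (at s within {0..N})"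
    by (intro DERIV_cmult robin_memory_derivative primitive_continuous[OF F] s)
  then show ?thesis
    by (rule has_field_derivative_transform_within[where d=1, THEN DERIV_cong])
      (use s G in \<open>auto simp: algebra_simps\<close>)
qed

lemma dirichlet_reflection:
  assumes "primitive F0 f0" "primitive G g" "primitive R r" "F0 1 = R 0 - G (-1)"
  obtains f where "primitive (reflect_dirichlet R F0 G) f" "\<And>y. y \<le> 1 \<Longrightarrow> f y = f0 y"
    "l2norm lborel f \<le> l2norm lborel f0 + l2norm lborel r + l2norm lborel g"
proof -
  let ?h = "\<lambda>y. r (y - 1) - g (y - 2)"
  have H: "primitive (\<lambda>y. R (y - 1) - G (y - 2)) ?h"
    using primitive_diff[OF primitive_shift[OF assms(3), of "-1"] primitive_shift[OF assms(2), of "-2"]] by simp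
  have "l2norm lborel ?h \<le> l2norm lborel (\<lambda>y. r (y - 1)) + l2norm lborel (\<lambda>y. g (y - 2))"
    using l2norm_triangle_diff[OF sqint_shift[OF primitive_sqint[OF assms(3)], of "-1"] sqint_shift[OF primitive_sqint[OF assms(2)], of "-2"]]
    by simp
  also have "\<dots> = l2norm lborel r + l2norm lborel g"
    using l2norm_shift[of r "-1"] l2norm_shift[of g "-2"] by simp
  finally have n: "l2norm lborel ?h \<le> l2norm lborel r + l2norm lborel g" .
  show thesis
  proof (rule that[of "\<lambda>y. if y \<le> 1 then f0 y else ?h y"])
    have "primitive (\<lambda>y. if y \<le> 1 then F0 y else R (y - 1) - G (y - 2)) (\<lambda>y. if y \<le> 1 then f0 y else ?h y)"
      by (rule primitive_glue[OF assms(1) H]) (use assms(4) in simp)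
    then show "primitive (reflect_dirichlet R F0 G) (\<lambda>y. if y \<le> 1 then f0 y else ?h y)"
      by (simp add: reflect_dirichlet_def[abs_def])
    show "l2norm lborel (\<lambda>y. if y \<le> 1 then f0 y else ?h y) \<le> l2norm lborel f0 + l2norm lborel r + l2norm lborel g"
      using l2norm_glue[OF primitive_sqint[OF assms(1)] primitive_sqint[OF H], of 1] n by linarith
  qed simp
qed

text \<open>Both reflections are causal, so the alternating iteration becomes stationary on every bounded interval.\<close>

lemma travelling_waves_exist:
  fixes n :: nat
  assumes "0 \<le> q"
  obtains C where "C \<ge> 0"
    "\<And>W w V R r D. primitive W w \<Longrightarrow> sqint lborel V \<Longrightarrow> primitive R r \<Longrightarrow> R 0 = W 1 \<Longrightarrow> \<bar>W 0\<bar> \<le> D \<Longrightarrow>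
       l2norm lborel w \<le> D \<Longrightarrow> l2norm lborel V \<le> D \<Longrightarrow> l2norm lborel r \<le> D \<Longrightarrow>
       \<exists>F f G g. primitive F f \<and> primitive G g \<and>
         (\<forall>x\<in>{0..1}. F x + G (- x) = W x \<and> f x + g (- x) = V x) \<and>
         (\<forall>s\<in>{0..real n}. ((\<lambda>s. F s - G s) has_real_derivative - q * (F s + G s)) (at s within {0..real n})) \<and>
         (\<forall>s\<in>{0..real n}. F (s + 1) + G (s - 1) = R s) \<and>
         \<bar>F 0\<bar> + \<bar>G 0\<bar> + l2norm lborel f + l2norm lborel g \<le> C * D \<and>
         (q = 0 \<longrightarrow> (\<forall>s\<ge>0. G s = F s))"
proof -
  obtain K where K: "K \<ge> 0"
    "\<And>F f G0 g0. primitive F f \<Longrightarrow> primitive G0 g0 \<Longrightarrow> G0 0 = F 0 \<Longrightarrow>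
       \<exists>g. primitive (reflect_robin q n G0 F) g \<and> (\<forall>y\<le>0. g y = g0 y) \<and>
           l2norm lborel g \<le> l2norm lborel g0 + K * (\<bar>F 0\<bar> + l2norm lborel f)"
    using robin_reflection[OF assms, of "real n"] by auto
  \<comment> \<open>Growth of the norm bound under one round of reflections: 3 adds the
    contributions of \<open>f0\<close>, \<open>r\<close> and \<open>g0\<close>, and
    \<open>K * (1 + c k)\<close> that of the reflected wave.\<close>
  define c where "c k = ((\<lambda>c. 3 + K * (1 + c)) ^^ k) 1" for k
  have c_Suc: "c (Suc k) = 3 + K * (1 + c k)" and c0: "c 0 = 1" for k by (simp_all add: c_def)
  have c_pos: "c k \<ge> 1" for k by (induction k) (use K(1) in \<open>auto simp: c0 c_Suc\<close>)
  define C where "C = 1 + c (Suc n) + (1 + K * (1 + c (Suc n)))"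
  show thesis
  proof (rule that[of C])
    show "C \<ge> 0" using K(1) c_pos[of "Suc n"] by (simp add: C_def)
    fix W w V R r :: "real \<Rightarrow> real" and D :: real
    assume W: "primitive W w" and V: "sqint lborel V" and R: "primitive R r" and R0: "R 0 = W 1"
      and D: "\<bar>W 0\<bar> \<le> D" "l2norm lborel w \<le> D" "l2norm lborel V \<le> D" "l2norm lborel r \<le> D"
    have w: "sqint lborel w" by (rule primitive_sqint[OF W])
    have "D \<ge> 0" using D(1) by linarith
    obtain P where P: "primitive P V" "P 0 = 0" using primitive_exists[OF V] by blast
    \<comment> \<open>The d'Alembert splitting of the initial data, with \<open>P\<close> an
      antiderivative of the velocity: \<open>F0 x + G0 (- x) = W x\<close> and
      \<open>f0 x + g0 (- x) = V x\<close>.\<close>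
    define F0 where "F0 x = (1/2) * (P x + W x)" for x
    define f0 where "f0 x = (1/2) * (V x + w x)" for x
    define G0 where "G0 x = (1/2) * (W (- x) - P (- x))" for x
    define g0 where "g0 x = (1/2) * ((- w (- x)) - (- V (- x)))" for x
    have F0: "primitive F0 f0" unfolding F0_def f0_def by (intro primitive_cmult primitive_add P W)
    have G0: "primitive G0 g0" unfolding G0_def g0_def
      by (intro primitive_cmult primitive_diff primitive_reflect P W)
    have refl: "sqint lborel (\<lambda>x. u (- x))" "l2norm lborel (\<lambda>x. u (- x)) = l2norm lborel u" if "sqint lborel u" for u :: "real \<Rightarrow> real"
      using sqint_affine[OF that, of "-1" 0] l2norm_affine[of "-1" u 0] by simp_all
    have "l2norm lborel f0 \<le> (1/2) * (l2norm lborel V + l2norm lborel w)"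
      unfolding f0_def using l2norm_triangle[OF V w] by (simp only: l2norm_cmult) simp
    then have f0n: "l2norm lborel f0 \<le> D" using D by simp
    have "l2norm lborel g0 \<le> (1/2) * (l2norm lborel w + l2norm lborel V)"
      unfolding g0_def using l2norm_triangle_diff[OF sqint_minus[OF refl(1)[OF w]] sqint_minus[OF refl(1)[OF V]]]
      by (simp only: l2norm_cmult) (simp add: l2norm_minus refl w V del: minus_diff_minus)
    then have g0n: "l2norm lborel g0 \<le> D" using D by simp
    have G00: "G0 0 = F0 0" by (simp add: G0_def F0_def P)
    let ?G = "reflect_robin q n G0"
    define Fk where "Fk k = ((\<lambda>F. reflect_dirichlet R F0 (?G F)) ^^ k) F0" for k
    have Fk_0: "Fk 0 = F0" and Fk_Suc: "Fk (Suc k) = reflect_dirichlet R F0 (?G (Fk k))" for k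
      by (simp_all add: Fk_def)
    have init: "Fk k y = F0 y" if "y \<le> 1" for k y
      using that by (cases k) (simp_all add: Fk_0 Fk_Suc reflect_dirichlet_def)
    have Gm1: "?G F (-1) = G0 (-1)" for F by (simp add: reflect_robin_def)
    \<comment> \<open>Compatibility of initial and boundary data, which permits glueing at
      \<open>y = 1\<close> without a jump.\<close>
    have F01: "F0 1 = R 0 - G0 (-1)" by (simp add: F0_def G0_def R0 field_simps)
    have robin: "\<exists>g. primitive (?G (Fk k)) g \<and> (\<forall>y\<le>0. g y = g0 y) \<and> l2norm lborel g \<le> (1 + K * (1 + c k)) * D"
      if "primitive (Fk k) f" "l2norm lborel f \<le> c k * D" for k f
    proof -
      have "\<bar>Fk k 0\<bar> \<le> D" using D(1) \<open>D \<ge> 0\<close> by (simp add: init F0_def P)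
      then have "K * (\<bar>Fk k 0\<bar> + l2norm lborel f) \<le> K * (D + c k * D)"
        using that(2) K(1) by (intro mult_left_mono add_mono) auto
      then show ?thesis
        using K(2)[OF that(1) G0] G00 g0n by (fastforce simp: init algebra_simps)
    qed
    have prim: "\<exists>f. primitive (Fk k) f \<and> (\<forall>y\<le>1. f y = f0 y) \<and> l2norm lborel f \<le> c k * D" for k
    proof (induction k)
      case 0
      then show ?case using F0 f0n by (auto simp: Fk_0 c0)
    next
      case (Suc k)
      then obtain f where "primitive (Fk k) f" "l2norm lborel f \<le> c k * D" by blast
      from robin[OF this] obtain g where g: "primitive (?G (Fk k)) g" "l2norm lborel g \<le> (1 + K * (1 + c k)) * D"
        by blast
      obtain f' where f': "primitive (Fk (Suc k)) f'" "\<And>y. y \<le> 1 \<Longrightarrow> f' y = f0 y"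
        "l2norm lborel f' \<le> l2norm lborel f0 + l2norm lborel r + l2norm lborel g"
        using dirichlet_reflection[OF F0 g(1) R] F01 by (auto simp: Fk_Suc Gm1)
      have "l2norm lborel f' \<le> c (Suc k) * D" using f'(3) f0n D(4) g(2) by (simp add: c_Suc algebra_simps)
      with f' show ?case by blast
    qed
    \<comment> \<open>The Dirichlet reflection reads the other wave at \<open>y - 2\<close>, so
      every round enlarges the range on which successive iterates agree; a gain of one unit per
      round is enough here.\<close>
    have stat: "Fk (Suc k) y = Fk k y" if "y \<le> real k + 1" for k y
      using that
    proof (induction k arbitrary: y)
      case 0
      then show ?case by (simp add: init)
    next
      case (Suc k)
      show ?case
      proof (cases "y \<le> 1")
        case True
        then show ?thesis by (simp add: init)
      next
        case False
        have "?G (Fk (Suc k)) (y - 2) = ?G (Fk k) (y - 2)"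
          by (rule reflect_robin_cong) (use Suc in auto)
        then show ?thesis using False by (simp add: Fk_Suc[of "Suc k"] Fk_Suc[of k] reflect_dirichlet_def)
      qed
    qed
    define F where "F = Fk (Suc n)"
    define G where "G = ?G F"
    obtain f where f: "primitive F f" "\<forall>y\<le>1. f y = f0 y" "l2norm lborel f \<le> c (Suc n) * D"
      using prim F_def by blast
    obtain g where g: "primitive G g" "\<forall>y\<le>0. g y = g0 y" "l2norm lborel g \<le> (1 + K * (1 + c (Suc n))) * D"
      using robin[of "Suc n" f] f by (auto simp: F_def G_def)
    have GF: "G y = G0 y" if "y \<le> 0" for y using that by (simp add: G_def reflect_robin_def)
    have FF: "F y = F0 y" if "y \<le> 1" for y using that init by (simp add: F_def)
    have "\<forall>x\<in>{0..1}. F x + G (- x) = W x \<and> f x + g (- x) = V x"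
    proof
      fix x :: real assume x: "x \<in> {0..1}"
      have "F x = F0 x" "G (- x) = G0 (- x)" "f x = f0 x" "g (- x) = g0 (- x)"
        using x f(2) g(2) GF[of "- x"] FF[of x] by auto
      then show "F x + G (- x) = W x \<and> f x + g (- x) = V x"
        by (simp add: F0_def G0_def f0_def g0_def)
    qed
    moreover have "\<forall>s\<in>{0..real n}. ((\<lambda>s. F s - G s) has_real_derivative - q * (F s + G s)) (at s within {0..real n})"
      unfolding G_def using reflect_robin_condition[OF f(1)] G00 FF[of 0] by auto
    moreover have "\<forall>s\<in>{0..real n}. F (s + 1) + G (s - 1) = R s"
    proof
      fix s assume s: "s \<in> {0..real n}"
      show "F (s + 1) + G (s - 1) = R s"
      proof (cases "s = 0")
        case True
        then show ?thesis using FF[of 1] GF[of "-1"] F01 by simp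
      next
        case False
        \<comment> \<open>\<open>F (s + 1)\<close> was produced from the previous iterate while the
          boundary condition asks for the current one; up to \<open>s - 1\<close> the two
          agree.\<close>
        have "?G (Fk (Suc n)) (s - 1) = ?G (Fk n) (s - 1)"
          by (rule reflect_robin_cong, rule stat) (use s in auto)
        then show ?thesis using False s by (simp add: F_def G_def Fk_Suc[of n] reflect_dirichlet_def)
      qed
    qed
    moreover have "\<bar>F 0\<bar> + \<bar>G 0\<bar> + l2norm lborel f + l2norm lborel g \<le> C * D"
    proof -
      have "\<bar>F 0\<bar> + \<bar>G 0\<bar> \<le> D" using D(1) by (simp add: FF GF F0_def G0_def P)
      then show ?thesis using f(3) g(3) unfolding C_def distrib_right[of _ _ D] by linarith
    qed
    \<comment> \<open>In the Neumann case the memory term drops out and the reflection is even. The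
      observer error is treated through this clause.\<close>
    moreover have "q = 0 \<longrightarrow> (\<forall>s\<ge>0. G s = F s)"
      using G00 FF[of 0] by (auto simp: G_def reflect_robin_def)
    ultimately show "\<exists>F f G g. primitive F f \<and> primitive G g \<and>
         (\<forall>x\<in>{0..1}. F x + G (- x) = W x \<and> f x + g (- x) = V x) \<and>
         (\<forall>s\<in>{0..real n}. ((\<lambda>s. F s - G s) has_real_derivative - q * (F s + G s)) (at s within {0..real n})) \<and>
         (\<forall>s\<in>{0..real n}. F (s + 1) + G (s - 1) = R s) \<and>
         \<bar>F 0\<bar> + \<bar>G 0\<bar> + l2norm lborel f + l2norm lborel g \<le> C * D \<and>
         (q = 0 \<longrightarrow> (\<forall>s\<ge>0. G s = F s))"
      using f(1) g(1) by blast
  qed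
qed

text \<open>\<open>C\<close> is bound before the data, so that one constant serves all starting
  times of the predictor. The profiles \<open>F\<close> and \<open>G\<close> are exported because
  the decay argument computes with them.\<close>

definition wave_solvable :: "real \<Rightarrow> nat \<Rightarrow> real \<Rightarrow> bool" where
  "wave_solvable q n C \<longleftrightarrow> 0 \<le> C \<and> (\<forall>w0 v0 R r D. w0 \<in> H1 \<longrightarrow> sqint I01 v0 \<longrightarrow> primitive R r \<longrightarrow> R 0 = w0 1 \<longrightarrow>
       \<bar>w0 0\<bar> \<le> D \<longrightarrow> l2norm I01 (wderiv w0) \<le> D \<longrightarrow> l2norm I01 v0 \<le> D \<longrightarrow> l2norm lborel r \<le> D \<longrightarrow>
      (\<exists>F G w v. wave_solution {0..real n} (\<lambda>s. - q * w 0 s) R w v \<and> w = (\<lambda>x s. F (s + x) + G (s - x)) \<and>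
         (\<forall>x\<in>{0..1}. w x 0 = w0 x) \<and> (AE x in I01. v x 0 = v0 x) \<and>
         (\<forall>s\<in>{0..real n}. space_H1_norm (\<lambda>x. w x s, \<lambda>x. v x s) \<le> C * D) \<and>
         (q = 0 \<longrightarrow> (\<forall>s\<ge>0. G s = F s))))"

lemma wave_solvableD:
  assumes "wave_solvable q n C" "w0 \<in> H1" "sqint I01 v0" "primitive R r" "R 0 = w0 1" "\<bar>w0 0\<bar> \<le> D" "l2norm I01 (wderiv w0) \<le> D" "l2norm I01 v0 \<le> D" "l2norm lborel r \<le> D"
  obtains F G w v where "wave_solution {0..real n} (\<lambda>s. - q * w 0 s) R w v" "w = (\<lambda>x s. F (s + x) + G (s - x))"
    "\<And>x. x \<in> {0..1} \<Longrightarrow> w x 0 = w0 x" "AE x in I01. v x 0 = v0 x"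
    "\<And>s. s \<in> {0..real n} \<Longrightarrow> space_H1_norm (\<lambda>x. w x s, \<lambda>x. v x s) \<le> C * D"
    "q = 0 \<Longrightarrow> (\<forall>s\<ge>0. G s = F s)"
proof -
  have "\<exists>F G w v. wave_solution {0..real n} (\<lambda>s. - q * w 0 s) R w v \<and> w = (\<lambda>x s. F (s + x) + G (s - x)) \<and>
         (\<forall>x\<in>{0..1}. w x 0 = w0 x) \<and> (AE x in I01. v x 0 = v0 x) \<and>
         (\<forall>s\<in>{0..real n}. space_H1_norm (\<lambda>x. w x s, \<lambda>x. v x s) \<le> C * D) \<and>
         (q = 0 \<longrightarrow> (\<forall>s\<ge>0. G s = F s))"
    using assms unfolding wave_solvable_def by blast
  then obtain F G w v where *: "wave_solution {0..real n} (\<lambda>s. - q * w 0 s) R w v" "w = (\<lambda>x s. F (s + x) + G (s - x))"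
    "\<forall>x\<in>{0..1}. w x 0 = w0 x" "AE x in I01. v x 0 = v0 x"
    "\<forall>s\<in>{0..real n}. space_H1_norm (\<lambda>x. w x s, \<lambda>x. v x s) \<le> C * D"
    "q = 0 \<longrightarrow> (\<forall>s\<ge>0. G s = F s)"
    by (elim exE conjE)
  show thesis by (rule that[OF *(1,2) _ *(4)]) (use *(3,5,6) in blast)+
qed

lemma wave_exists:
  assumes "0 \<le> q"
  shows "\<exists>C. wave_solvable q n C"
proof -
  obtain K where K: "K \<ge> 0" "\<And>W w V R r D. primitive W w \<Longrightarrow> sqint lborel V \<Longrightarrow> primitive R r \<Longrightarrow> R 0 = W 1 \<Longrightarrow> \<bar>W 0\<bar> \<le> D \<Longrightarrow>
       l2norm lborel w \<le> D \<Longrightarrow> l2norm lborel V \<le> D \<Longrightarrow> l2norm lborel r \<le> D \<Longrightarrow>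
       \<exists>F f G g. primitive F f \<and> primitive G g \<and>
         (\<forall>x\<in>{0..1}. F x + G (- x) = W x \<and> f x + g (- x) = V x) \<and>
         (\<forall>s\<in>{0..real n}. ((\<lambda>s. F s - G s) has_real_derivative - q * (F s + G s)) (at s within {0..real n})) \<and>
         (\<forall>s\<in>{0..real n}. F (s + 1) + G (s - 1) = R s) \<and>
         \<bar>F 0\<bar> + \<bar>G 0\<bar> + l2norm lborel f + l2norm lborel g \<le> K * D \<and>
         (q = 0 \<longrightarrow> (\<forall>s\<ge>0. G s = F s))"
    using travelling_waves_exist[OF assms, of n] by blast
  show ?thesis
    unfolding wave_solvable_def
  proof (intro exI[of _ "(3 + sqrt (real n + 1)) * K"] conjI allI impI)
    show "0 \<le> (3 + sqrt (real n + 1)) * K" using K(1) by simp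
    fix w0 v0 R r :: "real \<Rightarrow> real" and D :: real
    assume w0: "w0 \<in> H1" and v0: "sqint I01 v0" and R: "primitive R r" "R 0 = w0 1"
      and D: "\<bar>w0 0\<bar> \<le> D" "l2norm I01 (wderiv w0) \<le> D" "l2norm I01 v0 \<le> D" "l2norm lborel r \<le> D"
    obtain W Wd where W: "primitive W Wd" "\<And>x. x \<in> {0..1} \<Longrightarrow> W x = w0 x" "l2norm lborel Wd = l2norm I01 (wderiv w0)"
      using H1_primitive[OF w0] by metis
    obtain V where V: "sqint lborel V" "AE x in I01. V x = v0 x" "l2norm lborel V = l2norm I01 v0"
      using sqint_I01_borel_representative[OF v0] by metis
    obtain F f G g where FG: "primitive F f" "primitive G g"
         "\<forall>x\<in>{0..1}. F x + G (- x) = W x \<and> f x + g (- x) = V x"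
         "\<forall>s\<in>{0..real n}. ((\<lambda>s. F s - G s) has_real_derivative - q * (F s + G s)) (at s within {0..real n})"
         "\<forall>s\<in>{0..real n}. F (s + 1) + G (s - 1) = R s"
         "\<bar>F 0\<bar> + \<bar>G 0\<bar> + l2norm lborel f + l2norm lborel g \<le> K * D"
         "q = 0 \<longrightarrow> (\<forall>s\<ge>0. G s = F s)"
      using K(2)[OF W(1) V(1) R(1), of D] R(2) W(2)[of 0] W(2)[of 1] W(3) V(3) D by auto
    interpret travelling_waves F f G g by unfold_locales (fact FG)+
    have "wave_solution {0..real n} (\<lambda>s. - q * w 0 s) R w v"
      by (rule is_wave_solution) (use FG(4,5) in \<open>auto simp: w_def\<close>)
    moreover have "\<forall>x\<in>{0..1}. w x 0 = w0 x" using FG(3) W(2) by (simp add: w_def)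
    moreover have "AE x in I01. v x 0 = v0 x"
    proof -
      have "AE x in I01. x \<in> {0..1}" by (metis AE_space space_I01)
      with V(2) show ?thesis by eventually_elim (use FG(3) in \<open>simp add: v_def\<close>)
    qed
    moreover have "\<forall>s\<in>{0..real n}. space_H1_norm (\<lambda>x. w x s, \<lambda>x. v x s) \<le> (3 + sqrt (real n + 1)) * K * D"
      using norm_bound[OF FG(6), of _ "real n"] by (simp add: mult.assoc)
    moreover have "w = (\<lambda>x s. F (s + x) + G (s - x))" by (intro ext) (simp add: w_def)
    ultimately show "\<exists>F G w v. wave_solution {0..real n} (\<lambda>s. - q * w 0 s) R w v \<and> w = (\<lambda>x s. F (s + x) + G (s - x)) \<and>
         (\<forall>x\<in>{0..1}. w x 0 = w0 x) \<and> (AE x in I01. v x 0 = v0 x) \<and>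
         (\<forall>s\<in>{0..real n}. space_H1_norm (\<lambda>x. w x s, \<lambda>x. v x s) \<le> (3 + sqrt (real n + 1)) * K * D) \<and>
         (q = 0 \<longrightarrow> (\<forall>s\<ge>0. G s = F s))"
      using FG(7) by (intro exI[of _ F] exI[of _ G] exI[of _ w] exI[of _ v]) simp
  qed
qed

lemma inner01_zero_AE: "AE x in I01. f x = 0 \<Longrightarrow> inner01 f g = 0"
  unfolding inner01_def by (rule integral_eq_zero_AE) (auto elim: AE_mp)

text \<open>The conserved symplectic form is paired with the solution that runs backwards from
  the state \<open>(0, w(s))\<close>, which turns its value at time \<open>s\<close> into the squared norm of \<open>w(s)\<close>.\<close>

lemma homogeneous_wave_zero:
  assumes "0 \<le> q" "a < b" and sol: "wave_solution {a..b} (\<lambda>s. - q * w 0 s) (\<lambda>s. 0) w v"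
    and init: "\<And>x. x \<in> {0..1} \<Longrightarrow> w x a = 0" "AE x in I01. v x a = 0" and s: "s \<in> {a..b}"
  shows "\<forall>x\<in>{0..1}. w x s = 0" "AE x in I01. v x s = 0"
proof -
  have w0: "w x s0 = 0" if "s0 \<in> {a..b}" "x \<in> {0..1}" for s0 x
  proof -
    note reg = wave_solution_regularity[OF sol]
    have s0: "s0 \<in> {a..b}" by (rule that(1))
    obtain n :: nat where n: "s0 - a \<le> real n" using real_arch_simple by blast
    have z: "(\<lambda>x. 0) \<in> H1" "l2norm I01 (wderiv (\<lambda>x. 0)) = 0"
    proof -
      have p: "is_weak_deriv (\<lambda>x. 0) (\<lambda>x. 0)" "(\<lambda>x. 0) \<in> H1" using primitive_is_weak_deriv[OF primitive_const[of 0]] by auto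
      show "(\<lambda>x. 0) \<in> H1" by (rule p)
      have "l2norm I01 (wderiv (\<lambda>x. 0)) = l2norm I01 (\<lambda>x. 0)"
        by (rule l2norm_cong_AE) (use wderiv_AE[OF p(2,1)] wderiv_sqint[OF p(2)] in \<open>auto simp: sqint_def\<close>)
      then show "l2norm I01 (wderiv (\<lambda>x. 0)) = 0" by simp
    qed
    obtain C where C: "wave_solvable q n C" using wave_exists[OF assms(1)] by blast
    obtain \<phi> \<phi>s where \<phi>: "wave_solution {0..real n} (\<lambda>s. - q * \<phi> 0 s) (\<lambda>s. 0) \<phi> \<phi>s"
      "\<And>x. x \<in> {0..1} \<Longrightarrow> \<phi> x 0 = 0" "AE x in I01. \<phi>s x 0 = w x s0"
    proof (rule wave_solvableD[OF C z(1) reg(2)[OF s0] primitive_const[of 0], of "l2norm I01 (\<lambda>x. w x s0)"])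
      fix F G \<phi> \<phi>s
      assume "wave_solution {0..real n} (\<lambda>s. - q * \<phi> 0 s) (\<lambda>s. 0) \<phi> \<phi>s"
        "\<And>x. x \<in> {0..1} \<Longrightarrow> \<phi> x 0 = 0" "AE x in I01. \<phi>s x 0 = w x s0"
      then show thesis by (rule that)
    qed (use z(2) in simp_all)
    \<comment> \<open>Time is reversed and shifted, so that the backward solution meets
      \<open>w\<close> at \<open>s0\<close> with displacement 0 and velocity
      \<open>- w x s0\<close>.\<close>
    let ?p = "\<lambda>x s. \<phi> x (-1 * s + s0)" and ?ps = "\<lambda>x s. -1 * \<phi>s x (-1 * s + s0)"
    have bwd: "wave_solution {a..s0} (\<lambda>s. - q * ?p 0 s) (\<lambda>s. 0) ?p ?ps"
      by (rule wave_solution_affine[OF \<phi>(1)]) (use n in auto)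
    have fwd: "wave_solution {a..s0} (\<lambda>s. - q * w 0 s) (\<lambda>s. 0) w v"
      by (rule wave_solution_subset[OF sol]) (use that in auto)
    let ?B = "\<lambda>\<sigma>. inner01 (\<lambda>x. v x \<sigma>) (\<lambda>x. ?p x \<sigma>) - inner01 (\<lambda>x. ?ps x \<sigma>) (\<lambda>x. w x \<sigma>)"
    have "\<exists>c. \<forall>\<sigma>\<in>{a..s0}. ?B \<sigma> = c"
      by (rule has_field_derivative_zero_constant) (use symplectic_form_conserved[OF fwd bwd] in auto)
    then obtain c where c: "\<forall>\<sigma>\<in>{a..s0}. ?B \<sigma> = c" by (elim exE)
    have "?B s0 = c" "?B a = c" by (rule c[rule_format], use s0 in simp)+
    then have "?B s0 = ?B a" by (simp only:)
    moreover have "?B a = 0"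
    proof -
      \<comment> \<open>The zero function is written as \<open>0 * 0\<close>, so that homogeneity of
        the pairing with factor 0 evaluates it.\<close>
      have "inner01 (\<lambda>x. ?ps x a) (\<lambda>x. w x a) = inner01 (\<lambda>x. ?ps x a) (\<lambda>x. 0 * 0)"
        by (rule inner01_cong) (use init in auto)
      then show ?thesis using inner01_zero_AE[OF init(2)] by (simp only: inner01_cmult_right)
    qed
    moreover have "?B s0 = (l2norm I01 (\<lambda>x. w x s0))\<^sup>2"
    proof -
      have "inner01 (\<lambda>x. v x s0) (\<lambda>x. ?p x s0) = inner01 (\<lambda>x. v x s0) (\<lambda>x. 0 * 0)"
        by (rule inner01_cong) (use \<phi>(2) in auto)
      then have 1: "inner01 (\<lambda>x. v x s0) (\<lambda>x. ?p x s0) = 0" by (simp only: inner01_cmult_right)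
      have m: "(\<lambda>x. \<phi>s x 0) \<in> borel_measurable I01" "(\<lambda>x. w x s0) \<in> borel_measurable I01"
        using wave_solution_regularity(3)[OF \<phi>(1), of 0] reg(2)[OF that(1)] by (auto simp: sqint_def)
      have "inner01 (\<lambda>x. ?ps x s0) (\<lambda>x. w x s0) = - inner01 (\<lambda>x. \<phi>s x 0) (\<lambda>x. w x s0)"
        by (simp only: inner01_cmult_left) simp
      also have "\<dots> = - (l2norm I01 (\<lambda>x. w x s0))\<^sup>2"
        using inner01_cong_AE[OF m(1,2,2) \<phi>(3)] by (simp add: inner01_self)
      finally show ?thesis using 1 by simp
    qed
    ultimately have "l2norm I01 (\<lambda>x. w x s0) = 0" by simp
    then show ?thesis
      using continuous_l2norm_zero[OF H1_continuous[OF reg(1)[OF that(1)]]] that(2) by blast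
  qed
  then show "\<forall>x\<in>{0..1}. w x s = 0" using s by blast
  \<comment> \<open>As \<open>a < b\<close>, the time \<open>s\<close> is an accumulation point, and
    the vanishing displacement also determines the velocity.\<close>
  have "at s within {a..b} \<noteq> bot"
    using s \<open>a < b\<close> trivial_limit_within[of s "{a..b}"] islimpt_Icc[of a b s] by simp
  then show "AE x in I01. v x s = 0"
    using time_deriv_zero[of "{a..b}" w v s] w0 s sol wave_solution_regularity(3)[OF sol s]
    by (auto simp: wave_solution_def)
qed

lemma wave_solution_unique:
  assumes "0 \<le> q" "a < b"
    and 1: "wave_solution {a..b} (\<lambda>s. - q * w1 0 s) r w1 v1" and 2: "wave_solution {a..b} (\<lambda>s. - q * w2 0 s) r w2 v2"
    and init: "\<And>x. x \<in> {0..1} \<Longrightarrow> w1 x a = w2 x a" "AE x in I01. v1 x a = v2 x a" and s: "s \<in> {a..b}"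
  shows "\<forall>x\<in>{0..1}. w1 x s = w2 x s" "AE x in I01. v1 x s = v2 x s"
proof -
  have d: "wave_solution {a..b} (\<lambda>s. - q * (w1 0 s - w2 0 s)) (\<lambda>s. 0) (\<lambda>x s. w1 x s - w2 x s) (\<lambda>x s. v1 x s - v2 x s)"
    by (rule wave_solution_cong[OF wave_solution_diff[OF 1 2]]) (auto simp: algebra_simps)
  have ae: "AE x in I01. v1 x a - v2 x a = 0" using init(2) by simp
  show "\<forall>x\<in>{0..1}. w1 x s = w2 x s" "AE x in I01. v1 x s = v2 x s"
    using homogeneous_wave_zero[OF assms(1,2) d _ ae s] init(1) by auto
qed

section \<open>The transport equation\<close>

lemma plateau'_outside:
  assumes "e > 0" "a \<le> b" "x \<notin> {a - e..b + e}"
  shows "plateau' e a b x = 0"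
proof -
  have "hat ((x - y) / e) = 0" if "y \<in> {a, b}" for y
    by (rule hat_outside) (use assms that in \<open>auto simp: field_simps\<close>)
  then show ?thesis by (simp add: plateau'_def)
qed

lemma plateau_outside:
  assumes "e > 0" "a \<le> b" "x \<notin> {a - e..b + e}"
  shows "plateau e a b x = 0"
proof (cases "x < a - e")
  case True
  then have "(x - a) / e \<le> -1" "(x - b) / e \<le> -1" using assms by (auto simp: field_simps)
  then show ?thesis by (simp add: plateau_def ramp_simps)
next
  case False
  then have "(x - a) / e \<ge> 1" "(x - b) / e \<ge> 1" using assms by (auto simp: field_simps)
  then show ?thesis by (simp add: plateau_def ramp_simps)
qed

lemma plateau_primitive:
  assumes "e > 0" "a \<le> b" "0 < a - e" "b + e < 1"
  shows "primitive (plateau e a b) (plateau' e a b)"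
proof -
  have "(\<lambda>x. plateau e a b (max 0 (min 1 x))) = plateau e a b"
  proof
    fix x
    show "plateau e a b (max 0 (min 1 x)) = plateau e a b x"
      using assms by (cases "x \<in> {0..1}") (auto simp: plateau_outside)
  qed
  moreover have "(\<lambda>x. indicator {0..1} x * plateau' e a b x) = plateau' e a b"
  proof
    fix x
    show "indicator {0..1} x * plateau' e a b x = plateau' e a b x"
      using assms by (cases "x \<in> {0..1}") (auto simp: plateau'_outside)
  qed
  ultimately show ?thesis
    using test_fun_primitive(1)[OF test_fun_plateau[OF assms]] by (simp only:)
qed

lemma plateau_shift: "plateau e a b (x - h) = plateau e (a + h) (b + h) x"
  "plateau' e a b (x - h) = plateau' e (a + h) (b + h) x"
  by (simp_all add: plateau_def plateau'_def algebra_simps)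

lemma transport_regularity:
  assumes "transport_solution I b Y" "s \<in> I"
  shows "(\<lambda>x. Y x s) \<in> H1" "sqint I01 (\<lambda>x. Y x s)" "sqint I01 (wderiv (\<lambda>x. Y x s))"
  using assms H1_sqint wderiv_sqint by (auto simp: transport_solution_def cont_H1_def)

text \<open>The test function travels with the flow. Differentiating in the elapsed time, the
  contribution of \<open>Y\<^sub>s = - Y\<^sub>x\<close> and that of the moving plateau cancel by
  the definition of the weak derivative. The support condition keeps the plateau inside the open
  interval throughout.\<close>

lemma transport_pairing:
  assumes Y: "transport_solution {0..} b Y" and "0 \<le> s" "0 \<le> H"
    and e: "e > 0" "c \<le> d" "0 < c - e" "d + e + H < 1"
  shows "inner01 (\<lambda>x. Y x (s + H)) (\<lambda>x. plateau e c d (x - H)) = inner01 (\<lambda>x. Y x s) (plateau e c d)"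
proof -
  note reg = transport_regularity[OF Y]
  let ?I = "{0..H}"
  let ?p = "\<lambda>x h. plateau e c d (x - h)"
  let ?p' = "\<lambda>x h. plateau' e c d (x - h)"
  have P: "primitive (plateau e c d) (plateau' e c d)"
    by (rule plateau_primitive) (use e assms(3) in auto)
  have R: "primitive (\<lambda>x. plateau e c d (- x)) (\<lambda>x. - plateau' e c d (- x))"
    by (rule primitive_reflect[OF P])
  have sp: "sqint I01 (\<lambda>x. ?p x h)" for h
    by (rule continuous_sqint_I01) (use primitive_continuous[OF primitive_shift[OF P, of "- h"]] in simp)
  have sp': "sqint I01 (\<lambda>x. ?p' x h)" for h
    using sqint_I01(1)[OF sqint_shift[OF primitive_sqint[OF P], of "- h"]] by simp
  have "((\<lambda>\<sigma>. inner01 (\<lambda>x. Y x (s + \<sigma>)) (\<lambda>x. ?p x \<sigma>)) has_real_derivative 0) (at h within ?I)" if h: "h \<in> ?I" for h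
  proof -
    have sh: "s + h \<in> {0..}" using h assms(2) by simp
    have fl: "filterlim (\<lambda>r. 1 * r + s) (at (1 * h + s) within {0..}) (at h within ?I)"
      by (rule at_within_affine) (use assms(2) in auto)
    have "((\<lambda>r. l2norm I01 (\<lambda>x. (Y x r - Y x (1 * h + s)) / (r - (1 * h + s)) - - wderiv (\<lambda>y. Y y (1 * h + s)) x)) \<longlongrightarrow> 0)
        (at (1 * h + s) within {0..})"
      using Y sh by (auto simp: transport_solution_def time_deriv_def L2_norm_eq add.commute)
    from filterlim_compose[OF this fl]
    have "((\<lambda>r. l2norm I01 (\<lambda>x. (Y x (s + r) - Y x (s + h)) / (r - h) - - wderiv (\<lambda>y. Y y (s + h)) x)) \<longlongrightarrow> 0) (at h within ?I)"
      by (simp add: add.commute)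
    then have "((\<lambda>\<sigma>. inner01 (\<lambda>x. Y x (s + \<sigma>)) (\<lambda>x. ?p x h)) has_real_derivative inner01 (\<lambda>x. - wderiv (\<lambda>y. Y y (s + h)) x) (\<lambda>x. ?p x h)) (at h within ?I)"
      by (intro inner01_has_derivative[where w="\<lambda>x r. Y x (s + r)"] sp sqint_minus reg) (use assms(2) h in auto)
    moreover have "((\<lambda>r. l2norm I01 (\<lambda>x. Y x (s + r) - Y x (s + h))) \<longlongrightarrow> 0) (at h within ?I)"
    proof -
      have "((\<lambda>r. H1_norm (\<lambda>x. Y x r - Y x (1 * h + s))) \<longlongrightarrow> 0) (at (1 * h + s) within {0..})"
        using Y sh by (auto simp: transport_solution_def cont_H1_def add.commute)
      from filterlim_compose[OF this fl]
      have lim: "((\<lambda>r. H1_norm (\<lambda>x. Y x (s + r) - Y x (s + h))) \<longlongrightarrow> 0) (at h within ?I)"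
        by (simp add: add.commute)
      show ?thesis
        by (rule tendsto_sandwich[OF _ _ tendsto_const lim]) (auto simp: H1_norm_def L2_norm_eq)
    qed
    moreover have "((\<lambda>r. l2norm I01 (\<lambda>x. (?p x r - ?p x h) / (r - h) - - ?p' x h)) \<longlongrightarrow> 0) (at h within ?I)"
      using l2_travelling_derivative[OF R, of "-1" h ?I] by simp
    ultimately have "((\<lambda>\<sigma>. inner01 (\<lambda>x. Y x (s + \<sigma>)) (\<lambda>x. ?p x \<sigma>)) has_real_derivative
        inner01 (\<lambda>x. - wderiv (\<lambda>y. Y y (s + h)) x) (\<lambda>x. ?p x h) + inner01 (\<lambda>x. Y x (s + h)) (\<lambda>x. - ?p' x h)) (at h within ?I)"
      by (intro inner01_product_derivative[where v="\<lambda>x r. Y x (s + r)" and \<phi>="?p"] sp sqint_minus sp' reg)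
        (use assms(2) h in auto)
    moreover have "inner01 (\<lambda>x. Y x (s + h)) (\<lambda>x. ?p' x h) = - inner01 (wderiv (\<lambda>y. Y y (s + h))) (\<lambda>x. ?p x h)"
    proof -
      have "test_fun (\<lambda>x. ?p x h) (\<lambda>x. ?p' x h)"
        unfolding plateau_shift by (rule test_fun_plateau) (use e h in auto)
      then show ?thesis using H1_wderiv[OF reg(1)[OF sh]] by (auto simp: is_weak_deriv_def)
    qed
    ultimately show ?thesis
      using inner01_cmult_right[of "\<lambda>x. Y x (s + h)" "-1" "\<lambda>x. ?p' x h"]
      by (simp add: inner01_minus_left)
  qed
  then have "\<exists>k. \<forall>\<sigma>\<in>?I. inner01 (\<lambda>x. Y x (s + \<sigma>)) (\<lambda>x. ?p x \<sigma>) = k"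
    by (intro has_field_derivative_zero_constant) auto
  then obtain k where k: "\<forall>\<sigma>\<in>?I. inner01 (\<lambda>x. Y x (s + \<sigma>)) (\<lambda>x. ?p x \<sigma>) = k" by (elim exE)
  have "inner01 (\<lambda>x. Y x (s + H)) (\<lambda>x. ?p x H) = k" "inner01 (\<lambda>x. Y x (s + 0)) (\<lambda>x. ?p x 0) = k"
    by (rule k[rule_format], use assms(3) in simp)+
  then show ?thesis by simp
qed

text \<open>If \<open>D y\<close> were positive, so would be its mean over a short interval around
  \<open>y\<close>; the other sign follows with \<open>- D\<close>.\<close>

lemma continuous_zero_by_averages:
  fixes D :: "real \<Rightarrow> real"
  assumes c: "continuous_on UNIV D"
    and avg: "\<And>a b. 0 < a \<Longrightarrow> a \<le> b \<Longrightarrow> b < L \<Longrightarrow> (LINT x|lborel. indicator {a..b} x * D x) = 0" and y: "y \<in> {0<..<L}"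
  shows "D y = 0"
proof -
  have nonpos: "E y \<le> 0" if cE: "continuous_on UNIV E"
    and av: "\<And>a b. 0 < a \<Longrightarrow> a \<le> b \<Longrightarrow> b < L \<Longrightarrow> (LINT x|lborel. indicator {a..b} x * E x) = 0" for E :: "real \<Rightarrow> real"
  proof (rule ccontr)
    assume "\<not> E y \<le> 0"
    then have "E y / 2 > 0" by simp
    then obtain d where d: "d > 0" "\<And>x. \<bar>x - y\<bar> < d \<Longrightarrow> \<bar>E x - E y\<bar> < E y / 2"
      using cE unfolding continuous_on_iff by (metis UNIV_I dist_real_def)
    define r where "r = min (d / 2) (min (y / 2) ((L - y) / 2))"
    have "r > 0" "r \<le> d / 2" "r \<le> y / 2" "r \<le> (L - y) / 2"       unfolding r_def using d y by (simp, linarith+)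
    then have r: "r > 0" "r < d" "y - r > 0" "y + r < L" using d y by auto
    have "E y / 2 * (2 * r) = (LINT x|lborel. indicator {y-r..y+r} x * (E y / 2))"
      using r by simp
    also have "\<dots> \<le> (LINT x|lborel. indicator {y-r..y+r} x * E x)"
    proof (rule integral_mono)
      show "integrable lborel (\<lambda>x. indicator {y-r..y+r} x * (E y / 2))"
        using integrable_indicator_Icc by simp
      have "continuous_on {y-r..y+r} E" using cE continuous_on_subset by blast
      then show "integrable lborel (\<lambda>x. indicator {y-r..y+r} x * E x)"
        using borel_integrable_atLeastAtMost'[of "y-r" "y+r" E] by (simp add: set_integrable_def)
      show "indicator {y-r..y+r} x * (E y / 2) \<le> indicator {y-r..y+r} x * E x" for x
      proof (cases "x \<in> {y-r..y+r}")
        case True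
        then have "\<bar>x - y\<bar> < d" using r by auto
        then have "E y / 2 \<le> E x" using d(2)[of x] by linarith
        then show ?thesis using True by simp
      qed simp
    qed
    also have "\<dots> = 0" using r by (intro av) auto
    finally show False using r(1) \<open>E y / 2 > 0\<close> by (simp add: mult_le_0_iff)
  qed
  have "- D y \<le> 0" by (rule nonpos[of "\<lambda>x. - D x"]) (use c avg in \<open>auto intro: continuous_intros\<close>)
  with nonpos[OF c avg] show ?thesis by simp
qed

text \<open>Constancy along characteristics holds first against plateaus, hence for means over
  intervals, and then pointwise because members of \<open>H1\<close> are continuous.\<close>

lemma transport_characteristic:
  assumes Y: "transport_solution {0..} b Y" and "0 \<le> s" "0 \<le> H" "0 \<le> x" "x + H \<le> 1"
  shows "Y (x + H) (s + H) = Y x s"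
proof -
  have less1: "Y (x + H) (s + H) = Y x s" if "0 \<le> s" "0 \<le> H" "H < 1" "0 \<le> x" "x + H \<le> 1" for s x H
  proof -
    have h: "(\<lambda>x. Y x s) \<in> H1" "(\<lambda>x. Y x (s + H)) \<in> H1"
      by (rule transport_regularity(1)[OF Y], use that in simp)+
    obtain P p where P: "primitive P p" "\<And>x. x \<in> {0..1} \<Longrightarrow> P x = Y x (s + H)"
      using H1_primitive[OF h(2)] by metis
    obtain Q q where Q: "primitive Q q" "\<And>x. x \<in> {0..1} \<Longrightarrow> Q x = Y x s"
      using H1_primitive[OF h(1)] by metis
    let ?D = "\<lambda>x. P (x + H) - Q x"
    have PH: "primitive (\<lambda>x. P (x + H)) (\<lambda>x. p (x + H))" by (rule primitive_shift[OF P(1)])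
    have Dc: "continuous_on UNIV ?D" by (rule primitive_continuous[OF primitive_diff[OF PH Q(1)]])
    have [measurable]: "P \<in> borel_measurable borel" "Q \<in> borel_measurable borel" "ramp \<in> borel_measurable borel"
      using P Q primitive_measurable continuous_ramp[of UNIV] by (auto intro: borel_measurable_continuous_onI)
    let ?D1 = "\<lambda>x. indicator {0..1} x * ?D x"
    have D1m: "?D1 \<in> borel_measurable borel" by measurable
    have sD1: "sqint lborel ?D1"
    proof -
      have "continuous_on {0..1} ?D" using Dc continuous_on_subset by blast
      then obtain B where B: "\<And>x. x \<in> {0..1} \<Longrightarrow> \<bar>?D x\<bar> \<le> B"
        using compact_imp_bounded[OF compact_continuous_image[of "{0..1}" ?D]] by (fastforce simp: bounded_iff)
      show ?thesis
      proof (rule l2norm_mono(1)[OF sqint_cmult[OF sqint_indicator_Icc[of 0 1], of B]])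
        show "\<bar>?D1 x\<bar> \<le> \<bar>B * indicator {0..1} x\<bar>" for x
          using B[of x] by (cases "x \<in> {0..1}") auto
      qed (use D1m in simp)
    qed
    have int0: "(LINT x|lborel. ?D1 x * plateau e c d x) = 0" if e: "e > 0" "c \<le> d" "0 < c - e" "d + e + H < 1" for e c d
    proof -
      have out: "plateau e c d x = 0" if "x \<notin> {0..1 - H}" for x
        using plateau_outside[OF e(1,2), of x] e that by auto
      have ii: "integrable lborel (\<lambda>x. plateau e c d x * h x)" if "primitive h h'" for h h' :: "real \<Rightarrow> real"
      proof -
        have "continuous_on {0..1} (\<lambda>x. plateau e c d x * h x)"
          unfolding plateau_def using e(1)
          by (intro continuous_intros continuous_on_compose2[OF continuous_ramp[of UNIV]] primitive_continuous[OF that]) auto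
        from borel_integrable_atLeastAtMost'[OF this]
        have "integrable lborel (\<lambda>x. indicator {0..1} x * (plateau e c d x * h x))" by (simp add: set_integrable_def)
        moreover have "(\<lambda>x. indicator {0..1} x * (plateau e c d x * h x)) = (\<lambda>x. plateau e c d x * h x)"
          using out \<open>0 \<le> H\<close> by (fastforce split: split_indicator)
        ultimately show ?thesis by simp
      qed
      have pm[measurable]: "plateau e c d \<in> borel_measurable borel" unfolding plateau_def[abs_def] by measurable
      have "inner01 (\<lambda>x. Y x (s + H)) (\<lambda>x. plateau e c d (x - H)) = inner01 P (\<lambda>x. plateau e c d (x - H))"
        by (rule inner01_cong) (use P in auto)
      also have "\<dots> = (LINT x|lborel. indicator {0..1} x * (P x * plateau e c d (x - H)))"
        unfolding inner01_def by (rule integral_I01) measurable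
      also have "\<dots> = (LINT x|lborel. P x * plateau e c d (x - H))"
        by (rule Bochner_Integration.integral_cong) (use out \<open>0 \<le> H\<close> in \<open>auto split: split_indicator\<close>)
      also have "\<dots> = (LINT x|lborel. plateau e c d x * P (x + H))"
        by (subst lborel_integral_real_affine[where c=1 and t=H]) (auto simp: add.commute mult.commute)
      finally have l: "inner01 (\<lambda>x. Y x (s + H)) (\<lambda>x. plateau e c d (x - H)) = (LINT x|lborel. plateau e c d x * P (x + H))" .
      have "inner01 (\<lambda>x. Y x s) (plateau e c d) = inner01 Q (plateau e c d)"
        by (rule inner01_cong) (use Q in auto)
      also have "\<dots> = (LINT x|lborel. indicator {0..1} x * (Q x * plateau e c d x))"
        unfolding inner01_def by (rule integral_I01) measurable
      also have "\<dots> = (LINT x|lborel. plateau e c d x * Q x)"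
        by (rule Bochner_Integration.integral_cong) (use out \<open>0 \<le> H\<close> in \<open>auto split: split_indicator\<close>)
      finally have "(LINT x|lborel. plateau e c d x * P (x + H)) - (LINT x|lborel. plateau e c d x * Q x) = 0"
        using l transport_pairing[OF Y \<open>0 \<le> s\<close> \<open>0 \<le> H\<close> e] by simp
      then have "(LINT x|lborel. plateau e c d x * P (x + H) - plateau e c d x * Q x) = 0"
        using ii[OF PH] ii[OF Q(1)] by simp
      moreover have "(\<lambda>x. plateau e c d x * P (x + H) - plateau e c d x * Q x) = (\<lambda>x. ?D1 x * plateau e c d x)"
        using out \<open>0 \<le> H\<close> by (fastforce split: split_indicator simp: algebra_simps)
      ultimately show ?thesis by simp
    qed
    have "?D y = 0" if y: "y \<in> {0<..<1 - H}" for y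
    proof (rule continuous_zero_by_averages[OF Dc _ y])
      fix c d assume cd: "0 < c" "c \<le> d" "d < 1 - H"
      define m where "m = min c (1 - H - d)"
      define \<epsilon> where "\<epsilon> n = m / (real n + 2)" for n
      have "m > 0" using cd by (simp add: m_def)
      have \<epsilon>: "\<epsilon> n > 0" "\<epsilon> n < m" for n using \<open>m > 0\<close> by (auto simp: \<epsilon>_def field_simps intro: add_pos_nonneg)
      have "(\<lambda>n. m / real n) \<longlonglongrightarrow> 0" by (rule lim_const_over_n)
      from LIMSEQ_ignore_initial_segment[OF this, of 2] have \<epsilon>0: "\<epsilon> \<longlonglongrightarrow> 0" 
        by (simp add: \<epsilon>_def[abs_def] add.commute)
      have "(LINT x|lborel. ?D1 x * plateau (\<epsilon> n) c d x) = 0" for n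
        by (rule int0) (use \<epsilon>[of n] cd in \<open>auto simp: m_def\<close>)
      then have "(LINT x|lborel. indicator {c..d} x * ?D1 x) = 0"
        using plateau_pairing_tendsto[OF sD1 \<epsilon>(1) \<epsilon>0 cd(2)] by (simp add: LIMSEQ_const_iff)
      moreover have "(\<lambda>x. indicator {c..d} x * ?D1 x) = (\<lambda>x. indicator {c..d} x * ?D x)"
        using cd \<open>0 \<le> H\<close> by (fastforce split: split_indicator)
      ultimately show "(LINT x|lborel. indicator {c..d} x * ?D x) = 0" by simp
    qed
    then have "?D x = 0"
      using continuous_constant_on_closure[of "{0<..<1 - H}" ?D 0 x] continuous_on_subset[OF Dc] that by auto
    then show ?thesis using P(2)[of "x + H"] Q(2)[of x] that by simp
  qed
  show ?thesis
  proof (cases "H < 1")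
    case True
    then show ?thesis using less1 assms by blast
  next
    case False
    then have "H = 1" "x = 0" using assms by auto
    \<comment> \<open>For \<open>H = 1\<close> the interval \<open>{0<..<1 - H}\<close> is empty, so
      the crossing is composed of two halves.\<close>
    then show ?thesis using less1[of s "1/2" 0] less1[of "s + 1/2" "1/2" "1/2"] assms by (simp add: add.commute)
  qed
qed

text \<open>During each unit of time the outflow at 1 is the profile at the start of that unit, read
  backwards along the characteristics. It has to be a primitive in order to serve as boundary datum
  in \<open>wave_solvable\<close>.\<close>

lemma transport_outflow_primitive:
  assumes Y: "transport_solution {0..} b Y"
  shows "\<exists>R r. primitive R r \<and> (\<forall>s\<in>{0..real n}. R s = Y 1 s)"
proof (induction n)
  case 0
  then show ?case using primitive_const[of "Y 1 0"] by (intro exI[of _ "\<lambda>x. Y 1 0"] exI[of _ "\<lambda>x. 0"]) auto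
next
  case (Suc n)
  then obtain R r where R: "primitive R r" "\<And>s. s \<in> {0..real n} \<Longrightarrow> R s = Y 1 s" by blast
  have "(\<lambda>x. Y x (real n)) \<in> H1" using transport_regularity(1)[OF Y, of "real n"] by simp
  then obtain P p where P: "primitive P p" "\<And>x. x \<in> {0..1} \<Longrightarrow> P x = Y x (real n)"
    using H1_primitive by metis
  let ?P = "\<lambda>x. P ((1 + real n) + -1 * x)"
  have "primitive (\<lambda>x. if x \<le> real n then R x else ?P x) (\<lambda>x. if x \<le> real n then r x else -1 * p ((1 + real n) + -1 * x))"
    by (rule primitive_glue[OF R(1) primitive_travelling[OF P(1)]]) (use R(2)[of "real n"] P(2)[of 1] in auto)
  moreover have "(if s \<le> real n then R s else ?P s) = Y 1 s" if s: "s \<in> {0..real (Suc n)}" for s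
  proof (cases "s \<le> real n")
    case True
    then show ?thesis using R(2)[of s] s by simp
  next
    case False
    have "Y (1 + real n - s + (s - real n)) (real n + (s - real n)) = Y (1 + real n - s) (real n)"
      by (rule transport_characteristic[OF Y]) (use False s in auto)
    then show ?thesis using False s P(2)[of "1 + real n - s"] by simp
  qed
  ultimately show ?case by blast
qed

section \<open>Decay of the state observer error\<close>

lemma l2_tendsto_reverse:
  assumes "sqint M f" "\<forall>\<^sub>F r in F. sqint M (a r)" "((\<lambda>r. l2norm M (\<lambda>x. a r x - f x)) \<longlongrightarrow> 0) F"
  shows "((\<lambda>r. l2norm M (a r)) \<longlongrightarrow> l2norm M f) F"
proof -
  have "\<forall>\<^sub>F r in F. norm (l2norm M (a r) - l2norm M f) \<le> l2norm M (\<lambda>x. a r x - f x)"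
    using assms(2)
  proof eventually_elim
    case (elim r)
    have "l2norm M (a r) \<le> l2norm M (\<lambda>x. a r x - f x) + l2norm M f"
      using l2norm_triangle[OF sqint_diff[OF elim assms(1)] assms(1)] by simp
    moreover have "l2norm M f \<le> l2norm M (\<lambda>x. a r x - f x) + l2norm M (a r)"
      using l2norm_triangle_diff[OF elim sqint_diff[OF elim assms(1)]] by simp
    ultimately show ?case by simp
  qed
  from Lim_null_comparison[OF this assms(3)] show ?thesis by (simp add: LIM_zero_iff)
qed

lemma cont_L2_norm_continuous:
  assumes "cont_L2 I v"
  shows "continuous_on I (\<lambda>s. L2_norm (\<lambda>x. v x s))"
  unfolding continuous_on L2_norm_eq
proof
  fix s assume s: "s \<in> I"
  have h: "sqint I01 (\<lambda>x. v x r)" if "r \<in> I" for r using assms that by (simp add: cont_L2_def L2_iff)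
  show "((\<lambda>r. l2norm I01 (\<lambda>x. v x r)) \<longlongrightarrow> l2norm I01 (\<lambda>x. v x s)) (at s within I)"
    by (rule l2_tendsto_reverse[OF h[OF s] eventually_mono[OF eventually_at_within_mem h]])
      (use assms s in \<open>auto simp: cont_L2_def L2_norm_eq\<close>)
qed

lemma cont_H1_norm_continuous:
  assumes "cont_H1 I w"
  shows "continuous_on I (\<lambda>s. H1_norm (\<lambda>x. w x s))"
  unfolding continuous_on
proof
  fix s assume s: "s \<in> I"
  have h: "(\<lambda>x. w x r) \<in> H1" if "r \<in> I" for r using assms that by (simp add: cont_H1_def)
  have bound: "\<forall>\<^sub>F r in at s within I. norm (H1_norm (\<lambda>x. w x r) - H1_norm (\<lambda>x. w x s)) \<le> H1_norm (\<lambda>x. w x r - w x s)"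
    using eventually_at_within_mem
  proof eventually_elim
    case (elim r)
    have z: "(\<lambda>x. 0) \<in> H1" using primitive_is_weak_deriv(2)[OF primitive_const[of 0]] .
    have n0: "H1_norm (\<lambda>x. 0) = 0"
      using H1_norm_eq[OF z primitive_is_weak_deriv(1)[OF primitive_const[of 0]]] by simp
    have neg: "H1_norm (\<lambda>x. - f x) \<le> H1_norm f" if "f \<in> H1" for f
      using H1_norm_triangle_diff[OF z that] n0 by simp
    note hr = h[OF elim] and hs = h[OF s]
    have sw: "H1_norm (\<lambda>x. w x s - w x r) \<le> H1_norm (\<lambda>x. w x r - w x s)"
      using neg[OF H1_diff[OF hr hs]] by simp
    have "(\<lambda>x. 0 - w x s) \<in> H1" by (rule H1_diff[OF z hs])
    have "H1_norm (\<lambda>x. w x r) \<le> H1_norm (\<lambda>x. w x s) + H1_norm (\<lambda>x. w x s - w x r)"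
      using H1_norm_triangle_diff[OF hs H1_diff[OF hs hr]] by simp
    moreover have "H1_norm (\<lambda>x. w x s) \<le> H1_norm (\<lambda>x. w x r) + H1_norm (\<lambda>x. w x r - w x s)"
      using H1_norm_triangle_diff[OF hr H1_diff[OF hr hs]] by simp
    ultimately show ?case using sw by simp
  qed
  have "((\<lambda>r. H1_norm (\<lambda>x. w x r - w x s)) \<longlongrightarrow> 0) (at s within I)"
    using assms s by (simp add: cont_H1_def)
  from Lim_null_comparison[OF bound this]
  show "((\<lambda>r. H1_norm (\<lambda>x. w x r)) \<longlongrightarrow> H1_norm (\<lambda>x. w x s)) (at s within I)"
    by (simp add: LIM_zero_iff)
qed

text \<open>On an interval of length 1, \<open>f\<close> oscillates by at most the norm of its
  derivative, and a constant below \<open>\<bar>f\<bar>\<close> is at most the norm of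
  \<open>f\<close>; the factor 2 adds the two.\<close>

lemma H1_sup_bound:
  assumes f: "f \<in> H1" and x: "x \<in> {0..1}"
  shows "\<bar>f x\<bar> \<le> 2 * H1_norm f"
proof -
  obtain P p where P: "primitive P p" "\<And>x. x \<in> {0..1} \<Longrightarrow> P x = f x" "l2norm lborel p = l2norm I01 (wderiv f)"
    using H1_primitive[OF f] by metis
  let ?k = "l2norm I01 (wderiv f)"
  have osc: "\<bar>f x\<bar> \<le> \<bar>f y\<bar> + ?k" if "y \<in> {0..1}" for y
  proof -
    have "sqrt \<bar>x - y\<bar> * ?k \<le> 1 * ?k" using x that by (intro mult_right_mono) auto
    then show ?thesis using primitive_Holder[OF P(1), of x y] P(2)[OF x] P(2)[OF that] P(3) by simp
  qed
  have "\<bar>f x\<bar> - ?k \<le> l2norm I01 f"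
  proof (cases "\<bar>f x\<bar> - ?k \<le> 0")
    case False
    have "l2norm I01 (\<lambda>y. \<bar>f x\<bar> - ?k) \<le> l2norm I01 f"
      by (rule l2norm_mono(2)[OF H1_sqint[OF f]]) (use osc False in fastforce)+
    then show ?thesis using False by (simp add: l2norm_def)
  qed (use l2norm_nonneg[of I01 f] in linarith)
  moreover have "l2norm I01 f \<le> H1_norm f" "?k \<le> H1_norm f"
    by (auto simp: H1_norm_def L2_norm_eq intro: real_le_rsqrt)
  ultimately show ?thesis by simp
qed

lemma time_deriv_cmult:
  assumes "time_deriv I w v"
  shows "time_deriv I (\<lambda>x s. c * w x s) (\<lambda>x s. c * v x s)"
  unfolding time_deriv_def L2_norm_eq
proof
  fix s assume "s \<in> I"
  then have "((\<lambda>r. \<bar>c\<bar> * l2norm I01 (\<lambda>x. (w x r - w x s) / (r - s) - v x s)) \<longlongrightarrow> \<bar>c\<bar> * 0) (at s within I)"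
    using assms by (intro tendsto_intros) (auto simp: time_deriv_def L2_norm_eq)
  moreover have "\<bar>c\<bar> * l2norm I01 (\<lambda>x. (w x r - w x s) / (r - s) - v x s)
     = l2norm I01 (\<lambda>x. (c * w x r - c * w x s) / (r - s) - c * v x s)" for r
    unfolding l2norm_cmult[symmetric] by (simp add: right_diff_distrib)
  ultimately show "((\<lambda>r. l2norm I01 (\<lambda>x. (c * w x r - c * w x s) / (r - s) - c * v x s)) \<longlongrightarrow> 0) (at s within I)"
    by simp
qed

text \<open>The delay inequality reaches times from 3 on; iterating it leads down to
  \<open>{0..3}\<close>, where continuity gives a bound.\<close>

lemma contraction_decay:
  fixes N :: "real \<Rightarrow> real"
  assumes c: "continuous_on {0..3} N" and step: "\<And>s. s \<ge> 1 \<Longrightarrow> N (s + 2) \<le> l * N s" and nn: "\<And>s. 0 \<le> N s" and l: "l < 1"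
  shows "\<exists>C \<mu>. C > 0 \<and> \<mu> > 0 \<and> (\<forall>s\<ge>0. N s \<le> C * exp (- \<mu> * s))"
proof -
  obtain B where B: "\<And>s. s \<in> {0..3} \<Longrightarrow> N s \<le> B"
    using compact_imp_bounded[OF compact_continuous_image[OF c]] nn by (fastforce simp: bounded_iff)
  \<comment> \<open>The maximum with 1/2 keeps the factor positive, so that the rate
    \<open>- ln k / 2\<close> makes sense; the divisor 2 is the delay.\<close>
  define k where "k = max l (1/2)"
  have k: "0 < k" "k < 1" "l \<le> k" using l by (auto simp: k_def)
  define \<mu> where "\<mu> = - ln k / 2"
  have "\<mu> > 0" using k by (simp add: \<mu>_def)
  have ek: "exp (- \<mu> * 2) = k" using k by (simp add: \<mu>_def)
  \<comment> \<open>The factor \<open>exp (3 * \<mu>)\<close> keeps the exponential bound above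
    \<open>\<bar>B\<bar> + 1\<close> throughout \<open>{0..3}\<close>.\<close>
  define C where "C = (\<bar>B\<bar> + 1) * exp (3 * \<mu>)"
  have "C > 0" by (simp add: C_def add_nonneg_pos)
  have bound: "N s \<le> C * exp (- \<mu> * s)" if "0 \<le> s" "s \<le> 3 + 2 * real n" for n s
    using that
  proof (induction n arbitrary: s)
    case 0
    have "N s \<le> (\<bar>B\<bar> + 1) * 1" using B[of s] 0 by simp
    also have "\<dots> \<le> (\<bar>B\<bar> + 1) * exp (3 * \<mu> + - \<mu> * s)"
      using 0 \<open>\<mu> > 0\<close> by (intro mult_left_mono) (auto simp: algebra_simps)
    finally show ?case by (simp add: C_def mult.assoc flip: exp_add)
  next
    case (Suc n)
    show ?case
    proof (cases "s \<le> 3")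
      case True
      then show ?thesis using Suc by simp
    next
      case False
      have "N s \<le> l * N (s - 2)" using step[of "s - 2"] False by simp
      also have "\<dots> \<le> k * N (s - 2)" using k nn by (intro mult_right_mono) auto
      also have "\<dots> \<le> k * (C * exp (- \<mu> * (s - 2)))"
        using k Suc False by (intro mult_left_mono) auto
      also have "\<dots> = C * (exp (- \<mu> * 2) * exp (- \<mu> * (s - 2)))" unfolding ek by (simp only: mult.left_commute)
      also have "exp (- \<mu> * 2) * exp (- \<mu> * (s - 2)) = exp (- \<mu> * s)"
        by (simp add: algebra_simps flip: exp_add)
      finally show ?thesis .
    qed
  qed
  have "N s \<le> C * exp (- \<mu> * s)" if "s \<ge> 0" for s
  proof -
    obtain n :: nat where "s \<le> real n" using real_arch_simple by blast
    then show ?thesis using bound[of s n] that by simp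
  qed
  then show ?thesis using \<open>C > 0\<close> \<open>\<mu> > 0\<close> by blast
qed

text \<open>The outflow of the transport equation is treated as a prescribed boundary datum;
  existence and uniqueness for the Neumann problem then give \<open>z\<close> its d'Alembert form.
  The restriction \<open>s \<ge> 1\<close> keeps \<open>s - x \<ge> 0\<close>, where
  \<open>G = F\<close>.\<close>

lemma coupled_wave_transport_contraction:
  assumes z: "wave_solution {0..} (\<lambda>s. 0) r z zs" and Y: "transport_solution {0..} b Y"
    and r: "\<And>s. 0 \<le> s \<Longrightarrow> r s = - Y 1 s" and b: "\<And>s. 0 \<le> s \<Longrightarrow> Y 0 s = - c * z 0 s"
    and s: "1 \<le> s" and x: "x \<in> {0..1}"
  shows "z x (s + 2) = (2 * c - 1) * z x s"
proof -
  obtain n :: nat where n: "s + 3 \<le> real n" using real_arch_simple by blast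
  obtain R0 r0 where R0: "primitive R0 r0" "\<And>s. s \<in> {0..real n} \<Longrightarrow> R0 s = Y 1 s"
    using transport_outflow_primitive[OF Y] by metis
  let ?R = "\<lambda>s. -1 * R0 s"
  have R: "primitive ?R (\<lambda>s. -1 * r0 s)" by (rule primitive_cmult[OF R0(1)])
  note reg = wave_solution_regularity[OF z]
  have reg0: "(\<lambda>x. z x 0) \<in> H1" "sqint I01 (\<lambda>x. zs x 0)" using reg[of 0] by auto
  let ?D = "\<bar>z 0 0\<bar> + l2norm I01 (wderiv (\<lambda>x. z x 0)) + l2norm I01 (\<lambda>x. zs x 0) + l2norm lborel (\<lambda>s. -1 * r0 s)"
  have D: "\<bar>z 0 0\<bar> \<le> ?D" "l2norm I01 (wderiv (\<lambda>x. z x 0)) \<le> ?D" "l2norm I01 (\<lambda>x. zs x 0) \<le> ?D"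
    "l2norm lborel (\<lambda>s. -1 * r0 s) \<le> ?D"
    using l2norm_nonneg[of I01 "wderiv (\<lambda>x. z x 0)"] l2norm_nonneg[of I01 "\<lambda>x. zs x 0"]
      l2norm_nonneg[of lborel "\<lambda>s. -1 * r0 s"] abs_ge_zero[of "z 0 0"] by linarith+
  have R00: "-1 * R0 0 = z 1 0" using R0(2)[of 0] reg(4)[of 0] r[of 0] n s by simp
  obtain C where C: "wave_solvable 0 n C" using wave_exists[of 0] by blast
  obtain F G w v where FG: "wave_solution {0..real n} (\<lambda>s. - 0 * w 0 s) ?R w v" "w = (\<lambda>x s. F (s + x) + G (s - x))"
    "\<And>x. x \<in> {0..1} \<Longrightarrow> w x 0 = z x 0" "AE x in I01. v x 0 = zs x 0" "\<forall>s\<ge>0. G s = F s"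
  proof (rule wave_solvableD[OF C reg0 R R00 D])
    fix F G w v
    assume "wave_solution {0..real n} (\<lambda>s. - 0 * w 0 s) ?R w v" "w = (\<lambda>x s. F (s + x) + G (s - x))"
      "\<And>x. x \<in> {0..1} \<Longrightarrow> w x 0 = z x 0" "AE x in I01. v x 0 = zs x 0"
      "(0::real) = 0 \<Longrightarrow> \<forall>s\<ge>0. G s = F s"
    from this(1-4) this(5)[OF refl] show thesis by (rule that)
  qed
  have z': "wave_solution {0..real n} (\<lambda>s. - 0 * z 0 s) ?R z zs"
    by (rule wave_solution_cong[OF wave_solution_subset[OF z]]) (use r R0(2) in auto)
  have eq: "z x \<sigma> = F (\<sigma> + x) + G (\<sigma> - x)" if "\<sigma> \<in> {0..real n}" "x \<in> {0..1}" for \<sigma> x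
    using wave_solution_unique(1)[OF _ _ FG(1) z' FG(3,4) that(1)] that(2) n s by (auto simp: FG(2))
  \<comment> \<open>By the unit travel time the boundary value at time \<open>y + 1\<close> is
    \<open>- Y 0 y\<close>, which the inflow condition turns into
    \<open>c * z 0 y = 2 * c * F y\<close>.\<close>
  have FF: "F (y + 2) = (2 * c - 1) * F y" if "0 \<le> y" "y + 1 \<le> real n" for y
  proof -
    have "F (y + 2) + G y = z 1 (y + 1)" using eq[of "y + 1" 1] that by (simp add: add.assoc)
    also have "\<dots> = - Y 1 (y + 1)" using reg(4)[of "y + 1"] r that by simp
    also have "Y 1 (y + 1) = Y 0 y" using transport_characteristic[OF Y that(1), of 1 0] by simp
    also have "\<dots> = - c * z 0 y" by (rule b[OF that(1)])
    also have "z 0 y = F y + G y" using eq[of y 0] that by simp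
    finally show ?thesis using FG(5) that by (simp add: algebra_simps)
  qed
  have "z x (s + 2) = F (s + x + 2) + F (s - x + 2)"
    using eq[of "s + 2" x] FG(5) s x n by (simp add: algebra_simps)
  also have "\<dots> = (2 * c - 1) * (F (s + x) + F (s - x))"
    using FF[of "s + x"] FF[of "s - x"] s x n by (simp add: distrib_left)
  also have "F (s + x) + F (s - x) = z x s" using eq[of s x] FG(5) s x n by simp
  finally show ?thesis .
qed

text \<open>The contraction is available for displacements. For velocities it follows by
  differentiating the vanishing function \<open>z x (s + 2) - (2 * c - 1) * z x s\<close> in
  time.\<close>

lemma coupled_wave_transport_decay:
  assumes z: "wave_solution {0..} (\<lambda>s. 0) r z zs" and Y: "transport_solution {0..} b Y"
    and r: "\<And>s. 0 \<le> s \<Longrightarrow> r s = - Y 1 s" and b: "\<And>s. 0 \<le> s \<Longrightarrow> Y 0 s = - c * z 0 s"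
    and c: "0 < c" "c < 1"
  shows "\<exists>C \<mu>. C > 0 \<and> \<mu> > 0 \<and> (\<forall>s\<ge>0. H1_norm (\<lambda>x. z x s) \<le> C * exp (- \<mu> * s))"
    and "\<exists>C \<mu>. C > 0 \<and> \<mu> > 0 \<and> (\<forall>s\<ge>0. L2_norm (\<lambda>x. zs x s) \<le> C * exp (- \<mu> * s))"
proof -
  let ?l = "2 * c - 1"
  have l: "\<bar>?l\<bar> < 1" using c by (simp add: abs_if)
  note reg = wave_solution_regularity[OF z]
  note step = coupled_wave_transport_contraction[OF z Y r b]
  have cH: "cont_H1 {0..} z" and cL: "cont_L2 {0..} zs" and td: "time_deriv {0..} z zs"
    using z by (auto simp: wave_solution_def)
  have scale: "H1_norm (\<lambda>x. k * f x) = \<bar>k\<bar> * H1_norm f" if f: "f \<in> H1" for k f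
  proof -
    obtain P p where P: "primitive P p" "\<And>x. x \<in> {0..1} \<Longrightarrow> P x = f x" using H1_primitive[OF f] by metis
    have "is_weak_deriv f p" using primitive_is_weak_deriv(1)[OF P(1)] is_weak_deriv_cong[of P f] P(2) by blast
    moreover have "is_weak_deriv (\<lambda>x. k * f x) (\<lambda>x. k * p x)"
      using primitive_is_weak_deriv(1)[OF primitive_cmult[OF P(1), of k]]
        is_weak_deriv_cong[of "\<lambda>x. k * P x" "\<lambda>x. k * f x"] P(2) by simp
    moreover have "(\<lambda>x. k * f x) \<in> H1"
      by (rule is_weak_deriv_H1[OF _ calculation(2)]) (intro continuous_intros H1_continuous[OF f])
    ultimately show ?thesis
      using f by (simp add: H1_norm_eq l2norm_cmult power_mult_distrib real_sqrt_mult flip: distrib_left)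
  qed
  show "\<exists>C \<mu>. C > 0 \<and> \<mu> > 0 \<and> (\<forall>s\<ge>0. H1_norm (\<lambda>x. z x s) \<le> C * exp (- \<mu> * s))"
  proof (rule contraction_decay[OF _ _ H1_norm_nonneg l])
    show "continuous_on {0..3} (\<lambda>s. H1_norm (\<lambda>x. z x s))"
      by (rule continuous_on_subset[OF cont_H1_norm_continuous[OF cH]]) auto
    fix s :: real assume s: "s \<ge> 1"
    have "H1_norm (\<lambda>x. z x (s + 2)) = H1_norm (\<lambda>x. ?l * z x s)"
      by (rule H1_norm_cong) (use reg(1) s step[OF _ _ s] in auto)
    then show "H1_norm (\<lambda>x. z x (s + 2)) \<le> \<bar>?l\<bar> * H1_norm (\<lambda>x. z x s)"
      using scale[OF reg(1)[of s], of ?l] s by simp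
  qed
  show "\<exists>C \<mu>. C > 0 \<and> \<mu> > 0 \<and> (\<forall>s\<ge>0. L2_norm (\<lambda>x. zs x s) \<le> C * exp (- \<mu> * s))"
  proof (rule contraction_decay[OF _ _ _ l])
    show "continuous_on {0..3} (\<lambda>s. L2_norm (\<lambda>x. zs x s))"
      by (rule continuous_on_subset[OF cont_L2_norm_continuous[OF cL]]) auto
    show "0 \<le> L2_norm (\<lambda>x. zs x s)" for s by (simp add: L2_norm_eq)
    fix s :: real assume s: "s \<ge> 1"
    have sh: "wave_solution {1..} (\<lambda>s. 0) (\<lambda>s. r (1 * s + 2)) (\<lambda>x s. z x (1 * s + 2)) (\<lambda>x s. 1 * zs x (1 * s + 2))"
      by (rule wave_solution_affine[OF z]) auto
    have "time_deriv {1..} (\<lambda>x s. z x (1 * s + 2) - ?l * z x s) (\<lambda>x s. 1 * zs x (1 * s + 2) - ?l * zs x s)"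
    proof (rule time_deriv_diff)
      show "time_deriv {1..} (\<lambda>x s. z x (1 * s + 2)) (\<lambda>x s. 1 * zs x (1 * s + 2))"
        using sh by (simp add: wave_solution_def)
      show "time_deriv {1..} (\<lambda>x s. ?l * z x s) (\<lambda>x s. ?l * zs x s)"
        by (rule time_deriv_cmult) (use wave_solution_subset[OF z, of "{1..}"] in \<open>auto simp: wave_solution_def\<close>)
    qed (use wave_solution_regularity[OF sh] reg in \<open>auto intro!: sqint_cmult\<close>)
    then have "AE x in I01. 1 * zs x (1 * s + 2) - ?l * zs x s = 0"
    proof (rule time_deriv_zero)
      show "z x (1 * r + 2) - ?l * z x r = 0" if "r \<in> {1..}" "x \<in> {0..1}" for r x
        using step[of r x] that by (simp add: add.commute)
      have "s islimpt {1..}"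
        using islimpt_subset[of s "{s..s+1}" "{1..}"] s by simp
      then show "at s within {1..} \<noteq> bot" by (simp add: trivial_limit_within)
    qed (use s reg(3)[of s] reg(3)[of "s + 2"] in \<open>auto intro!: sqint_diff sqint_cmult simp: add.commute\<close>)
    then have ae: "AE x in I01. zs x (s + 2) = ?l * zs x s" by (auto simp: add.commute elim: AE_mp)
    have "l2norm I01 (\<lambda>x. zs x (s + 2)) = l2norm I01 (\<lambda>x. ?l * zs x s)"
      by (rule l2norm_cong_AE[OF _ _ ae])
        (use reg(3)[of "s + 2"] sqint_cmult[OF reg(3)[of s], of ?l] s in \<open>auto simp: sqint_def\<close>)
    then show "L2_norm (\<lambda>x. zs x (s + 2)) \<le> \<bar>?l\<bar> * L2_norm (\<lambda>x. zs x s)"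
      by (simp add: L2_norm_eq l2norm_cmult)
  qed
qed

section \<open>Convergence of the adaptive observer\<close>

text \<open>Constant and rate are existential because sums take the smaller rate and square roots
  halve it.\<close>

definition exp_decaying :: "(real \<Rightarrow> real) \<Rightarrow> bool" where
  "exp_decaying f \<longleftrightarrow> (\<exists>C \<mu>. C > 0 \<and> \<mu> > 0 \<and> (\<forall>s\<ge>0. \<bar>f s\<bar> \<le> C * exp (- \<mu> * s)))"

lemma exp_decaying_mono:
  assumes "exp_decaying g" "\<And>s. s \<ge> 0 \<Longrightarrow> \<bar>f s\<bar> \<le> g s"
  shows "exp_decaying f"
  using assms unfolding exp_decaying_def by (meson abs_le_D1 order_trans)

lemma exp_decaying_abs: "exp_decaying f \<Longrightarrow> exp_decaying (\<lambda>s. \<bar>f s\<bar>)"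
  by (simp add: exp_decaying_def)

lemma exp_decaying_minus: "exp_decaying f \<Longrightarrow> exp_decaying (\<lambda>s. - f s)"
  by (simp add: exp_decaying_def)

lemma exp_decaying_add:
  assumes "exp_decaying f" "exp_decaying g"
  shows "exp_decaying (\<lambda>s. f s + g s)"
proof -
  obtain C \<mu> where f: "C > 0" "\<mu> > 0" "\<And>s. s \<ge> 0 \<Longrightarrow> \<bar>f s\<bar> \<le> C * exp (- \<mu> * s)"
    using assms(1) unfolding exp_decaying_def by blast
  obtain D \<nu> where g: "D > 0" "\<nu> > 0" "\<And>s. s \<ge> 0 \<Longrightarrow> \<bar>g s\<bar> \<le> D * exp (- \<nu> * s)"
    using assms(2) unfolding exp_decaying_def by blast
  have "\<bar>f s + g s\<bar> \<le> (C + D) * exp (- min \<mu> \<nu> * s)" if "s \<ge> 0" for s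
  proof -
    have "exp (- \<mu> * s) \<le> exp (- min \<mu> \<nu> * s)" "exp (- \<nu> * s) \<le> exp (- min \<mu> \<nu> * s)"
      using that by (auto intro!: mult_right_mono)
    then have "C * exp (- \<mu> * s) + D * exp (- \<nu> * s) \<le> C * exp (- min \<mu> \<nu> * s) + D * exp (- min \<mu> \<nu> * s)"
      using f(1) g(1) by (intro add_mono mult_left_mono) auto
    then show ?thesis using f(3)[OF that] g(3)[OF that] by (simp add: distrib_right)
  qed
  then show ?thesis unfolding exp_decaying_def using f g
    by (intro exI[of _ "C + D"] exI[of _ "min \<mu> \<nu>"]) auto
qed

lemma exp_decaying_bounded_mult:
  assumes "exp_decaying f" "\<And>s. s \<ge> 0 \<Longrightarrow> \<bar>g s\<bar> \<le> B"
  shows "exp_decaying (\<lambda>s. g s * f s)"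
proof -
  obtain C \<mu> where f: "C > 0" "\<mu> > 0" "\<And>s. s \<ge> 0 \<Longrightarrow> \<bar>f s\<bar> \<le> C * exp (- \<mu> * s)"
    using assms(1) unfolding exp_decaying_def by blast
  have "\<bar>g s * f s\<bar> \<le> ((\<bar>B\<bar> + 1) * C) * exp (- \<mu> * s)" if "s \<ge> 0" for s
  proof -
    have "\<bar>g s\<bar> \<le> \<bar>B\<bar> + 1" using assms(2)[OF that] by linarith
    then have "\<bar>g s\<bar> * \<bar>f s\<bar> \<le> (\<bar>B\<bar> + 1) * (C * exp (- \<mu> * s))"
      using f(3)[OF that] by (intro mult_mono) auto
    then show ?thesis by (simp add: abs_mult mult.assoc)
  qed
  then show ?thesis unfolding exp_decaying_def using f
    by (intro exI[of _ "(\<bar>B\<bar> + 1) * C"] exI[of _ \<mu>]) (auto intro: mult_pos_pos add_nonneg_pos)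
qed

lemma exp_decaying_cmult: "exp_decaying f \<Longrightarrow> exp_decaying (\<lambda>s. c * f s)"
  by (rule exp_decaying_bounded_mult[where g="\<lambda>_. c" and B="\<bar>c\<bar>"]) auto

lemma exp_decaying_bounded:
  assumes "exp_decaying f"
  obtains B where "B > 0" "\<And>s. s \<ge> 0 \<Longrightarrow> \<bar>f s\<bar> \<le> B"
proof -
  obtain C \<mu> where f: "C > 0" "\<mu> > 0" "\<And>s. s \<ge> 0 \<Longrightarrow> \<bar>f s\<bar> \<le> C * exp (- \<mu> * s)"
    using assms unfolding exp_decaying_def by blast
  have "\<bar>f s\<bar> \<le> C" if "s \<ge> 0" for s
  proof -
    have "C * exp (- \<mu> * s) \<le> C * 1" using f that by (intro mult_left_mono) auto
    then show ?thesis using f(3)[OF that] by simp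
  qed
  then show thesis using that f(1) by blast
qed

lemma exp_decaying_sqrt:
  assumes "exp_decaying f" "\<And>s. s \<ge> 0 \<Longrightarrow> (g s)\<^sup>2 \<le> f s"
  shows "exp_decaying g"
proof -
  obtain C \<mu> where f: "C > 0" "\<mu> > 0" "\<And>s. s \<ge> 0 \<Longrightarrow> \<bar>f s\<bar> \<le> C * exp (- \<mu> * s)"
    using assms(1) unfolding exp_decaying_def by blast
  have "\<bar>g s\<bar> \<le> sqrt C * exp (- (\<mu> / 2) * s)" if "s \<ge> 0" for s
  proof -
    have "(exp (- (\<mu> / 2) * s))\<^sup>2 = exp (- \<mu> * s)"
      by (simp add: power2_eq_square flip: exp_add)
    then have "\<bar>g s\<bar>\<^sup>2 \<le> (sqrt C * exp (- (\<mu> / 2) * s))\<^sup>2"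
      using assms(2)[OF that] f(3)[OF that] f(1) by (simp add: power_mult_distrib)
    then show ?thesis by (rule power2_le_imp_le) (use f in simp)
  qed
  then show ?thesis unfolding exp_decaying_def using f
    by (intro exI[of _ "sqrt C"] exI[of _ "\<mu> / 2"]) auto
qed

lemma nonincreasing_from_0:
  fixes g :: "real \<Rightarrow> real"
  assumes d: "\<And>s. s \<ge> 0 \<Longrightarrow> (g has_real_derivative g' s) (at s within {0..})"
    and n: "\<And>s. s \<ge> 0 \<Longrightarrow> g' s \<le> 0" and s: "s \<ge> 0"
  shows "g s \<le> g 0"
proof (cases "s = 0")
  case False
  show ?thesis
  proof (rule DERIV_nonpos_imp_decreasing_open[where f=g and a=0 and b=s])
    show "0 \<le> s" by fact
    show "\<exists>y. DERIV g x :> y \<and> y \<le> 0" if "0 < x" "x < s" for x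
      using d[of x] n[of x] that at_within_interior[of x "{0..}"] by (auto simp: interior_Ici)
    show "continuous_on {0..s} g"
      by (rule continuous_on_subset[of "{0..}"]) (use d DERIV_continuous_on in \<open>blast, auto\<close>)
  qed
qed simp

lemma constant_from_0:
  fixes g :: "real \<Rightarrow> real"
  assumes d: "\<And>s. s \<ge> 0 \<Longrightarrow> (g has_real_derivative 0) (at s within {0..})" and s: "s \<ge> 0"
  shows "g s = g 0"
  using nonincreasing_from_0[of g "\<lambda>_. 0" s] nonincreasing_from_0[of "\<lambda>s. - g s" "\<lambda>_. 0" s] DERIV_minus[OF d] d s
  by force

text \<open>The rate \<open>m + q'\<close> may be negative at times; boundedness of \<open>q\<close>
  makes it positive on average. \<open>exp (L s)\<close> is an integrating factor: its summand
  \<open>q s\<close> absorbs the fluctuation, and its last summand, with derivative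
  \<open>- K * exp (- \<mu> * s)\<close>, absorbs \<open>h s * W s\<close>.\<close>

lemma averaged_decay:
  fixes W W' q q' h :: "real \<Rightarrow> real"
  assumes W: "\<And>s. s \<ge> 0 \<Longrightarrow> (W has_real_derivative W' s) (at s within {0..})" "\<And>s. s \<ge> 0 \<Longrightarrow> 0 \<le> W s"
    and q: "\<And>s. s \<ge> 0 \<Longrightarrow> (q has_real_derivative q' s) (at s within {0..})" "\<And>s. s \<ge> 0 \<Longrightarrow> \<bar>q s\<bar> \<le> Q"
    and m: "m > 0" and h: "exp_decaying h"
    and ineq: "\<And>s. s \<ge> 0 \<Longrightarrow> W' s \<le> - (m + q' s) * W s + h s * (W s + 1)"
  shows "exp_decaying W"
proof -
  obtain K \<mu> where K: "K > 0" "\<mu> > 0" "\<And>s. s \<ge> 0 \<Longrightarrow> \<bar>h s\<bar> \<le> K * exp (- \<mu> * s)"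
    using h unfolding exp_decaying_def by blast
  \<comment> \<open>The rate stays below \<mu>, so that the forcing multiplied by
    \<open>exp (n * s)\<close> is still integrable.\<close>
  define n where "n = min m (\<mu> / 2)"
  have n: "n > 0" "n \<le> m" "n < \<mu>" using m K by (auto simp: n_def)
  define L where "L s = n * s + q s + K / \<mu> * exp (- \<mu> * s)" for s
  define A where "A = K * exp (Q + K / \<mu>)"
  have "A > 0" using K by (simp add: A_def)
  \<comment> \<open>The second summand has derivative \<open>- A * exp (- (\<mu> - n) * s)\<close>,
    which compensates the forcing and makes \<open>P\<close> nonincreasing.\<close>
  define P where "P s = W s * exp (L s) + A / (\<mu> - n) * exp (- (\<mu> - n) * s)" for s
  have dP: "(P has_real_derivative
      (W' s * exp (L s) + exp (L s) * (n + q' s - K * exp (- \<mu> * s)) * W s - A * exp (- (\<mu> - n) * s))) (at s within {0..})"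
    if s: "s \<ge> 0" for s
  proof -
    have "(L has_real_derivative n + q' s + K / \<mu> * (- \<mu> * exp (- \<mu> * s))) (at s within {0..})"
      unfolding L_def[abs_def] by (auto intro!: derivative_eq_intros q s)
    then have L: "(L has_real_derivative n + q' s - K * exp (- \<mu> * s)) (at s within {0..})"
      using K by simp
    have "((\<lambda>s. A / (\<mu> - n) * exp (- (\<mu> - n) * s)) has_real_derivative A / (\<mu> - n) * (- (\<mu> - n) * exp (- (\<mu> - n) * s))) (at s within {0..})"
      using n by (auto intro!: derivative_eq_intros)
    then have E: "((\<lambda>s. A / (\<mu> - n) * exp (- (\<mu> - n) * s)) has_real_derivative - (A * exp (- (\<mu> - n) * s))) (at s within {0..})"
    proof (rule DERIV_cong)
      have "A / k * (- k * e) = - (A * e)" if "k \<noteq> 0" for k e :: real using that by simp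
      from this[of "\<mu> - n"] show "A / (\<mu> - n) * (- (\<mu> - n) * exp (- (\<mu> - n) * s)) = - (A * exp (- (\<mu> - n) * s))"
        using n by simp
    qed
    have X: "((\<lambda>s. exp (L s)) has_real_derivative exp (L s) * (n + q' s - K * exp (- \<mu> * s))) (at s within {0..})"
      by (rule DERIV_chain'[OF L]) (rule DERIV_exp)
    show ?thesis
      unfolding P_def[abs_def] using DERIV_add[OF DERIV_mult[OF W(1)[OF s] X] E] by simp
  qed
  have le: "W' s * exp (L s) + exp (L s) * (n + q' s - K * exp (- \<mu> * s)) * W s - A * exp (- (\<mu> - n) * s) \<le> 0"
    if s: "s \<ge> 0" for s
  proof -
    have "h s * (W s + 1) \<le> K * exp (- \<mu> * s) * (W s + 1)"
      using K(3)[OF s] W(2)[OF s] by (intro mult_right_mono) auto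
    moreover have "n * W s \<le> m * W s" using n W(2)[OF s] by (intro mult_right_mono) auto
    ultimately have "W' s + (n + q' s - K * exp (- \<mu> * s)) * W s \<le> K * exp (- \<mu> * s)"
      using ineq[OF s] by (simp add: algebra_simps)
    then have "exp (L s) * (W' s + (n + q' s - K * exp (- \<mu> * s)) * W s) \<le> exp (L s) * (K * exp (- \<mu> * s))"
      by (intro mult_left_mono) auto
    also have "exp (L s) \<le> exp (n * s + (Q + K / \<mu>))"
    proof -
      have "K / \<mu> * exp (- \<mu> * s) \<le> K / \<mu> * 1" using K s by (intro mult_left_mono) auto
      then show ?thesis using q(2)[OF s] by (simp add: L_def)
    qed
    then have "exp (L s) * (K * exp (- \<mu> * s)) \<le> exp (n * s + (Q + K / \<mu>)) * (K * exp (- \<mu> * s))"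
      using K by (intro mult_right_mono) auto
    also have "\<dots> = A * exp (- (\<mu> - n) * s)"
    proof -
      have "exp (n * s + (Q + K / \<mu>)) * exp (- \<mu> * s) = exp (Q + K / \<mu>) * exp (- (\<mu> - n) * s)"
        by (simp add: algebra_simps flip: exp_add)
      then show ?thesis by (simp add: A_def mult.left_commute mult.assoc)
    qed
    finally show ?thesis by (simp add: algebra_simps)
  qed
  have bound: "W s \<le> (\<bar>P 0\<bar> + 1) * exp Q * exp (- n * s)" if s: "s \<ge> 0" for s
  proof -
    have "P s \<le> P 0" by (rule nonincreasing_from_0[OF dP le s])
    moreover have "W s * exp (L s) \<le> P s" using \<open>A > 0\<close> n by (simp add: P_def)
    ultimately have "W s * exp (L s) \<le> \<bar>P 0\<bar> + 1" by linarith
    have "n * s - Q \<le> L s"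
    proof -
      have "0 \<le> K / \<mu> * exp (- \<mu> * s)" using K by simp
      then show ?thesis using q(2)[OF s] by (simp add: L_def)
    qed
    then have "W s * exp (n * s - Q) \<le> W s * exp (L s)" using W(2)[OF s] by (intro mult_left_mono) auto
    then have "W s * exp (n * s - Q) \<le> \<bar>P 0\<bar> + 1" using \<open>W s * exp (L s) \<le> \<bar>P 0\<bar> + 1\<close> by linarith
    then have "W s * exp (n * s - Q) * exp (Q - n * s) \<le> (\<bar>P 0\<bar> + 1) * exp (Q - n * s)"
      by (intro mult_right_mono) auto
    moreover have "W s * exp (n * s - Q) * exp (Q - n * s) = W s"
      by (simp add: mult.assoc flip: exp_add)
    moreover have "(\<bar>P 0\<bar> + 1) * exp (Q - n * s) = (\<bar>P 0\<bar> + 1) * exp Q * exp (- n * s)"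
      by (simp add: mult.assoc flip: exp_add)
    ultimately show ?thesis by linarith
  qed
  show ?thesis
    unfolding exp_decaying_def
  proof (intro exI conjI allI impI)
    show "0 < (\<bar>P 0\<bar> + 1) * exp Q" by (simp add: add_nonneg_pos)
    show "0 < n" by (rule n)
    show "\<bar>W s\<bar> \<le> (\<bar>P 0\<bar> + 1) * exp Q * exp (- n * s)" if "0 \<le> s" for s
      using bound[OF that] W(2)[OF that] by simp
  qed
qed

lemma stable_linear_decay:
  fixes y h :: "real \<Rightarrow> real"
  assumes "k > 0" and y: "\<And>s. s \<ge> 0 \<Longrightarrow> (y has_real_derivative - k * y s + h s) (at s within {0..})"
    and h: "exp_decaying h"
  shows "exp_decaying y"
proof -
  have "exp_decaying (\<lambda>s. (y s)\<^sup>2)"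
  proof (rule averaged_decay[where q="\<lambda>_. 0" and q'="\<lambda>_. 0" and Q=0 and m="2 * k" and h="\<lambda>s. \<bar>h s\<bar>"])
    show "((\<lambda>s. (y s)\<^sup>2) has_real_derivative 2 * y s * (- k * y s + h s)) (at s within {0..})" if "s \<ge> 0" for s
      by (auto intro!: derivative_eq_intros y that)
    show "2 * y s * (- k * y s + h s) \<le> - (2 * k + 0) * (y s)\<^sup>2 + \<bar>h s\<bar> * ((y s)\<^sup>2 + 1)" for s
    proof -
      have "2 * \<bar>y s\<bar> \<le> (y s)\<^sup>2 + 1" using sum_squares_bound[of "\<bar>y s\<bar>" 1] by simp
      then have "\<bar>h s\<bar> * (2 * \<bar>y s\<bar>) \<le> \<bar>h s\<bar> * ((y s)\<^sup>2 + 1)" by (intro mult_left_mono) auto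
      moreover have "2 * y s * h s \<le> \<bar>h s\<bar> * (2 * \<bar>y s\<bar>)"
        using abs_ge_self[of "2 * y s * h s"] by (simp add: abs_mult mult.commute)
      ultimately have "2 * y s * h s \<le> \<bar>h s\<bar> * ((y s)\<^sup>2 + 1)" by linarith
      then show ?thesis by (simp add: power2_eq_square algebra_simps)
    qed
  qed (use assms exp_decaying_abs in auto)
  then show ?thesis by (rule exp_decaying_sqrt) auto
qed

text \<open>The regressor is not bounded below, only its square is on average. The cross term
  \<open>\<xi> x y\<close> turns \<open>\<xi>\<^sup>2 y\<^sup>2\<close> into dissipation, at the price of a term
  of second order in its small coefficient \<open>a\<close>.\<close>

lemma persistent_excitation_decay:
  fixes x y \<xi> \<xi>' h1 h2 q q' e :: "real \<Rightarrow> real"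
  assumes x: "\<And>s. s \<ge> 0 \<Longrightarrow> (x has_real_derivative - k0 * x s + \<xi> s * y s + h1 s) (at s within {0..})"
    and y: "\<And>s. s \<ge> 0 \<Longrightarrow> (y has_real_derivative - k1 * \<xi> s * x s + h2 s) (at s within {0..})"
    and \<xi>: "\<And>s. s \<ge> 0 \<Longrightarrow> (\<xi> has_real_derivative \<xi>' s) (at s within {0..})"
    and bounds: "\<And>s. s \<ge> 0 \<Longrightarrow> \<bar>\<xi> s\<bar> \<le> X" "\<And>s. s \<ge> 0 \<Longrightarrow> \<bar>\<xi>' s\<bar> \<le> X'"
    and pos: "k0 > 0" "k1 > 0" "\<kappa> > 0"
    and q: "\<And>s. s \<ge> 0 \<Longrightarrow> (q has_real_derivative q' s) (at s within {0..})" "\<And>s. s \<ge> 0 \<Longrightarrow> \<bar>q s\<bar> \<le> Q"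
    and pe: "\<And>s. s \<ge> 0 \<Longrightarrow> \<kappa> + q' s - e s \<le> (\<xi> s)\<^sup>2"
    and dec: "exp_decaying e" "exp_decaying h1" "exp_decaying h2"
  shows "exp_decaying x" "exp_decaying y"
proof -
  define X0 where "X0 = \<bar>X\<bar> + 1"
  define X1 where "X1 = \<bar>X'\<bar> + k0 * X0 + 1"
  have X0: "X0 > 0" and X1: "X1 > 0" using pos by (auto simp: X0_def X1_def add_nonneg_pos)
  have \<xi>b: "\<bar>\<xi> s\<bar> \<le> X0" if "s \<ge> 0" for s using bounds(1)[OF that] by (simp add: X0_def)
  have \<xi>b': "\<bar>\<xi>' s - k0 * \<xi> s\<bar> \<le> X1" if "s \<ge> 0" for s
  proof -
    have "\<bar>k0 * \<xi> s\<bar> \<le> k0 * X0" using \<xi>b[OF that] pos by (simp add: abs_mult)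
    then show ?thesis using bounds(2)[OF that] by (simp add: X1_def)
  qed
  \<comment> \<open>Three smallness conditions: the terms in \<open>a * \<xi>^2 * x^2\<close> stay
    below the damping of \<open>x\<close>, the cross term stays below half of \<open>V\<close>, and
    the error \<open>B\<close> of order \<open>a^2\<close> stays below the gain of order
    \<open>a * \<kappa>\<close>.\<close>
  define a where "a = min (k0 / (4 * X0\<^sup>2)) (min (sqrt k1 / (2 * X0)) (\<kappa> * k0 * k1 / (6 * X1\<^sup>2)))"
  have a: "a > 0" "a * X0\<^sup>2 \<le> k0 / 4" "2 * (a * X0) \<le> sqrt k1" "a * X1\<^sup>2 \<le> \<kappa> * k0 * k1 / 6"
  proof -
    show "a > 0" using pos X0 X1 by (simp add: a_def)
    have "a \<le> k0 / (4 * X0\<^sup>2)" "a \<le> sqrt k1 / (2 * X0)" "a \<le> \<kappa> * k0 * k1 / (6 * X1\<^sup>2)"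
      unfolding a_def by (meson min.cobounded1 min.coboundedI2 min.cobounded2)+
    then show "a * X0\<^sup>2 \<le> k0 / 4" "2 * (a * X0) \<le> sqrt k1" "a * X1\<^sup>2 \<le> \<kappa> * k0 * k1 / 6"
      using X0 X1 by (simp_all add: field_simps)
  qed
  \<comment> \<open>The coefficient of \<open>(y s)^2\<close> that Young's inequality leaves when
    the mixed term is balanced against \<open>k0 * k1 / 2 * (x s)^2\<close>.\<close>
  define B where "B = 2 * a\<^sup>2 * X1\<^sup>2 / (k0 * k1)"
  have B: "0 \<le> B" "2 * B \<le> 2 / 3 * a * \<kappa>"
  proof -
    show "0 \<le> B" using pos by (simp add: B_def)
    have "a * (a * X1\<^sup>2) \<le> a * (\<kappa> * k0 * k1 / 6)" using a by (intro mult_left_mono) auto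
    then show "2 * B \<le> 2 / 3 * a * \<kappa>" using pos by (simp add: B_def field_simps power2_eq_square)
  qed
  \<comment> \<open>The weight \<open>k1\<close> makes the two coupling terms in
    \<open>\<xi> * x * y\<close> cancel in the derivative of \<open>V\<close>.\<close>
  define V where "V s = k1 * (x s)\<^sup>2 + (y s)\<^sup>2" for s
  define W where "W s = V s - 2 * a * (\<xi> s * (x s * y s))" for s
  have V0: "0 \<le> V s" for s using pos by (simp add: V_def)
  have cross: "\<bar>2 * a * (\<xi> s * (x s * y s))\<bar> \<le> V s / 2" if s: "s \<ge> 0" for s
  proof -
    have "2 * (sqrt k1 * \<bar>x s\<bar>) * \<bar>y s\<bar> \<le> (sqrt k1 * \<bar>x s\<bar>)\<^sup>2 + \<bar>y s\<bar>\<^sup>2"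
      by (rule sum_squares_bound)
    then have 1: "2 * (sqrt k1 * (\<bar>x s\<bar> * \<bar>y s\<bar>)) \<le> V s"
      using pos by (simp add: V_def power_mult_distrib mult.assoc)
    have "\<bar>2 * a * (\<xi> s * (x s * y s))\<bar> = 2 * (a * \<bar>\<xi> s\<bar>) * (\<bar>x s\<bar> * \<bar>y s\<bar>)"
      using a(1) by (simp add: abs_mult)
    also have "\<dots> \<le> sqrt k1 * (\<bar>x s\<bar> * \<bar>y s\<bar>)"
    proof (rule mult_right_mono)
      have "a * \<bar>\<xi> s\<bar> \<le> a * X0" using \<xi>b[OF s] a(1) by (intro mult_left_mono) auto
      then show "2 * (a * \<bar>\<xi> s\<bar>) \<le> sqrt k1" using a(3) by linarith
    qed simp
    finally show ?thesis using 1 by linarith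
  qed
  have WV: "V s / 2 \<le> W s" "W s \<le> 3 / 2 * V s" if "s \<ge> 0" for s
    using cross[OF that] unfolding W_def by linarith+
  define pert where "pert s = 2 * k1 * (x s * h1 s) + 2 * (y s * h2 s) - 2 * a * (\<xi> s * (y s * h1 s)) - 2 * a * (\<xi> s * (x s * h2 s))" for s
  define W' where "W' s = - 2 * k0 * k1 * (x s)\<^sup>2 + 2 * a * k1 * (\<xi> s)\<^sup>2 * (x s)\<^sup>2 - 2 * a * (\<xi> s)\<^sup>2 * (y s)\<^sup>2
      - 2 * a * ((\<xi>' s - k0 * \<xi> s) * (x s * y s)) + pert s" for s
  have dW: "(W has_real_derivative W' s) (at s within {0..})" if s: "s \<ge> 0" for s
  proof -
    have "(W has_real_derivative k1 * (2 * x s * (- k0 * x s + \<xi> s * y s + h1 s)) + 2 * y s * (- k1 * \<xi> s * x s + h2 s)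
       - 2 * a * (\<xi>' s * (x s * y s) + ((- k0 * x s + \<xi> s * y s + h1 s) * y s + (- k1 * \<xi> s * x s + h2 s) * x s) * \<xi> s)) (at s within {0..})"
      unfolding W_def[abs_def] V_def[abs_def]
      by (auto intro!: derivative_eq_intros x y \<xi> s)
    moreover have "k1 * (2 * x s * (- k0 * x s + \<xi> s * y s + h1 s)) + 2 * y s * (- k1 * \<xi> s * x s + h2 s)
       - 2 * a * (\<xi>' s * (x s * y s) + ((- k0 * x s + \<xi> s * y s + h1 s) * y s + (- k1 * \<xi> s * x s + h2 s) * x s) * \<xi> s) = W' s"
      unfolding W'_def pert_def by (simp add: algebra_simps power2_eq_square)
    ultimately show ?thesis by simp
  qed
  define H where "H s = (2 * k1 + 2 * a * X0) * \<bar>h1 s\<bar> + (2 + 2 * a * X0) * \<bar>h2 s\<bar>" for s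
  define M where "M = 1 + 1 / k1"
  have M: "M > 0" using pos by (simp add: M_def add_pos_pos)
  have H0: "0 \<le> H s" for s using a pos X0 by (simp add: H_def)
  have pert: "pert s \<le> H s * (M * V s + 1)" if s: "s \<ge> 0" for s
  proof -
    have sq: "\<bar>u\<bar> \<le> M * V s + 1" if "u = x s \<or> u = y s" for u
    proof -
      have "(x s)\<^sup>2 \<le> M * V s" "(y s)\<^sup>2 \<le> M * V s"
      proof -
        have "M * V s = V s + V s / k1" by (simp add: M_def distrib_right)
        moreover have "V s / k1 = (x s)\<^sup>2 + (y s)\<^sup>2 / k1" using pos by (simp add: V_def add_divide_distrib)
        moreover have "0 \<le> (y s)\<^sup>2 / k1" "0 \<le> k1 * (x s)\<^sup>2" using pos by auto
        ultimately show "(x s)\<^sup>2 \<le> M * V s" "(y s)\<^sup>2 \<le> M * V s"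
          using V0[of s] zero_le_power2[of "x s"] unfolding V_def by linarith+
      qed
      then have "u\<^sup>2 \<le> M * V s" using that by auto
      moreover have "2 * \<bar>u\<bar> \<le> u\<^sup>2 + 1" using sum_squares_bound[of "\<bar>u\<bar>" 1] by simp
      ultimately show ?thesis using abs_ge_zero[of u] by linarith
    qed
    let ?R = "M * V s + 1"
    have t: "\<bar>c * (u * h)\<bar> \<le> d * \<bar>h\<bar> * ?R" if "\<bar>c\<bar> \<le> d" "u = x s \<or> u = y s" for c d u h
    proof -
      have "\<bar>c * (u * h)\<bar> = (\<bar>c\<bar> * \<bar>h\<bar>) * \<bar>u\<bar>" by (simp add: abs_mult)
      also have "\<dots> \<le> (d * \<bar>h\<bar>) * ?R" using sq[OF that(2)] that(1) by (intro mult_mono) auto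
      finally show ?thesis .
    qed
    have ax: "\<bar>2 * a * \<xi> s\<bar> \<le> 2 * a * X0" using \<xi>b[OF s] a(1) by (simp add: abs_mult)
    have "\<bar>2 * k1 * (x s * h1 s)\<bar> \<le> 2 * k1 * \<bar>h1 s\<bar> * ?R" by (rule t) (use pos in auto)
    moreover have "\<bar>2 * (y s * h2 s)\<bar> \<le> 2 * \<bar>h2 s\<bar> * ?R" by (rule t) auto
    moreover have "\<bar>2 * a * \<xi> s * (y s * h1 s)\<bar> \<le> 2 * a * X0 * \<bar>h1 s\<bar> * ?R" by (rule t[OF ax]) auto
    moreover have "\<bar>2 * a * \<xi> s * (x s * h2 s)\<bar> \<le> 2 * a * X0 * \<bar>h2 s\<bar> * ?R" by (rule t[OF ax]) auto
    moreover have "pert s = 2 * k1 * (x s * h1 s) + 2 * (y s * h2 s) - 2 * a * \<xi> s * (y s * h1 s) - 2 * a * \<xi> s * (x s * h2 s)"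
      by (simp add: pert_def mult.assoc)
    ultimately have "pert s \<le> 2 * k1 * \<bar>h1 s\<bar> * ?R + 2 * \<bar>h2 s\<bar> * ?R + 2 * a * X0 * \<bar>h1 s\<bar> * ?R + 2 * a * X0 * \<bar>h2 s\<bar> * ?R"
      by linarith
    also have "\<dots> = H s * ?R" unfolding H_def by (simp add: algebra_simps)
    finally show ?thesis .
  qed
  \<comment> \<open>The damping of \<open>x\<close> pays for the term
    \<open>2 * a * k1 * \<xi>^2 * x^2\<close>, for the mixed term, and for completing
    \<open>y^2\<close> to \<open>V\<close> in the excitation term. Since
    \<open>W \<le> 3 / 2 * V\<close>, this gives decay of \<open>W\<close> at the rate
    \<open>4 / 3 * a * \<xi>^2\<close>, up to \<open>B\<close> and the perturbation.\<close>
  have main: "W' s \<le> - (4 / 3 * a * (\<xi> s)\<^sup>2) * W s + 2 * B * W s + H s * (M * V s + 1)" if s: "s \<ge> 0" for s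
  proof -
    have xi2: "(\<xi> s)\<^sup>2 \<le> X0\<^sup>2" using \<xi>b[OF s] X0 by (simp add: abs_le_square_iff[symmetric])
    then have "a * (\<xi> s)\<^sup>2 \<le> a * X0\<^sup>2" using a(1) by (intro mult_left_mono) auto
    then have axi: "4 * (a * (\<xi> s)\<^sup>2) \<le> k0" using a(2) by linarith
    have A1: "4 * (a * (\<xi> s)\<^sup>2) * (k1 * (x s)\<^sup>2) \<le> k0 * (k1 * (x s)\<^sup>2)"
      by (rule mult_right_mono[OF axi]) (use pos in simp)
    have A2: "- 2 * a * ((\<xi>' s - k0 * \<xi> s) * (x s * y s)) \<le> k0 * k1 / 2 * (x s)\<^sup>2 + B * (y s)\<^sup>2"
    proof -
      define r where "r = sqrt (k0 * k1 / 2)"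
      have r: "r > 0" "r\<^sup>2 = k0 * k1 / 2" using pos by (auto simp: r_def)
      define t where "t = a * X1 / r"
      have t2: "t\<^sup>2 = B" by (simp add: t_def B_def power_divide power_mult_distrib r(2))
      have "2 * (r * \<bar>x s\<bar>) * (t * \<bar>y s\<bar>) \<le> (r * \<bar>x s\<bar>)\<^sup>2 + (t * \<bar>y s\<bar>)\<^sup>2" by (rule sum_squares_bound)
      then have 1: "2 * (r * t) * (\<bar>x s\<bar> * \<bar>y s\<bar>) \<le> k0 * k1 / 2 * (x s)\<^sup>2 + B * (y s)\<^sup>2"
        using r(2) t2 by (simp add: power_mult_distrib mult_ac)
      have rt: "r * t = a * X1" using r(1) by (simp add: t_def)
      have "- 2 * a * ((\<xi>' s - k0 * \<xi> s) * (x s * y s)) \<le> \<bar>- 2 * a * ((\<xi>' s - k0 * \<xi> s) * (x s * y s))\<bar>" by (rule abs_ge_self)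
      also have "\<dots> = 2 * (a * \<bar>\<xi>' s - k0 * \<xi> s\<bar>) * (\<bar>x s\<bar> * \<bar>y s\<bar>)" using a(1) by (simp add: abs_mult)
      also have "\<dots> \<le> 2 * (a * X1) * (\<bar>x s\<bar> * \<bar>y s\<bar>)"
        using \<xi>b'[OF s] a(1) by (intro mult_right_mono mult_left_mono) auto
      finally show ?thesis using 1 unfolding rt by linarith
    qed
    have "W' s \<le> - 2 * (a * (\<xi> s)\<^sup>2) * V s + B * V s + pert s"
    proof -
      have "B * (y s)\<^sup>2 \<le> B * V s" using B(1) pos by (intro mult_left_mono) (auto simp: V_def)
      moreover have "0 \<le> k0 * (k1 * (x s)\<^sup>2)" using pos by simp
      moreover have "W' s = - 2 * (k0 * (k1 * (x s)\<^sup>2)) + 2 * ((a * (\<xi> s)\<^sup>2) * (k1 * (x s)\<^sup>2)) - 2 * ((a * (\<xi> s)\<^sup>2) * (y s)\<^sup>2)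
          + - 2 * a * ((\<xi>' s - k0 * \<xi> s) * (x s * y s)) + pert s"
        unfolding W'_def by (simp add: algebra_simps)
      moreover have "2 * (a * (\<xi> s)\<^sup>2) * V s = 2 * ((a * (\<xi> s)\<^sup>2) * (k1 * (x s)\<^sup>2)) + 2 * ((a * (\<xi> s)\<^sup>2) * (y s)\<^sup>2)"
        unfolding V_def by (simp add: algebra_simps)
      moreover have "4 * (a * (\<xi> s)\<^sup>2) * (k1 * (x s)\<^sup>2) = 4 * ((a * (\<xi> s)\<^sup>2) * (k1 * (x s)\<^sup>2))" "k0 * k1 / 2 * (x s)\<^sup>2 = k0 * (k1 * (x s)\<^sup>2) / 2"
        by simp_all
      ultimately show ?thesis using A1 A2 by linarith
    qed
    moreover have "4 / 3 * (a * (\<xi> s)\<^sup>2) * W s \<le> 2 * (a * (\<xi> s)\<^sup>2) * V s"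
    proof -
      have "4 / 3 * (a * (\<xi> s)\<^sup>2) * W s \<le> 4 / 3 * (a * (\<xi> s)\<^sup>2) * (3 / 2 * V s)"
        using WV(2)[OF s] a(1) by (intro mult_left_mono) auto
      then show ?thesis by simp
    qed
    moreover have "B * V s \<le> 2 * B * W s"
    proof -
      have "2 * B * (V s / 2) \<le> 2 * B * W s" using WV(1)[OF s] B(1) by (intro mult_left_mono) auto
      then show ?thesis by simp
    qed
    ultimately show ?thesis using pert[OF s] by (simp add: algebra_simps)
  qed
  have "exp_decaying W"
  \<comment> \<open>The excitation inequality replaces \<open>\<xi>^2\<close> by
    \<open>\<kappa> + q'\<close>; the resulting rate is positive because
    \<open>2 * B \<le> 2 / 3 * a * \<kappa>\<close>.\<close>
  proof (rule averaged_decay[where q="\<lambda>s. 4 / 3 * a * q s" and q'="\<lambda>s. 4 / 3 * a * q' s" and Q="4 / 3 * a * \<bar>Q\<bar>" and m="4 / 3 * a * \<kappa> - 2 * B"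
        and h="\<lambda>s. 4 / 3 * a * \<bar>e s\<bar> + (2 * M + 1) * H s"])
    show "(W has_real_derivative W' s) (at s within {0..})" if "s \<ge> 0" for s by (rule dW[OF that])
    show "0 \<le> W s" if "s \<ge> 0" for s using WV(1)[OF that] V0[of s] by linarith
    show "((\<lambda>s. 4 / 3 * a * q s) has_real_derivative 4 / 3 * a * q' s) (at s within {0..})" if "s \<ge> 0" for s
      by (rule DERIV_cmult[OF q(1)[OF that]])
    show "\<bar>4 / 3 * a * q s\<bar> \<le> 4 / 3 * a * \<bar>Q\<bar>" if "s \<ge> 0" for s
      using q(2)[OF that] a(1) by (simp add: abs_mult)
    show "4 / 3 * a * \<kappa> - 2 * B > 0" using B(2) mult_pos_pos[OF a(1) pos(3)] by linarith
    show "exp_decaying (\<lambda>s. 4 / 3 * a * \<bar>e s\<bar> + (2 * M + 1) * H s)"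
      unfolding H_def by (intro exp_decaying_add exp_decaying_cmult exp_decaying_abs dec)
    fix s :: real assume s: "s \<ge> 0"
    have W0: "0 \<le> W s" using WV(1)[OF s] V0[of s] by linarith
    have "(\<kappa> + q' s - \<bar>e s\<bar>) * W s \<le> (\<xi> s)\<^sup>2 * W s"
      using pe[OF s] W0 by (intro mult_right_mono) auto
    then have "4 / 3 * a * ((\<kappa> + q' s - \<bar>e s\<bar>) * W s) \<le> 4 / 3 * a * ((\<xi> s)\<^sup>2 * W s)"
      using a(1) by (intro mult_left_mono) auto
    moreover have "H s * (M * V s + 1) \<le> H s * ((2 * M + 1) * (W s + 1))"
    proof (intro mult_left_mono H0)
      have "M * V s \<le> M * (2 * W s)" using WV(1)[OF s] M by (intro mult_left_mono) auto
      moreover have "(2 * M + 1) * (W s + 1) = M * (2 * W s) + 2 * M + W s + 1" by (simp add: algebra_simps)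
      ultimately show "M * V s + 1 \<le> (2 * M + 1) * (W s + 1)" using M W0 by linarith
    qed
    moreover have "4 / 3 * a * (\<bar>e s\<bar> * W s) \<le> 4 / 3 * a * (\<bar>e s\<bar> * (W s + 1))"
      using a(1) by (intro mult_left_mono) auto
    moreover have "4 / 3 * a * ((\<kappa> + q' s - \<bar>e s\<bar>) * W s) = (4 / 3 * a * \<kappa> + 4 / 3 * a * q' s) * W s - 4 / 3 * a * (\<bar>e s\<bar> * W s)"
      by (simp add: algebra_simps)
    moreover have "W' s \<le> - (4 / 3 * a * ((\<xi> s)\<^sup>2 * W s)) + 2 * B * W s + H s * (M * V s + 1)"
      using main[OF s] by (simp add: mult.assoc)
    \<comment> \<open>Naming the products \<open>t1\<close> to \<open>t8\<close> exposes the
      combination as purely linear.\<close>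
    moreover have "w \<le> - t7 + t8 + t4 + t6"
      if "t1 \<le> t2" "t5 \<le> t6" "t3 \<le> t4" "t1 = t7 - t3" "w \<le> - t2 + t8 + t5" for w t1 t2 t3 t4 t5 t6 t7 t8 :: real
      using that by linarith
    ultimately have "W' s \<le> - ((4 / 3 * a * \<kappa> + 4 / 3 * a * q' s) * W s) + 2 * B * W s + 4 / 3 * a * (\<bar>e s\<bar> * (W s + 1))
        + H s * ((2 * M + 1) * (W s + 1))"
      by blast
    then show "W' s \<le> - (4 / 3 * a * \<kappa> - 2 * B + 4 / 3 * a * q' s) * W s + (4 / 3 * a * \<bar>e s\<bar> + (2 * M + 1) * H s) * (W s + 1)"
      by (simp add: algebra_simps)
  qed
  then have dV: "exp_decaying (\<lambda>s. 2 * W s)" by (rule exp_decaying_cmult)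
  have "exp_decaying (\<lambda>s. sqrt k1 * x s)"
  proof (rule exp_decaying_sqrt[OF dV])
    show "(sqrt k1 * x s)\<^sup>2 \<le> 2 * W s" if "s \<ge> 0" for s
    proof -
      have "(sqrt k1 * x s)\<^sup>2 = k1 * (x s)\<^sup>2" using pos by (simp add: power_mult_distrib)
      moreover have "V s \<le> 2 * W s" using WV(1)[OF that] by linarith
      moreover have "k1 * (x s)\<^sup>2 \<le> V s" by (simp add: V_def)
      ultimately show ?thesis by simp
    qed
  qed
  from exp_decaying_cmult[OF this, of "1 / sqrt k1"] show "exp_decaying x" using pos by simp
  show "exp_decaying y"
  proof (rule exp_decaying_sqrt[OF dV])
    show "(y s)\<^sup>2 \<le> 2 * W s" if "s \<ge> 0" for s
    proof -
      have "0 \<le> k1 * (x s)\<^sup>2" using pos by simp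
      then have "(y s)\<^sup>2 \<le> V s" by (simp add: V_def)
      then show ?thesis using WV(1)[OF that] by linarith
    qed
  qed
qed

lemma oscillator_energy:
  fixes d1 d2 :: "real \<Rightarrow> real"
  assumes d1: "\<And>s. s \<ge> 0 \<Longrightarrow> (d1 has_real_derivative d2 s) (at s within {0..})"
    and d2: "\<And>s. s \<ge> 0 \<Longrightarrow> (d2 has_real_derivative - \<theta> * d1 s) (at s within {0..})" and s: "s \<ge> 0"
  shows "\<theta> * (d1 s)\<^sup>2 + (d2 s)\<^sup>2 = \<theta> * (d1 0)\<^sup>2 + (d2 0)\<^sup>2"
proof (rule constant_from_0[of "\<lambda>s. \<theta> * (d1 s)\<^sup>2 + (d2 s)\<^sup>2", OF _ s])
  fix s :: real assume s: "s \<ge> 0"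
  have "((\<lambda>s. \<theta> * (d1 s)\<^sup>2 + (d2 s)\<^sup>2) has_real_derivative \<theta> * (2 * d1 s * d2 s) + 2 * d2 s * (- \<theta> * d1 s)) (at s within {0..})"
    by (auto intro!: derivative_eq_intros d1 d2 s)
  then show "((\<lambda>s. \<theta> * (d1 s)\<^sup>2 + (d2 s)\<^sup>2) has_real_derivative 0) (at s within {0..})"
    by (simp add: algebra_simps)
qed

lemma oscillator_bounded:
  fixes d1 d2 :: "real \<Rightarrow> real"
  assumes d1: "\<And>s. s \<ge> 0 \<Longrightarrow> (d1 has_real_derivative d2 s) (at s within {0..})"
    and d2: "\<And>s. s \<ge> 0 \<Longrightarrow> (d2 has_real_derivative - \<theta> * d1 s) (at s within {0..})" and pos: "\<theta> > 0"
  shows "\<exists>D. \<forall>s\<ge>0. \<bar>d1 s\<bar> \<le> D \<and> \<bar>d2 s\<bar> \<le> D"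
proof -
  define R where "R = \<theta> * (d1 0)\<^sup>2 + (d2 0)\<^sup>2"
  have "R \<ge> 0" using pos by (simp add: R_def)
  have "\<bar>d1 s\<bar> \<le> sqrt (R / \<theta>) + sqrt R \<and> \<bar>d2 s\<bar> \<le> sqrt (R / \<theta>) + sqrt R" if "s \<ge> 0" for s
  proof -
    have e: "\<theta> * (d1 s)\<^sup>2 + (d2 s)\<^sup>2 = R" unfolding R_def by (rule oscillator_energy[OF d1 d2 that])
    have "\<theta> * (d1 s)\<^sup>2 \<le> R" using e zero_le_power2[of "d2 s"] by linarith
    then have "(d1 s)\<^sup>2 \<le> R / \<theta>" using pos by (simp add: field_simps)
    then have 1: "\<bar>d1 s\<bar> \<le> sqrt (R / \<theta>)" using real_sqrt_le_mono by fastforce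
    have "0 \<le> \<theta> * (d1 s)\<^sup>2" using pos by simp
    then have "(d2 s)\<^sup>2 \<le> R" using e by linarith
    then have 2: "\<bar>d2 s\<bar> \<le> sqrt R" using real_sqrt_le_mono by fastforce
    have "0 \<le> sqrt (R / \<theta>)" "0 \<le> sqrt R" using \<open>R \<ge> 0\<close> pos by auto
    with 1 2 show ?thesis by linarith
  qed
  then show ?thesis by blast
qed

text \<open>The observer is brought into the form of \<open>persistent_excitation_decay\<close>:
  \<xi> approaches the filtered sinusoid \<open>\<xi>p\<close>, the filter mismatch \<delta> decays,
  and the errors of \<open>\<chi>h\<close> and \<open>\<theta>h\<close> solve the linear system with
  regressor \<xi> up to decaying terms.\<close>

lemma adaptive_observer_converges:
  fixes d1 d2 p :: "real \<Rightarrow> real"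
  assumes pos: "\<iota> > 0" "k0 > 0" "k1 > 0" "\<theta> > 0"
    and d1: "\<And>s. s \<ge> 0 \<Longrightarrow> (d1 has_real_derivative d2 s) (at s within {0..})"
    and d2: "\<And>s. s \<ge> 0 \<Longrightarrow> (d2 has_real_derivative - \<theta> * d1 s) (at s within {0..})"
    and nz: "\<theta> * (d1 0)\<^sup>2 + (d2 0)\<^sup>2 > 0" and p: "exp_decaying p"
    and obs: "adaptive_observer \<iota> k0 k1 (\<lambda>s. d1 s + p s) \<xi> \<chi>h \<phi>h \<theta>h"
  shows "exp_decaying (\<lambda>s. d1 s - \<chi>h s)" "exp_decaying (\<lambda>s. \<theta> - \<theta>h s)"
    "exp_decaying (\<lambda>s. d2 s - (\<phi>h s + \<xi> s * \<theta>h s + \<iota> * \<chi>h s))"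
proof -
  have o\<xi>: "(\<xi> has_real_derivative (- \<iota> * \<xi> s - (d1 s + p s))) (at s within {0..})"
    and o\<chi>: "(\<chi>h has_real_derivative (\<phi>h s + \<iota> * (d1 s + p s) + \<theta>h s * \<xi> s + k0 * (d1 s + p s - \<chi>h s))) (at s within {0..})"
    and o\<phi>: "(\<phi>h has_real_derivative (- \<iota> * \<phi>h s - \<iota>\<^sup>2 * (d1 s + p s))) (at s within {0..})"
    and o\<theta>: "(\<theta>h has_real_derivative (k1 * \<xi> s * (d1 s + p s - \<chi>h s))) (at s within {0..})" if "s \<ge> 0" for s
    using obs that unfolding adaptive_observer_def by auto
  define R where "R = \<theta> * (d1 0)\<^sup>2 + (d2 0)\<^sup>2"
  have energy: "\<theta> * (d1 s)\<^sup>2 + (d2 s)\<^sup>2 = R" if "s \<ge> 0" for s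
    unfolding R_def by (rule oscillator_energy[OF d1 d2 that])
  have "R > 0" using nz by (simp add: R_def)
  obtain D where db: "\<And>s. s \<ge> 0 \<Longrightarrow> \<bar>d1 s\<bar> \<le> D" "\<And>s. s \<ge> 0 \<Longrightarrow> \<bar>d2 s\<bar> \<le> D"
    using oscillator_bounded[OF d1 d2 pos(4)] by blast
  \<comment> \<open>\<alpha> and \<beta> are the coefficients for which
    \<open>\<alpha> * d1 + \<beta> * d2\<close> solves
    \<open>\<xi>' = - \<iota> * \<xi> - d1\<close> exactly.\<close>
  define \<beta> where "\<beta> = 1 / (\<theta> + \<iota>\<^sup>2)"
  define \<alpha> where "\<alpha> = - \<iota> * \<beta>"
  have "\<theta> + \<iota>\<^sup>2 > 0" using pos by (simp add: add_pos_pos)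
  then have \<beta>: "\<beta> > 0" "\<theta> * \<beta> + \<iota>\<^sup>2 * \<beta> = 1" by (auto simp: \<beta>_def simp flip: add_divide_distrib)
  define \<xi>p where "\<xi>p s = \<alpha> * d1 s + \<beta> * d2 s" for s
  define er where "er s = \<xi> s - \<xi>p s" for s
  have er: "exp_decaying er"
  proof (rule stable_linear_decay[OF pos(1) _ exp_decaying_minus[OF p]])
    fix s :: real assume s: "s \<ge> 0"
    have D: "(er has_real_derivative (- \<iota> * \<xi> s - (d1 s + p s)) - (\<alpha> * d2 s + \<beta> * (- \<theta> * d1 s))) (at s within {0..})"
      unfolding er_def[abs_def] \<xi>p_def by (intro DERIV_diff DERIV_add DERIV_cmult o\<xi> d1 d2 s)
    have "d1 s = (\<theta> * \<beta> + \<iota>\<^sup>2 * \<beta>) * d1 s" using \<beta> by simp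
    then have eq: "(- \<iota> * \<xi> s - (d1 s + p s)) - (\<alpha> * d2 s + \<beta> * (- \<theta> * d1 s)) = - \<iota> * er s + - p s"
      unfolding er_def \<xi>p_def \<alpha>_def by (simp add: algebra_simps power2_eq_square)
    show "(er has_real_derivative - \<iota> * er s + - p s) (at s within {0..})" by (rule DERIV_cong[OF D eq])
  qed
  obtain E where E: "\<And>s. s \<ge> 0 \<Longrightarrow> \<bar>er s\<bar> \<le> E" using exp_decaying_bounded[OF er] by blast
  obtain P where P: "\<And>s. s \<ge> 0 \<Longrightarrow> \<bar>p s\<bar> \<le> P" using exp_decaying_bounded[OF p] by blast
  have \<xi>pb: "\<bar>\<xi>p s\<bar> \<le> \<bar>\<alpha>\<bar> * D + \<beta> * D" if "s \<ge> 0" for s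
  proof -
    have "\<bar>\<xi>p s\<bar> \<le> \<bar>\<alpha>\<bar> * \<bar>d1 s\<bar> + \<beta> * \<bar>d2 s\<bar>"
      unfolding \<xi>p_def using \<beta>(1) abs_triangle_ineq[of "\<alpha> * d1 s" "\<beta> * d2 s"] by (simp add: abs_mult)
    also have "\<dots> \<le> \<bar>\<alpha>\<bar> * D + \<beta> * D" using db[OF that] \<beta>(1) by (intro add_mono mult_left_mono) auto
    finally show ?thesis .
  qed
  define X where "X = E + \<bar>\<alpha>\<bar> * D + \<beta> * D"
  have X: "\<bar>\<xi> s\<bar> \<le> X" if "s \<ge> 0" for s
    using E[OF that] \<xi>pb[OF that] unfolding er_def X_def by linarith
  have X': "\<bar>- \<iota> * \<xi> s - (d1 s + p s)\<bar> \<le> \<iota> * X + D + P" if "s \<ge> 0" for s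
  proof -
    have "\<bar>\<iota> * \<xi> s\<bar> \<le> \<iota> * X" using X[OF that] pos by (simp add: abs_mult)
    then show ?thesis using db(1)[OF that] P[OF that] by (simp add: abs_le_iff)
  qed
  \<comment> \<open>With the true \<theta>, the combination
    \<open>\<phi>h + \<xi> * \<theta> + \<iota> * d1\<close> tracks \<open>d2\<close>: in the
    derivative of the mismatch all terms cancel except \<open>- \<iota> * \<delta>\<close> and a
    multiple of \<open>p\<close>.\<close>
  define \<delta> where "\<delta> s = \<phi>h s + \<xi> s * \<theta> + \<iota> * d1 s - d2 s" for s
  have \<delta>: "exp_decaying \<delta>"
  proof (rule stable_linear_decay[OF pos(1) _ exp_decaying_cmult[OF p, of "- (\<iota>\<^sup>2 + \<theta>)"]])
    fix s :: real assume s: "s \<ge> 0"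
    have D: "(\<delta> has_real_derivative (- \<iota> * \<phi>h s - \<iota>\<^sup>2 * (d1 s + p s)) + (- \<iota> * \<xi> s - (d1 s + p s)) * \<theta> + \<iota> * d2 s - - \<theta> * d1 s) (at s within {0..})"
      unfolding \<delta>_def[abs_def] by (intro DERIV_diff DERIV_add DERIV_cmult DERIV_cmult_right o\<xi> o\<phi> d1 d2 s)
    have eq: "(- \<iota> * \<phi>h s - \<iota>\<^sup>2 * (d1 s + p s)) + (- \<iota> * \<xi> s - (d1 s + p s)) * \<theta> + \<iota> * d2 s - - \<theta> * d1 s = - \<iota> * \<delta> s + - (\<iota>\<^sup>2 + \<theta>) * p s"
      unfolding \<delta>_def by (simp add: algebra_simps power2_eq_square)
    show "(\<delta> has_real_derivative - \<iota> * \<delta> s + - (\<iota>\<^sup>2 + \<theta>) * p s) (at s within {0..})"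
      by (rule DERIV_cong[OF D eq])
  qed
  define h1 where "h1 s = - \<delta> s + - (\<iota> + k0) * p s" for s
  define h2 where "h2 s = (- k1 * \<xi> s) * p s" for s
  have h1: "exp_decaying h1" unfolding h1_def by (intro exp_decaying_add exp_decaying_minus exp_decaying_cmult \<delta> p)
  have h2: "exp_decaying h2" unfolding h2_def
  proof (rule exp_decaying_bounded_mult[OF p])
    show "\<bar>- k1 * \<xi> s\<bar> \<le> k1 * X" if "s \<ge> 0" for s using X[OF that] pos by (simp add: abs_mult)
  qed
  let ?x = "\<lambda>s. d1 s - \<chi>h s" and ?y = "\<lambda>s. \<theta> - \<theta>h s"
  have dx: "(?x has_real_derivative - k0 * ?x s + \<xi> s * ?y s + h1 s) (at s within {0..})" if "s \<ge> 0" for s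
    using DERIV_diff[OF d1[OF that] o\<chi>[OF that]]
    by (rule DERIV_cong) (simp add: h1_def \<delta>_def algebra_simps)
  have dy: "(?y has_real_derivative - k1 * \<xi> s * ?x s + h2 s) (at s within {0..})" if "s \<ge> 0" for s
    using DERIV_diff[OF DERIV_const[of \<theta>] o\<theta>[OF that]]
    by (rule DERIV_cong) (simp add: h2_def algebra_simps)
  \<comment> \<open>\<kappa> is the mean of \<open>\<xi>p^2\<close>, and \<open>q\<close> is a
    bounded antiderivative of the rest, found from
    \<open>(d1 * d2)' = d2^2 - \<theta> * d1^2\<close>, \<open>(d1^2)' = 2 * d1 * d2\<close> and the
    conserved energy \<open>R\<close>.\<close>
  define q where "q s = (- \<alpha>\<^sup>2 / (2 * \<theta>) + \<beta>\<^sup>2 / 2) * (d1 s * d2 s) + \<alpha> * \<beta> * (d1 s)\<^sup>2" for s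
  define q' where "q' s = (- \<alpha>\<^sup>2 / (2 * \<theta>) + \<beta>\<^sup>2 / 2) * (d2 s * d2 s + (- \<theta> * d1 s) * d1 s) + \<alpha> * \<beta> * (2 * d1 s * d2 s)" for s
  define \<kappa> where "\<kappa> = \<alpha>\<^sup>2 * R / (2 * \<theta>) + \<beta>\<^sup>2 * R / 2"
  have \<kappa>: "\<kappa> > 0" using \<beta>(1) \<open>R > 0\<close> pos by (simp add: \<kappa>_def add_nonneg_pos)
  have dq: "(q has_real_derivative q' s) (at s within {0..})" if "s \<ge> 0" for s
  proof -
    have "((\<lambda>s. (d1 s)\<^sup>2) has_real_derivative 2 * d1 s * d2 s) (at s within {0..})"
      by (auto intro!: derivative_eq_intros d1 that)
    then show ?thesis
      unfolding q_def[abs_def] q'_def by (intro DERIV_add DERIV_cmult DERIV_mult d1 d2 that)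
  qed
  have qb: "\<bar>q s\<bar> \<le> \<bar>- \<alpha>\<^sup>2 / (2 * \<theta>) + \<beta>\<^sup>2 / 2\<bar> * (D * D) + \<bar>\<alpha> * \<beta>\<bar> * (D * D)" if "s \<ge> 0" for s
  proof -
    have "\<bar>d1 s * d2 s\<bar> \<le> D * D" "\<bar>(d1 s)\<^sup>2\<bar> \<le> D * D"
      using mult_mono[OF db[OF that]] mult_mono[OF db(1)[OF that] db(1)[OF that]] db[OF that]
      by (simp_all add: abs_mult power2_eq_square)
    moreover have "\<bar>c * t\<bar> \<le> \<bar>c\<bar> * (D * D)" if "\<bar>t\<bar> \<le> D * D" for c t
      using that by (simp add: abs_mult mult_left_mono)
    ultimately have "\<bar>(- \<alpha>\<^sup>2 / (2 * \<theta>) + \<beta>\<^sup>2 / 2) * (d1 s * d2 s)\<bar> \<le> \<bar>- \<alpha>\<^sup>2 / (2 * \<theta>) + \<beta>\<^sup>2 / 2\<bar> * (D * D)"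
      "\<bar>\<alpha> * \<beta> * (d1 s)\<^sup>2\<bar> \<le> \<bar>\<alpha> * \<beta>\<bar> * (D * D)"
      by blast+
    then show ?thesis unfolding q_def by linarith
  qed
  have sq: "(\<xi>p s)\<^sup>2 = \<kappa> + q' s" if "s \<ge> 0" for s
  proof -
    define u where "u = \<alpha>\<^sup>2 / (2 * \<theta>)"
    have u: "- \<alpha>\<^sup>2 / (2 * \<theta>) = - u" "\<alpha>\<^sup>2 * R / (2 * \<theta>) = u * R" by (simp_all add: u_def)
    have "\<kappa> + q' s = u * (R - (d2 s * d2 s - \<theta> * (d1 s * d1 s))) + \<beta>\<^sup>2 / 2 * (R + (d2 s * d2 s - \<theta> * (d1 s * d1 s))) + 2 * \<alpha> * \<beta> * (d1 s * d2 s)"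
      unfolding \<kappa>_def q'_def u by (simp add: algebra_simps)
    also have "R - (d2 s * d2 s - \<theta> * (d1 s * d1 s)) = 2 * \<theta> * (d1 s * d1 s)"
      using energy[OF that] by (simp add: power2_eq_square)
    also have "R + (d2 s * d2 s - \<theta> * (d1 s * d1 s)) = 2 * (d2 s * d2 s)"
      using energy[OF that] by (simp add: power2_eq_square)
    also have "u * (2 * \<theta> * (d1 s * d1 s)) + \<beta>\<^sup>2 / 2 * (2 * (d2 s * d2 s)) + 2 * \<alpha> * \<beta> * (d1 s * d2 s) = (\<xi>p s)\<^sup>2"
      unfolding \<xi>p_def u_def using pos by (simp add: power2_eq_square algebra_simps)
    finally show ?thesis by simp
  qed
  \<comment> \<open>The halves come from
    \<open>\<xi>p^2 \<le> 2 * \<xi>^2 + 2 * er^2\<close>.\<close>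
  have pe: "\<kappa> / 2 + q' s / 2 - (er s)\<^sup>2 \<le> (\<xi> s)\<^sup>2" if "s \<ge> 0" for s
  proof -
    have "(\<xi>p s)\<^sup>2 \<le> 2 * (\<xi> s)\<^sup>2 + 2 * (er s)\<^sup>2"
      using zero_le_power2[of "\<xi> s + er s"] unfolding er_def by (simp add: power2_eq_square algebra_simps)
    then show ?thesis using sq[OF that] by linarith
  qed
  have er2: "exp_decaying (\<lambda>s. (er s)\<^sup>2)"
    using exp_decaying_bounded_mult[OF er, of er E] E by (simp add: power2_eq_square)
  show x: "exp_decaying ?x" and y: "exp_decaying ?y"
    by (rule persistent_excitation_decay[OF dx dy o\<xi> X X' pos(2,3) _ DERIV_cdivide[OF dq] _ pe er2 h1 h2,
        where Q="(\<bar>- \<alpha>\<^sup>2 / (2 * \<theta>) + \<beta>\<^sup>2 / 2\<bar> * (D * D) + \<bar>\<alpha> * \<beta>\<bar> * (D * D)) / 2"]; use \<kappa> qb in force)+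
  have "exp_decaying (\<lambda>s. - \<delta> s + (\<xi> s * ?y s + \<iota> * ?x s))"
    by (intro exp_decaying_add exp_decaying_minus \<delta> exp_decaying_cmult x exp_decaying_bounded_mult[OF y X])
  moreover have "- \<delta> s + (\<xi> s * ?y s + \<iota> * ?x s) = d2 s - (\<phi>h s + \<xi> s * \<theta>h s + \<iota> * \<chi>h s)" for s
    unfolding \<delta>_def by (simp add: algebra_simps)
  ultimately show "exp_decaying (\<lambda>s. d2 s - (\<phi>h s + \<xi> s * \<theta>h s + \<iota> * \<chi>h s))" by simp
qed

section \<open>Lipschitz dependence on the frequency\<close>

text \<open>The squared norm is used since the norm itself is not differentiable at 0. The forcing
  is split off by \<open>2 * norm y * H \<le> norm y ^ 2 + H^2\<close>, whence the rate
  \<open>c = 2 * L + 1\<close>.\<close>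

lemma gronwall_linear:
  fixes y y' :: "real \<Rightarrow> 'a::real_inner"
  assumes d: "\<And>s. s \<in> {a..b} \<Longrightarrow> (y has_vector_derivative y' s) (at s within {a..b})"
    and bound: "\<And>s. s \<in> {a..b} \<Longrightarrow> norm (y' s) \<le> L * norm (y s) + H" and pos: "0 \<le> L" "0 \<le> H" and s: "s \<in> {a..b}"
  shows "norm (y s) \<le> exp ((L + 1) * (b - a)) * (norm (y a) + H * sqrt (b - a))"
proof -
  define c where "c = 2 * L + 1"
  define N where "N s = y s \<bullet> y s" for s
  define g where "g s = exp (- c * (s - a)) * N s - H\<^sup>2 * (s - a)" for s
  have ab: "a \<le> b" using s by simp
  have dN: "(N has_real_derivative 2 * (y s \<bullet> y' s)) (at s within {a..b})" if "s \<in> {a..b}" for s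
  proof -
    have v: "(y has_derivative (\<lambda>h. h *\<^sub>R y' s)) (at s within {a..b})"
      using d[OF that] by (simp add: has_vector_derivative_def)
    have "(N has_derivative (\<lambda>h. y s \<bullet> (h *\<^sub>R y' s) + (h *\<^sub>R y' s) \<bullet> y s)) (at s within {a..b})"
      unfolding N_def[abs_def] by (rule has_derivative_inner[OF v v])
    moreover have "(\<lambda>h. y s \<bullet> (h *\<^sub>R y' s) + (h *\<^sub>R y' s) \<bullet> y s) = (*) (2 * (y s \<bullet> y' s))"
      by (auto simp: inner_commute)
    ultimately show ?thesis by (simp add: has_field_derivative_def)
  qed
  have dg: "(g has_real_derivative (exp (- c * (s - a)) * (- c)) * N s + 2 * (y s \<bullet> y' s) * exp (- c * (s - a)) - H\<^sup>2) (at s within {a..b})"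
    if "s \<in> {a..b}" for s
    unfolding g_def[abs_def] by (auto intro!: derivative_eq_intros dN that)
  have le: "(exp (- c * (s - a)) * (- c)) * N s + 2 * (y s \<bullet> y' s) * exp (- c * (s - a)) - H\<^sup>2 \<le> 0"
    if "s \<in> {a..b}" for s
  proof -
    have "y s \<bullet> y' s \<le> norm (y s) * norm (y' s)" by (rule norm_cauchy_schwarz)
    also have "\<dots> \<le> norm (y s) * (L * norm (y s) + H)" using bound[OF that] by (intro mult_left_mono) auto
    finally have "2 * (y s \<bullet> y' s) \<le> 2 * L * N s + 2 * (norm (y s) * H)"
      by (simp add: N_def algebra_simps power2_norm_eq_inner[symmetric] power2_eq_square)
    moreover have "2 * (norm (y s) * H) \<le> N s + H\<^sup>2"
      using sum_squares_bound[of "norm (y s)" H] by (simp add: N_def power2_norm_eq_inner mult.assoc)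
    ultimately have "2 * (y s \<bullet> y' s) - c * N s \<le> H\<^sup>2" by (simp add: c_def algebra_simps)
    then have "exp (- c * (s - a)) * (2 * (y s \<bullet> y' s) - c * N s) \<le> exp (- c * (s - a)) * H\<^sup>2"
      by (intro mult_left_mono) auto
    also have "\<dots> \<le> 1 * H\<^sup>2"
    proof (rule mult_right_mono)
      have "0 \<le> c * (s - a)" using that pos by (simp add: c_def)
      then show "exp (- c * (s - a)) \<le> 1" by simp
    qed simp
    finally show ?thesis by (simp add: algebra_simps)
  qed
  have "g s \<le> g a"
  proof (rule DERIV_nonpos_imp_decreasing_open[where f=g and a=a and b=s])
    show "a \<le> s" using s by simp
    show "\<exists>y. DERIV g x :> y \<and> y \<le> 0" if "a < x" "x < s" for x
      using dg[of x] le[of x] that s at_within_interior[of x "{a..b}"] by auto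
    have "continuous_on {a..b} g" by (rule DERIV_continuous_on[OF dg])
    then show "continuous_on {a..s} g" by (rule continuous_on_subset) (use s in auto)
  qed
  then have "exp (- c * (s - a)) * N s \<le> N a + H\<^sup>2 * (s - a)" by (simp add: g_def)
  also have "\<dots> \<le> N a + H\<^sup>2 * (b - a)" using s by (auto intro!: mult_left_mono)
  also have "\<dots> \<le> (norm (y a) + H * sqrt (b - a))\<^sup>2"
    using ab pos by (simp add: N_def power2_sum power_mult_distrib power2_norm_eq_inner)
  finally have "exp (c * (s - a)) * (exp (- c * (s - a)) * N s) \<le> exp (c * (s - a)) * (norm (y a) + H * sqrt (b - a))\<^sup>2"
    by (intro mult_left_mono) auto
  moreover have "exp (c * (s - a)) * (exp (- c * (s - a)) * N s) = N s"
    by (simp add: mult.assoc[symmetric] flip: exp_add)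
  moreover have "exp (c * (s - a)) \<le> (exp ((L + 1) * (b - a)))\<^sup>2"
  proof -
    have "c * (s - a) \<le> (2 * (L + 1)) * (b - a)" using s pos by (intro mult_mono) (auto simp: c_def)
    then show ?thesis by (simp add: power2_eq_square algebra_simps flip: exp_add)
  qed
  then have "exp (c * (s - a)) * (norm (y a) + H * sqrt (b - a))\<^sup>2
      \<le> (exp ((L + 1) * (b - a)))\<^sup>2 * (norm (y a) + H * sqrt (b - a))\<^sup>2"
    by (intro mult_right_mono) auto
  ultimately have "N s \<le> (exp ((L + 1) * (b - a)))\<^sup>2 * (norm (y a) + H * sqrt (b - a))\<^sup>2" by linarith
  then have "(norm (y s))\<^sup>2 \<le> (exp ((L + 1) * (b - a)) * (norm (y a) + H * sqrt (b - a)))\<^sup>2"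
    by (simp add: N_def power2_norm_eq_inner power_mult_distrib)
  then show ?thesis by (rule power2_le_imp_le) (use ab pos in simp)
qed

section \<open>Bounds for the companion matrix\<close>

lemma S_c_mult: "S_c \<rho> *v x = vector [x $ 2, - \<rho> * x $ 1]"
  by (simp add: S_c_def vec_eq_iff forall_2 matrix_vector_mult_def sum_2)

lemma mult_S_c: "x v* S_c \<rho> = vector [- \<rho> * x $ 2, x $ 1]"
  by (simp add: S_c_def vec_eq_iff forall_2 vector_matrix_mult_def sum_2)

lemma mult_S_c_square: "x v* (S_c \<rho> ** S_c \<rho>) = (- \<rho>) *\<^sub>R x"
  by (simp add: S_c_def vec_eq_iff forall_2 vector_matrix_mult_def matrix_matrix_mult_def sum_2)

lemma norm_vec2_le: "norm (x :: real ^ 2) \<le> \<bar>x $ 1\<bar> + \<bar>x $ 2\<bar>"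
  using norm_le_l1_cart[of x] by (simp add: sum_2)

lemma norm_mult_S_c: "norm (x v* S_c \<rho>) \<le> (1 + \<bar>\<rho>\<bar>) * norm x"
proof -
  have "norm (x v* S_c \<rho>) \<le> \<bar>\<rho>\<bar> * \<bar>x $ 2\<bar> + \<bar>x $ 1\<bar>"
    using norm_vec2_le[of "x v* S_c \<rho>"] by (simp add: mult_S_c abs_mult)
  also have "\<dots> \<le> \<bar>\<rho>\<bar> * norm x + norm x"
    using component_le_norm_cart[of x] by (intro add_mono mult_left_mono) auto
  finally show ?thesis by (simp add: algebra_simps)
qed

lemma norm_S_c_mult: "norm (S_c \<rho> *v x) \<le> (1 + \<bar>\<rho>\<bar>) * norm x"
proof -
  have "norm (S_c \<rho> *v x) \<le> \<bar>x $ 2\<bar> + \<bar>\<rho>\<bar> * \<bar>x $ 1\<bar>"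
    using norm_vec2_le[of "S_c \<rho> *v x"] by (simp add: S_c_mult abs_mult)
  also have "\<dots> \<le> norm x + \<bar>\<rho>\<bar> * norm x"
    using component_le_norm_cart[of x] by (intro add_mono mult_left_mono) auto
  finally show ?thesis by (simp add: algebra_simps)
qed

lemma norm_mult_S_c_diff: "norm (x v* S_c \<rho> - x v* S_c \<sigma>) \<le> \<bar>\<rho> - \<sigma>\<bar> * norm x"
proof -
  have "norm (x v* S_c \<rho> - x v* S_c \<sigma>) \<le> \<bar>\<sigma> * x $ 2 - \<rho> * x $ 2\<bar>"
    using norm_vec2_le[of "x v* S_c \<rho> - x v* S_c \<sigma>"] by (simp add: mult_S_c)
  also have "\<dots> = \<bar>\<rho> - \<sigma>\<bar> * \<bar>x $ 2\<bar>" by (simp add: abs_mult[symmetric] abs_minus_commute algebra_simps)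
  also have "\<dots> \<le> \<bar>\<rho> - \<sigma>\<bar> * norm x" using component_le_norm_cart[of x 2] by (intro mult_left_mono) auto
  finally show ?thesis .
qed

lemma norm_S_c_mult_diff: "norm (S_c \<rho> *v x - S_c \<sigma> *v x) \<le> \<bar>\<rho> - \<sigma>\<bar> * norm x"
proof -
  have "norm (S_c \<rho> *v x - S_c \<sigma> *v x) \<le> \<bar>\<sigma> * x $ 1 - \<rho> * x $ 1\<bar>"
    using norm_vec2_le[of "S_c \<rho> *v x - S_c \<sigma> *v x"] by (simp add: S_c_mult)
  also have "\<dots> = \<bar>\<rho> - \<sigma>\<bar> * \<bar>x $ 1\<bar>" by (simp add: abs_mult[symmetric] abs_minus_commute algebra_simps)
  also have "\<dots> \<le> \<bar>\<rho> - \<sigma>\<bar> * norm x" using component_le_norm_cart[of x 1] by (intro mult_left_mono) auto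
  finally show ?thesis .
qed

text \<open>Local in the frequency: solutions of the linear equations may grow exponentially with
  its size, so \<open>K\<close> may depend on the range \<open>P\<close>, but it is uniform in
  \<open>x\<close>.\<close>

definition lipschitz_family :: "real \<Rightarrow> (real \<Rightarrow> real \<Rightarrow> 'a::real_normed_vector) \<Rightarrow> bool" where
  "lipschitz_family P u \<longleftrightarrow> (\<exists>K\<ge>0. \<forall>x\<in>{0..1}. \<forall>\<rho> \<sigma>. \<bar>\<rho>\<bar> \<le> P \<longrightarrow> \<bar>\<sigma>\<bar> \<le> P \<longrightarrow>
     norm (u x \<rho>) \<le> K \<and> norm (u x \<rho> - u x \<sigma>) \<le> K * \<bar>\<rho> - \<sigma>\<bar>)"

lemma lipschitz_family_add:
  assumes "lipschitz_family P u" "lipschitz_family P v"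
  shows "lipschitz_family P (\<lambda>x \<rho>. u x \<rho> + v x \<rho>)"
proof -
  obtain K where K: "K \<ge> 0" "\<forall>x\<in>{0..1}. \<forall>\<rho> \<sigma>. \<bar>\<rho>\<bar> \<le> P \<longrightarrow> \<bar>\<sigma>\<bar> \<le> P \<longrightarrow>
     norm (u x \<rho>) \<le> K \<and> norm (u x \<rho> - u x \<sigma>) \<le> K * \<bar>\<rho> - \<sigma>\<bar>" using assms(1) by (auto simp: lipschitz_family_def)
  obtain L where L: "L \<ge> 0" "\<forall>x\<in>{0..1}. \<forall>\<rho> \<sigma>. \<bar>\<rho>\<bar> \<le> P \<longrightarrow> \<bar>\<sigma>\<bar> \<le> P \<longrightarrow>
     norm (v x \<rho>) \<le> L \<and> norm (v x \<rho> - v x \<sigma>) \<le> L * \<bar>\<rho> - \<sigma>\<bar>" using assms(2) by (auto simp: lipschitz_family_def)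
  show ?thesis
    unfolding lipschitz_family_def
  proof (intro exI[of _ "K + L"] conjI ballI allI impI)
    show "0 \<le> K + L" using K L by simp
    fix x \<rho> \<sigma> :: real assume a: "x \<in> {0..1}" "\<bar>\<rho>\<bar> \<le> P" "\<bar>\<sigma>\<bar> \<le> P"
    show "norm (u x \<rho> + v x \<rho>) \<le> K + L"
      using K(2)[rule_format, OF a] L(2)[rule_format, OF a] norm_triangle_ineq[of "u x \<rho>" "v x \<rho>"] by linarith
    have "norm (u x \<rho> + v x \<rho> - (u x \<sigma> + v x \<sigma>)) \<le> norm (u x \<rho> - u x \<sigma>) + norm (v x \<rho> - v x \<sigma>)"
      by (rule norm_diff_triangle_ineq)
    then show "norm (u x \<rho> + v x \<rho> - (u x \<sigma> + v x \<sigma>)) \<le> (K + L) * \<bar>\<rho> - \<sigma>\<bar>"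
      using K(2)[rule_format, OF a] L(2)[rule_format, OF a] unfolding distrib_right by linarith
  qed
qed

lemma lipschitz_family_S_c:
  assumes "lipschitz_family P u"
  shows "lipschitz_family P (\<lambda>x \<rho>. u x \<rho> v* S_c \<rho>)"
proof -
  obtain K where K: "K \<ge> 0" "\<forall>x\<in>{0..1}. \<forall>\<rho> \<sigma>. \<bar>\<rho>\<bar> \<le> P \<longrightarrow> \<bar>\<sigma>\<bar> \<le> P \<longrightarrow>
     norm (u x \<rho>) \<le> K \<and> norm (u x \<rho> - u x \<sigma>) \<le> K * \<bar>\<rho> - \<sigma>\<bar>" using assms(1) by (auto simp: lipschitz_family_def)
  show ?thesis
    unfolding lipschitz_family_def
  proof (intro exI[of _ "(2 + \<bar>P\<bar>) * K"] conjI ballI allI impI)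
    show "0 \<le> (2 + \<bar>P\<bar>) * K" using K by simp
    fix x \<rho> \<sigma> :: real assume a: "x \<in> {0..1}" "\<bar>\<rho>\<bar> \<le> P" "\<bar>\<sigma>\<bar> \<le> P"
    note k = K(2)[rule_format, OF a] K(2)[rule_format, OF a(1,3,2)]
    have b: "norm (z v* S_c \<rho>) \<le> (1 + \<bar>P\<bar>) * norm z" for z
    proof -
      have "(1 + \<bar>\<rho>\<bar>) * norm z \<le> (1 + \<bar>P\<bar>) * norm z" using a by (intro mult_right_mono) auto
      then show ?thesis using norm_mult_S_c[of z \<rho>] by linarith
    qed
    have "(1 + \<bar>P\<bar>) * norm (u x \<rho>) \<le> (2 + \<bar>P\<bar>) * K" using k K(1) by (intro mult_mono) auto
    then show "norm (u x \<rho> v* S_c \<rho>) \<le> (2 + \<bar>P\<bar>) * K" using b[of "u x \<rho>"] by linarith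
    have "u x \<rho> v* S_c \<rho> - u x \<sigma> v* S_c \<sigma> = (u x \<rho> - u x \<sigma>) v* S_c \<rho> + (u x \<sigma> v* S_c \<rho> - u x \<sigma> v* S_c \<sigma>)"
      by (simp add: mult_S_c vec_eq_iff forall_2 algebra_simps)
    then have "norm (u x \<rho> v* S_c \<rho> - u x \<sigma> v* S_c \<sigma>) \<le> norm ((u x \<rho> - u x \<sigma>) v* S_c \<rho>) + norm (u x \<sigma> v* S_c \<rho> - u x \<sigma> v* S_c \<sigma>)"
      using norm_triangle_ineq by metis
    also have "\<dots> \<le> (1 + \<bar>P\<bar>) * (K * \<bar>\<rho> - \<sigma>\<bar>) + \<bar>\<rho> - \<sigma>\<bar> * K"
    proof (rule add_mono)
      have "(1 + \<bar>P\<bar>) * norm (u x \<rho> - u x \<sigma>) \<le> (1 + \<bar>P\<bar>) * (K * \<bar>\<rho> - \<sigma>\<bar>)" using k by (intro mult_left_mono) auto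
      then show "norm ((u x \<rho> - u x \<sigma>) v* S_c \<rho>) \<le> (1 + \<bar>P\<bar>) * (K * \<bar>\<rho> - \<sigma>\<bar>)" using b[of "u x \<rho> - u x \<sigma>"] by linarith
      have "\<bar>\<rho> - \<sigma>\<bar> * norm (u x \<sigma>) \<le> \<bar>\<rho> - \<sigma>\<bar> * K" using k by (intro mult_left_mono) auto
      then show "norm (u x \<sigma> v* S_c \<rho> - u x \<sigma> v* S_c \<sigma>) \<le> \<bar>\<rho> - \<sigma>\<bar> * K"
        using norm_mult_S_c_diff[of "u x \<sigma>" \<rho> \<sigma>] by linarith
    qed
    also have "\<dots> = (2 + \<bar>P\<bar>) * K * \<bar>\<rho> - \<sigma>\<bar>" by (simp add: algebra_simps)
    finally show "norm (u x \<rho> v* S_c \<rho> - u x \<sigma> v* S_c \<sigma>) \<le> (2 + \<bar>P\<bar>) * K * \<bar>\<rho> - \<sigma>\<bar>" .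
  qed
qed

text \<open>The splitting pairs the frequency error with the exact state \<open>c\<close>, which is
  bounded a priori, and lets the estimate \<open>d\<close> enter through \<open>c - d\<close>
  only.\<close>

lemma lipschitz_family_inner:
  fixes u :: "real \<Rightarrow> real \<Rightarrow> 'a::real_inner"
  assumes "lipschitz_family P u"
  obtains K where "K \<ge> 0" "\<And>x \<rho> \<sigma> c d. x \<in> {0..1} \<Longrightarrow> \<bar>\<rho>\<bar> \<le> P \<Longrightarrow> \<bar>\<sigma>\<bar> \<le> P \<Longrightarrow> norm c \<le> D \<Longrightarrow>
     \<bar>u x \<rho> \<bullet> c - u x \<sigma> \<bullet> d\<bar> \<le> K * (\<bar>\<rho> - \<sigma>\<bar> + norm (c - d))"
proof -
  obtain K where K: "K \<ge> 0" "\<forall>x\<in>{0..1}. \<forall>\<rho> \<sigma>. \<bar>\<rho>\<bar> \<le> P \<longrightarrow> \<bar>\<sigma>\<bar> \<le> P \<longrightarrow>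
     norm (u x \<rho>) \<le> K \<and> norm (u x \<rho> - u x \<sigma>) \<le> K * \<bar>\<rho> - \<sigma>\<bar>" using assms(1) by (auto simp: lipschitz_family_def)
  show thesis
  proof (rule that[of "K * (\<bar>D\<bar> + 1)"])
    show "0 \<le> K * (\<bar>D\<bar> + 1)" using K by simp
    fix x \<rho> \<sigma> :: real and c d :: 'a assume a: "x \<in> {0..1}" "\<bar>\<rho>\<bar> \<le> P" "\<bar>\<sigma>\<bar> \<le> P" and c: "norm c \<le> D"
    note k = K(2)[rule_format, OF a] K(2)[rule_format, OF a(1,3,2)]
    have "u x \<rho> \<bullet> c - u x \<sigma> \<bullet> d = (u x \<rho> - u x \<sigma>) \<bullet> c + u x \<sigma> \<bullet> (c - d)"
      by (simp add: inner_diff_left inner_diff_right)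
    then have "\<bar>u x \<rho> \<bullet> c - u x \<sigma> \<bullet> d\<bar> \<le> norm (u x \<rho> - u x \<sigma>) * norm c + norm (u x \<sigma>) * norm (c - d)"
      using Cauchy_Schwarz_ineq2[of "u x \<rho> - u x \<sigma>" c] Cauchy_Schwarz_ineq2[of "u x \<sigma>" "c - d"] by linarith
    also have "\<dots> \<le> (K * \<bar>\<rho> - \<sigma>\<bar>) * (\<bar>D\<bar> + 1) + (K * (\<bar>D\<bar> + 1)) * norm (c - d)"
    proof (intro add_mono mult_mono)
      show "norm c \<le> \<bar>D\<bar> + 1" using c by linarith
      have "K * 1 \<le> K * (\<bar>D\<bar> + 1)" using K(1) by (intro mult_left_mono) auto
      then show "norm (u x \<sigma>) \<le> K * (\<bar>D\<bar> + 1)" using k by simp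
    qed (use k K(1) in auto)
    also have "\<dots> = K * (\<bar>D\<bar> + 1) * (\<bar>\<rho> - \<sigma>\<bar> + norm (c - d))" by (simp add: algebra_simps)
    finally show "\<bar>u x \<rho> \<bullet> c - u x \<sigma> \<bullet> d\<bar> \<le> K * (\<bar>D\<bar> + 1) * (\<bar>\<rho> - \<sigma>\<bar> + norm (c - d))" .
  qed
qed

text \<open>The difference of two solutions starts at 0 and solves the equation for \<rho> with
  forcing \<open>A \<rho> (y x \<sigma>) - A \<sigma> (y x \<sigma>)\<close>. Gronwall's inequality
  is applied first to a solution and then to the difference.\<close>

lemma linear_ivp_lipschitz_family:
  fixes y y' :: "real \<Rightarrow> real \<Rightarrow> 'a::real_inner"
  assumes d: "\<And>\<rho> x. x \<in> {0..1} \<Longrightarrow> ((\<lambda>x. y x \<rho>) has_vector_derivative A \<rho> (y x \<rho>)) (at x within {0..1})"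
    and lin: "\<And>\<rho> u v. A \<rho> u - A \<rho> v = A \<rho> (u - v)"
    and A: "\<And>\<rho> u. norm (A \<rho> u) \<le> (1 + \<bar>\<rho>\<bar>) * norm u" "\<And>\<rho> \<sigma> u. norm (A \<rho> u - A \<sigma> u) \<le> \<bar>\<rho> - \<sigma>\<bar> * norm u"
    and init: "\<And>\<rho>. y 0 \<rho> = c"
  shows "lipschitz_family P y"
proof -
  define E where "E = exp (1 + \<bar>P\<bar> + 1)"
  have b: "norm (A \<rho> u) \<le> (1 + \<bar>P\<bar>) * norm u" if "\<bar>\<rho>\<bar> \<le> P" for \<rho> u
  proof -
    have "(1 + \<bar>\<rho>\<bar>) * norm u \<le> (1 + \<bar>P\<bar>) * norm u" using that by (intro mult_right_mono) auto
    then show ?thesis using A(1)[of \<rho> u] by linarith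
  qed
  have 1: "norm (y x \<rho>) \<le> E * norm c" if "x \<in> {0..1}" "\<bar>\<rho>\<bar> \<le> P" for x \<rho>
  proof -
    have "norm (y x \<rho>) \<le> exp ((1 + \<bar>P\<bar> + 1) * (1 - 0)) * (norm (y 0 \<rho>) + 0 * sqrt (1 - 0))"
      by (rule gronwall_linear[where y="\<lambda>x. y x \<rho>" and y'="\<lambda>x. A \<rho> (y x \<rho>)"]) (use d b that in auto)
    then show ?thesis by (simp add: init E_def)
  qed
  have 2: "norm (y x \<rho> - y x \<sigma>) \<le> E * (E * norm c) * \<bar>\<rho> - \<sigma>\<bar>" if x: "x \<in> {0..1}" and P: "\<bar>\<rho>\<bar> \<le> P" "\<bar>\<sigma>\<bar> \<le> P" for x \<rho> \<sigma>
  proof -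
    have "norm (y x \<rho> - y x \<sigma>) \<le> exp ((1 + \<bar>P\<bar> + 1) * (1 - 0)) * (norm (y 0 \<rho> - y 0 \<sigma>) + \<bar>\<rho> - \<sigma>\<bar> * (E * norm c) * sqrt (1 - 0))"
    proof (rule gronwall_linear[where y="\<lambda>x. y x \<rho> - y x \<sigma>" and y'="\<lambda>x. A \<rho> (y x \<rho>) - A \<sigma> (y x \<sigma>)"])
      fix x :: real assume x: "x \<in> {0..1}"
      show "((\<lambda>x. y x \<rho> - y x \<sigma>) has_vector_derivative A \<rho> (y x \<rho>) - A \<sigma> (y x \<sigma>)) (at x within {0..1})"
        by (intro has_vector_derivative_diff d x)
      have "A \<rho> (y x \<rho>) - A \<sigma> (y x \<sigma>) = A \<rho> (y x \<rho> - y x \<sigma>) + (A \<rho> (y x \<sigma>) - A \<sigma> (y x \<sigma>))"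
        by (simp add: lin[symmetric])
      then have "norm (A \<rho> (y x \<rho>) - A \<sigma> (y x \<sigma>)) \<le> norm (A \<rho> (y x \<rho> - y x \<sigma>)) + norm (A \<rho> (y x \<sigma>) - A \<sigma> (y x \<sigma>))"
        using norm_triangle_ineq by metis
      moreover have "\<bar>\<rho> - \<sigma>\<bar> * norm (y x \<sigma>) \<le> \<bar>\<rho> - \<sigma>\<bar> * (E * norm c)"
        using 1[OF x P(2)] by (intro mult_left_mono) auto
      ultimately show "norm (A \<rho> (y x \<rho>) - A \<sigma> (y x \<sigma>)) \<le> (1 + \<bar>P\<bar>) * norm (y x \<rho> - y x \<sigma>) + \<bar>\<rho> - \<sigma>\<bar> * (E * norm c)"
        using b[OF P(1), of "y x \<rho> - y x \<sigma>"] A(2)[of \<rho> "y x \<sigma>" \<sigma>] by linarith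
    qed (use x in \<open>auto simp: E_def\<close>)
    then show ?thesis by (simp add: init E_def mult_ac)
  qed
  show ?thesis
    unfolding lipschitz_family_def
  proof (intro exI[of _ "E * (E * norm c)"] conjI ballI allI impI)
    have "1 \<le> E" by (simp add: E_def)
    then have "1 * (E * norm c) \<le> E * (E * norm c)" by (intro mult_right_mono) (auto simp: E_def)
    then show "norm (y x \<rho>) \<le> E * (E * norm c)" if "x \<in> {0..1}" "\<bar>\<rho>\<bar> \<le> P" for x \<rho>
      using 1[OF that] by simp
    show "0 \<le> E * (E * norm c)" by (simp add: E_def)
  qed (use 2 in blast)
qed

text \<open>The second order equation becomes a first order one for the pair
  \<open>(f1, f1')\<close>, since the square of \<open>S_c \<rho>\<close> is \<open>- \<rho>\<close>
  times the identity. The derivative is returned as one family over \<rho>, for the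
  \<open>H1\<close> part of the initial error.\<close>

lemma f_functions_lipschitz:
  assumes "f_functions c2 f1 f2"
  obtains f1' where
    "\<And>\<rho> x. x \<in> {0..1} \<Longrightarrow> ((\<lambda>x. f1 x \<rho>) has_vector_derivative f1' x \<rho>) (at x within {0..1})"
    "\<And>\<rho>. continuous_on {0..1} (\<lambda>x. f1' x \<rho>)"
    "\<And>P. lipschitz_family P f1" "\<And>P. lipschitz_family P f1'" "\<And>P. lipschitz_family P f2"
proof -
  have "\<forall>\<rho>. \<exists>g. (\<forall>x\<in>{0..1}. ((\<lambda>x. f1 x \<rho>) has_vector_derivative g x) (at x within {0..1}) \<and>
               (g has_vector_derivative (f1 x \<rho> v* (S_c \<rho> ** S_c \<rho>))) (at x within {0..1})) \<and> g 0 = 0"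
    using assms unfolding f_functions_def by blast
  then obtain g where g: "\<And>\<rho> x. x \<in> {0..1} \<Longrightarrow> ((\<lambda>x. f1 x \<rho>) has_vector_derivative g \<rho> x) (at x within {0..1})"
    "\<And>\<rho> x. x \<in> {0..1} \<Longrightarrow> (g \<rho> has_vector_derivative (f1 x \<rho> v* (S_c \<rho> ** S_c \<rho>))) (at x within {0..1})" "\<And>\<rho>. g \<rho> 0 = 0"
    by metis
  have i: "f1 0 \<rho> = gamma_eta" "f2 0 \<rho> = - c2 *\<^sub>R gamma_eta" for \<rho> using assms unfolding f_functions_def by blast+
  have f2: "((\<lambda>x. f2 x \<rho>) has_vector_derivative - (f2 x \<rho> v* S_c \<rho>)) (at x within {0..1})" if "x \<in> {0..1}" for x \<rho>
    using assms that unfolding f_functions_def by blast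
  have nf: "norm (fst u) \<le> norm u" "norm (snd u) \<le> norm u" for u :: "(real^2) \<times> (real^2)"
    by (metis norm_fst_le prod.collapse, metis norm_snd_le prod.collapse)
  have pair: "lipschitz_family P (\<lambda>x \<rho>. (f1 x \<rho>, g \<rho> x))" for P
  proof (rule linear_ivp_lipschitz_family[where A="\<lambda>\<rho> u. (snd u, (- \<rho>) *\<^sub>R fst u)"])
    show "((\<lambda>x. (f1 x \<rho>, g \<rho> x)) has_vector_derivative (snd (f1 x \<rho>, g \<rho> x), (- \<rho>) *\<^sub>R fst (f1 x \<rho>, g \<rho> x))) (at x within {0..1})"
      if "x \<in> {0..1}" for x \<rho>
      using has_vector_derivative_Pair[OF g(1)[OF that] g(2)[OF that]] by (simp add: mult_S_c_square)
    show "(f1 0 \<rho>, g \<rho> 0) = (gamma_eta, 0)" for \<rho> by (simp add: i g)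
    fix \<rho> \<sigma> :: real and u v :: "(real^2) \<times> (real^2)"
    show "(snd u, - \<rho> *\<^sub>R fst u) - (snd v, - \<rho> *\<^sub>R fst v) = (snd (u - v), - \<rho> *\<^sub>R fst (u - v))"
      by (simp add: algebra_simps)
    have "norm (snd u, - \<rho> *\<^sub>R fst u) \<le> norm (snd u) + \<bar>\<rho>\<bar> * norm (fst u)"
      using norm_Pair_le[of "snd u" "- \<rho> *\<^sub>R fst u"] by simp
    also have "\<dots> \<le> norm u + \<bar>\<rho>\<bar> * norm u"
      by (intro add_mono mult_left_mono nf) auto
    finally show "norm (snd u, - \<rho> *\<^sub>R fst u) \<le> (1 + \<bar>\<rho>\<bar>) * norm u" by (simp add: algebra_simps)
    have "norm ((snd u, - \<rho> *\<^sub>R fst u) - (snd u, - \<sigma> *\<^sub>R fst u)) = norm ((\<sigma> - \<rho>) *\<^sub>R fst u)"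
      by (simp add: norm_Pair algebra_simps)
    also have "\<dots> \<le> \<bar>\<rho> - \<sigma>\<bar> * norm u"
      by (simp add: abs_minus_commute nf mult_left_mono)
    finally show "norm ((snd u, - \<rho> *\<^sub>R fst u) - (snd u, - \<sigma> *\<^sub>R fst u)) \<le> \<bar>\<rho> - \<sigma>\<bar> * norm u" .
  qed
  have comp: "lipschitz_family P (\<lambda>x \<rho>. h (f1 x \<rho>, g \<rho> x))" if "\<And>u. norm (h u) \<le> norm u" "\<And>u v. h u - h v = h (u - v)"
    for h :: "(real^2) \<times> (real^2) \<Rightarrow> real^2" and P
  proof -
    obtain K where "K \<ge> 0" "\<forall>x\<in>{0..1}. \<forall>\<rho> \<sigma>. \<bar>\<rho>\<bar> \<le> P \<longrightarrow> \<bar>\<sigma>\<bar> \<le> P \<longrightarrow>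
      norm (f1 x \<rho>, g \<rho> x) \<le> K \<and> norm ((f1 x \<rho>, g \<rho> x) - (f1 x \<sigma>, g \<sigma> x)) \<le> K * \<bar>\<rho> - \<sigma>\<bar>"
      using pair[of P] by (auto simp: lipschitz_family_def)
    then show ?thesis
      unfolding lipschitz_family_def that(2) using that(1) order_trans by blast
  qed
  have L1: "lipschitz_family P f1" for P using comp[of fst P] nf by simp
  have L1': "lipschitz_family P (\<lambda>x \<rho>. g \<rho> x)" for P using comp[of snd P] nf by simp
  have L2: "lipschitz_family P f2" for P
  proof (rule linear_ivp_lipschitz_family[where A="\<lambda>\<rho> u. - (u v* S_c \<rho>)"])
    fix \<rho> \<sigma> :: real and u v :: "real^2"
    show "- (u v* S_c \<rho>) - - (v v* S_c \<rho>) = - ((u - v) v* S_c \<rho>)"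
      by (simp add: mult_S_c vec_eq_iff forall_2 algebra_simps)
    show "norm (- (u v* S_c \<rho>)) \<le> (1 + \<bar>\<rho>\<bar>) * norm u" using norm_mult_S_c[of u \<rho>] by simp
    show "norm (- (u v* S_c \<rho>) - - (u v* S_c \<sigma>)) \<le> \<bar>\<rho> - \<sigma>\<bar> * norm u"
      using norm_mult_S_c_diff[of u \<rho> \<sigma>] norm_minus_commute[of "u v* S_c \<rho>" "u v* S_c \<sigma>"] by simp
  qed (use f2 i in auto)
  show thesis
  proof (rule that[of "\<lambda>x \<rho>. g \<rho> x"])
    show "continuous_on {0..1} (\<lambda>x. g \<rho> x)" for \<rho>
      unfolding continuous_on_eq_continuous_within
      by (intro ballI has_vector_derivative_continuous[OF g(2)])
  qed (use g L1 L1' L2 in auto)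
qed

section \<open>Separable solutions\<close>

lemma continuous_derivative_is_weak_deriv:
  assumes d: "\<And>x. x \<in> {0..1} \<Longrightarrow> (f has_real_derivative f' x) (at x within {0..1})"
    and c: "continuous_on {0..1} f'"
  shows "is_weak_deriv f f'"
proof -
  have "primitive (\<lambda>x. f (max 0 (min 1 x))) (\<lambda>x. indicator {0..1} x * f' x)"
    by (rule continuous_derivative_primitive[OF _ d c]) auto
  from primitive_is_weak_deriv(1)[OF this]
  have 1: "is_weak_deriv f (\<lambda>x. indicator {0..1} x * f' x)"
    by (subst (asm) is_weak_deriv_cong[where f'=f]) (auto simp: max_def min_def)
  have 2: "inner01 (\<lambda>x. indicator {0..1} x * f' x) \<phi> = inner01 f' \<phi>" for \<phi>
    by (rule inner01_cong) auto
  show ?thesis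
    using 1 continuous_sqint_I01[OF c] unfolding is_weak_deriv_def L2_iff 2 by blast
qed

lemma H1_by_parts:
  assumes f: "f \<in> H1" "is_weak_deriv f f'" and g: "g \<in> H1" "is_weak_deriv g g'"
  shows "inner01 f' g + inner01 f g' = f 1 * g 1 - f 0 * g 0"
proof -
  obtain F f0 where F: "primitive F f0" "\<And>x. x \<in> {0..1} \<Longrightarrow> F x = f x" "AE x in I01. f0 x = f' x"
    by (rule weak_deriv_primitive[OF H1_continuous[OF f(1)] f(2)]) blast
  obtain G g0 where G: "primitive G g0" "\<And>x. x \<in> {0..1} \<Longrightarrow> G x = g x" "AE x in I01. g0 x = g' x"
    by (rule weak_deriv_primitive[OF H1_continuous[OF g(1)] g(2)]) blast
  note m = primitive_measurable[OF F(1)] primitive_measurable[OF G(1)]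
    primitive_sqint[OF F(1), THEN sqint_measurable] primitive_sqint[OF G(1), THEN sqint_measurable]
  have mb: "f0 \<in> borel_measurable borel" "g0 \<in> borel_measurable borel" using m(3,4) by simp_all
  have "inner01 f' g = inner01 f0 G"
  proof -
    have "inner01 f' g = inner01 f' G" by (rule inner01_cong) (auto simp: G)
    also have "\<dots> = inner01 f0 G"
      by (rule inner01_cong_AE) (use F(3) is_weak_deriv_sqint[OF f(2)] m mb in \<open>auto simp: borel_I01 sqint_measurable\<close>)
    finally show ?thesis .
  qed
  moreover have "inner01 f g' = inner01 F g0"
  proof -
    have "inner01 f g' = inner01 g' F" by (subst inner01_commute) (rule inner01_cong, auto simp: F)
    also have "\<dots> = inner01 g0 F"
      by (rule inner01_cong_AE) (use G(3) is_weak_deriv_sqint[OF g(2)] m mb in \<open>auto simp: borel_I01 sqint_measurable\<close>)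
    finally show ?thesis by (simp add: inner01_commute)
  qed
  moreover have "inner01 f0 G = (LINT x|lborel. indicator {0..1} x * (f0 x * G x))"
    "inner01 F g0 = (LINT x|lborel. indicator {0..1} x * (F x * g0 x))"
    unfolding inner01_eq using m mb by (subst integral_I01, auto)+
  ultimately show ?thesis using primitive_by_parts[OF F(1) G(1), of 0 1] F(2) G(2) by simp
qed

lemma separable_l2_tendsto:
  fixes G :: "real \<Rightarrow> 'a::real_inner"
  assumes c: "continuous_on {0..1} G" and u: "(u \<longlongrightarrow> 0) F"
  shows "((\<lambda>r. l2norm I01 (\<lambda>x. G x \<bullet> u r)) \<longlongrightarrow> 0) F"
proof -
  have "bounded (G ` {0..1})" by (intro compact_imp_bounded compact_continuous_image c) simp
  then obtain B where "\<forall>y\<in>G ` {0..1}. norm y \<le> B" unfolding bounded_iff by blast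
  then have B: "\<And>x. x \<in> {0..1} \<Longrightarrow> norm (G x) \<le> B" by blast
  show ?thesis
  proof (rule l2norm_tendsto_0I)
    show "l2norm I01 (\<lambda>x. G x \<bullet> u r) \<le> B * norm (u r)" for r
    proof (rule l2norm_le_sup_I01)
      show "continuous_on {0..1} (\<lambda>x. G x \<bullet> u r)" by (intro continuous_intros c)
      show "\<bar>G x \<bullet> u r\<bar> \<le> B * norm (u r)" if "x \<in> {0..1}" for x
        by (rule order_trans[OF Cauchy_Schwarz_ineq2]) (intro mult_right_mono B that norm_ge_zero)
    qed
    show "((\<lambda>r. B * norm (u r)) \<longlongrightarrow> 0) F"
      using tendsto_mult_right_zero[OF tendsto_norm_zero[OF u]] by simp
  qed
qed

lemma has_vector_derivative_quotient_tendsto: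
  assumes "(h has_vector_derivative h') (at s within I)"
  shows "((\<lambda>r. (1 / (r - s)) *\<^sub>R (h r - h s) - h') \<longlongrightarrow> 0) (at s within I)"
proof -
  have "((\<lambda>r. norm ((1 / (r - s)) *\<^sub>R (h r - h s) - h')) \<longlongrightarrow> 0) (at s within I)"
  proof (rule Lim_transform_eventually)
    show "((\<lambda>r. norm (h r - h s - (r - s) *\<^sub>R h') / norm (r - s)) \<longlongrightarrow> 0) (at s within I)"
      using assms by (simp add: has_vector_derivative_def has_derivative_iff_norm)
    show "\<forall>\<^sub>F r in at s within I. norm (h r - h s - (r - s) *\<^sub>R h') / norm (r - s) = norm ((1 / (r - s)) *\<^sub>R (h r - h s) - h')"
    proof (rule eventually_at_topological[THEN iffD2], intro exI[of _ UNIV] conjI ballI impI)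
      fix r assume "r \<noteq> s"
      then have "(1 / (r - s)) *\<^sub>R (h r - h s) - h' = (1 / (r - s)) *\<^sub>R (h r - h s - (r - s) *\<^sub>R h')"
        by (simp add: scaleR_diff_right)
      then show "norm (h r - h s - (r - s) *\<^sub>R h') / norm (r - s) = norm ((1 / (r - s)) *\<^sub>R (h r - h s) - h')"
        by simp
    qed auto
  qed
  then show ?thesis by (rule tendsto_norm_zero_cancel)
qed

text \<open>Products such as \<open>g1 x \<bullet> \<eta> s\<close> are classical solutions. They
  have to be recognised as solutions in the sense of the weak definitions before they can be
  subtracted from plant and compensator.\<close>

locale separable =
  fixes G G' :: "real \<Rightarrow> 'a::real_inner" and h h' :: "real \<Rightarrow> 'a" and I
  assumes G: "\<And>x. x \<in> {0..1} \<Longrightarrow> (G has_vector_derivative G' x) (at x within {0..1})"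
    and G': "continuous_on {0..1} G'"
    and h: "\<And>s. s \<in> I \<Longrightarrow> (h has_vector_derivative h' s) (at s within I)"
begin

lemma cont_G: "continuous_on {0..1} G"
  by (rule continuous_on_vector_derivative[OF G])

lemma weak_deriv: "is_weak_deriv (\<lambda>x. G x \<bullet> u) (\<lambda>x. G' x \<bullet> u)"
proof (rule continuous_derivative_is_weak_deriv)
  show "((\<lambda>x. G x \<bullet> u) has_real_derivative G' x \<bullet> u) (at x within {0..1})" if "x \<in> {0..1}" for x
    using bounded_linear.has_vector_derivative[OF bounded_linear_inner_left G[OF that]]
    by (simp add: has_real_derivative_iff_has_vector_derivative)
  show "continuous_on {0..1} (\<lambda>x. G' x \<bullet> u)" by (intro continuous_intros G')
qed

lemma in_H1: "(\<lambda>x. G x \<bullet> u) \<in> H1"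
  by (rule is_weak_deriv_H1[OF _ weak_deriv]) (intro continuous_intros cont_G)

lemma cont_H1: "cont_H1 I (\<lambda>x s. G x \<bullet> h s)"
  unfolding cont_H1_def
proof (intro ballI conjI in_H1)
  fix s assume "s \<in> I"
  from h[OF this] have "(h \<longlongrightarrow> h s) (at s within I)"
    using has_vector_derivative_continuous continuous_within by blast
  then have 0: "((\<lambda>r. h r - h s) \<longlongrightarrow> 0) (at s within I)" by (simp add: LIM_zero)
  have "((\<lambda>r. H1_norm (\<lambda>x. G x \<bullet> (h r - h s))) \<longlongrightarrow> 0) (at s within I)"
    by (rule H1_norm_tendsto_0I[OF weak_deriv])
      (intro continuous_intros cont_G separable_l2_tendsto G' 0)+
  then show "((\<lambda>r. H1_norm (\<lambda>x. G x \<bullet> h r - G x \<bullet> h s)) \<longlongrightarrow> 0) (at s within I)"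
    by (simp add: inner_diff_right)
qed

lemma time_deriv: "time_deriv I (\<lambda>x s. G x \<bullet> h s) (\<lambda>x s. G x \<bullet> h' s)"
  unfolding time_deriv_def L2_norm_eq
proof
  fix s assume "s \<in> I"
  from separable_l2_tendsto[OF cont_G has_vector_derivative_quotient_tendsto[OF h[OF this]]]
  show "((\<lambda>r. l2norm I01 (\<lambda>x. (G x \<bullet> h r - G x \<bullet> h s) / (r - s) - G x \<bullet> h' s)) \<longlongrightarrow> 0) (at s within I)"
    by (simp add: inner_diff_right)
qed

lemma is_wave_solution:
  assumes G'': "\<And>x. x \<in> {0..1} \<Longrightarrow> (G' has_vector_derivative G'' x) (at x within {0..1})" "continuous_on {0..1} G''"
    and h'': "\<And>s. s \<in> I \<Longrightarrow> (h' has_vector_derivative h'' s) (at s within I)"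
    and eq: "\<And>x s. x \<in> {0..1} \<Longrightarrow> s \<in> I \<Longrightarrow> G x \<bullet> h'' s = G'' x \<bullet> h s"
  shows "wave_solution I (\<lambda>s. G' 0 \<bullet> h s) (\<lambda>s. G 1 \<bullet> h s) (\<lambda>x s. G x \<bullet> h s) (\<lambda>x s. G x \<bullet> h' s)"
proof -
  interpret t: separable G G' h' h'' I by unfold_locales (use G G' h'' in auto)
  \<comment> \<open>This instance gives \<open>G' x \<bullet> h s\<close> a weak derivative, as the
    integration by parts against \<psi> requires.\<close>
  interpret x: separable G' G'' h h' I by unfold_locales (use G'' h in auto)
  show ?thesis
    unfolding wave_solution_def
  proof (intro conjI ballI refl cont_H1 time_deriv)
    show "cont_L2 I (\<lambda>x s. G x \<bullet> h' s)"
      unfolding cont_L2_def L2_iff L2_norm_eq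
    proof (intro ballI conjI H1_sqint in_H1)
      fix s assume "s \<in> I"
      from h''[OF this] have "(h' \<longlongrightarrow> h' s) (at s within I)"
        using has_vector_derivative_continuous continuous_within by blast
      then have "((\<lambda>r. h' r - h' s) \<longlongrightarrow> 0) (at s within I)" by (simp add: LIM_zero)
      from separable_l2_tendsto[OF cont_G this]
      show "((\<lambda>r. l2norm I01 (\<lambda>x. G x \<bullet> h' r - G x \<bullet> h' s)) \<longlongrightarrow> 0) (at s within I)"
        by (simp add: inner_diff_right)
    qed
    fix \<psi> s assume \<psi>: "\<psi> \<in> H1_R" and s: "s \<in> I"
    then have \<psi>H: "\<psi> \<in> H1" "\<psi> 1 = 0" by (auto simp: H1_R_def)
    have "((\<lambda>\<sigma>. inner01 (\<lambda>x. G x \<bullet> h' \<sigma>) \<psi>) has_real_derivative inner01 (\<lambda>x. G x \<bullet> h'' s) \<psi>) (at s within I)"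
      by (rule inner01_has_derivative) (use t.time_deriv s in \<open>auto simp: time_deriv_def L2_norm_eq intro!: H1_sqint in_H1 \<psi>H\<close>)
    moreover have "inner01 (\<lambda>x. G x \<bullet> h'' s) \<psi> = inner01 (\<lambda>x. G'' x \<bullet> h s) \<psi>"
      by (rule inner01_cong) (auto simp: eq s)
    moreover have "inner01 (\<lambda>x. G'' x \<bullet> h s) \<psi> = - inner01 (\<lambda>x. G' x \<bullet> h s) (wderiv \<psi>) - G' 0 \<bullet> h s * \<psi> 0"
      using H1_by_parts[OF x.in_H1 x.weak_deriv \<psi>H(1) H1_wderiv[OF \<psi>H(1)], of "h s"] \<psi>H(2) by simp
    moreover have "inner01 (\<lambda>x. G' x \<bullet> h s) (wderiv \<psi>) = inner01 (wderiv (\<lambda>x. G x \<bullet> h s)) (wderiv \<psi>)"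
      by (rule inner01_cong_AE)
        (use wderiv_AE[OF in_H1 weak_deriv, of "h s"] in \<open>auto intro!: sqint_measurable wderiv_sqint in_H1 \<psi>H is_weak_deriv_sqint[OF weak_deriv] elim: eventually_mono\<close>)
    ultimately show "((\<lambda>\<sigma>. inner01 (\<lambda>x. G x \<bullet> h' \<sigma>) \<psi>) has_real_derivative
        - inner01 (wderiv (\<lambda>x. G x \<bullet> h s)) (wderiv \<psi>) - G' 0 \<bullet> h s * \<psi> 0) (at s within I)" by simp
  qed
qed

end

lemma time_deriv_cong_AE:
  assumes t: "time_deriv I w v" and ae: "\<And>s. s \<in> I \<Longrightarrow> AE x in I01. v x s = v' x s"
    and h: "\<And>r. r \<in> I \<Longrightarrow> sqint I01 (\<lambda>x. w x r)" "\<And>r. r \<in> I \<Longrightarrow> sqint I01 (\<lambda>x. v x r)" "\<And>r. r \<in> I \<Longrightarrow> sqint I01 (\<lambda>x. v' x r)"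
  shows "time_deriv I w v'"
  unfolding time_deriv_def L2_norm_eq
proof
  fix s assume s: "s \<in> I"
  have "((\<lambda>r. l2norm I01 (\<lambda>x. (w x r - w x s) / (r - s) - v x s)) \<longlongrightarrow> 0) (at s within I)"
    using t s by (auto simp: time_deriv_def L2_norm_eq)
  then show "((\<lambda>r. l2norm I01 (\<lambda>x. (w x r - w x s) / (r - s) - v' x s)) \<longlongrightarrow> 0) (at s within I)"
  proof (rule Lim_transform_eventually)
    show "\<forall>\<^sub>F r in at s within I. l2norm I01 (\<lambda>x. (w x r - w x s) / (r - s) - v x s) = l2norm I01 (\<lambda>x. (w x r - w x s) / (r - s) - v' x s)"
      using eventually_at_within_mem
    proof eventually_elim
      case (elim r)
      show ?case
      proof (rule l2norm_cong_AE)
        show "AE x in I01. (w x r - w x s) / (r - s) - v x s = (w x r - w x s) / (r - s) - v' x s"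
          using ae[OF s] by eventually_elim simp
      qed (intro sqint_measurable sqint_diff sqint_divide h s elim)+
    qed
  qed
qed

text \<open>\<open>wderiv\<close> chooses representatives, so it is additive only almost everywhere,
  and the time derivative has to be exchanged accordingly.\<close>

lemma transport_solution_diff:
  assumes 1: "transport_solution I b1 Y1" and 2: "transport_solution I b2 Y2"
  shows "transport_solution I (\<lambda>s. b1 s - b2 s) (\<lambda>x s. Y1 x s - Y2 x s)"
proof -
  note reg = transport_regularity[OF 1] transport_regularity[OF 2]
  have "time_deriv I (\<lambda>x s. Y1 x s - Y2 x s) (\<lambda>x s. - wderiv (\<lambda>y. Y1 y s) x - - wderiv (\<lambda>y. Y2 y s) x)"
    using 1 2 by (intro time_deriv_diff) (auto simp: transport_solution_def intro!: reg sqint_minus)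
  then have "time_deriv I (\<lambda>x s. Y1 x s - Y2 x s) (\<lambda>x s. - wderiv (\<lambda>y. Y1 y s - Y2 y s) x)"
  proof (rule time_deriv_cong_AE)
    show "AE x in I01. - wderiv (\<lambda>y. Y1 y s) x - - wderiv (\<lambda>y. Y2 y s) x = - wderiv (\<lambda>y. Y1 y s - Y2 y s) x"
      if "s \<in> I" for s
      using wderiv_diff_AE[OF reg(1,4)[OF that]] by eventually_elim simp
  qed (intro sqint_diff sqint_minus reg wderiv_sqint H1_diff; assumption)+
  then show ?thesis
    using 1 2 cont_H1_diff by (auto simp: transport_solution_def)
qed

lemma (in separable) is_transport_solution:
  assumes eq: "\<And>x s. x \<in> {0..1} \<Longrightarrow> s \<in> I \<Longrightarrow> G x \<bullet> h' s = - (G' x \<bullet> h s)"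
  shows "transport_solution I (\<lambda>s. G 0 \<bullet> h s) (\<lambda>x s. G x \<bullet> h s)"
proof -
  have "time_deriv I (\<lambda>x s. G x \<bullet> h s) (\<lambda>x s. - wderiv (\<lambda>y. G y \<bullet> h s) x)"
  proof (rule time_deriv_cong_AE[OF time_deriv])
    show "AE x in I01. G x \<bullet> h' s = - wderiv (\<lambda>y. G y \<bullet> h s) x" if s: "s \<in> I" for s
      using wderiv_AE[OF in_H1 weak_deriv, of "h s"] AE_space
      by eventually_elim (simp add: eq s)
  qed (intro H1_sqint sqint_minus wderiv_sqint in_H1)+
  then show ?thesis by (simp add: transport_solution_def cont_H1)
qed

section \<open>Errors of the predictors\<close>

text \<open>Subtracting the separable solution and the observer from the plant leaves a Neumann
  datum that vanishes by the measurement equation and \<open>g1' 0 = 0\<close>. The coupling with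
  the transport error at both ends is read off from \<open>space_H4\<close>.\<close>

lemma observer_error_decay:
  assumes dist: "disturbance_model \<omega> A B \<eta>" and g: "g_functions \<omega> c2 g1 g2"
    and pl: "plant q u \<eta> \<epsilon> \<epsilon>s" and me: "measurement \<tau> \<epsilon> e" and co: "compensator \<tau> c2 e Y1"
    and ob: "state_observer \<tau> q c2 u e Y1 zh zhs Y2h" and c2: "0 < c2" "c2 < 1"
    and H4: "\<And>s. s \<ge> 0 \<Longrightarrow> (\<lambda>x. z_err \<epsilon> g1 \<eta> zh x s, \<lambda>x. zs_err \<omega> \<epsilon>s g1 \<eta> zhs x s, \<lambda>x. Y2_err Y1 g2 \<eta> Y2h x s) \<in> space_H4 c2"
  shows "exp_decaying (\<lambda>s. H1_norm (\<lambda>x. z_err \<epsilon> g1 \<eta> zh x s))"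
    "exp_decaying (\<lambda>s. L2_norm (\<lambda>x. zs_err \<omega> \<epsilon>s g1 \<eta> zhs x s))"
proof -
  let ?S = "S_eta \<omega>"
  have \<eta>: "(\<eta> has_vector_derivative ?S *v \<eta> s) (at s within {0..})" if "s \<in> {0..}" for s
    using dist that by (auto simp: disturbance_model_def)
  have S\<eta>: "((\<lambda>s. ?S *v \<eta> s) has_vector_derivative ?S *v (?S *v \<eta> s)) (at s within {0..})" if "s \<in> {0..}" for s
    by (rule bounded_linear.has_vector_derivative[OF matrix_vector_mul_bounded_linear \<eta>[OF that]])
  obtain g1' where g1: "\<And>x. x \<in> {0..1} \<Longrightarrow> (g1 has_vector_derivative g1' x) (at x within {0..1})"
      "\<And>x. x \<in> {0..1} \<Longrightarrow> (g1' has_vector_derivative (g1 x v* (?S ** ?S))) (at x within {0..1})" "g1' 0 = 0"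
    using g unfolding g_functions_def by blast
  have g2: "(g2 has_vector_derivative - (g2 x v* ?S)) (at x within {0..1})" if "x \<in> {0..1}" for x
    using g that unfolding g_functions_def by blast
  have cont: "continuous_on {0..1} (\<lambda>x. y x v* M)" if "continuous_on {0..1} y" for y :: "real \<Rightarrow> real ^ 2" and M :: "real ^ 2 ^ 2"
    unfolding transpose_matrix_vector[symmetric] by (intro bounded_linear.continuous_on[OF matrix_vector_mul_bounded_linear] that)
  interpret g1: separable g1 g1' \<eta> "\<lambda>s. ?S *v \<eta> s" "{0..}"
    by unfold_locales (use g1(1) \<eta> continuous_on_vector_derivative[OF g1(2)] in auto)
  interpret g2: separable g2 "\<lambda>x. - (g2 x v* ?S)" \<eta> "\<lambda>s. ?S *v \<eta> s" "{0..}"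
    by unfold_locales (use g2 \<eta> in \<open>auto intro!: continuous_intros cont continuous_on_vector_derivative[OF g2]\<close>)
  have wg: "wave_solution {0..} (\<lambda>s. g1' 0 \<bullet> \<eta> s) (\<lambda>s. g1 1 \<bullet> \<eta> s) (\<lambda>x s. g1 x \<bullet> \<eta> s) (\<lambda>x s. g1 x \<bullet> (?S *v \<eta> s))"
    by (rule g1.is_wave_solution[OF g1(2) cont[OF g1.cont_G] S\<eta>])
      (auto simp: dot_lmul_matrix matrix_vector_mul_assoc)
  have ob': "wave_solution {0..} (\<lambda>s. - q * e (s + \<tau>)) (\<lambda>s. u s - (Y2h 1 s - Y1 1 s)) zh zhs"
    "transport_solution {0..} (\<lambda>s. - c2 * zh 0 s) Y2h"
    using ob by (auto simp: state_observer_def)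
  let ?z = "z_err \<epsilon> g1 \<eta> zh" and ?zs = "zs_err \<omega> \<epsilon>s g1 \<eta> zhs" and ?Y = "Y2_err Y1 g2 \<eta> Y2h"
  have "wave_solution {0..} (\<lambda>s. (- q * \<epsilon> 0 s - g1' 0 \<bullet> \<eta> s) - - q * e (s + \<tau>))
      (\<lambda>s. (u s - gamma_eta \<bullet> \<eta> s - g1 1 \<bullet> \<eta> s) - (u s - (Y2h 1 s - Y1 1 s))) ?z ?zs"
    unfolding z_err_def[abs_def] zs_err_def[abs_def] dot_lmul_matrix
    by (rule wave_solution_diff[OF wave_solution_diff[OF pl[unfolded plant_def] wg] ob'(1)])
  note wz' = this
  have z: "wave_solution {0..} (\<lambda>s. 0) (\<lambda>s. ?z 1 s) ?z ?zs"
    by (rule wave_solution_cong[OF wz'])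
      (use me g1(3) wave_solution_regularity(4)[OF wz'] in \<open>auto simp: measurement_def\<close>)
  have "transport_solution {0..} (\<lambda>s. g2 0 \<bullet> \<eta> s) (\<lambda>x s. g2 x \<bullet> \<eta> s)"
    by (rule g2.is_transport_solution) (simp add: dot_lmul_matrix)
  from transport_solution_diff[OF transport_solution_diff[OF co[unfolded compensator_def] this] ob'(2)]
  have Y: "transport_solution {0..} (\<lambda>s. - c2 * e (s + \<tau>) - g2 0 \<bullet> \<eta> s - - c2 * zh 0 s) ?Y"
    by (simp add: Y2_err_def[abs_def])
  have bd: "?z 1 s = - ?Y 1 s" "?Y 0 s = - c2 * ?z 0 s" if "0 \<le> s" for s
    using H4[OF that] by (auto simp: space_H4_def)
  from coupled_wave_transport_decay[OF z Y bd c2]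
  show "exp_decaying (\<lambda>s. H1_norm (\<lambda>x. ?z x s))" "exp_decaying (\<lambda>s. L2_norm (\<lambda>x. ?zs x s))"
    by (auto simp: exp_decaying_def H1_norm_nonneg L2_norm_eq)
qed

text \<open>In the coordinates given by \<open>T\<close> the disturbance is an oscillator in
  companion form whose first component is \<open>g1 0 \<bullet> \<eta> s\<close>, the observer input
  up to \<open>p\<close>. Invertibility of \<open>T\<close> and
  \<open>A\<^sup>2 + B\<^sup>2 > 0\<close> make its energy positive, which provides the
  excitation.\<close>

lemma disturbance_error_decay:
  fixes T :: "real ^ 2 ^ 2" and \<eta> d dh :: "real \<Rightarrow> real ^ 2" and p :: "real \<Rightarrow> real"
  assumes pos: "\<iota> > 0" "k0 > 0" "k1 > 0" "\<theta> > 0" and AB: "A\<^sup>2 + B\<^sup>2 > 0"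
    and dist: "disturbance_model \<omega> A B \<eta>" and T: "canonical_transformation \<omega> \<theta> g1 T"
    and d_def: "d = (\<lambda>s. T *v \<eta> s)" and p: "exp_decaying p"
    and yd: "\<And>s. s \<ge> 0 \<Longrightarrow> yd s = g1 0 \<bullet> \<eta> s + p s"
    and obs: "adaptive_observer \<iota> k0 k1 yd \<xi> \<chi>h \<phi>h \<theta>h" and dh: "dh = d_hat \<iota> \<xi> \<chi>h \<phi>h \<theta>h"
  shows "\<And>s. s \<ge> 0 \<Longrightarrow> (d has_vector_derivative S_c \<theta> *v d s) (at s within {0..})"
    and "\<exists>D. \<forall>s\<ge>0. norm (d s) \<le> D"
    and "exp_decaying (\<lambda>s. \<bar>\<theta> - \<theta>h s\<bar> + norm (d s - dh s))"
proof -
  let ?I = "matrix_inv T"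
  have TI: "invertible T" "S_c \<theta> = T ** S_eta \<omega> ** ?I" "gamma_eta = g1 0 v* ?I"
    using T by (auto simp: canonical_transformation_def)
  have IT: "?I *v (T *v x) = x" for x
  proof -
    have "?I ** T = mat 1"
      using someI_ex[OF TI(1)[unfolded invertible_def]] by (simp add: matrix_inv_def)
    then show ?thesis by (simp add: matrix_vector_mul_assoc)
  qed
  show dd: "(d has_vector_derivative S_c \<theta> *v d s) (at s within {0..})" if "s \<ge> 0" for s
  proof -
    have "(\<eta> has_vector_derivative S_eta \<omega> *v \<eta> s) (at s within {0..})"
      using dist that by (auto simp: disturbance_model_def)
    from bounded_linear.has_vector_derivative[OF matrix_vector_mul_bounded_linear this, of T]
    have "(d has_vector_derivative T *v (S_eta \<omega> *v \<eta> s)) (at s within {0..})" by (simp add: d_def)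
    moreover have "T *v (S_eta \<omega> *v \<eta> s) = S_c \<theta> *v d s"
      by (simp add: d_def TI(2) IT flip: matrix_vector_mul_assoc)
    ultimately show ?thesis by simp
  qed
  have comp: "((\<lambda>s. d s $ i) has_real_derivative (S_c \<theta> *v d s) $ i) (at s within {0..})" if "s \<ge> 0" for s i
    using bounded_linear.has_vector_derivative[OF bounded_linear_vec_nth dd[OF that]]
    by (simp add: has_real_derivative_iff_has_vector_derivative)
  have d1: "((\<lambda>s. d s $ 1) has_real_derivative d s $ 2) (at s within {0..})"
    and d2: "((\<lambda>s. d s $ 2) has_real_derivative - \<theta> * d s $ 1) (at s within {0..})" if "s \<ge> 0" for s
    using comp[OF that, of 1] comp[OF that, of 2] by (simp_all add: S_c_mult)
  have "d 0 \<noteq> 0"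
  proof
    assume "d 0 = 0"
    then have "\<eta> 0 = 0" using IT[of "\<eta> 0"] by (simp add: d_def)
    then have "A = 0 \<and> B = 0" using dist by (simp add: disturbance_model_def vec_eq_iff forall_2)
    then show False using AB by simp
  qed
  then have "d 0 $ 1 \<noteq> 0 \<or> d 0 $ 2 \<noteq> 0" by (simp add: vec_eq_iff forall_2)
  then have nz: "\<theta> * (d 0 $ 1)\<^sup>2 + (d 0 $ 2)\<^sup>2 > 0"
    using pos(4) by (auto intro: add_pos_nonneg add_nonneg_pos)
  have "d s $ 1 = g1 0 \<bullet> \<eta> s" for s
  proof -
    have "d s $ 1 = gamma_eta \<bullet> d s" by (simp add: gamma_eta_def inner_vec_def sum_2)
    also have "\<dots> = g1 0 \<bullet> (?I *v d s)" by (simp add: TI(3) dot_lmul_matrix)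
    finally show ?thesis by (simp add: d_def IT)
  qed
  then have obs': "adaptive_observer \<iota> k0 k1 (\<lambda>s. d s $ 1 + p s) \<xi> \<chi>h \<phi>h \<theta>h"
    using obs yd by (simp add: adaptive_observer_def)
  note conv = adaptive_observer_converges[OF pos d1 d2 nz p obs']
  obtain D where D: "\<And>s. s \<ge> 0 \<Longrightarrow> \<bar>d s $ 1\<bar> \<le> D \<and> \<bar>d s $ 2\<bar> \<le> D"
    using oscillator_bounded[OF d1 d2 pos(4)] by blast
  have "norm (d s) \<le> 2 * D" if "s \<ge> 0" for s
    using norm_vec2_le[of "d s"] D[OF that] by linarith
  then show "\<exists>D. \<forall>s\<ge>0. norm (d s) \<le> D" by blast
  show "exp_decaying (\<lambda>s. \<bar>\<theta> - \<theta>h s\<bar> + norm (d s - dh s))"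
  proof (rule exp_decaying_mono[OF exp_decaying_add[OF exp_decaying_abs[OF conv(2)] exp_decaying_add[OF exp_decaying_abs[OF conv(1)] exp_decaying_abs[OF conv(3)]]]])
    show "\<bar>\<bar>\<theta> - \<theta>h s\<bar> + norm (d s - dh s)\<bar> \<le> \<bar>\<theta> - \<theta>h s\<bar> + (\<bar>d s $ 1 - \<chi>h s\<bar> + \<bar>d s $ 2 - (\<phi>h s + \<xi> s * \<theta>h s + \<iota> * \<chi>h s)\<bar>)" for s
      using norm_vec2_le[of "d s - dh s"] by (simp add: dh d_hat_def)
  qed
qed

text \<open>The derivative of \<open>Delta\<close> is a difference covered by the Lipschitz bound,
  and Gronwall's inequality carries the state error from the left end of the window across it.
  \<open>P\<close> and \<open>D\<close> are fixed before \<open>t\<close>, and the window has length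
  \<tau>, so \<open>K\<close> is independent of \<open>t\<close>. \<open>R\<close> starts at time 0,
  as \<open>wave_solvable\<close> expects.\<close>

lemma Delta_primitive:
  fixes d dh :: "real \<Rightarrow> real ^ 2"
  assumes f: "f_functions c2 f1 f2" and \<tau>: "0 < \<tau>"
    and d: "\<And>s. s \<ge> 0 \<Longrightarrow> (d has_vector_derivative S_c \<theta> *v d s) (at s within {0..})"
    and D: "\<And>s. s \<ge> 0 \<Longrightarrow> norm (d s) \<le> D"
  obtains K where "K \<ge> 0"
    "\<And>t dht. t > \<tau> \<Longrightarrow> \<bar>\<theta>\<bar> \<le> P \<Longrightarrow> \<bar>\<theta>h (t - \<tau>)\<bar> \<le> P \<Longrightarrow> disturbance_predictor \<tau> \<theta>h dh t dht \<Longrightarrow>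
      \<exists>R r. primitive R r \<and> (\<forall>s\<in>{t - \<tau>..t}. R (s - (t - \<tau>)) = Delta \<tau> \<theta> f1 f2 d \<theta>h t dht s) \<and>
        l2norm lborel r \<le> K * (\<bar>\<theta> - \<theta>h (t - \<tau>)\<bar> + norm (d (t - \<tau>) - dh (t - \<tau>)))"
proof -
  obtain f1' where lf: "\<And>P. lipschitz_family P f1" "\<And>P. lipschitz_family P f2"
    by (rule f_functions_lipschitz[OF f]) blast
  let ?a = "\<lambda>x \<rho>. f1 x \<rho> + f2 x \<rho>"
  obtain K1 where K1: "K1 \<ge> 0" "\<And>x \<rho> \<sigma> c d. x \<in> {0..1} \<Longrightarrow> \<bar>\<rho>\<bar> \<le> P \<Longrightarrow> \<bar>\<sigma>\<bar> \<le> P \<Longrightarrow> norm c \<le> D \<Longrightarrow>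
     \<bar>(?a x \<rho> v* S_c \<rho>) \<bullet> c - (?a x \<sigma> v* S_c \<sigma>) \<bullet> d\<bar> \<le> K1 * (\<bar>\<rho> - \<sigma>\<bar> + norm (c - d))"
    by (rule lipschitz_family_inner[OF lipschitz_family_S_c[OF lipschitz_family_add[OF lf]]]) blast
  have D0: "0 \<le> D" using D[of 0] norm_ge_zero[of "d 0"] by linarith
  \<comment> \<open>Gronwall's factor for the rate \<open>1 + \<bar>P\<bar>\<close> over a window of
    length \<tau>, with forcing at most \<open>\<bar>\<theta> - \<rho>\<bar> * D\<close>.\<close>
  define K2 where "K2 = exp ((1 + \<bar>P\<bar> + 1) * \<tau>) * (1 + D * sqrt \<tau>)"
  have K2: "0 \<le> K2" using D0 \<tau> by (simp add: K2_def)
  show thesis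
  proof (rule that[of "K1 * (1 + K2) * sqrt \<tau>"])
    show "K1 * (1 + K2) * sqrt \<tau> \<ge> 0" using K1(1) K2 \<tau> by simp
    fix t dht
    assume t: "t > \<tau>" and P: "\<bar>\<theta>\<bar> \<le> P" "\<bar>\<theta>h (t - \<tau>)\<bar> \<le> P" and pr: "disturbance_predictor \<tau> \<theta>h dh t dht"
    define s0 where "s0 = t - \<tau>"
    define \<rho> where "\<rho> = \<theta>h s0"
    define E where "E = \<bar>\<theta> - \<rho>\<bar> + norm (d s0 - dh s0)"
    have s0: "0 \<le> s0" "s0 \<le> t" "t - s0 = \<tau>" using t \<tau> by (auto simp: s0_def)
    have E0: "0 \<le> E" by (simp add: E_def)
    have dt: "(dht has_vector_derivative S_c \<rho> *v dht s) (at s within {s0..t})" if "s \<in> {s0..t}" for s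
      using pr that unfolding disturbance_predictor_def \<rho>_def s0_def by blast
    have d': "(d has_vector_derivative S_c \<theta> *v d s) (at s within {s0..t})" if "s \<in> {s0..t}" for s
      by (rule has_vector_derivative_within_subset[OF d]) (use that s0 in auto)
    have init: "dht s0 = dh s0" using pr by (simp add: disturbance_predictor_def s0_def)
    have y: "norm (d s - dht s) \<le> K2 * E" if s: "s \<in> {s0..t}" for s
    proof -
      have "norm (d s - dht s) \<le> exp ((1 + \<bar>P\<bar> + 1) * (t - s0)) * (norm (d s0 - dht s0) + \<bar>\<theta> - \<rho>\<bar> * D * sqrt (t - s0))"
      proof (rule gronwall_linear[of s0 t "\<lambda>s. d s - dht s" "\<lambda>s. S_c \<theta> *v d s - S_c \<rho> *v dht s"])
        show "((\<lambda>s. d s - dht s) has_vector_derivative S_c \<theta> *v d s - S_c \<rho> *v dht s) (at s within {s0..t})"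
          if "s \<in> {s0..t}" for s by (intro has_vector_derivative_diff d' dt that)
        show "norm (S_c \<theta> *v d s - S_c \<rho> *v dht s) \<le> (1 + \<bar>P\<bar>) * norm (d s - dht s) + \<bar>\<theta> - \<rho>\<bar> * D"
          if "s \<in> {s0..t}" for s
        proof -
          have eq: "S_c \<theta> *v d s - S_c \<rho> *v dht s = S_c \<rho> *v (d s - dht s) + (S_c \<theta> *v d s - S_c \<rho> *v d s)"
            by (simp add: matrix_vector_mult_diff_distrib)
          have "norm (S_c \<rho> *v (d s - dht s)) \<le> (1 + \<bar>\<rho>\<bar>) * norm (d s - dht s)" by (rule norm_S_c_mult)
          also have "\<dots> \<le> (1 + \<bar>P\<bar>) * norm (d s - dht s)"
            using P by (intro mult_right_mono) (auto simp: \<rho>_def s0_def)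
          finally have 1: "norm (S_c \<rho> *v (d s - dht s)) \<le> (1 + \<bar>P\<bar>) * norm (d s - dht s)" .
          have "norm (S_c \<theta> *v d s - S_c \<rho> *v d s) \<le> \<bar>\<theta> - \<rho>\<bar> * norm (d s)" by (rule norm_S_c_mult_diff)
          also have "\<dots> \<le> \<bar>\<theta> - \<rho>\<bar> * D" using D[of s] that s0 by (intro mult_left_mono) auto
          finally show ?thesis unfolding eq using 1 norm_triangle_ineq order_trans by (meson add_mono)
        qed
      qed (use D0 s in auto)
      also have "\<dots> \<le> exp ((1 + \<bar>P\<bar> + 1) * \<tau>) * (E + E * D * sqrt \<tau>)"
        unfolding s0(3) init E_def using D0 \<tau>
        by (intro mult_left_mono add_mono mult_right_mono) auto
      also have "\<dots> = K2 * E" by (simp add: K2_def algebra_simps)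
      finally show ?thesis .
    qed
    define Q where "Q = Delta \<tau> \<theta> f1 f2 d \<theta>h t dht"
    define Q' where "Q' s = (?a 1 \<theta> v* S_c \<theta>) \<bullet> d s - (?a 1 \<rho> v* S_c \<rho>) \<bullet> dht s" for s
    have Q: "Q s = ?a 1 \<theta> \<bullet> d s - ?a 1 \<rho> \<bullet> dht s" for s
      by (simp add: Q_def Delta_def D_pred_def \<rho>_def s0_def)
    have dQ: "(Q has_real_derivative Q' s) (at s within {s0..t})" if "s \<in> {s0..t}" for s
    proof -
      have "(Q has_vector_derivative ?a 1 \<theta> \<bullet> (S_c \<theta> *v d s) - ?a 1 \<rho> \<bullet> (S_c \<rho> *v dht s)) (at s within {s0..t})"
        unfolding Q[abs_def]
        by (intro has_vector_derivative_diff bounded_linear.has_vector_derivative[OF bounded_linear_inner_right] d' dt that)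
      then show ?thesis by (simp add: Q'_def dot_lmul_matrix has_real_derivative_iff_has_vector_derivative)
    qed
    have cQ: "continuous_on {s0..t} Q'"
      unfolding Q'_def[abs_def]
      by (intro continuous_intros continuous_on_vector_derivative[OF d'] continuous_on_vector_derivative[OF dt])
    have bQ: "\<bar>Q' s\<bar> \<le> K1 * (1 + K2) * E" if s: "s \<in> {s0..t}" for s
    proof -
      have "\<bar>Q' s\<bar> \<le> K1 * (\<bar>\<theta> - \<rho>\<bar> + norm (d s - dht s))"
        unfolding Q'_def by (rule K1(2)) (use P D[of s] s s0 in \<open>auto simp: \<rho>_def s0_def\<close>)
      also have "\<dots> \<le> K1 * (E + K2 * E)"
        by (intro mult_left_mono add_mono y s K1) (simp add: E_def)
      finally show ?thesis by (simp add: algebra_simps)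
    qed
    define R where "R x = Q (max s0 (min t (x + s0)))" for x
    define r where "r x = indicator {s0..t} (x + s0) * Q' (x + s0)" for x
    have "primitive R r"
      using primitive_shift[OF continuous_derivative_primitive[OF s0(2) dQ cQ], of s0]
      by (simp add: R_def[abs_def] r_def[abs_def])
    moreover have "\<forall>s\<in>{s0..t}. R (s - s0) = Q s" by (auto simp: R_def max_def min_def)
    moreover have "l2norm lborel r \<le> K1 * (1 + K2) * sqrt \<tau> * E"
    proof -
      have "l2norm lborel r = l2norm lborel (\<lambda>x. indicator {s0..t} x * Q' x)"
        unfolding r_def by (rule l2norm_shift)
      also have "\<dots> \<le> (K1 * (1 + K2) * E) * sqrt (t - s0)"
        by (rule l2norm_truncated_le[OF s0(2) cQ bQ])
      finally show ?thesis by (simp add: s0(3) mult_ac)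
    qed
    ultimately show "\<exists>R r. primitive R r \<and> (\<forall>s\<in>{t - \<tau>..t}. R (s - (t - \<tau>)) = Delta \<tau> \<theta> f1 f2 d \<theta>h t dht s) \<and>
        l2norm lborel r \<le> K1 * (1 + K2) * sqrt \<tau> * (\<bar>\<theta> - \<theta>h (t - \<tau>)\<bar> + norm (d (t - \<tau>) - dh (t - \<tau>)))"
      unfolding Q_def E_def \<rho>_def s0_def by blast
  qed
qed

text \<open>\<open>wave_solvable\<close> measures data by the value at 0, the derivative and the
  velocity; each is that of the observer error plus a Lipschitz term. The factor 2 is that of
  \<open>H1_sup_bound\<close>.\<close>

lemma perturbed_initial_data_bounds:
  fixes f1 f2 :: "real \<Rightarrow> real \<Rightarrow> real ^ 2"
  assumes f: "f_functions c2 f1 f2"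
  obtains K where "K \<ge> 0"
    "\<And>z zs w v \<theta> \<rho> c d. z \<in> H1 \<Longrightarrow> sqint I01 zs \<Longrightarrow> \<bar>\<theta>\<bar> \<le> P \<Longrightarrow> \<bar>\<rho>\<bar> \<le> P \<Longrightarrow> norm c \<le> D \<Longrightarrow>
      w = (\<lambda>x. z x + f1 x \<theta> \<bullet> c - f1 x \<rho> \<bullet> d) \<Longrightarrow> v = (\<lambda>x. zs x + (f1 x \<theta> v* S_c \<theta>) \<bullet> c - (f1 x \<rho> v* S_c \<rho>) \<bullet> d) \<Longrightarrow>
      w \<in> H1 \<and> \<bar>w 0\<bar> \<le> 2 * H1_norm z + K * (\<bar>\<theta> - \<rho>\<bar> + norm (c - d)) \<and>
      l2norm I01 (wderiv w) \<le> H1_norm z + K * (\<bar>\<theta> - \<rho>\<bar> + norm (c - d)) \<and>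
      l2norm I01 v \<le> L2_norm zs + K * (\<bar>\<theta> - \<rho>\<bar> + norm (c - d))"
proof -
  obtain f1' where f1: "\<And>\<rho> x. x \<in> {0..1} \<Longrightarrow> ((\<lambda>x. f1 x \<rho>) has_vector_derivative f1' x \<rho>) (at x within {0..1})"
    "\<And>\<rho>. continuous_on {0..1} (\<lambda>x. f1' x \<rho>)" "\<And>P. lipschitz_family P f1" "\<And>P. lipschitz_family P f1'"
    by (rule f_functions_lipschitz[OF f]) blast
  obtain K1 where K1: "K1 \<ge> 0" "\<And>x \<rho> \<sigma> c d. x \<in> {0..1} \<Longrightarrow> \<bar>\<rho>\<bar> \<le> P \<Longrightarrow> \<bar>\<sigma>\<bar> \<le> P \<Longrightarrow> norm c \<le> D \<Longrightarrow>
     \<bar>f1 x \<rho> \<bullet> c - f1 x \<sigma> \<bullet> d\<bar> \<le> K1 * (\<bar>\<rho> - \<sigma>\<bar> + norm (c - d))"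
    by (rule lipschitz_family_inner[OF f1(3)]) blast
  obtain K2 where K2: "K2 \<ge> 0" "\<And>x \<rho> \<sigma> c d. x \<in> {0..1} \<Longrightarrow> \<bar>\<rho>\<bar> \<le> P \<Longrightarrow> \<bar>\<sigma>\<bar> \<le> P \<Longrightarrow> norm c \<le> D \<Longrightarrow>
     \<bar>f1' x \<rho> \<bullet> c - f1' x \<sigma> \<bullet> d\<bar> \<le> K2 * (\<bar>\<rho> - \<sigma>\<bar> + norm (c - d))"
    by (rule lipschitz_family_inner[OF f1(4)]) blast
  obtain K3 where K3: "K3 \<ge> 0" "\<And>x \<rho> \<sigma> c d. x \<in> {0..1} \<Longrightarrow> \<bar>\<rho>\<bar> \<le> P \<Longrightarrow> \<bar>\<sigma>\<bar> \<le> P \<Longrightarrow> norm c \<le> D \<Longrightarrow>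
     \<bar>(f1 x \<rho> v* S_c \<rho>) \<bullet> c - (f1 x \<sigma> v* S_c \<sigma>) \<bullet> d\<bar> \<le> K3 * (\<bar>\<rho> - \<sigma>\<bar> + norm (c - d))"
    by (rule lipschitz_family_inner[OF lipschitz_family_S_c[OF f1(3)]]) blast
  show thesis
  proof (rule that[of "K1 + K2 + K3"])
    show "K1 + K2 + K3 \<ge> 0" using K1 K2 K3 by simp
    fix z zs w v :: "real \<Rightarrow> real" and \<theta> \<rho> and c d :: "real ^ 2"
    assume z: "z \<in> H1" "sqint I01 zs" and P: "\<bar>\<theta>\<bar> \<le> P" "\<bar>\<rho>\<bar> \<le> P" "norm c \<le> D"
      and w: "w = (\<lambda>x. z x + f1 x \<theta> \<bullet> c - f1 x \<rho> \<bullet> d)" and v: "v = (\<lambda>x. zs x + (f1 x \<theta> v* S_c \<theta>) \<bullet> c - (f1 x \<rho> v* S_c \<rho>) \<bullet> d)"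
    let ?E = "\<bar>\<theta> - \<rho>\<bar> + norm (c - d)"
    have mono: "K1 * ?E \<le> (K1 + K2 + K3) * ?E" "K2 * ?E \<le> (K1 + K2 + K3) * ?E" "K3 * ?E \<le> (K1 + K2 + K3) * ?E"
      using K1(1) K2(1) K3(1) by (auto intro!: mult_right_mono)
    define g where "g x = f1 x \<rho> \<bullet> d - f1 x \<theta> \<bullet> c" for x
    define g' where "g' x = f1' x \<rho> \<bullet> d - f1' x \<theta> \<bullet> c" for x
    define k where "k x = (f1 x \<rho> v* S_c \<rho>) \<bullet> d - (f1 x \<theta> v* S_c \<theta>) \<bullet> c" for x
    have cf: "continuous_on {0..1} (\<lambda>x. f1 x \<rho>)" for \<rho> by (rule continuous_on_vector_derivative[OF f1(1)])
    have cg': "continuous_on {0..1} g'" unfolding g'_def by (intro continuous_intros f1)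
    have ck: "continuous_on {0..1} k" unfolding k_def dot_lmul_matrix by (intro continuous_intros cf)
    have "(g has_real_derivative g' x) (at x within {0..1})" if "x \<in> {0..1}" for x
    proof -
      have "(g has_vector_derivative g' x) (at x within {0..1})"
        unfolding g_def g'_def
        by (intro has_vector_derivative_diff bounded_linear.has_vector_derivative[OF bounded_linear_inner_left] f1 that)
      then show ?thesis by (simp add: has_real_derivative_iff_has_vector_derivative)
    qed
    from continuous_derivative_is_weak_deriv[OF this cg']
    have wg: "is_weak_deriv g g'" .
    have g: "g \<in> H1" by (rule is_weak_deriv_H1[OF _ wg]) (unfold g_def, intro continuous_intros cf)
    have wz: "w = (\<lambda>x. z x - g x)" by (simp add: w g_def algebra_simps)
    have vz: "v = (\<lambda>x. zs x - k x)" by (simp add: v k_def algebra_simps)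
    have wH: "w \<in> H1" unfolding wz by (rule H1_diff[OF z(1) g])
    have w0: "\<bar>w 0\<bar> \<le> 2 * H1_norm z + (K1 + K2 + K3) * ?E"
    proof -
      have "\<bar>f1 0 \<theta> \<bullet> c - f1 0 \<rho> \<bullet> d\<bar> \<le> K1 * ?E" by (rule K1(2)) (use P in auto)
      moreover have "\<bar>z 0\<bar> \<le> 2 * H1_norm z" by (rule H1_sup_bound[OF z(1)]) simp
      ultimately show ?thesis using mono(1) unfolding w by linarith
    qed
    have dw: "l2norm I01 (wderiv w) \<le> H1_norm z + (K1 + K2 + K3) * ?E"
    proof -
      note sq = wderiv_sqint[OF z(1)] continuous_sqint_I01[OF cg']
      have "l2norm I01 (wderiv w) = l2norm I01 (\<lambda>x. wderiv z x - g' x)"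
      proof (rule l2norm_cong_AE)
        show "AE x in I01. wderiv w x = wderiv z x - g' x"
          unfolding wz by (rule wderiv_AE[OF H1_diff[OF z(1) g] is_weak_deriv_diff[OF z(1) g H1_wderiv[OF z(1)] wg]])
      qed (intro sqint_measurable sqint_diff sq wderiv_sqint wH)+
      also have "\<dots> \<le> l2norm I01 (wderiv z) + l2norm I01 g'" by (rule l2norm_triangle_diff[OF sq])
      also have "l2norm I01 (wderiv z) \<le> H1_norm z"
        unfolding H1_norm_eq[OF z(1) H1_wderiv[OF z(1)]] by (rule real_le_rsqrt) simp
      also have "l2norm I01 g' \<le> K2 * ?E"
      proof (rule l2norm_le_sup_I01[OF cg'])
        show "\<bar>g' x\<bar> \<le> K2 * ?E" if "x \<in> {0..1}" for x
          using K2(2)[OF that P(1,2,3), of d] by (simp add: g'_def abs_minus_commute)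
      qed
      finally show ?thesis using mono(2) by simp
    qed
    have "l2norm I01 v \<le> L2_norm zs + (K1 + K2 + K3) * ?E"
    proof -
      have "l2norm I01 v \<le> l2norm I01 zs + l2norm I01 k"
        unfolding vz by (rule l2norm_triangle_diff[OF z(2) continuous_sqint_I01[OF ck]])
      also have "l2norm I01 k \<le> K3 * ?E"
      proof (rule l2norm_le_sup_I01[OF ck])
        show "\<bar>k x\<bar> \<le> K3 * ?E" if "x \<in> {0..1}" for x
          using K3(2)[OF that P(1,2,3), of d] by (simp add: k_def abs_minus_commute)
      qed
      finally show ?thesis using mono(3) by (simp add: L2_norm_eq)
    qed
    with wH w0 dw show "w \<in> H1 \<and> \<bar>w 0\<bar> \<le> 2 * H1_norm z + (K1 + K2 + K3) * ?E \<and>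
      l2norm I01 (wderiv w) \<le> H1_norm z + (K1 + K2 + K3) * ?E \<and>
      l2norm I01 v \<le> L2_norm zs + (K1 + K2 + K3) * ?E" by blast
  qed
qed

theorem theorem2p2:
  fixes \<tau> q c2 \<iota> k0 k1 \<omega> \<theta> A B :: real
    and \<eta> d :: "real \<Rightarrow> real ^ 2"
    and g1 g2 :: "real \<Rightarrow> real ^ 2"
    and f1 f2 :: "real \<Rightarrow> real \<Rightarrow> real ^ 2"
    and T :: "real ^ 2 ^ 2"
    and u e yd :: "real \<Rightarrow> real"
    and \<epsilon> \<epsilon>s Y1 zh zhs Y2h zt zts Y2t et ets :: "real \<Rightarrow> real \<Rightarrow> real"
    and \<xi> \<chi>h \<phi>h \<theta>h :: "real \<Rightarrow> real"
    and dh :: "real \<Rightarrow> real ^ 2"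
    and dht :: "real \<Rightarrow> real \<Rightarrow> real ^ 2"
    and \<Delta> :: "real \<Rightarrow> real \<Rightarrow> real"
  assumes "\<tau> > 0" and "q > 0" and "0 < c2" and "c2 < 1" and "\<iota> > 0" and "k0 > 1 / (4 * \<iota>)"
    and "k1 > 0" and "\<omega> > 0" and "\<theta> = \<omega>\<^sup>2" and "A\<^sup>2 + B\<^sup>2 > 0"
    and "disturbance_model \<omega> A B \<eta>"
    and "g_functions \<omega> c2 g1 g2"
    and "canonical_transformation \<omega> \<theta> g1 T"
    and "d = (\<lambda>s. T *v \<eta> s)"
    and "f_functions c2 f1 f2"
    and "plant q u \<eta> \<epsilon> \<epsilon>s"
    and "measurement \<tau> \<epsilon> e"
    and "compensator \<tau> c2 e Y1"
    and "state_observer \<tau> q c2 u e Y1 zh zhs Y2h"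
    and "zt = z_err \<epsilon> g1 \<eta> zh"
    and "zts = zs_err \<omega> \<epsilon>s g1 \<eta> zhs"
    and "Y2t = Y2_err Y1 g2 \<eta> Y2h"
    and "\<forall>s\<ge>0. (\<lambda>x. zt x s, \<lambda>x. zts x s, \<lambda>x. Y2t x s) \<in> space_H4 c2"
    and "yd = (\<lambda>s. e (s + \<tau>) - zh 0 s)"
    and "adaptive_observer \<iota> k0 k1 yd \<xi> \<chi>h \<phi>h \<theta>h"
    and "dh = d_hat \<iota> \<xi> \<chi>h \<phi>h \<theta>h"
    and "et = obs_err \<theta> f1 zt d \<theta>h dh"
    and "ets = obs_err_s \<theta> f1 zts d \<theta>h dh"
    and "\<forall>t>\<tau>. disturbance_predictor \<tau> \<theta>h dh t (dht t)"
    and "\<Delta> = (\<lambda>t. Delta \<tau> \<theta> f1 f2 d \<theta>h t (dht t))"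
  shows "\<exists>M5 \<mu>5. M5 > 0 \<and> \<mu>5 > 0 \<and>
    (\<forall>t>\<tau>. (\<lambda>x. et x (t - \<tau>) - \<Delta> t (t - \<tau>), \<lambda>x. ets x (t - \<tau>)) \<in> space_H1 \<longrightarrow>
      (\<exists>w v.
        predictor_error_solution \<tau> q t (\<Delta> t) (\<lambda>x. et x (t - \<tau>)) (\<lambda>x. ets x (t - \<tau>)) w v \<and>
        (\<forall>w' v'.
          predictor_error_solution \<tau> q t (\<Delta> t) (\<lambda>x. et x (t - \<tau>)) (\<lambda>x. ets x (t - \<tau>)) w' v' \<longrightarrow>
          (\<forall>s\<in>{t-\<tau>..t}. (\<forall>x\<in>{0..1}. w' x s = w x s) \<and>
             (AE x in lebesgue_on {0..1}. v' x s = v x s))) \<and>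
        space_H1_norm (\<lambda>x. w x t, \<lambda>x. v x t) \<le> M5 * exp (- \<mu>5 * t)))"
proof -
  note a = assms
  have pos: "\<iota> > 0" "k0 > 0" "k1 > 0" "\<theta> > 0"
    using a(5-9) less_trans[of 0 "1 / (4 * \<iota>)" k0] by auto
  have H4: "(\<lambda>x. zt x s, \<lambda>x. zts x s, \<lambda>x. Y2t x s) \<in> space_H4 c2" if "s \<ge> 0" for s
    using a(23) that by blast
  have z: "(\<lambda>x. zt x s) \<in> H1" "sqint I01 (\<lambda>x. zts x s)" if "s \<ge> 0" for s
    using H4[OF that] by (auto simp: space_H4_def L2_iff)
  note ez = observer_error_decay[OF a(11,12,16-19,3,4) H4[unfolded a(20-22)], folded a(20,21)]
  \<comment> \<open>The observer input differs from the disturbance output by the trace of the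
    observer error at 0, which the \<open>H1\<close> norm controls.\<close>
  have p: "exp_decaying (\<lambda>s. zt 0 s)"
  proof (rule exp_decaying_mono[OF exp_decaying_cmult[OF ez(1), of 2]])
    show "\<bar>zt 0 s\<bar> \<le> 2 * H1_norm (\<lambda>x. zt x s)" if "s \<ge> 0" for s
      using H1_sup_bound[OF z(1)[OF that], of 0] by simp
  qed
  have yd: "yd s = g1 0 \<bullet> \<eta> s + zt 0 s" if "s \<ge> 0" for s
    using a(17) that by (simp add: a(24) a(20) z_err_def measurement_def)
  note dist = disturbance_error_decay[OF pos a(10,11,13,14) p yd a(25,26)]
  define E where "E s = \<bar>\<theta> - \<theta>h s\<bar> + norm (d s - dh s)" for s
  have E: "exp_decaying E" using dist(3) by (simp add: E_def[abs_def])
  obtain D where D: "\<And>s. s \<ge> 0 \<Longrightarrow> norm (d s) \<le> D" using dist(2) by blast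
  obtain B' where B': "B' > 0" "\<And>s. s \<ge> 0 \<Longrightarrow> \<bar>E s\<bar> \<le> B'" by (rule exp_decaying_bounded[OF E]) blast
  \<comment> \<open>Convergence of \<open>\<theta>h\<close> confines it to a bounded range, on which
    the Lipschitz constants are uniform.\<close>
  define P where "P = \<bar>\<theta>\<bar> + B'"
  have P: "\<bar>\<theta>\<bar> \<le> P" "\<And>s. s \<ge> 0 \<Longrightarrow> \<bar>\<theta>h s\<bar> \<le> P"
  proof -
    show "\<bar>\<theta>\<bar> \<le> P" using B'(1) by (simp add: P_def)
    fix s :: real assume "s \<ge> 0"
    then have "\<bar>\<theta> - \<theta>h s\<bar> \<le> B'" using B'(2)[of s] norm_ge_zero[of "d s - dh s"] unfolding E_def by linarith
    then show "\<bar>\<theta>h s\<bar> \<le> P" by (simp add: P_def)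
  qed
  obtain Kd where Kd: "Kd \<ge> 0" "\<And>t. t > \<tau> \<Longrightarrow>
      \<exists>R r. primitive R r \<and> (\<forall>s\<in>{t - \<tau>..t}. R (s - (t - \<tau>)) = \<Delta> t s) \<and> l2norm lborel r \<le> Kd * E (t - \<tau>)"
  proof (rule Delta_primitive[OF a(15,1) dist(1) D])
    fix K
    assume K: "K \<ge> 0" and *: "\<And>t dht. t > \<tau> \<Longrightarrow> \<bar>\<theta>\<bar> \<le> P \<Longrightarrow> \<bar>\<theta>h (t - \<tau>)\<bar> \<le> P \<Longrightarrow> disturbance_predictor \<tau> \<theta>h dh t dht \<Longrightarrow>
      \<exists>R r. primitive R r \<and> (\<forall>s\<in>{t - \<tau>..t}. R (s - (t - \<tau>)) = Delta \<tau> \<theta> f1 f2 d \<theta>h t dht s) \<and>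
        l2norm lborel r \<le> K * (\<bar>\<theta> - \<theta>h (t - \<tau>)\<bar> + norm (d (t - \<tau>) - dh (t - \<tau>)))"
    show thesis
    proof (rule that[OF K])
      fix t assume t: "t > \<tau>"
      then have "disturbance_predictor \<tau> \<theta>h dh t (dht t)" using a(29) by blast
      from *[OF t P(1) P(2) this] t
      show "\<exists>R r. primitive R r \<and> (\<forall>s\<in>{t - \<tau>..t}. R (s - (t - \<tau>)) = \<Delta> t s) \<and> l2norm lborel r \<le> K * E (t - \<tau>)"
        by (simp add: E_def a(30))
    qed
  qed
  obtain Ki where Ki: "Ki \<ge> 0" "\<And>s. s \<ge> 0 \<Longrightarrow> (\<lambda>x. et x s) \<in> H1 \<and>
      \<bar>et 0 s\<bar> \<le> 2 * H1_norm (\<lambda>x. zt x s) + Ki * E s \<and>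
      l2norm I01 (wderiv (\<lambda>x. et x s)) \<le> H1_norm (\<lambda>x. zt x s) + Ki * E s \<and>
      l2norm I01 (\<lambda>x. ets x s) \<le> L2_norm (\<lambda>x. zts x s) + Ki * E s"
  proof (rule perturbed_initial_data_bounds[OF a(15), of P D])
    fix K
    assume K: "K \<ge> 0" and *: "\<And>z zs w v \<theta> \<rho> c d. z \<in> H1 \<Longrightarrow> sqint I01 zs \<Longrightarrow> \<bar>\<theta>\<bar> \<le> P \<Longrightarrow> \<bar>\<rho>\<bar> \<le> P \<Longrightarrow> norm c \<le> D \<Longrightarrow>
      w = (\<lambda>x. z x + f1 x \<theta> \<bullet> c - f1 x \<rho> \<bullet> d) \<Longrightarrow> v = (\<lambda>x. zs x + (f1 x \<theta> v* S_c \<theta>) \<bullet> c - (f1 x \<rho> v* S_c \<rho>) \<bullet> d) \<Longrightarrow>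
      w \<in> H1 \<and> \<bar>w 0\<bar> \<le> 2 * H1_norm z + K * (\<bar>\<theta> - \<rho>\<bar> + norm (c - d)) \<and>
      l2norm I01 (wderiv w) \<le> H1_norm z + K * (\<bar>\<theta> - \<rho>\<bar> + norm (c - d)) \<and>
      l2norm I01 v \<le> L2_norm zs + K * (\<bar>\<theta> - \<rho>\<bar> + norm (c - d))"
    show thesis
    proof (rule that[OF K])
      fix s :: real assume s: "s \<ge> 0"
      have "(\<lambda>x. et x s) = (\<lambda>x. zt x s + f1 x \<theta> \<bullet> d s - f1 x (\<theta>h s) \<bullet> dh s)"
        "(\<lambda>x. ets x s) = (\<lambda>x. zts x s + (f1 x \<theta> v* S_c \<theta>) \<bullet> d s - (f1 x (\<theta>h s) v* S_c (\<theta>h s)) \<bullet> dh s)"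
        by (simp_all add: a(27,28) obs_err_def obs_err_s_def)
      from *[OF z[OF s] P(1) P(2)[OF s] D[OF s] this]
      show "(\<lambda>x. et x s) \<in> H1 \<and>
        \<bar>et 0 s\<bar> \<le> 2 * H1_norm (\<lambda>x. zt x s) + K * E s \<and>
        l2norm I01 (wderiv (\<lambda>x. et x s)) \<le> H1_norm (\<lambda>x. zt x s) + K * E s \<and>
        l2norm I01 (\<lambda>x. ets x s) \<le> L2_norm (\<lambda>x. zts x s) + K * E s"
        unfolding E_def .
    qed
  qed
  \<comment> \<open>A single decaying bound for the four quantities in which
    \<open>wave_solvable\<close> measures the data.\<close>
  define N where "N s = 2 * H1_norm (\<lambda>x. zt x s) + L2_norm (\<lambda>x. zts x s) + (Kd + Ki) * E s" for s
  have "exp_decaying N"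
    unfolding N_def[abs_def] by (intro exp_decaying_add exp_decaying_cmult ez E)
  then obtain CN \<mu> where CN: "CN > 0" "\<mu> > 0" "\<And>s. s \<ge> 0 \<Longrightarrow> \<bar>N s\<bar> \<le> CN * exp (- \<mu> * s)"
    by (auto simp: exp_decaying_def)
  \<comment> \<open>The window of length \<tau> fits into \<open>{0..real n}\<close>;
    \<open>n\<close>, and with it \<open>C\<close>, is chosen before \<open>t\<close>.\<close>
  obtain n :: nat where n: "\<tau> \<le> real n" using real_arch_simple by blast
  obtain C where C: "wave_solvable q n C" using wave_exists[of q n] a(2) by auto
  have C0: "0 \<le> C" using C by (simp add: wave_solvable_def)
  show ?thesis
  \<comment> \<open>The factor \<open>exp (\<mu> * \<tau>)\<close> converts decay at
    \<open>t - \<tau>\<close> into decay at \<open>t\<close>; the summand 1 ensures positivity, as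
    \<open>C\<close> may be 0.\<close>
  proof (rule exI[of _ "C * CN * exp (\<mu> * \<tau>) + 1"], rule exI[of _ \<mu>], intro conjI allI impI)
    show "0 < C * CN * exp (\<mu> * \<tau>) + 1" using C0 CN by (simp add: add_nonneg_pos)
    show "0 < \<mu>" by (rule CN)
    fix t
    assume t: "\<tau> < t" and mem: "(\<lambda>x. et x (t - \<tau>) - \<Delta> t (t - \<tau>), \<lambda>x. ets x (t - \<tau>)) \<in> space_H1"
    define s0 where "s0 = t - \<tau>"
    have s0: "0 \<le> s0" "s0 < t" "t - s0 = \<tau>" using t a(1) by (auto simp: s0_def)
    have m: "sqint I01 (\<lambda>x. ets x s0)" "et 1 s0 = \<Delta> t s0"
      using mem by (auto simp: space_H1_def H1_R_def L2_iff s0_def)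
    obtain R r where R: "primitive R r" "\<And>s. s \<in> {s0..t} \<Longrightarrow> R (s - s0) = \<Delta> t s" "l2norm lborel r \<le> Kd * E s0"
      using Kd(2)[OF t] unfolding s0_def by blast
    have nn: "0 \<le> H1_norm (\<lambda>x. zt x s0)" "0 \<le> L2_norm (\<lambda>x. zts x s0)" "0 \<le> Kd * E s0" "0 \<le> Ki * E s0"
      using Kd(1) Ki(1) by (auto simp: H1_norm_nonneg L2_norm_eq E_def)
    have N: "N s0 = 2 * H1_norm (\<lambda>x. zt x s0) + L2_norm (\<lambda>x. zts x s0) + Kd * E s0 + Ki * E s0"
      by (simp add: N_def algebra_simps)
    \<comment> \<open>The compatibility of initial and boundary data contained in the membership
      assumption; without it the two could not be joined at the corner.\<close>
    have R0: "R 0 = et 1 s0" using R(2)[of s0] s0 m(2) by simp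
    have bounds: "(\<lambda>x. et x s0) \<in> H1" "\<bar>et 0 s0\<bar> \<le> N s0" "l2norm I01 (wderiv (\<lambda>x. et x s0)) \<le> N s0"
      "l2norm I01 (\<lambda>x. ets x s0) \<le> N s0" "l2norm lborel r \<le> N s0"
      using Ki(2)[OF s0(1)] nn R(3) unfolding N by linarith+
    show "\<exists>w v. predictor_error_solution \<tau> q t (\<Delta> t) (\<lambda>x. et x (t - \<tau>)) (\<lambda>x. ets x (t - \<tau>)) w v \<and>
        (\<forall>w' v'. predictor_error_solution \<tau> q t (\<Delta> t) (\<lambda>x. et x (t - \<tau>)) (\<lambda>x. ets x (t - \<tau>)) w' v' \<longrightarrow>
          (\<forall>s\<in>{t-\<tau>..t}. (\<forall>x\<in>{0..1}. w' x s = w x s) \<and> (AE x in lebesgue_on {0..1}. v' x s = v x s))) \<and>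
        space_H1_norm (\<lambda>x. w x t, \<lambda>x. v x t) \<le> (C * CN * exp (\<mu> * \<tau>) + 1) * exp (- \<mu> * t)"
    proof (rule wave_solvableD[OF C bounds(1) m(1) R(1) R0 bounds(2-5)])
      fix F G w v
      assume sol: "wave_solution {0..real n} (\<lambda>s. - q * w 0 s) R w v"
        and init: "\<And>x. x \<in> {0..1} \<Longrightarrow> w x 0 = et x s0" "AE x in I01. v x 0 = ets x s0"
        and bd: "\<And>s. s \<in> {0..real n} \<Longrightarrow> space_H1_norm (\<lambda>x. w x s, \<lambda>x. v x s) \<le> C * N s0"
      \<comment> \<open>The solution is moved from time 0 to the window; the factors 1 match the
        form of \<open>wave_solution_affine\<close>.\<close>
      define w1 v1 where "w1 x s = w x (1 * s + - s0)" and "v1 x s = 1 * v x (1 * s + - s0)" for x s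
      have "wave_solution {s0..t} (\<lambda>s. - q * w1 0 s) (\<lambda>s. R (1 * s + - s0)) w1 v1"
        unfolding w1_def v1_def
        by (rule wave_solution_affine[OF sol, where k=1 and c="- s0"]) (use s0 n in auto)
      then have sol1: "wave_solution {s0..t} (\<lambda>s. - q * w1 0 s) (\<Delta> t) w1 v1"
        by (rule wave_solution_cong) (use R(2) in auto)
      have const: "(\<lambda>x. c) \<in> H1" for c :: real
        by (rule is_weak_deriv_H1[OF _ continuous_derivative_is_weak_deriv[of _ "\<lambda>x. 0"]]) auto
      have pes: "predictor_error_solution \<tau> q t (\<Delta> t) (\<lambda>x. et x s0) (\<lambda>x. ets x s0) w1 v1"
        unfolding predictor_error_solution_def s0_def[symmetric]
      proof (intro conjI ballI sol1)
        show "(\<lambda>x. w1 x s - \<Delta> t s, \<lambda>x. v1 x s) \<in> space_H1" if "s \<in> {s0..t}" for s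
          using wave_solution_regularity[OF sol1 that] H1_diff[OF _ const]
          by (auto simp: space_H1_def H1_R_def L2_iff)
        show "w1 x s0 = et x s0" if "x \<in> {0..1}" for x using init(1)[OF that] by (simp add: w1_def)
        show "AE x in I01. v1 x s0 = ets x s0" using init(2) by (simp add: v1_def)
      qed
      moreover have "(\<forall>x\<in>{0..1}. w' x s = w1 x s) \<and> (AE x in I01. v' x s = v1 x s)"
        if s: "s \<in> {s0..t}" and pes': "predictor_error_solution \<tau> q t (\<Delta> t) (\<lambda>x. et x s0) (\<lambda>x. ets x s0) w' v'" for w' v' s
      proof -
        have sol': "wave_solution {s0..t} (\<lambda>s. - q * w' 0 s) (\<Delta> t) w' v'"
          and i': "\<And>x. x \<in> {0..1} \<Longrightarrow> w' x s0 = et x s0" "AE x in I01. v' x s0 = ets x s0"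
          using pes' by (auto simp: predictor_error_solution_def simp flip: s0_def)
        have i1: "\<And>x. x \<in> {0..1} \<Longrightarrow> w1 x s0 = et x s0" "AE x in I01. v1 x s0 = ets x s0"
          using pes by (auto simp: predictor_error_solution_def simp flip: s0_def)
        have ae: "AE x in I01. v' x s0 = v1 x s0" using i'(2) i1(2) by eventually_elim simp
        show ?thesis
          using wave_solution_unique[OF less_imp_le[OF a(2)] s0(2) sol' sol1 _ ae s] i'(1) i1(1) by simp
      qed
      moreover have "space_H1_norm (\<lambda>x. w1 x t, \<lambda>x. v1 x t) \<le> (C * CN * exp (\<mu> * \<tau>) + 1) * exp (- \<mu> * t)"
      proof -
        have "space_H1_norm (\<lambda>x. w1 x t, \<lambda>x. v1 x t) \<le> C * N s0"
          using bd[of \<tau>] n a(1) s0(3) by (simp add: w1_def v1_def)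
        also have "\<dots> \<le> C * (CN * exp (- \<mu> * s0))"
          using CN(3)[OF s0(1)] by (intro mult_left_mono C0) auto
        also have "\<dots> = C * CN * exp (\<mu> * \<tau>) * exp (- \<mu> * t)"
          by (simp add: s0_def algebra_simps flip: exp_add)
        also have "\<dots> \<le> (C * CN * exp (\<mu> * \<tau>) + 1) * exp (- \<mu> * t)" by (intro mult_right_mono) auto
        finally show ?thesis .
      qed
      ultimately show ?thesis unfolding s0_def[symmetric] by blast
    qed
  qed
qed

end
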